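(* Let $G$ be a finite group, let $\widehat G$ be the set of equivalence classes of irreducible complex representations of $G$, and let $n_\rho$ denote the dimension of $\rho\in\widehat G$. Let $M=(V,E,F)$ be a map with vertex set $V$, edge set $E$ and face set $F$. The number $q_G(M)$ of nowhere-identity local $G$-flows of $M$ is given by $$q_G(M)=\sum_{A\subseteq E}(-1)^{|A^c|}\,|G|^{|A|-|V|}\prod_{M_i}\Big(\sum_{\rho\in\widehat G}n_\rho^{\,2-2g(M_i)}\Big)\prod_{M_j}\Big(\sum_{\rho\in\widehat G}\mathcal F(\rho)^{g(M_j)}n_\rho^{\,2-g(M_j)}\Big),$$ where $A^c=E\setminus A$, the first product ranges over the orientable connected components $M_i$ of $M\backslash A^c$, the second product ranges over the non-orientable connected components $M_j$ of $M\backslash A^c$, $g$ denotes the genus, and $\mathcal F(\rho)$ is the Frobenius-Schur indicator of $\rho$.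
   Context: MAPS. Permutations are composed right to left. A connected map $(\theta,\sigma,\tau;C)$ consists of a finite set $C$ of $4m$ elements ("crosses"), $m\ge 1$, and permutations $\theta,\sigma,\tau$ of $C$ such that (1) $\theta^2=\sigma^2=\mathrm{id}$ and $\theta\sigma=\sigma\theta$; (2) for every $a\in C$ the elements $a,\theta a,\sigma a,\theta\sigma a$ are distinct; (3) $\tau\sigma=\sigma\tau^{-1}$; (4) for every $a\in C$ the orbits of $a$ and $\sigma a$ under $\langle\tau\rangle$ are distinct; (5) $\langle\theta,\sigma,\tau\rangle$ acts transitively on $C$. In addition, for $m=0$, there is the connected map consisting of an isolated vertex: $C=\emptyset$, and by convention $\tau$ (and likewise $\tau\theta\sigma$) consists of one pair of empty cycles; it has one vertex, no edges and one face. A map is a finite disjoint union of connected maps, called its connected components. Put $\varphi=\tau\theta\sigma$. The edges are the orbits $\{a,\theta a,\sigma a,\theta\sigma a\}$ of $\langle\theta,\sigma\rangle$; the vertices are the pairs consisting of the cycle of $\tau$ through $a$ and the cycle of $\tau$ through $\sigma a$ (and the pairs of empty cycles); the faces are the pairs consisting of the cycle of $\varphi$ through $a$ and the cycle of $\varphi$ through $\theta a$ (and one face for each isolated vertex component). The sets of vertices, edges, faces are $V,E,F$, of sizes $v(M),e(M),f(M)$; $k(M)$ is the number of connected components. (Maps correspond to graphs 2-cell embedded in compact surfaces, one surface per component.) GENUS. A connected map is orientable if it is an isolated vertex or if $\langle\theta\sigma,\tau\rangle$ has exactly two orbits on $C$, and non-orientable if $\langle\theta\sigma,\tau\rangle$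 is transitive on $C$ (exactly one of these occurs). The Euler genus of a map is $s(M)=2k(M)-v(M)+e(M)-f(M)$. For a connected map the genus is $g(M)=s(M)/2$ if $M$ is orientable and $g(M)=s(M)$ if $M$ is non-orientable. DELETION. For an edge $e=\{a,\theta a,\sigma a,\theta\sigma a\}$ of $M=(\theta,\sigma,\tau;C)$, $M\backslash e=(\theta',\sigma',\tau';C\setminus e)$, where $\theta',\sigma'$ are the restrictions of $\theta,\sigma$, $\tau' b=\tau^j b$ with $j\ge1$ minimal such that $\tau^j b\notin e$, empty cycles of $\tau$ are kept, and $\tau'$ gets one extra empty cycle for each cycle of $\tau$ all of whose crosses lie in $e$. For a set $B$ of edges, $M\backslash B$ is obtained by deleting all edges of $B$ (the order is immaterial). LOCAL FLOWS. A local $G$-flow of $M=(\theta,\sigma,\tau;C)$ is a function $\psi:C\to G$ with (i) $\psi(\sigma a)=\psi(a)^{-1}$ and $\psi(\theta a)=\psi(a)$ for all $a\in C$; (ii) $\psi(a)\psi(\tau a)\cdots\psi(\tau^{-1}a)=1$ for each (non-empty) cycle $(a\ \tau a\ \cdots\ \tau^{-1}a)$ of $\tau$. It is nowhere-identity if $\psi(a)\neq 1$ for all $a\in C$. FROBENIUS-SCHUR INDICATOR. For a representation $\rho$ of $G$ with character $\chi_\rho$, $\mathcal F(\rho)=\frac1{|G|}\sum_{g\in G}\chi_\rho(g^2)$. *)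

theory Defs
  imports
    "HOL-Library.Multiset"
    "HOL-Combinatorics.Orbits"
    "HOL-Combinatorics.Cycles"
    "HOL-Algebra.Generated_Groups"
    "Jordan_Normal_Form.VS_Connect"
begin

section \<open>Permutation groups\<close>

definition sym_grp :: "'c set \<Rightarrow> ('c \<Rightarrow> 'c) monoid" where
  "sym_grp C = \<lparr>carrier = {p. p permutes C}, monoid.mult = (\<circ>), one = id\<rparr>"

text \<open>The orbit of \<open>a\<close> under the subgroup of \<open>Sym(C)\<close> generated by \<open>S\<close>.\<close>

definition gen_orbit :: "'c set \<Rightarrow> ('c \<Rightarrow> 'c) set \<Rightarrow> 'c \<Rightarrow> 'c set" where
  "gen_orbit C S a = {p a | p. p \<in> generate (sym_grp C) S}"

definition gen_orbits :: "'c set \<Rightarrow> ('c \<Rightarrow> 'c) set \<Rightarrow> 'c set set" where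
  "gen_orbits C S = gen_orbit C S ` C"

section \<open>Maps\<close>

text \<open>Permutations of \<open>C\<close> are functions that are the identity outside \<open>C\<close> (library notion
  \<open>permutes\<close>).  The field \<open>empty_pairs\<close> counts the pairs of empty cycles of \<open>\<tau>\<close>; since empty
  cycles carry no crosses, their number is the only information to record.  Each such pair is an
  isolated vertex.\<close>

record 'c gmap =
  crosses :: "'c set"
  theta :: "'c \<Rightarrow> 'c"
  sigma :: "'c \<Rightarrow> 'c"
  tau :: "'c \<Rightarrow> 'c"
  empty_pairs :: nat

definition isolated_vertex :: "'c gmap" where
  "isolated_vertex =
    \<lparr>crosses = {}, theta = id, sigma = id, tau = id, empty_pairs = 1\<rparr>"

definition connected_map :: "'c gmap \<Rightarrow> bool" where
  "connected_map M \<longleftrightarrow> M = isolated_vertex \<or>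
    (let C = crosses M; \<theta> = theta M; \<sigma> = sigma M; \<tau> = tau M in
      empty_pairs M = 0 \<and>
      finite C \<and> (\<exists>m\<ge>1. card C = 4 * m) \<and>
      \<theta> permutes C \<and> \<sigma> permutes C \<and> \<tau> permutes C \<and>
      \<theta> \<circ> \<theta> = id \<and> \<sigma> \<circ> \<sigma> = id \<and> \<theta> \<circ> \<sigma> = \<sigma> \<circ> \<theta> \<and>
      (\<forall>a\<in>C. distinct [a, \<theta> a, \<sigma> a, \<theta> (\<sigma> a)]) \<and>
      \<tau> \<circ> \<sigma> = \<sigma> \<circ> inv_into UNIV \<tau> \<and>
      (\<forall>a\<in>C. orbit \<tau> a \<noteq> orbit \<tau> (\<sigma> a)) \<and>
      (\<forall>a\<in>C. gen_orbit C {\<theta>, \<sigma>, \<tau>} a = C))"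

definition submap :: "'c gmap \<Rightarrow> 'c set \<Rightarrow> 'c gmap" where
  "submap M D =
    \<lparr>crosses = D, theta = perm_restrict (theta M) D, sigma = perm_restrict (sigma M) D,
     tau = perm_restrict (tau M) D, empty_pairs = 0\<rparr>"

text \<open>A multiset, because all isolated vertices are represented by the same record.\<close>

definition components :: "'c gmap \<Rightarrow> 'c gmap multiset" where
  "components M =
    image_mset (submap M) (mset_set (gen_orbits (crosses M) {theta M, sigma M, tau M})) +
    replicate_mset (empty_pairs M) isolated_vertex"

text \<open>A finite set \<open>C\<close> with permutations \<open>\<theta>\<close>, \<open>\<sigma>\<close>, \<open>\<tau>\<close> is the disjoint union of its restrictions
  to the orbits of \<open>\<langle>\<theta>, \<sigma>, \<tau>\<rangle>\<close>, and a decomposition into connected maps can only be this one.  So a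
  finite disjoint union of connected maps is such a structure whose pieces are connected maps.\<close>

definition is_map :: "'c gmap \<Rightarrow> bool" where
  "is_map M \<longleftrightarrow> finite (crosses M) \<and>
    theta M permutes crosses M \<and> sigma M permutes crosses M \<and> tau M permutes crosses M \<and>
    (\<forall>N \<in># components M. connected_map N)"

definition phi :: "'c gmap \<Rightarrow> 'c \<Rightarrow> 'c" where
  "phi M = tau M \<circ> theta M \<circ> sigma M"

definition edges :: "'c gmap \<Rightarrow> 'c set set" where
  "edges M = gen_orbits (crosses M) {theta M, sigma M}"

text \<open>The cycle of a permutation through \<open>a\<close> is represented by its set of crosses, and a pair of
  cycles is unordered, as \<open>a\<close> and \<open>\<sigma> a\<close> belong to the same vertex.  The two sets below leave out
  the vertices and faces of isolated vertex components, which are added in the counts.\<close>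

definition cycle_vertices :: "'c gmap \<Rightarrow> 'c set set set" where
  "cycle_vertices M = (\<lambda>a. {orbit (tau M) a, orbit (tau M) (sigma M a)}) ` crosses M"

definition cycle_faces :: "'c gmap \<Rightarrow> 'c set set set" where
  "cycle_faces M = (\<lambda>a. {orbit (phi M) a, orbit (phi M) (theta M a)}) ` crosses M"

definition num_vertices :: "'c gmap \<Rightarrow> nat" where
  "num_vertices M = card (cycle_vertices M) + empty_pairs M"

definition num_edges :: "'c gmap \<Rightarrow> nat" where
  "num_edges M = card (edges M)"

definition num_faces :: "'c gmap \<Rightarrow> nat" where
  "num_faces M = card (cycle_faces M) + empty_pairs M"

definition num_components :: "'c gmap \<Rightarrow> nat" where
  "num_components M = size (components M)"

section \<open>Genus\<close>

definition orientable :: "'c gmap \<Rightarrow> bool" where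
  "orientable M \<longleftrightarrow> M = isolated_vertex \<or>
    card (gen_orbits (crosses M) {theta M \<circ> sigma M, tau M}) = 2"

definition nonorientable :: "'c gmap \<Rightarrow> bool" where
  "nonorientable M \<longleftrightarrow> crosses M \<noteq> {} \<and>
    (\<forall>a\<in>crosses M. gen_orbit (crosses M) {theta M \<circ> sigma M, tau M} a = crosses M)"

definition euler_genus :: "'c gmap \<Rightarrow> int" where
  "euler_genus M = 2 * int (num_components M) - int (num_vertices M)
     + int (num_edges M) - int (num_faces M)"

text \<open>The Euler genus of an orientable connected map is even (it is \<open>2 - \<chi>\<close> of a closed
  orientable surface), so the integer division below is exact.\<close>

definition genus :: "'c gmap \<Rightarrow> int" where
  "genus M = (if orientable M then euler_genus M div 2 else euler_genus M)"

section \<open>Deletion of edges\<close>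

text \<open>The cycles of \<open>\<tau>\<close> come in pairs (the vertices), and since an edge is closed under \<open>\<sigma>\<close>, both
  cycles of a pair are contained in it or neither is.  Hence each vertex with all crosses in the
  deleted edge \<open>e\<close> contributes one new pair of empty cycles.\<close>

definition delete_edge :: "'c gmap \<Rightarrow> 'c set \<Rightarrow> 'c gmap" where
  "delete_edge M e =
    \<lparr>crosses = crosses M - e,
     theta = perm_restrict (theta M) (crosses M - e),
     sigma = perm_restrict (sigma M) (crosses M - e),
     tau = perm_restrict (\<lambda>b. (tau M ^^ (LEAST j. 1 \<le> j \<and> (tau M ^^ j) b \<notin> e)) b) (crosses M - e),
     empty_pairs = empty_pairs M + card {v \<in> cycle_vertices M. \<Union>v \<subseteq> e}\<rparr>"

text \<open>The edges in \<open>B\<close> are deleted one after the other.  For edges of a map, first return maps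
  compose, so every order of deletion gives the same result and the fold is well-defined.\<close>

definition delete_edges :: "'c gmap \<Rightarrow> 'c set set \<Rightarrow> 'c gmap" where
  "delete_edges M B = Finite_Set.fold (\<lambda>e N. delete_edge N e) M B"

section \<open>Local flows\<close>

text \<open>The library's \<open>support \<tau> a\<close> is the list \<open>[a, \<tau> a, \<dots>, \<tau>\<^sup>-\<^sup>1 a]\<close> of the crosses of the cycle of \<open>\<tau>\<close>
  through \<open>a\<close>.  Local flows are extensional functions, so that they can be counted.\<close>

definition local_flows :: "('g, 'x) monoid_scheme \<Rightarrow> 'c gmap \<Rightarrow> ('c \<Rightarrow> 'g) set" where
  "local_flows G M = {\<psi> \<in> crosses M \<rightarrow>\<^sub>E carrier G.
     (\<forall>a\<in>crosses M. \<psi> (sigma M a) = inv\<^bsub>G\<^esub> (\<psi> a) \<and> \<psi> (theta M a) = \<psi> a) \<and>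
     (\<forall>a\<in>crosses M.
        foldr (\<lambda>x y. x \<otimes>\<^bsub>G\<^esub> y) (map \<psi> (support (tau M) a)) \<one>\<^bsub>G\<^esub> = \<one>\<^bsub>G\<^esub>)}"

definition num_nowhere_identity_flows :: "('g, 'x) monoid_scheme \<Rightarrow> 'c gmap \<Rightarrow> nat" where
  "num_nowhere_identity_flows G M =
     card {\<psi> \<in> local_flows G M. \<forall>a\<in>crosses M. \<psi> a \<noteq> \<one>\<^bsub>G\<^esub>}"

section \<open>Complex representations\<close>

text \<open>Representations are given in coordinates, as homomorphisms into \<open>GL\<^sub>n(\<complex>)\<close>; irreducible
  complex representations of a finite group are finite-dimensional.  Only the values on the carrier
  matter, and functions that agree there are equivalent.\<close>

abbreviation mat_ring :: "nat \<Rightarrow> complex mat ring" where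
  "mat_ring n \<equiv> ring_mat TYPE(complex) n ()"

definition rep_dim :: "('g, 'x) monoid_scheme \<Rightarrow> ('g \<Rightarrow> complex mat) \<Rightarrow> nat" where
  "rep_dim G R = dim_row (R \<one>\<^bsub>G\<^esub>)"

definition representation :: "('g, 'x) monoid_scheme \<Rightarrow> ('g \<Rightarrow> complex mat) \<Rightarrow> bool" where
  "representation G R \<longleftrightarrow> R \<in> hom G (units_of (mat_ring (rep_dim G R)))"

definition irreducible_rep :: "('g, 'x) monoid_scheme \<Rightarrow> ('g \<Rightarrow> complex mat) \<Rightarrow> bool" where
  "irreducible_rep G R \<longleftrightarrow> representation G R \<and> rep_dim G R > 0 \<and>
    (\<forall>W. VectorSpace.subspace class_ring W (module_vec TYPE(complex) (rep_dim G R)) \<longrightarrow>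
         (\<forall>g\<in>carrier G. \<forall>w\<in>W. R g *\<^sub>v w \<in> W) \<longrightarrow>
         W = {0\<^sub>v (rep_dim G R)} \<or> W = carrier_vec (rep_dim G R))"

definition equivalent_reps ::
    "('g, 'x) monoid_scheme \<Rightarrow> ('g \<Rightarrow> complex mat) \<Rightarrow> ('g \<Rightarrow> complex mat) \<Rightarrow> bool" where
  "equivalent_reps G R S \<longleftrightarrow> rep_dim G R = rep_dim G S \<and>
    (\<exists>P\<in>Units (mat_ring (rep_dim G R)). \<forall>g\<in>carrier G. P * R g = S g * P)"

definition irrep_classes :: "('g, 'x) monoid_scheme \<Rightarrow> ('g \<Rightarrow> complex mat) set set" where
  "irrep_classes G = {R. irreducible_rep G R} //
     {(R, S). irreducible_rep G R \<and> irreducible_rep G S \<and> equivalent_reps G R S}"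

definition rep_character ::
    "('g, 'x) monoid_scheme \<Rightarrow> ('g \<Rightarrow> complex mat) \<Rightarrow> 'g \<Rightarrow> complex" where
  "rep_character G R g = (\<Sum>i<rep_dim G R. R g $$ (i, i))"

definition frobenius_schur :: "('g, 'x) monoid_scheme \<Rightarrow> ('g \<Rightarrow> complex mat) \<Rightarrow> complex" where
  "frobenius_schur G R =
     (1 / of_nat (card (carrier G))) * (\<Sum>g\<in>carrier G. rep_character G R (g \<otimes>\<^bsub>G\<^esub> g))"

text \<open>Dimension and indicator of an equivalence class, read off from a representative (they do not
  depend on which).\<close>

definition class_dim :: "('g, 'x) monoid_scheme \<Rightarrow> ('g \<Rightarrow> complex mat) set \<Rightarrow> nat" where
  "class_dim G \<rho> = rep_dim G (SOME R. R \<in> \<rho>)"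

definition class_frobenius_schur ::
    "('g, 'x) monoid_scheme \<Rightarrow> ('g \<Rightarrow> complex mat) set \<Rightarrow> complex" where
  "class_frobenius_schur G \<rho> = frobenius_schur G (SOME R. R \<in> \<rho>)"

end

theory Submission
  imports Defs "Jordan_Normal_Form.Spectral_Radius"
begin

text \<open>By inclusion-exclusion over the edges on which a flow is trivial it suffices to count all local
  flows of the maps \<open>M \ A\<^sup>c\<close>: a flow of \<open>M\<close> that is trivial on \<open>A\<^sup>c\<close> is the same as a flow of
  \<open>M \ A\<^sup>c\<close>, since the two products around a vertex agree.  The number of flows is multiplicative
  over components.

  For one component, choose one cycle at every vertex and replace each vertex condition by the
  expansion of the delta function at \<open>1\<close> in irreducible characters.  Written out in matrix
  entries, this is a sum over representations at the vertices and over an index at every corner.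
  Schur orthogonality, applied to the sum over the group element at each edge, forces adjacent
  representations to be equal across an untwisted edge and dual across a twisted one, and
  identifies indices along the faces.  Hence one representation \<open>\<rho>\<close> survives on the whole
  component, each vertex and each face contributes a factor \<open>n\<^sub>\<rho>\<close> and each edge \<open>|G| / n\<^sub>\<rho>\<close>.  If the
  component is non-orientable, \<open>\<rho>\<close> must be self-dual, and the twisted edges insert an invariant
  bilinear form \<open>B\<close> with \<open>B\<^sup>T = F(\<rho>) B\<close>.  These matrices cancel along the faces up to a power of
  \<open>F(\<rho>)\<close>, whose exponent has the parity of the genus; the parity is found by comparing signs
  of permutations.\<close>

section \<open>Matrix representations of finite groups\<close>

lemma mat_entry_mult:
  assumes "A \<in> carrier_mat n k" "B \<in> carrier_mat k m" "i < n" "j < m"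
  shows "(A * B) $$ (i, j) = (\<Sum>l<k. A $$ (i, l) * B $$ (l, j))"
  using assms by (auto simp: scalar_prod_def atLeast0LessThan)

lemma mat_vec_entry:
  assumes "A \<in> carrier_mat n k" "x \<in> carrier_vec k" "i < n"
  shows "(A *\<^sub>v x) $ i = (\<Sum>l<k. A $$ (i, l) * x $ l)"
  using assms by (auto simp: scalar_prod_def atLeast0LessThan)

lemma mat_eq_by_vec:
  fixes A B :: "'a :: comm_ring_1 mat"
  assumes A: "A \<in> carrier_mat n m" and B: "B \<in> carrier_mat n m"
    and eq: "\<And>x. x \<in> carrier_vec m \<Longrightarrow> A *\<^sub>v x = B *\<^sub>v x"
  shows "A = B"
proof (rule eq_matI)
  fix i j assume ij: "i < dim_row B" "j < dim_col B"
  then have j: "j < m" and i: "i < n" using B by auto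
  have "(A *\<^sub>v unit_vec m j) $ i = (B *\<^sub>v unit_vec m j) $ i"
    using eq[of "unit_vec m j"] by simp
  then show "A $$ (i,j) = B $$ (i,j)"
    using i j A B by (simp add: scalar_prod_right_unit)
qed (use A B in auto)

lemma left_inverse_dim_le:
  fixes P Q :: "'a :: field mat"
  assumes P: "P \<in> carrier_mat n m" and Q: "Q \<in> carrier_mat m n" and QP: "Q * P = 1\<^sub>m m"
  shows "m \<le> n"
proof (rule ccontr)
  assume "\<not> m \<le> n"
  then have nm: "n < m" by simp
  define P' where "P' = mat m m (\<lambda>(i,j). if i < n then P $$ (i,j) else 0)"
  define Q' where "Q' = mat m m (\<lambda>(i,j). if j < n then Q $$ (i,j) else 0)"
  have P': "P' \<in> carrier_mat m m" and Q': "Q' \<in> carrier_mat m m"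
    unfolding P'_def Q'_def by auto
  have "Q' * P' = Q * P"
  proof (rule eq_matI)
    fix i j assume "i < dim_row (Q * P)" "j < dim_col (Q * P)"
    then have ij: "i < m" "j < m" using P Q by auto
    have "(Q' * P') $$ (i,j) = (\<Sum>l<m. Q' $$ (i,l) * P' $$ (l,j))"
      using mat_entry_mult[OF Q' P' ij] .
    also have "\<dots> = (\<Sum>l<m. if l \<in> {..<n} then Q $$ (i,l) * P $$ (l,j) else 0)"
      using ij by (intro sum.cong) (auto simp: P'_def Q'_def)
    also have "\<dots> = (\<Sum>l\<in>{..<m} \<inter> {..<n}. Q $$ (i,l) * P $$ (l,j))"
      by (rule sum.inter_restrict[symmetric]) simp
    also have "{..<m} \<inter> {..<n} = {..<n}" using nm by auto
    also have "(\<Sum>l<n. Q $$ (i,l) * P $$ (l,j)) = (Q * P) $$ (i,j)"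
      using mat_entry_mult[OF Q P ij] by simp
    finally show "(Q' * P') $$ (i,j) = (Q * P) $$ (i,j)" .
  qed (use P Q P' Q' in auto)
  then have "P' * Q' = 1\<^sub>m m"
    using mat_mult_left_right_inverse[OF Q' P'] QP by simp
  then have "(P' * Q') $$ (n, n) = 1" using nm by simp
  moreover have "(P' * Q') $$ (n, n) = (\<Sum>l<m. P' $$ (n,l) * Q' $$ (l,n))"
    using mat_entry_mult[OF P' Q' nm nm] .
  ultimately show False using nm by (simp add: P'_def)
qed

definition lin_subspace :: "nat \<Rightarrow> 'a :: field vec set \<Rightarrow> bool" where
  "lin_subspace n W \<longleftrightarrow> W \<subseteq> carrier_vec n \<and> 0\<^sub>v n \<in> W \<and>
     (\<forall>u\<in>W. \<forall>v\<in>W. u + v \<in> W) \<and> (\<forall>c. \<forall>v\<in>W. c \<cdot>\<^sub>v v \<in> W)"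

lemma lin_subspace_basis:
  fixes W :: "'a :: field vec set"
  assumes W: "lin_subspace n W"
  obtains m P Q where "P \<in> carrier_mat n m" "Q \<in> carrier_mat m n" "Q * P = 1\<^sub>m m"
    "W = {P *\<^sub>v x | x. x \<in> carrier_vec m}"
proof -
  define Good where "Good m P Q \<longleftrightarrow> P \<in> carrier_mat n m \<and> Q \<in> carrier_mat m n \<and>
    Q * P = 1\<^sub>m m \<and> (\<forall>x\<in>carrier_vec m. P *\<^sub>v x \<in> W)" for m and P Q :: "'a mat"
  have sub: "W \<subseteq> carrier_vec n" and add: "\<And>u v. u \<in> W \<Longrightarrow> v \<in> W \<Longrightarrow> u + v \<in> W"
    and smult: "\<And>c v. v \<in> W \<Longrightarrow> c \<cdot>\<^sub>v v \<in> W" and zero: "0\<^sub>v n \<in> W"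
    using W unfolding lin_subspace_def by auto
  have "Good 0 (0\<^sub>m n 0) (0\<^sub>m 0 n)"
  proof -
    have "0\<^sub>m n 0 *\<^sub>v x = 0\<^sub>v n" if "x \<in> carrier_vec 0" for x :: "'a vec"
      using that by (intro eq_vecI) (auto simp: scalar_prod_def)
    then show ?thesis unfolding Good_def using zero by (auto intro!: eq_matI)
  qed
  then have ex: "\<exists>m. \<exists>P Q. Good m P Q" by blast
  have bound: "m \<le> n" if "\<exists>P Q. Good m P Q" for m
    using that left_inverse_dim_le unfolding Good_def by blast
  define m where "m = (GREATEST m. \<exists>P Q. Good m P Q)"
  have "\<exists>P Q. Good m P Q" unfolding m_def
    using ex bound by (rule GreatestI_ex_nat)
  then obtain P Q where G: "Good m P Q" by blast
  have max: "\<not> Good (Suc m) P' Q'" for P' Q'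
  proof
    assume "Good (Suc m) P' Q'"
    then have "\<exists>P Q. Good (Suc m) P Q" by blast
    then have "Suc m \<le> (GREATEST m. \<exists>P Q. Good m P Q)" using bound by (rule Greatest_le_nat)
    then have "Suc m \<le> m" unfolding m_def .
    then show False by simp
  qed
  have P: "P \<in> carrier_mat n m" and Q: "Q \<in> carrier_mat m n" and QP: "Q * P = 1\<^sub>m m"
    and PW: "\<And>x. x \<in> carrier_vec m \<Longrightarrow> P *\<^sub>v x \<in> W" using G unfolding Good_def by auto
  have "W \<subseteq> {P *\<^sub>v x | x. x \<in> carrier_vec m}"
  proof (rule ccontr)
    assume "\<not> ?thesis"
    then obtain w where w: "w \<in> W" and nw: "\<And>x. x \<in> carrier_vec m \<Longrightarrow> w \<noteq> P *\<^sub>v x" by blast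
    have wc: "w \<in> carrier_vec n" using w sub by auto
    have Qw: "Q *\<^sub>v w \<in> carrier_vec m" using Q wc by auto
    have PQw: "P *\<^sub>v (Q *\<^sub>v w) \<in> carrier_vec n" using P Qw by auto
    define w' where "w' = w + (-1) \<cdot>\<^sub>v (P *\<^sub>v (Q *\<^sub>v w))"
    have w'W: "w' \<in> W" unfolding w'_def using w PW[OF Qw] add smult by blast
    have w'c: "w' \<in> carrier_vec n" using w'W sub by auto
    have "Q *\<^sub>v w' = Q *\<^sub>v w + (-1) \<cdot>\<^sub>v (Q *\<^sub>v (P *\<^sub>v (Q *\<^sub>v w)))"
      unfolding w'_def using Q wc PQw by (simp add: mult_add_distrib_mat_vec mult_mat_vec)
    also have "Q *\<^sub>v (P *\<^sub>v (Q *\<^sub>v w)) = Q *\<^sub>v w"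
      using assoc_mult_mat_vec[OF Q P Qw] QP Qw by simp
    also have "Q *\<^sub>v w + (-1) \<cdot>\<^sub>v (Q *\<^sub>v w) = 0\<^sub>v m"
      using Q by (intro eq_vecI) (auto simp del: index_mult_mat_vec)
    finally have Qw': "Q *\<^sub>v w' = 0\<^sub>v m" .
    have "w' \<noteq> 0\<^sub>v n"
    proof
      assume "w' = 0\<^sub>v n"
      have "w = P *\<^sub>v (Q *\<^sub>v w)"
      proof (rule eq_vecI)
        fix i assume "i < dim_vec (P *\<^sub>v (Q *\<^sub>v w))"
        then have i: "i < n" using P by simp
        have "w' $ i = 0" using \<open>w' = 0\<^sub>v n\<close> i by simp
        then show "w $ i = (P *\<^sub>v (Q *\<^sub>v w)) $ i" using i wc PQw P Q unfolding w'_def by (simp del: index_mult_mat_vec)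
      qed (use P wc in simp)
      then show False using nw[OF Qw] by simp
    qed
    then obtain k where k: "k < n" "w' $ k \<noteq> 0" using w'c
      by (metis carrier_vecD eq_vecI index_zero_vec(1) index_zero_vec(2))
    define P' where "P' = mat n (Suc m) (\<lambda>(i,j). if j < m then P $$ (i,j) else w' $ i / w' $ k)"
    define Q' where "Q' = mat (Suc m) n (\<lambda>(i,j). if i < m then Q $$ (i,j) else
       (if j = k then 1 else 0) - (\<Sum>l<m. P $$ (k,l) * Q $$ (l,j)))"
    have P': "P' \<in> carrier_mat n (Suc m)" and Q': "Q' \<in> carrier_mat (Suc m) n"
      unfolding P'_def Q'_def by auto
    have Qw'e: "(\<Sum>l<n. Q $$ (i,l) * w' $ l) = 0" if "i < m" for i
      using mat_vec_entry[OF Q w'c that] Qw' that by simp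
    have QPe: "(\<Sum>l<n. Q $$ (i,l) * P $$ (l,j)) = (if i = j then 1 else 0)" if "i < m" "j < m" for i j
      using mat_entry_mult[OF Q P that] QP that by simp
    have "Q' * P' = 1\<^sub>m (Suc m)"
    proof (rule eq_matI)
      fix i j assume "i < dim_row (1\<^sub>m (Suc m))" "j < dim_col (1\<^sub>m (Suc m))"
      then have ij: "i < Suc m" "j < Suc m" by auto
      have e: "(Q' * P') $$ (i,j) = (\<Sum>l<n. Q' $$ (i,l) * P' $$ (l,j))"
        using mat_entry_mult[OF Q' P' ij] .
      define v where "v l = (if j < m then P $$ (l,j) else w' $ l / w' $ k)" for l
      have v: "P' $$ (l,j) = v l" if "l < n" for l using ij that by (simp add: P'_def v_def)
      have Qv: "(\<Sum>l<n. Q $$ (r,l) * v l) = (if r = j then 1 else 0)" if r: "r < m" for r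
      proof (cases "j < m")
        case True then show ?thesis using QPe[OF r True] by (simp add: v_def)
      next
        case False
        then have "(\<Sum>l<n. Q $$ (r,l) * v l) = (\<Sum>l<n. Q $$ (r,l) * w' $ l) / w' $ k"
          by (simp add: v_def sum_divide_distrib)
        then show ?thesis using Qw'e[OF r] False r by auto
      qed
      show "(Q' * P') $$ (i,j) = 1\<^sub>m (Suc m) $$ (i,j)"
      proof (cases "i < m")
        case True
        have "(Q' * P') $$ (i,j) = (\<Sum>l<n. Q $$ (i,l) * v l)" unfolding e
          using ij True by (intro sum.cong) (auto simp: Q'_def v)
        then show ?thesis using Qv[OF True] ij by simp
      next
        case False
        then have im: "i = m" using ij by simp
        have "(Q' * P') $$ (i,j) = (\<Sum>l<n. ((if l = k then 1 else 0) - (\<Sum>r<m. P $$ (k,r) * Q $$ (r,l))) * v l)"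
          unfolding e using ij im by (intro sum.cong) (auto simp: Q'_def v)
        also have "\<dots> = (\<Sum>l<n. (if l = k then v l else 0)) - (\<Sum>l<n. (\<Sum>r<m. P $$ (k,r) * Q $$ (r,l)) * v l)"
          by (simp add: left_diff_distrib sum_subtractf if_distrib[of "\<lambda>x. x * _"] cong: if_cong)
        also have "(\<Sum>l<n. (if l = k then v l else 0)) = v k" using k by simp
        also have "(\<Sum>l<n. (\<Sum>r<m. P $$ (k,r) * Q $$ (r,l)) * v l) = (\<Sum>r<m. P $$ (k,r) * (\<Sum>l<n. Q $$ (r,l) * v l))"
          unfolding sum_distrib_left sum_distrib_right by (subst sum.swap) (simp add: mult.assoc)
        also have "\<dots> = (\<Sum>r<m. if r = j then P $$ (k,r) else 0)"
          by (intro sum.cong) (auto simp: Qv)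
        also have "\<dots> = (if j < m then P $$ (k,j) else 0)" by simp
        finally show ?thesis using k ij im by (auto simp: v_def)
      qed
    qed (use P' Q' in auto)
    moreover have "P' *\<^sub>v x \<in> W" if x: "x \<in> carrier_vec (Suc m)" for x
    proof -
      define y where "y = vec m (\<lambda>i. x $ i)"
      have y: "y \<in> carrier_vec m" unfolding y_def by simp
      have Py: "P *\<^sub>v y \<in> carrier_vec n" using P y by auto
      have "P' *\<^sub>v x = P *\<^sub>v y + (x $ m / w' $ k) \<cdot>\<^sub>v w'"
      proof (rule eq_vecI)
        fix i assume "i < dim_vec (P *\<^sub>v y + (x $ m / w' $ k) \<cdot>\<^sub>v w')"
        then have i: "i < n" using w'c by simp
        have "(P' *\<^sub>v x) $ i = (\<Sum>l<m. P' $$ (i,l) * x $ l) + P' $$ (i,m) * x $ m"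
          unfolding mat_vec_entry[OF P' x i] by simp
        also have "(\<Sum>l<m. P' $$ (i,l) * x $ l) = (\<Sum>l<m. P $$ (i,l) * y $ l)"
          using i by (intro sum.cong) (auto simp: P'_def y_def)
        also have "\<dots> = (P *\<^sub>v y) $ i" unfolding mat_vec_entry[OF P y i] ..
        finally show "(P' *\<^sub>v x) $ i = (P *\<^sub>v y + (x $ m / w' $ k) \<cdot>\<^sub>v w') $ i"
          using i w'c Py by (simp add: P'_def del: index_mult_mat_vec)
      qed (use P' w'c in auto)
      then show ?thesis using PW[OF y] w'W add smult by auto
    qed
    ultimately have "Good (Suc m) P' Q'" unfolding Good_def using P' Q' by auto
    then show False using max by blast
  qed
  then have "W = {P *\<^sub>v x | x. x \<in> carrier_vec m}" using PW by auto
  then show ?thesis using that P Q QP by blast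
qed

definition mat_rep :: "('g, 'x) monoid_scheme \<Rightarrow> nat \<Rightarrow> ('g \<Rightarrow> complex mat) \<Rightarrow> bool" where
  "mat_rep G n R \<longleftrightarrow> (\<forall>g\<in>carrier G. R g \<in> carrier_mat n n) \<and> R \<one>\<^bsub>G\<^esub> = 1\<^sub>m n \<and>
     (\<forall>g\<in>carrier G. \<forall>h\<in>carrier G. R (g \<otimes>\<^bsub>G\<^esub> h) = R g * R h)"

lemma mat_repD:
  assumes "mat_rep G n R"
  shows "g \<in> carrier G \<Longrightarrow> R g \<in> carrier_mat n n" "R \<one>\<^bsub>G\<^esub> = 1\<^sub>m n"
    "g \<in> carrier G \<Longrightarrow> h \<in> carrier G \<Longrightarrow> R (g \<otimes>\<^bsub>G\<^esub> h) = R g * R h"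
  using assms unfolding mat_rep_def by auto

lemma mult_mat_zero_vec: "A \<in> carrier_mat n m \<Longrightarrow> A *\<^sub>v 0\<^sub>v m = 0\<^sub>v n" for A :: "'a :: semiring_0 mat"
  by (intro eq_vecI) auto

lemma mult_zero_mat_vec: "x \<in> carrier_vec m \<Longrightarrow> 0\<^sub>m n m *\<^sub>v x = 0\<^sub>v n" for x :: "'a :: semiring_0 vec"
  by (intro eq_vecI) auto

lemma smult_one_mat_commute:
  fixes A :: "'a :: comm_ring_1 mat"
  assumes "A \<in> carrier_mat n n"
  shows "(c \<cdot>\<^sub>m 1\<^sub>m n) * A = c \<cdot>\<^sub>m A" "A * (c \<cdot>\<^sub>m 1\<^sub>m n) = c \<cdot>\<^sub>m A"
proof -
  show "(c \<cdot>\<^sub>m 1\<^sub>m n) * A = c \<cdot>\<^sub>m A"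
    using mult_smult_assoc_mat[OF one_carrier_mat assms] assms by simp
  show "A * (c \<cdot>\<^sub>m 1\<^sub>m n) = c \<cdot>\<^sub>m A"
    using mult_smult_distrib[OF assms one_carrier_mat] assms by simp
qed

lemma (in group) mat_rep_inv:
  assumes "mat_rep G n R" "g \<in> carrier G"
  shows "R g * R (inv g) = 1\<^sub>m n" "R (inv g) * R g = 1\<^sub>m n"
  using mat_repD(2,3)[OF assms(1)] assms(2) by (metis inv_closed r_inv l_inv)+

lemma (in group) representation_iff_mat_rep:
  "representation G R \<longleftrightarrow> mat_rep G (rep_dim G R) R"
proof
  let ?n = "rep_dim G R"
  interpret mr: ring "mat_ring ?n" by (rule ring_mat)
  assume "representation G R"
  then have hom: "R \<in> hom G (units_of (mat_ring ?n))" unfolding representation_def .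
  interpret u: group "units_of (mat_ring ?n)" by (rule mr.units_group)
  interpret h: group_hom G "units_of (mat_ring ?n)" R
    by unfold_locales (use hom in auto)
  have "R g \<in> carrier_mat ?n ?n" if "g \<in> carrier G" for g
    using h.hom_closed[OF that] by (auto simp: units_of_def Units_def ring_mat_simps)
  moreover have "R \<one> = 1\<^sub>m ?n" using h.hom_one by (simp add: units_of_def ring_mat_simps)
  moreover have "R (g \<otimes> h) = R g * R h" if "g \<in> carrier G" "h \<in> carrier G" for g h
    using h.hom_mult[OF that] by (simp add: units_of_def ring_mat_simps)
  ultimately show "mat_rep G ?n R" unfolding mat_rep_def by auto
next
  let ?n = "rep_dim G R"
  assume m: "mat_rep G ?n R"
  have "R g \<in> Units (mat_ring ?n)" if "g \<in> carrier G" for g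
    using mat_repD(1)[OF m that] mat_repD(1)[OF m inv_closed[OF that]] mat_rep_inv[OF m that]
    by (auto simp: Units_def ring_mat_simps)
  then show "representation G R" unfolding representation_def hom_def
    using mat_repD(3)[OF m] by (auto simp: units_of_def ring_mat_simps)
qed

lemma mat_rep_dim: "mat_rep G n R \<Longrightarrow> rep_dim G R = n"
  unfolding mat_rep_def rep_dim_def by auto

lemma lin_subspace_iff:
  "VectorSpace.subspace class_ring W (module_vec TYPE(complex) n) \<longleftrightarrow> lin_subspace n W"
proof -
  interpret v: vec_space "TYPE(complex)" n .
  have "vectorspace class_ring (module_vec TYPE(complex) n)" by (rule v.vectorspace_axioms)
  moreover have "Module.module class_ring (module_vec TYPE(complex) n)" by (rule v.module_axioms)
  ultimately show ?thesis
    unfolding VectorSpace.subspace_def submodule_def lin_subspace_def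
    by (auto simp: module_vec_simps)
qed

definition irreducible_mat_rep :: "('g, 'x) monoid_scheme \<Rightarrow> nat \<Rightarrow> ('g \<Rightarrow> complex mat) \<Rightarrow> bool" where
  "irreducible_mat_rep G n R \<longleftrightarrow> mat_rep G n R \<and> n > 0 \<and>
     (\<forall>W. lin_subspace n W \<longrightarrow> (\<forall>g\<in>carrier G. \<forall>w\<in>W. R g *\<^sub>v w \<in> W) \<longrightarrow>
        W = {0\<^sub>v n} \<or> W = carrier_vec n)"

lemma (in group) irreducible_rep_iff:
  "irreducible_rep G R \<longleftrightarrow> irreducible_mat_rep G (rep_dim G R) R"
  unfolding irreducible_rep_def irreducible_mat_rep_def
  by (simp add: representation_iff_mat_rep lin_subspace_iff)

lemma lin_subspace_range:
  assumes A: "A \<in> carrier_mat n m"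
  shows "lin_subspace n {A *\<^sub>v x | x. x \<in> carrier_vec m}"
  unfolding lin_subspace_def
proof (intro conjI ballI allI)
  show "{A *\<^sub>v x |x. x \<in> carrier_vec m} \<subseteq> carrier_vec n" using A by auto
  have "A *\<^sub>v 0\<^sub>v m = 0\<^sub>v n" using A by (intro eq_vecI) auto
  then show "0\<^sub>v n \<in> {A *\<^sub>v x |x. x \<in> carrier_vec m}" by (metis (mono_tags) mem_Collect_eq zero_carrier_vec)
next
  fix u v assume "u \<in> {A *\<^sub>v x |x. x \<in> carrier_vec m}" "v \<in> {A *\<^sub>v x |x. x \<in> carrier_vec m}"
  then obtain x y where "x \<in> carrier_vec m" "y \<in> carrier_vec m" "u = A *\<^sub>v x" "v = A *\<^sub>v y" by auto
  then show "u + v \<in> {A *\<^sub>v x |x. x \<in> carrier_vec m}"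
    using mult_add_distrib_mat_vec[OF A] by (metis (mono_tags, lifting) add_carrier_vec mem_Collect_eq)
next
  fix c u assume "u \<in> {A *\<^sub>v x |x. x \<in> carrier_vec m}"
  then obtain x where "x \<in> carrier_vec m" "u = A *\<^sub>v x" by auto
  then show "c \<cdot>\<^sub>v u \<in> {A *\<^sub>v x |x. x \<in> carrier_vec m}"
    using mult_mat_vec[OF A] by (metis (mono_tags, lifting) smult_carrier_vec mem_Collect_eq)
qed

lemma lin_subspace_kernel:
  assumes A: "A \<in> carrier_mat n m"
  shows "lin_subspace m {x \<in> carrier_vec m. A *\<^sub>v x = 0\<^sub>v n}"
  unfolding lin_subspace_def
  using A by (auto simp: mult_add_distrib_mat_vec mult_mat_vec)

lemma irreducible_range:
  assumes irr: "irreducible_mat_rep G n R" and A: "A \<in> carrier_mat n m"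
    and inv: "\<And>g x. g \<in> carrier G \<Longrightarrow> x \<in> carrier_vec m \<Longrightarrow> \<exists>y\<in>carrier_vec m. R g *\<^sub>v (A *\<^sub>v x) = A *\<^sub>v y"
  shows "A = 0\<^sub>m n m \<or> (\<exists>C\<in>carrier_mat m n. A * C = 1\<^sub>m n)"
proof -
  let ?W = "{A *\<^sub>v x | x. x \<in> carrier_vec m}"
  have "?W = {0\<^sub>v n} \<or> ?W = carrier_vec n"
    using irr lin_subspace_range[OF A] inv unfolding irreducible_mat_rep_def by blast
  then show ?thesis
  proof
    assume W: "?W = {0\<^sub>v n}"
    have "A = 0\<^sub>m n m"
    proof (rule mat_eq_by_vec[OF A])
      fix x :: "complex vec" assume "x \<in> carrier_vec m"
      then show "A *\<^sub>v x = 0\<^sub>m n m *\<^sub>v x" using W by (subst mult_zero_mat_vec) auto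
    qed simp
    then show ?thesis ..
  next
    assume W: "?W = carrier_vec n"
    have "\<forall>i<n. \<exists>x. x \<in> carrier_vec m \<and> A *\<^sub>v x = unit_vec n i"
      using W by (smt (verit) mem_Collect_eq unit_vec_carrier)
    then obtain x where x: "\<And>i. i < n \<Longrightarrow> x i \<in> carrier_vec m" "\<And>i. i < n \<Longrightarrow> A *\<^sub>v x i = unit_vec n i"
      by metis
    define C where "C = mat m n (\<lambda>(i,j). x j $ i)"
    have C: "C \<in> carrier_mat m n" unfolding C_def by simp
    have "A * C = 1\<^sub>m n"
    proof (rule eq_matI)
      fix i j assume "i < dim_row (1\<^sub>m n)" "j < dim_col (1\<^sub>m n)"
      then have ij: "i < n" "j < n" by auto
      have "(A * C) $$ (i,j) = (\<Sum>l<m. A $$ (i,l) * C $$ (l,j))" using mat_entry_mult[OF A C ij] .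
      also have "\<dots> = (\<Sum>l<m. A $$ (i,l) * x j $ l)" using ij by (intro sum.cong) (auto simp: C_def)
      also have "\<dots> = (A *\<^sub>v x j) $ i" using mat_vec_entry[OF A x(1)[OF ij(2)] ij(1)] by simp
      finally show "(A * C) $$ (i,j) = 1\<^sub>m n $$ (i,j)" using x(2)[OF ij(2)] ij by simp
    qed (use A C in auto)
    then show ?thesis using C by blast
  qed
qed

lemma inj_mat_left_inverse:
  fixes A A' :: "'a :: field mat"
  assumes A: "A \<in> carrier_mat n m" and C: "C \<in> carrier_mat m n" "A * C = 1\<^sub>m n"
    and D: "D \<in> carrier_mat m n" "D * A = 1\<^sub>m m"
  shows "C = D" "n = m"
proof -
  have "C = (D * A) * C" using C D by simp
  also have "\<dots> = D * (A * C)" using A C D by (intro assoc_mult_mat) auto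
  also have "\<dots> = D" using C D by simp
  finally show "C = D" .
  show "n = m"
    using left_inverse_dim_le[OF A D] left_inverse_dim_le[OF C(1) A C(2)] by simp
qed

lemma schur:
  assumes R: "irreducible_mat_rep G n R" and S: "irreducible_mat_rep G m S"
    and A: "A \<in> carrier_mat m n" and int: "\<And>g. g \<in> carrier G \<Longrightarrow> A * R g = S g * A"
    and nz: "A \<noteq> 0\<^sub>m m n"
  shows "m = n" "\<exists>C\<in>carrier_mat n n. A * C = 1\<^sub>m n \<and> C * A = 1\<^sub>m n"
proof -
  have Rc: "\<And>g. g \<in> carrier G \<Longrightarrow> R g \<in> carrier_mat n n" and Sc: "\<And>g. g \<in> carrier G \<Longrightarrow> S g \<in> carrier_mat m m"
    using R S unfolding irreducible_mat_rep_def mat_rep_def by auto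
  have "\<exists>C\<in>carrier_mat n m. A * C = 1\<^sub>m m"
  proof -
    have "\<exists>y\<in>carrier_vec n. S g *\<^sub>v (A *\<^sub>v x) = A *\<^sub>v y" if g: "g \<in> carrier G" and x: "x \<in> carrier_vec n" for g x
    proof (rule bexI[of _ "R g *\<^sub>v x"])
      show "R g *\<^sub>v x \<in> carrier_vec n" using Rc[OF g] x by auto
      have "S g *\<^sub>v (A *\<^sub>v x) = (S g * A) *\<^sub>v x" using Sc[OF g] A x by simp
      also have "\<dots> = A *\<^sub>v (R g *\<^sub>v x)" using Rc[OF g] A x int[OF g] by (metis assoc_mult_mat_vec)
      finally show "S g *\<^sub>v (A *\<^sub>v x) = A *\<^sub>v (R g *\<^sub>v x)" .
    qed
    then show ?thesis using irreducible_range[OF S A] nz by blast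
  qed
  then obtain C where C: "C \<in> carrier_mat n m" "A * C = 1\<^sub>m m" by blast
  let ?K = "{x \<in> carrier_vec n. A *\<^sub>v x = 0\<^sub>v m}"
  have inv: "R g *\<^sub>v w \<in> ?K" if g: "g \<in> carrier G" and w: "w \<in> ?K" for g w
  proof -
    have "A *\<^sub>v (R g *\<^sub>v w) = (A * R g) *\<^sub>v w" using Rc[OF g] A w by simp
    also have "\<dots> = S g *\<^sub>v (A *\<^sub>v w)" using int[OF g] Sc[OF g] A w by simp
    also have "\<dots> = 0\<^sub>v m" using w mult_mat_zero_vec[OF Sc[OF g]] by simp
    finally show ?thesis using Rc[OF g] w by auto
  qed
  have "?K = {0\<^sub>v n} \<or> ?K = carrier_vec n"
    using R lin_subspace_kernel[OF A] inv unfolding irreducible_mat_rep_def by blast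
  moreover have "?K \<noteq> carrier_vec n"
  proof
    assume K: "?K = carrier_vec n"
    have "A = 0\<^sub>m m n"
    proof (rule mat_eq_by_vec[OF A])
      fix x :: "complex vec" assume "x \<in> carrier_vec n"
      then show "A *\<^sub>v x = 0\<^sub>m m n *\<^sub>v x" using K by (subst mult_zero_mat_vec) auto
    qed simp
    then show False using nz by simp
  qed
  ultimately have K: "?K = {0\<^sub>v n}" by blast
  have CA: "C * A = 1\<^sub>m n"
  proof (rule mat_eq_by_vec[of _ n n])
    show "C * A \<in> carrier_mat n n" using C A by auto
    fix x :: "complex vec" assume x: "x \<in> carrier_vec n"
    have Ax: "A *\<^sub>v x \<in> carrier_vec m" using A x by auto
    have CAx: "C *\<^sub>v (A *\<^sub>v x) \<in> carrier_vec n" using C Ax by auto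
    have "A *\<^sub>v (C *\<^sub>v (A *\<^sub>v x)) = (A * C) *\<^sub>v (A *\<^sub>v x)" using A C(1) Ax by simp
    also have "\<dots> = A *\<^sub>v x" using C(2) Ax by simp
    finally have e: "A *\<^sub>v (C *\<^sub>v (A *\<^sub>v x)) = A *\<^sub>v x" .
    have "A *\<^sub>v (C *\<^sub>v (A *\<^sub>v x) - x) = A *\<^sub>v (C *\<^sub>v (A *\<^sub>v x)) - A *\<^sub>v x"
      using mult_minus_distrib_mat_vec[OF A CAx x] .
    also have "\<dots> = 0\<^sub>v m" using e Ax by simp
    finally have "C *\<^sub>v (A *\<^sub>v x) - x \<in> ?K" using CAx x by auto
    then have z: "C *\<^sub>v (A *\<^sub>v x) - x = 0\<^sub>v n" using K by blast
    have "C *\<^sub>v (A *\<^sub>v x) = x"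
    proof (rule eq_vecI)
      fix i assume i: "i < dim_vec x"
      have "(C *\<^sub>v (A *\<^sub>v x) - x) $ i = 0" using z i x by simp
      then show "(C *\<^sub>v (A *\<^sub>v x)) $ i = x $ i" using i by (simp del: index_mult_mat_vec)
    qed (use C x in simp)
    then show "C * A *\<^sub>v x = 1\<^sub>m n *\<^sub>v x" using C(1) A x by simp
  qed simp
  show "m = n" using inj_mat_left_inverse(2)[OF A C C(1) CA] .
  then show "\<exists>C\<in>carrier_mat n n. A * C = 1\<^sub>m n \<and> C * A = 1\<^sub>m n" using C CA by auto
qed

lemma schur_scalar:
  assumes R: "irreducible_mat_rep G n R" and A: "A \<in> carrier_mat n n"
    and int: "\<And>g. g \<in> carrier G \<Longrightarrow> A * R g = R g * A"
  shows "\<exists>c. A = c \<cdot>\<^sub>m 1\<^sub>m n"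
proof -
  have Rc: "\<And>g. g \<in> carrier G \<Longrightarrow> R g \<in> carrier_mat n n" and n: "n > 0"
    using R unfolding irreducible_mat_rep_def mat_rep_def by auto
  from spectrum_non_empty[OF A n] obtain c where "eigenvalue A c" unfolding spectrum_def by auto
  then obtain v where v: "v \<in> carrier_vec n" "v \<noteq> 0\<^sub>v n" "A *\<^sub>v v = c \<cdot>\<^sub>v v"
    using A unfolding eigenvalue_def eigenvector_def by auto
  define D where "D = A - c \<cdot>\<^sub>m 1\<^sub>m n"
  have D: "D \<in> carrier_mat n n" using A unfolding D_def by auto
  have "D *\<^sub>v v = A *\<^sub>v v - (c \<cdot>\<^sub>m 1\<^sub>m n) *\<^sub>v v"
    using v A unfolding D_def by (intro minus_mult_distrib_mat_vec) auto
  also have "(c \<cdot>\<^sub>m 1\<^sub>m n) *\<^sub>v v = c \<cdot>\<^sub>v v"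
    using v(1) by (intro eq_vecI) auto
  finally have Dv: "D *\<^sub>v v = 0\<^sub>v n" using v by simp
  have "D * R g = R g * D" if g: "g \<in> carrier G" for g
  proof -
    have "D * R g = A * R g - (c \<cdot>\<^sub>m 1\<^sub>m n) * R g" unfolding D_def using A Rc[OF g]
      by (intro minus_mult_distrib_mat) auto
    also have "(c \<cdot>\<^sub>m 1\<^sub>m n) * R g = R g * (c \<cdot>\<^sub>m 1\<^sub>m n)"
      using smult_one_mat_commute[OF Rc[OF g]] by simp
    also have "A * R g - R g * (c \<cdot>\<^sub>m 1\<^sub>m n) = R g * D" unfolding D_def int[OF g] using A Rc[OF g]
      by (intro mult_minus_distrib_mat[symmetric]) auto
    finally show ?thesis .
  qed
  note comm = this
  have D0: "D = 0\<^sub>m n n"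
  proof (rule ccontr)
    assume "D \<noteq> 0\<^sub>m n n"
    from schur(2)[OF R R D comm this] obtain C where C: "C \<in> carrier_mat n n" "C * D = 1\<^sub>m n" by auto
    have "v = (C * D) *\<^sub>v v" using C v by simp
    also have "\<dots> = C *\<^sub>v (D *\<^sub>v v)" using C(1) D v(1) by (rule assoc_mult_mat_vec)
    also have "\<dots> = 0\<^sub>v n" using Dv mult_mat_zero_vec[OF C(1)] by simp
    finally show False using v by simp
  qed
  have "A = c \<cdot>\<^sub>m 1\<^sub>m n"
  proof (rule eq_matI)
    fix i j assume ij: "i < dim_row (c \<cdot>\<^sub>m 1\<^sub>m n)" "j < dim_col (c \<cdot>\<^sub>m 1\<^sub>m n)"
    then have "D $$ (i,j) = 0" using D0 by simp
    then show "A $$ (i,j) = (c \<cdot>\<^sub>m 1\<^sub>m n) $$ (i,j)" using ij A unfolding D_def by simp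
  qed (use A in auto)
  then show ?thesis ..
qed

definition mat_sum :: "nat \<Rightarrow> nat \<Rightarrow> ('i \<Rightarrow> 'a :: comm_ring_1 mat) \<Rightarrow> 'i set \<Rightarrow> 'a mat" where
  "mat_sum n m f A = mat n m (\<lambda>ij. \<Sum>g\<in>A. f g $$ ij)"

lemma mat_sum_carrier [simp]: "mat_sum n m f A \<in> carrier_mat n m"
  unfolding mat_sum_def by simp

lemma mat_sum_entry: "i < n \<Longrightarrow> j < m \<Longrightarrow> mat_sum n m f A $$ (i, j) = (\<Sum>g\<in>A. f g $$ (i, j))"
  unfolding mat_sum_def by simp

lemma mat_sum_cong: "(\<And>g. g \<in> A \<Longrightarrow> f g = f' g) \<Longrightarrow> mat_sum n m f A = mat_sum n m f' A"
  unfolding mat_sum_def by simp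

lemma mat_sum_mult_left:
  assumes X: "X \<in> carrier_mat k n" and f: "\<And>g. g \<in> A \<Longrightarrow> f g \<in> carrier_mat n m"
  shows "X * mat_sum n m f A = mat_sum k m (\<lambda>g. X * f g) A"
proof (rule eq_matI)
  fix i j assume "i < dim_row (mat_sum k m (\<lambda>g. X * f g) A)" "j < dim_col (mat_sum k m (\<lambda>g. X * f g) A)"
  then have ij: "i < k" "j < m" by (auto simp: mat_sum_def)
  have "(X * mat_sum n m f A) $$ (i,j) = (\<Sum>l<n. \<Sum>g\<in>A. X $$ (i,l) * f g $$ (l,j))"
    unfolding mat_entry_mult[OF X mat_sum_carrier ij] using ij by (simp add: mat_sum_entry sum_distrib_left)
  also have "\<dots> = (\<Sum>g\<in>A. \<Sum>l<n. X $$ (i,l) * f g $$ (l,j))" by (rule sum.swap)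
  also have "\<dots> = (\<Sum>g\<in>A. (X * f g) $$ (i,j))"
    by (intro sum.cong refl mat_entry_mult[OF X f ij, symmetric])
  finally show "(X * mat_sum n m f A) $$ (i,j) = mat_sum k m (\<lambda>g. X * f g) A $$ (i,j)"
    using ij by (simp add: mat_sum_entry)
qed (use X in \<open>auto simp: mat_sum_def\<close>)

lemma mat_sum_mult_right:
  assumes X: "X \<in> carrier_mat m k" and f: "\<And>g. g \<in> A \<Longrightarrow> f g \<in> carrier_mat n m"
  shows "mat_sum n m f A * X = mat_sum n k (\<lambda>g. f g * X) A"
proof (rule eq_matI)
  fix i j assume "i < dim_row (mat_sum n k (\<lambda>g. f g * X) A)" "j < dim_col (mat_sum n k (\<lambda>g. f g * X) A)"
  then have ij: "i < n" "j < k" by (auto simp: mat_sum_def)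
  have "(mat_sum n m f A * X) $$ (i,j) = (\<Sum>l<m. \<Sum>g\<in>A. f g $$ (i,l) * X $$ (l,j))"
    unfolding mat_entry_mult[OF mat_sum_carrier X ij] using ij by (simp add: mat_sum_entry sum_distrib_right)
  also have "\<dots> = (\<Sum>g\<in>A. \<Sum>l<m. f g $$ (i,l) * X $$ (l,j))" by (rule sum.swap)
  also have "\<dots> = (\<Sum>g\<in>A. (f g * X) $$ (i,j))"
    by (intro sum.cong refl mat_entry_mult[OF f X ij, symmetric])
  finally show "(mat_sum n m f A * X) $$ (i,j) = mat_sum n k (\<lambda>g. f g * X) A $$ (i,j)"
    using ij by (simp add: mat_sum_entry)
qed (use X in \<open>auto simp: mat_sum_def\<close>)

lemma card_le_of_biorthogonal:
  fixes X :: "'b \<Rightarrow> 'a \<Rightarrow> 'c :: field"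
  assumes fin: "finite I" "finite J"
    and bi: "\<And>x y. x \<in> I \<Longrightarrow> y \<in> I \<Longrightarrow> (\<Sum>g\<in>J. Y x g * X g y) = (if x = y then 1 else 0)"
  shows "card I \<le> card J"
proof -
  obtain eI where eI: "bij_betw eI {..<card I} I"
    using ex_bij_betw_nat_finite[OF fin(1)] by (auto simp: atLeast0LessThan)
  obtain eJ where eJ: "bij_betw eJ {..<card J} J"
    using ex_bij_betw_nat_finite[OF fin(2)] by (auto simp: atLeast0LessThan)
  define P where "P = mat (card J) (card I) (\<lambda>(a,b). X (eJ a) (eI b))"
  define Q where "Q = mat (card I) (card J) (\<lambda>(a,b). Y (eI a) (eJ b))"
  have P: "P \<in> carrier_mat (card J) (card I)" and Q: "Q \<in> carrier_mat (card I) (card J)"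
    unfolding P_def Q_def by auto
  have "Q * P = 1\<^sub>m (card I)"
  proof (rule eq_matI)
    fix i j assume "i < dim_row (1\<^sub>m (card I))" "j < dim_col (1\<^sub>m (card I))"
    then have ij: "i < card I" "j < card I" by auto
    have "(Q * P) $$ (i,j) = (\<Sum>l<card J. Y (eI i) (eJ l) * X (eJ l) (eI j))"
      unfolding mat_entry_mult[OF Q P ij] using ij by (intro sum.cong) (auto simp: P_def Q_def)
    also have "\<dots> = (\<Sum>g\<in>J. Y (eI i) g * X g (eI j))"
      using sum.reindex_bij_betw[OF eJ, of "\<lambda>g. Y (eI i) g * X g (eI j)"] .
    also have "\<dots> = (if eI i = eI j then 1 else 0)"
      using bi bij_betwE[OF eI] ij by auto
    also have "eI i = eI j \<longleftrightarrow> i = j" using eI ij by (auto simp: bij_betw_def inj_on_def)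
    finally show "(Q * P) $$ (i,j) = 1\<^sub>m (card I) $$ (i,j)" using ij by simp
  qed (use P Q in auto)
  then show ?thesis using left_inverse_dim_le[OF P Q] by simp
qed

locale finite_group = group G for G (structure) +
  assumes fin_carrier: "finite (carrier G)"
begin

lemma order_pos: "card (carrier G) > 0"
  using fin_carrier one_closed by (auto simp: card_gt_0_iff)

lemma bij_left_mult: "h \<in> carrier G \<Longrightarrow> bij_betw (\<lambda>g. h \<otimes> g) (carrier G) (carrier G)"
  by (rule bij_betw_byWitness[where f' = "\<lambda>g. inv h \<otimes> g"])
     (auto simp: m_assoc[symmetric])

lemma mat_sum_shift:
  assumes h: "h \<in> carrier G"
  shows "mat_sum n m (\<lambda>g. f (h \<otimes> g)) (carrier G) = mat_sum n m f (carrier G)"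
  unfolding mat_sum_def
  by (rule cong_mat) (auto intro!: sum.reindex_bij_betw[OF bij_left_mult[OF h], where g = "\<lambda>g. f g $$ _"])

lemma average_intertwines:
  assumes R: "mat_rep G n R" and S: "mat_rep G m S" and X: "X \<in> carrier_mat n m" and h: "h \<in> carrier G"
  shows "R h * mat_sum n m (\<lambda>g. R g * X * S (inv g)) (carrier G)
       = mat_sum n m (\<lambda>g. R g * X * S (inv g)) (carrier G) * S h"
proof -
  note Rc = mat_repD(1)[OF R] and Sc = mat_repD(1)[OF S]
  let ?f = "\<lambda>g. R g * X * S (inv g) * S h"
  have "R h * mat_sum n m (\<lambda>g. R g * X * S (inv g)) (carrier G)
      = mat_sum n m (\<lambda>g. R h * (R g * X * S (inv g))) (carrier G)"
    by (rule mat_sum_mult_left[OF Rc[OF h]]) (use Rc Sc X in \<open>auto intro!: mult_carrier_mat\<close>)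
  also have "\<dots> = mat_sum n m (\<lambda>g. ?f (h \<otimes> g)) (carrier G)"
  proof (rule mat_sum_cong)
    fix g assume g: "g \<in> carrier G"
    have "?f (h \<otimes> g) = R (h \<otimes> g) * X * (S (inv (h \<otimes> g)) * S h)"
      using Rc[of "h \<otimes> g"] Sc X g h by (intro assoc_mult_mat[of _ n m _ m _ m]) auto
    also have "S (inv (h \<otimes> g)) * S h = S (inv g)"
      using g h by (simp flip: mat_repD(3)[OF S] add: inv_mult_group m_assoc)
    also have "R (h \<otimes> g) * X * S (inv g) = R h * R g * X * S (inv g)"
      using mat_repD(3)[OF R h g] by simp
    also have "\<dots> = R h * (R g * X) * S (inv g)"
      using assoc_mult_mat[OF Rc[OF h] Rc[OF g] X] by simp
    also have "\<dots> = R h * (R g * X * S (inv g))"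
      using Rc[OF h] Rc[OF g] Sc[of "inv g"] X g by (intro assoc_mult_mat) auto
    finally show "R h * (R g * X * S (inv g)) = ?f (h \<otimes> g)" by simp
  qed
  also have "\<dots> = mat_sum n m ?f (carrier G)" by (rule mat_sum_shift[OF h])
  also have "\<dots> = mat_sum n m (\<lambda>g. R g * X * S (inv g)) (carrier G) * S h"
    by (rule mat_sum_mult_right[OF Sc[OF h], symmetric]) (use Rc Sc X in \<open>auto intro!: mult_carrier_mat\<close>)
  finally show ?thesis .
qed

lemma sandwich_unit_entry:
  assumes A: "A \<in> carrier_mat n n" and B: "B \<in> carrier_mat m m" and b: "i < n" "j < n" "p < m" "q < m"
  shows "(A * mat n m (\<lambda>ab. if ab = (j,p) then 1 else 0) * B) $$ (i,q) = A $$ (i,j) * (B $$ (p,q) :: complex)"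
proof -
  let ?E = "mat n m (\<lambda>ab. if ab = (j,p) then 1 else (0::complex))"
  have E: "?E \<in> carrier_mat n m" by simp
  have AE: "A * ?E \<in> carrier_mat n m" using A by auto
  have "(A * ?E * B) $$ (i,q) = (\<Sum>l<m. (A * ?E) $$ (i,l) * B $$ (l,q))"
    using mat_entry_mult[OF AE B b(1,4)] .
  also have "\<dots> = (\<Sum>l<m. if l = p then A $$ (i,j) * B $$ (l,q) else 0)"
  proof (rule sum.cong)
    fix l assume "l \<in> {..<m}"
    then have l: "l < m" by simp
    have "(A * ?E) $$ (i,l) = (\<Sum>k<n. A $$ (i,k) * ?E $$ (k,l))" using mat_entry_mult[OF A E b(1) l] .
    also have "\<dots> = (\<Sum>k<n. if k = j then (if l = p then A $$ (i,j) else 0) else 0)"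
      using l by (intro sum.cong) auto
    also have "\<dots> = (if l = p then A $$ (i,j) else 0)" using b by simp
    finally show "(A * ?E) $$ (i,l) * B $$ (l,q) = (if l = p then A $$ (i,j) * B $$ (l,q) else 0)" by simp
  qed simp
  finally show ?thesis using b by simp
qed

lemma orthogonality_distinct:
  assumes R: "irreducible_mat_rep G n R" and S: "irreducible_mat_rep G m S"
    and ne: "\<not> equivalent_reps G S R" and b: "i < n" "j < n" "p < m" "q < m"
  shows "(\<Sum>g\<in>carrier G. R g $$ (i,j) * S (inv g) $$ (p,q)) = 0"
proof -
  have Rr: "mat_rep G n R" and Sr: "mat_rep G m S" using R S unfolding irreducible_mat_rep_def by auto
  let ?X = "mat n m (\<lambda>ab. if ab = (j,p) then 1 else (0::complex))"
  let ?T = "mat_sum n m (\<lambda>g. R g * ?X * S (inv g)) (carrier G)"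
  have int: "?T * S h = R h * ?T" if "h \<in> carrier G" for h
    using average_intertwines[OF Rr Sr _ that, of ?X] by simp
  have "?T = 0\<^sub>m n m"
  proof (rule ccontr)
    assume nz: "?T \<noteq> 0\<^sub>m n m"
    note sch = schur[OF S R mat_sum_carrier int nz]
    have "?T \<in> Units (mat_ring m)" using sch by (auto simp: Units_def ring_mat_simps)
    then have "equivalent_reps G S R" unfolding equivalent_reps_def
      using int sch(1) mat_rep_dim[OF Rr] mat_rep_dim[OF Sr] by (auto simp: )
    then show False using ne by simp
  qed
  then have "?T $$ (i,q) = 0" using b by simp
  then show ?thesis
    using b mat_repD(1)[OF Rr] mat_repD(1)[OF Sr]
    by (simp add: mat_sum_entry sandwich_unit_entry cong: sum.cong)
qed

lemma orthogonality_same: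
  assumes R: "irreducible_mat_rep G n R" and b: "i < n" "j < n" "p < n" "q < n"
  shows "(\<Sum>g\<in>carrier G. R g $$ (i,j) * R (inv g) $$ (p,q)) =
    (if i = q \<and> j = p then of_nat (card (carrier G)) / of_nat n else 0)"
proof -
  have Rr: "mat_rep G n R" and n: "n > 0" using R unfolding irreducible_mat_rep_def by auto
  note Rc = mat_repD(1)[OF Rr]
  let ?X = "mat n n (\<lambda>ab. if ab = (j,p) then 1 else (0::complex))"
  let ?T = "mat_sum n n (\<lambda>g. R g * ?X * R (inv g)) (carrier G)"
  have int: "?T * R h = R h * ?T" if "h \<in> carrier G" for h
    using average_intertwines[OF Rr Rr _ that, of ?X] by simp
  from schur_scalar[OF R mat_sum_carrier int] obtain c where c: "?T = c \<cdot>\<^sub>m 1\<^sub>m n" by blast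
  have ent: "?T $$ (a,b) = (\<Sum>g\<in>carrier G. R g $$ (a,j) * R (inv g) $$ (p,b))" if "a < n" "b < n" for a b
    using that b Rc by (simp add: mat_sum_entry sandwich_unit_entry cong: sum.cong)
  have "of_nat n * c = (\<Sum>a<n. ?T $$ (a,a))" unfolding c by simp
  also have "\<dots> = (\<Sum>a<n. \<Sum>g\<in>carrier G. R g $$ (a,j) * R (inv g) $$ (p,a))"
    by (intro sum.cong refl) (simp only: ent lessThan_iff)
  also have "\<dots> = (\<Sum>g\<in>carrier G. \<Sum>a<n. R (inv g) $$ (p,a) * R g $$ (a,j))"
    by (subst sum.swap) (simp add: mult.commute)
  also have "\<dots> = (\<Sum>g\<in>carrier G. (R (inv g) * R g) $$ (p,j))"
    using b Rc by (intro sum.cong refl mat_entry_mult[symmetric]) auto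
  also have "\<dots> = (\<Sum>g\<in>carrier G. if p = j then 1 else 0)"
    using b mat_rep_inv[OF Rr] by (intro sum.cong) auto
  finally have "of_nat n * c = (if p = j then of_nat (card (carrier G)) else 0)" by simp
  then have c': "c = (if p = j then of_nat (card (carrier G)) / of_nat n else 0)"
    using n by (auto simp: field_simps split: if_splits)
  have "(\<Sum>g\<in>carrier G. R g $$ (i,j) * R (inv g) $$ (p,q)) = (c \<cdot>\<^sub>m 1\<^sub>m n) $$ (i,q)"
    using ent[OF b(1,4)] c by simp
  then show ?thesis using b c' by auto
qed

lemma invariant_subspace_rep:
  assumes R: "mat_rep G n R" and W: "W = {P *\<^sub>v x | x. x \<in> carrier_vec m}"
    and inv: "\<forall>g\<in>carrier G. \<forall>w\<in>W. R g *\<^sub>v w \<in> W"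
    and P: "P \<in> carrier_mat n m" and Q: "Q \<in> carrier_mat m n" and QP: "Q * P = 1\<^sub>m m"
  shows "mat_rep G m (\<lambda>g. Q * R g * P)"
    and "\<And>g. g \<in> carrier G \<Longrightarrow> R g * P = P * (Q * R g * P)"
proof -
  note Rc = mat_repD(1)[OF R]
  show int: "R g * P = P * (Q * R g * P)" if g: "g \<in> carrier G" for g
  proof (rule mat_eq_by_vec[of _ n m])
    show "R g * P \<in> carrier_mat n m" "P * (Q * R g * P) \<in> carrier_mat n m" using Rc[OF g] P Q by auto
    fix x :: "complex vec" assume x: "x \<in> carrier_vec m"
    have "P *\<^sub>v x \<in> W" using W x by auto
    then have "R g *\<^sub>v (P *\<^sub>v x) \<in> W" using inv g by blast
    then obtain y where y: "y \<in> carrier_vec m" "R g *\<^sub>v (P *\<^sub>v x) = P *\<^sub>v y" using W by auto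
    have RPx: "(R g * P) *\<^sub>v x = P *\<^sub>v y" using assoc_mult_mat_vec[OF Rc[OF g] P x] y by simp
    have "(P * (Q * R g * P)) *\<^sub>v x = P *\<^sub>v ((Q * R g * P) *\<^sub>v x)"
      using assoc_mult_mat_vec[OF P _ x, of "Q * R g * P"] Rc[OF g] P Q by simp
    also have "(Q * R g * P) *\<^sub>v x = (Q * (R g * P)) *\<^sub>v x" using assoc_mult_mat[OF Q Rc[OF g] P] by simp
    also have "\<dots> = Q *\<^sub>v ((R g * P) *\<^sub>v x)"
      using assoc_mult_mat_vec[OF Q _ x, of "R g * P"] Rc[OF g] P by simp
    also have "\<dots> = (Q * P) *\<^sub>v y" using RPx assoc_mult_mat_vec[OF Q P y(1)] by simp
    also have "\<dots> = y" using QP y by simp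
    finally show "(R g * P) *\<^sub>v x = (P * (Q * R g * P)) *\<^sub>v x" using RPx by simp
  qed
  show "mat_rep G m (\<lambda>g. Q * R g * P)" unfolding mat_rep_def
  proof (intro conjI ballI)
    show "Q * R g * P \<in> carrier_mat m m" if "g \<in> carrier G" for g using Rc[OF that] P Q by auto
    show "Q * R \<one> * P = 1\<^sub>m m" using mat_repD(2)[OF R] P Q QP by simp
    fix g h assume g: "g \<in> carrier G" and h: "h \<in> carrier G"
    have "Q * R (g \<otimes> h) * P = Q * (R g * R h) * P" using mat_repD(3)[OF R g h] by simp
    also have "\<dots> = Q * R g * R h * P" using assoc_mult_mat[OF Q Rc[OF g] Rc[OF h]] by simp
    also have "\<dots> = Q * R g * (R h * P)"
      using Rc[OF g] Rc[OF h] P Q by (intro assoc_mult_mat) auto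
    also have "\<dots> = Q * R g * (P * (Q * R h * P))" using int[OF h] by simp
    also have "\<dots> = Q * R g * P * (Q * R h * P)"
      using Rc[OF g] Rc[OF h] P Q by (intro assoc_mult_mat[symmetric]) auto
    finally show "Q * R (g \<otimes> h) * P = Q * R g * P * (Q * R h * P)" .
  qed
qed

end

context finite_group
begin

lemma complement_basis:
  assumes R: "mat_rep G n R" and W: "W = {P *\<^sub>v x | x. x \<in> carrier_vec m}"
    and inv: "\<forall>g\<in>carrier G. \<forall>w\<in>W. R g *\<^sub>v w \<in> W"
    and P: "P \<in> carrier_mat n m" and Q: "Q \<in> carrier_mat m n" and QP: "Q * P = 1\<^sub>m m"
  obtains Q' where "Q' \<in> carrier_mat m n" "Q' * P = 1\<^sub>m m"
    "\<And>g. g \<in> carrier G \<Longrightarrow> Q' * R g = (Q * R g * P) * Q'"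
proof -
  note S = invariant_subspace_rep[OF assms]
  note Rc = mat_repD(1)[OF R] and Sc = mat_repD(1)[OF S(1)]
  let ?S = "\<lambda>g. Q * R g * P"
  let ?T = "mat_sum m n (\<lambda>g. ?S g * Q * R (inv g)) (carrier G)"
  define N where "N = (of_nat (card (carrier G)) :: complex)"
  have N: "N \<noteq> 0" unfolding N_def using order_pos by simp
  have int: "?S h * ?T = ?T * R h" if "h \<in> carrier G" for h
    by (rule average_intertwines[OF S(1) R Q that])
  have TP: "?T * P = N \<cdot>\<^sub>m 1\<^sub>m m"
  proof -
    have "?T * P = mat_sum m m (\<lambda>g. ?S g * Q * R (inv g) * P) (carrier G)"
      by (rule mat_sum_mult_right[OF P], rule mult_carrier_mat[OF mult_carrier_mat[OF Sc Q] Rc]) auto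
    also have "\<dots> = mat_sum m m (\<lambda>g. 1\<^sub>m m) (carrier G)"
    proof (rule mat_sum_cong)
      fix g assume g: "g \<in> carrier G"
      have ig: "inv g \<in> carrier G" using g by simp
      have "?S g * Q * R (inv g) * P = ?S g * Q * (R (inv g) * P)"
        by (rule assoc_mult_mat[OF mult_carrier_mat[OF Sc[OF g] Q] Rc[OF ig] P])
      also have "\<dots> = ?S g * Q * (P * ?S (inv g))" unfolding S(2)[OF ig] ..
      also have "\<dots> = ?S g * Q * P * ?S (inv g)"
        by (rule assoc_mult_mat[OF mult_carrier_mat[OF Sc[OF g] Q] P Sc[OF ig], symmetric])
      also have "?S g * Q * P = ?S g * (Q * P)"
        by (rule assoc_mult_mat[OF Sc[OF g] Q P])
      also have "\<dots> = ?S g" unfolding QP by (rule right_mult_one_mat[OF Sc[OF g]])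
      also have "?S g * ?S (inv g) = 1\<^sub>m m" by (rule mat_rep_inv(1)[OF S(1) g])
      finally show "?S g * Q * R (inv g) * P = 1\<^sub>m m" .
    qed
    also have "\<dots> = N \<cdot>\<^sub>m 1\<^sub>m m" unfolding N_def by (intro eq_matI) (auto simp: mat_sum_def)
    finally show ?thesis .
  qed
  define Q' where "Q' = (1 / N) \<cdot>\<^sub>m ?T"
  have "Q' \<in> carrier_mat m n" unfolding Q'_def by simp
  moreover have "Q' * P = 1\<^sub>m m"
    unfolding Q'_def mult_smult_assoc_mat[OF mat_sum_carrier P] TP using N by (intro eq_matI) auto
  moreover have "Q' * R g = ?S g * Q'" if g: "g \<in> carrier G" for g
    unfolding Q'_def mult_smult_assoc_mat[OF mat_sum_carrier Rc[OF g]]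
      mult_smult_distrib[OF Sc[OF g] mat_sum_carrier] int[OF g] ..
  ultimately show ?thesis using that by blast
qed

definition fourier :: "nat \<Rightarrow> ('a \<Rightarrow> complex) \<Rightarrow> ('a \<Rightarrow> complex mat) \<Rightarrow> complex mat" where
  "fourier n v R = mat_sum n n (\<lambda>g. v g \<cdot>\<^sub>m R g) (carrier G)"

lemma fourier_carrier [simp]: "fourier n v R \<in> carrier_mat n n"
  unfolding fourier_def by simp

lemma fourier_mult:
  assumes R: "mat_rep G n R" and S: "mat_rep G m S" and P: "P \<in> carrier_mat n m"
    and int: "\<And>g. g \<in> carrier G \<Longrightarrow> R g * P = P * S g"
  shows "fourier n v R * P = P * fourier m v S"
proof -
  note Rc = mat_repD(1)[OF R] and Sc = mat_repD(1)[OF S]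
  have "fourier n v R * P = mat_sum n m (\<lambda>g. (v g \<cdot>\<^sub>m R g) * P) (carrier G)"
    unfolding fourier_def by (rule mat_sum_mult_right[OF P]) (use Rc in auto)
  also have "\<dots> = mat_sum n m (\<lambda>g. P * (v g \<cdot>\<^sub>m S g)) (carrier G)"
    using mult_smult_assoc_mat[OF Rc P] mult_smult_distrib[OF P Sc] int by (intro mat_sum_cong) simp
  also have "\<dots> = P * fourier m v S"
    unfolding fourier_def by (rule mat_sum_mult_left[OF P, symmetric]) (use Sc in auto)
  finally show ?thesis .
qed

lemma fourier_vanishes:
  assumes irr: "\<forall>m S. irreducible_mat_rep G m S \<longrightarrow> fourier m v S = 0\<^sub>m m m"
    and R: "mat_rep G n R"
  shows "fourier n v R = 0\<^sub>m n n"
  using R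
proof (induction n arbitrary: R rule: less_induct)
  case (less n)
  note R = less.prems
  note Rc = mat_repD(1)[OF R]
  show ?case
  proof (cases "n = 0 \<or> irreducible_mat_rep G n R")
    case True
    then show ?thesis
    proof
      assume "n = 0"
      then show ?thesis by (intro eq_matI) (auto simp: fourier_def mat_sum_def)
    next
      assume "irreducible_mat_rep G n R"
      then show ?thesis using irr by blast
    qed
  next
    case False
    then have "n > 0" "\<not> irreducible_mat_rep G n R" by simp_all
    then have "\<not> (\<forall>W. lin_subspace n W \<longrightarrow> (\<forall>g\<in>carrier G. \<forall>w\<in>W. R g *\<^sub>v w \<in> W) \<longrightarrow>
        W = {0\<^sub>v n} \<or> W = carrier_vec n)"
      using R unfolding irreducible_mat_rep_def by blast
    then obtain W where W: "lin_subspace n W" and inv: "\<forall>g\<in>carrier G. \<forall>w\<in>W. R g *\<^sub>v w \<in> W"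
      and W0: "W \<noteq> {0\<^sub>v n}" and Wn: "W \<noteq> carrier_vec n"
      by blast
    obtain m P Q where P: "P \<in> carrier_mat n m" and Q: "Q \<in> carrier_mat m n" and QP: "Q * P = 1\<^sub>m m"
      and WP: "W = {P *\<^sub>v x | x. x \<in> carrier_vec m}" by (rule lin_subspace_basis[OF W])
    note S = invariant_subspace_rep[OF R WP inv P Q QP]
    note Sc = mat_repD(1)[OF S(1)]
    obtain Q' where Q': "Q' \<in> carrier_mat m n" and Q'P: "Q' * P = 1\<^sub>m m"
      and int: "\<And>g. g \<in> carrier G \<Longrightarrow> Q' * R g = (Q * R g * P) * Q'"
      by (rule complement_basis[OF R WP inv P Q QP]) blast
    define V where "V = {x \<in> carrier_vec n. Q' *\<^sub>v x = 0\<^sub>v m}"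
    have V: "lin_subspace n V" unfolding V_def by (rule lin_subspace_kernel[OF Q'])
    have invV: "\<forall>g\<in>carrier G. \<forall>w\<in>V. R g *\<^sub>v w \<in> V"
    proof (intro ballI)
      fix g w assume g: "g \<in> carrier G" and w: "w \<in> V"
      have wc: "w \<in> carrier_vec n" and Qw: "Q' *\<^sub>v w = 0\<^sub>v m" using w unfolding V_def by auto
      have "Q' *\<^sub>v (R g *\<^sub>v w) = (Q' * R g) *\<^sub>v w" using assoc_mult_mat_vec[OF Q' Rc[OF g] wc] by simp
      also have "\<dots> = (Q * R g * P) *\<^sub>v (Q' *\<^sub>v w)"
        unfolding int[OF g] by (rule assoc_mult_mat_vec[OF Sc[OF g] Q' wc])
      also have "\<dots> = 0\<^sub>v m" unfolding Qw by (rule mult_mat_zero_vec[OF Sc[OF g]])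
      finally show "R g *\<^sub>v w \<in> V" unfolding V_def using Rc[OF g] wc by auto
    qed
    obtain m2 P2 Q2 where P2: "P2 \<in> carrier_mat n m2" and Q2: "Q2 \<in> carrier_mat m2 n" and QP2: "Q2 * P2 = 1\<^sub>m m2"
      and VP: "V = {P2 *\<^sub>v x | x. x \<in> carrier_vec m2}" by (rule lin_subspace_basis[OF V])
    note S2 = invariant_subspace_rep[OF R VP invV P2 Q2 QP2]
    have whole: "U = carrier_vec n" if "A \<in> carrier_mat n n" "B \<in> carrier_mat n n" "B * A = 1\<^sub>m n"
      "U = {A *\<^sub>v x | x. x \<in> carrier_vec n}" for A B and U :: "complex vec set"
    proof -
      have AB: "A * B = 1\<^sub>m n" using mat_mult_left_right_inverse[OF that(2,1,3)] .
      have "y \<in> U" if y: "y \<in> carrier_vec n" for y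
      proof -
        have "y = A *\<^sub>v (B *\<^sub>v y)" using assoc_mult_mat_vec[OF \<open>A \<in> _\<close> \<open>B \<in> _\<close> y] AB y by simp
        moreover have "B *\<^sub>v y \<in> carrier_vec n" using \<open>B \<in> _\<close> y by auto
        ultimately show ?thesis using \<open>U = _\<close> by blast
      qed
      moreover have "U \<subseteq> carrier_vec n" unfolding that(4) using that(1) by auto
      ultimately show ?thesis by blast
    qed
    have m: "m < n"
    proof -
      have "m \<le> n" using left_inverse_dim_le[OF P Q QP] .
      moreover have "m \<noteq> n" using whole[of P Q W] P Q QP WP Wn by auto
      ultimately show ?thesis by simp
    qed
    have m2: "m2 < n"
    proof -
      have "m2 \<le> n" using left_inverse_dim_le[OF P2 Q2 QP2] .
      moreover have "m2 \<noteq> n"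
      proof
        assume "m2 = n"
        then have "V = carrier_vec n" using whole[of P2 Q2 V] P2 Q2 QP2 VP by auto
        obtain w where w: "w \<in> W" "w \<noteq> 0\<^sub>v n" using W W0 unfolding lin_subspace_def by auto
        then obtain x where x: "x \<in> carrier_vec m" "w = P *\<^sub>v x" using WP by auto
        have "w \<in> V" using \<open>V = carrier_vec n\<close> x P by auto
        then have "Q' *\<^sub>v w = 0\<^sub>v m" unfolding V_def by blast
        then have "0\<^sub>v m = Q' *\<^sub>v (P *\<^sub>v x)" unfolding x(2) by (rule sym)
        also have "\<dots> = x" using assoc_mult_mat_vec[OF Q' P x(1)] Q'P x by simp
        finally have "w = 0\<^sub>v n" using x mult_mat_zero_vec[OF P] by simp
        then show False using w by simp
      qed
      ultimately show ?thesis by simp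
    qed
    let ?F = "fourier n v R"
    have FP: "?F * P = 0\<^sub>m n m"
      using fourier_mult[OF R S(1) P S(2)] less.IH[OF m S(1)] P by simp
    have FP2: "?F * P2 = 0\<^sub>m n m2"
      using fourier_mult[OF R S2(1) P2 S2(2)] less.IH[OF m2 S2(1)] P2 by simp
    show ?thesis
    proof (rule mat_eq_by_vec[of _ n n])
      fix x :: "complex vec" assume x: "x \<in> carrier_vec n"
      define y where "y = P *\<^sub>v (Q' *\<^sub>v x)"
      have Q'x: "Q' *\<^sub>v x \<in> carrier_vec m" using Q' x by auto
      have y: "y \<in> carrier_vec n" unfolding y_def using P Q'x by auto
      have "Q' *\<^sub>v (x - y) = Q' *\<^sub>v x - Q' *\<^sub>v y" using mult_minus_distrib_mat_vec[OF Q' x y] .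
      also have "Q' *\<^sub>v y = Q' *\<^sub>v x"
        unfolding y_def using assoc_mult_mat_vec[OF Q' P Q'x] Q'P Q'x by simp
      also have "Q' *\<^sub>v x - Q' *\<^sub>v x = 0\<^sub>v m" using Q'x by simp
      finally have "x - y \<in> V" unfolding V_def using x y by auto
      then obtain z where z: "z \<in> carrier_vec m2" "x - y = P2 *\<^sub>v z" using VP by auto
      have "?F *\<^sub>v (x - y) = 0\<^sub>v n"
        unfolding z(2) using assoc_mult_mat_vec[OF _ P2 z(1), of ?F n] FP2 z(1) by (simp add: mult_zero_mat_vec)
      moreover have "?F *\<^sub>v y = 0\<^sub>v n"
        unfolding y_def using assoc_mult_mat_vec[OF _ P Q'x, of ?F n] FP Q'x by (simp add: mult_zero_mat_vec)
      moreover have "?F *\<^sub>v x = ?F *\<^sub>v (x - y) + ?F *\<^sub>v y"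
      proof -
        have "x = (x - y) + y" using x y by (intro eq_vecI) auto
        then have "?F *\<^sub>v x = ?F *\<^sub>v ((x - y) + y)" by (rule arg_cong)
        also have "\<dots> = ?F *\<^sub>v (x - y) + ?F *\<^sub>v y"
          by (rule mult_add_distrib_mat_vec[OF fourier_carrier _ y]) (use x y in auto)
        finally show ?thesis .
      qed
      ultimately have "?F *\<^sub>v x = 0\<^sub>v n" by simp
      then show "?F *\<^sub>v x = 0\<^sub>m n n *\<^sub>v x" using x by (simp add: mult_zero_mat_vec)
    qed simp_all
  qed
qed

lemma fourier_injective:
  assumes irr: "\<forall>m S. irreducible_mat_rep G m S \<longrightarrow> fourier m v S = 0\<^sub>m m m"
    and g: "g \<in> carrier G"
  shows "v g = 0"
proof -
  define N where "N = card (carrier G)"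
  obtain e where e: "bij_betw e {..<N} (carrier G)"
    using ex_bij_betw_nat_finite[OF fin_carrier] unfolding N_def by (auto simp: atLeast0LessThan)
  have ec: "\<And>i. i < N \<Longrightarrow> e i \<in> carrier G" using bij_betwE[OF e] by auto
  have ei: "\<And>i j. i < N \<Longrightarrow> j < N \<Longrightarrow> e i = e j \<longleftrightarrow> i = j" using e by (auto simp: bij_betw_def inj_on_def)
  define L where "L h = mat N N (\<lambda>(i,j). if e i = h \<otimes> e j then 1 else (0::complex))" for h
  have Lc: "L h \<in> carrier_mat N N" for h unfolding L_def by simp
  have "mat_rep G N L" unfolding mat_rep_def
  proof (intro conjI ballI)
    show "L \<one> = 1\<^sub>m N" unfolding L_def using ec ei by (intro eq_matI) auto
    fix h k assume h: "h \<in> carrier G" and k: "k \<in> carrier G"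
    show "L (h \<otimes> k) = L h * L k"
    proof (rule eq_matI[OF _ _ _])
      show "dim_row (L (h \<otimes> k)) = dim_row (L h * L k)" "dim_col (L (h \<otimes> k)) = dim_col (L h * L k)"
        by (simp_all add: L_def)
      fix i j assume "i < dim_row (L h * L k)" "j < dim_col (L h * L k)"
      then have ij: "i < N" "j < N" using Lc[of h] Lc[of k] by auto
      have "(L h * L k) $$ (i,j) = (\<Sum>l<N. L h $$ (i,l) * L k $$ (l,j))" using mat_entry_mult[OF Lc Lc ij] .
      also have "\<dots> = (\<Sum>l<N. (if e i = h \<otimes> e l then 1 else 0) * (if e l = k \<otimes> e j then 1 else 0))"
        using ij by (intro sum.cong) (auto simp: L_def)
      also have "\<dots> = (\<Sum>x\<in>carrier G. (if e i = h \<otimes> x then 1 else 0) * (if x = k \<otimes> e j then 1 else 0))"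
        by (rule sum.reindex_bij_betw[OF e])
      also have "\<dots> = (\<Sum>x\<in>carrier G. if x = k \<otimes> e j then (if e i = h \<otimes> x then 1 else 0) else 0)"
        by (intro sum.cong) auto
      also have "\<dots> = (if e i = h \<otimes> (k \<otimes> e j) then 1 else 0)"
        using fin_carrier k ec[OF ij(2)] by simp
      also have "\<dots> = L (h \<otimes> k) $$ (i,j)" using ij ec h k by (simp add: L_def m_assoc)
      finally show "L (h \<otimes> k) $$ (i,j) = (L h * L k) $$ (i,j)" by simp
    qed
  qed (rule Lc)
  from fourier_vanishes[OF irr this] have F: "fourier N v L = 0\<^sub>m N N" by simp
  have surj: "\<exists>i<N. e i = x" if "x \<in> carrier G" for x
    using bij_betw_imp_surj_on[OF e] that by (metis imageE lessThan_iff)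
  obtain i where i: "i < N" "e i = g" using surj[OF g] by auto
  obtain j where j: "j < N" "e j = \<one>" using surj[OF one_closed] by auto
  have "fourier N v L $$ (i,j) = (\<Sum>h\<in>carrier G. v h * L h $$ (i,j))"
    unfolding fourier_def using i j Lc by (simp add: mat_sum_entry carrier_matD[OF Lc])
  also have "\<dots> = (\<Sum>h\<in>carrier G. if h = g then v h else 0)"
    using i j by (intro sum.cong) (auto simp: L_def)
  also have "\<dots> = v g" using fin_carrier g by simp
  finally show ?thesis using F i j by simp
qed

end

context finite_group
begin

definition class_rep :: "('a \<Rightarrow> complex mat) set \<Rightarrow> 'a \<Rightarrow> complex mat" where
  "class_rep c = (SOME R. R \<in> c)"

lemma class_dim_class_rep: "class_dim G c = rep_dim G (class_rep c)"
  unfolding class_dim_def class_rep_def ..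

lemma Units_mat_ringE:
  assumes "P \<in> Units (mat_ring n)"
  obtains P' where "P \<in> carrier_mat n n" "P' \<in> carrier_mat n n" "P * P' = 1\<^sub>m n" "P' * P = 1\<^sub>m n"
  using assms unfolding Units_def ring_mat_simps by blast

lemma Units_mat_ringI:
  "P \<in> carrier_mat n n \<Longrightarrow> P' \<in> carrier_mat n n \<Longrightarrow> P * P' = 1\<^sub>m n \<Longrightarrow> P' * P = 1\<^sub>m n \<Longrightarrow>
    P \<in> Units (mat_ring n)"
  unfolding Units_def ring_mat_simps by blast

lemma equiv_irreducible:
  "equiv {R. irreducible_rep G R}
     {(R, S). irreducible_rep G R \<and> irreducible_rep G S \<and> equivalent_reps G R S}"
proof (rule equivI)
  have Rc: "R g \<in> carrier_mat (rep_dim G R) (rep_dim G R)" if "irreducible_rep G R" "g \<in> carrier G" for R g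
    using that(1) mat_repD(1)[OF _ that(2), of "rep_dim G R" R]
    unfolding irreducible_rep_iff irreducible_mat_rep_def by simp
  show "refl_on {R. irreducible_rep G R}
     {(R, S). irreducible_rep G R \<and> irreducible_rep G S \<and> equivalent_reps G R S}"
  proof (rule refl_onI)
    fix R assume "R \<in> {R. irreducible_rep G R}"
    then have R: "irreducible_rep G R" by simp
    have "1\<^sub>m (rep_dim G R) \<in> Units (mat_ring (rep_dim G R))"
      by (simp add: Units_def ring_mat_simps)
    moreover have "\<forall>g\<in>carrier G. 1\<^sub>m (rep_dim G R) * R g = R g * 1\<^sub>m (rep_dim G R)"
      using left_mult_one_mat[OF Rc[OF R]] right_mult_one_mat[OF Rc[OF R]] by simp
    ultimately show "(R, R) \<in> {(R, S). irreducible_rep G R \<and> irreducible_rep G S \<and> equivalent_reps G R S}"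
      using R unfolding equivalent_reps_def by blast
  qed
  show "sym {(R, S). irreducible_rep G R \<and> irreducible_rep G S \<and> equivalent_reps G R S}"
  proof (rule symI)
    fix R S assume "(R, S) \<in> {(R, S). irreducible_rep G R \<and> irreducible_rep G S \<and> equivalent_reps G R S}"
    then have R: "irreducible_rep G R" and S: "irreducible_rep G S" and "equivalent_reps G R S" by auto
    then obtain P where PU: "P \<in> Units (mat_ring (rep_dim G R))" and d: "rep_dim G R = rep_dim G S"
      and int: "\<And>g. g \<in> carrier G \<Longrightarrow> P * R g = S g * P" unfolding equivalent_reps_def by blast
    define n where "n = rep_dim G R"
    from PU obtain P' where P: "P \<in> carrier_mat n n" and P': "P' \<in> carrier_mat n n"
      and PP: "P * P' = 1\<^sub>m n" "P' * P = 1\<^sub>m n" unfolding n_def by (rule Units_mat_ringE)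
    have "P' * S g = R g * P'" if g: "g \<in> carrier G" for g
    proof -
      have rc: "R g \<in> carrier_mat n n" and sc: "S g \<in> carrier_mat n n"
        using Rc[OF R g] Rc[OF S g] d unfolding n_def by auto
      have "P' * S g = P' * (S g * (P * P'))" using PP sc by simp
      also have "\<dots> = P' * ((S g * P) * P')" using assoc_mult_mat[OF sc P P'] by simp
      also have "\<dots> = P' * (P * R g * P')" using int[OF g] by simp
      also have "\<dots> = P' * (P * R g) * P'" using assoc_mult_mat[OF P' mult_carrier_mat[OF P rc] P'] by simp
      also have "\<dots> = P' * P * R g * P'" using assoc_mult_mat[OF P' P rc] by simp
      also have "\<dots> = R g * P'" using PP rc by simp
      finally show ?thesis .
    qed
    moreover have "P' \<in> Units (mat_ring n)" by (rule Units_mat_ringI[OF P' P PP(2,1)])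
    ultimately have "equivalent_reps G S R"
      unfolding equivalent_reps_def d[symmetric] n_def[symmetric] by blast
    then show "(S, R) \<in> {(R, S). irreducible_rep G R \<and> irreducible_rep G S \<and> equivalent_reps G R S}"
      using R S by simp
  qed
  show "trans {(R, S). irreducible_rep G R \<and> irreducible_rep G S \<and> equivalent_reps G R S}"
  proof (rule transI)
    fix R S U
    assume "(R, S) \<in> {(R, S). irreducible_rep G R \<and> irreducible_rep G S \<and> equivalent_reps G R S}"
      "(S, U) \<in> {(R, S). irreducible_rep G R \<and> irreducible_rep G S \<and> equivalent_reps G R S}"
    then have R: "irreducible_rep G R" and S: "irreducible_rep G S" and U: "irreducible_rep G U"
      and e: "equivalent_reps G R S" "equivalent_reps G S U" by auto
    define n where "n = rep_dim G R"
    from e obtain P P2 where PU: "P \<in> Units (mat_ring n)" and d: "rep_dim G S = n" "rep_dim G U = n"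
      and int: "\<And>g. g \<in> carrier G \<Longrightarrow> P * R g = S g * P"
      and PU2: "P2 \<in> Units (mat_ring n)"
      and int2: "\<And>g. g \<in> carrier G \<Longrightarrow> P2 * S g = U g * P2"
      unfolding equivalent_reps_def n_def by metis
    interpret mr: ring "mat_ring n" by (rule ring_mat)
    have P: "P \<in> carrier_mat n n" and P2: "P2 \<in> carrier_mat n n"
      using PU PU2 by (auto simp: Units_def ring_mat_simps)
    have "(P2 * P) * R g = U g * (P2 * P)" if g: "g \<in> carrier G" for g
    proof -
      have rc: "R g \<in> carrier_mat n n" and sc: "S g \<in> carrier_mat n n" and uc: "U g \<in> carrier_mat n n"
        using Rc[OF R g] Rc[OF S g] Rc[OF U g] d unfolding n_def by auto
      have "(P2 * P) * R g = P2 * (P * R g)" by (rule assoc_mult_mat[OF P2 P rc])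
      also have "\<dots> = P2 * (S g * P)" using int[OF g] by simp
      also have "\<dots> = P2 * S g * P" by (rule assoc_mult_mat[OF P2 sc P, symmetric])
      also have "\<dots> = U g * P2 * P" using int2[OF g] by simp
      also have "\<dots> = U g * (P2 * P)" by (rule assoc_mult_mat[OF uc P2 P])
      finally show ?thesis .
    qed
    moreover have "P2 * P \<in> Units (mat_ring n)"
      using mr.Units_m_closed[OF PU2 PU] by (simp add: ring_mat_simps)
    ultimately have "equivalent_reps G R U"
      unfolding equivalent_reps_def d n_def[symmetric] by blast
    then show "(R, U) \<in> {(R, S). irreducible_rep G R \<and> irreducible_rep G S \<and> equivalent_reps G R S}"
      using R U by simp
  qed
qed (auto)

lemma class_rep_in:
  assumes "c \<in> irrep_classes G"
  shows "class_rep c \<in> c" "irreducible_rep G (class_rep c)"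
proof -
  have "c \<noteq> {}" using assms in_quotient_imp_non_empty[OF equiv_irreducible] unfolding irrep_classes_def by blast
  then show "class_rep c \<in> c" unfolding class_rep_def by (simp add: some_in_eq)
  then show "irreducible_rep G (class_rep c)"
    using assms in_quotient_imp_subset[OF equiv_irreducible] unfolding irrep_classes_def by blast
qed

lemma class_rep_irreducible:
  "c \<in> irrep_classes G \<Longrightarrow> irreducible_mat_rep G (class_dim G c) (class_rep c)"
  using class_rep_in(2) unfolding irreducible_rep_iff class_dim_class_rep .

lemma class_dim_pos: "c \<in> irrep_classes G \<Longrightarrow> class_dim G c > 0"
  using class_rep_irreducible unfolding irreducible_mat_rep_def by blast

lemma class_rep_carrier:
  "c \<in> irrep_classes G \<Longrightarrow> g \<in> carrier G \<Longrightarrow> class_rep c g \<in> carrier_mat (class_dim G c) (class_dim G c)"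
  using class_rep_irreducible[of c] mat_repD(1)[of G "class_dim G c" "class_rep c" g]
  unfolding irreducible_mat_rep_def by simp

lemma class_rep_equivalent:
  assumes c: "c \<in> irrep_classes G" "c' \<in> irrep_classes G" and e: "equivalent_reps G (class_rep c) (class_rep c')"
  shows "c = c'"
proof (rule ccontr)
  assume "c \<noteq> c'"
  then have "c \<inter> c' = {}" using quotient_disj[OF equiv_irreducible] c unfolding irrep_classes_def by blast
  moreover have "class_rep c' \<in> c"
    using in_quotient_imp_closed[OF equiv_irreducible c(1)[unfolded irrep_classes_def] class_rep_in(1)[OF c(1)]]
      class_rep_in(2)[OF c(1)] class_rep_in(2)[OF c(2)] e by blast
  ultimately show False using class_rep_in(1)[OF c(2)] by blast
qed

lemma ex_class_rep:
  assumes "irreducible_rep G S"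
  shows "\<exists>c\<in>irrep_classes G. equivalent_reps G (class_rep c) S"
proof -
  let ?E = "{(R, S). irreducible_rep G R \<and> irreducible_rep G S \<and> equivalent_reps G R S}"
  let ?c = "?E `` {S}"
  have c: "?c \<in> irrep_classes G" unfolding irrep_classes_def by (rule quotientI) (use assms in simp)
  have "(S, class_rep ?c) \<in> ?E" using class_rep_in(1)[OF c] by blast
  then have "(class_rep ?c, S) \<in> ?E"
    using equiv_irreducible unfolding equiv_def sym_def by blast
  then show ?thesis using c by blast
qed

lemma class_orthogonality:
  assumes c: "c \<in> irrep_classes G" "c' \<in> irrep_classes G"
    and b: "i < class_dim G c" "j < class_dim G c" "p < class_dim G c'" "q < class_dim G c'"
  shows "(\<Sum>g\<in>carrier G. class_rep c g $$ (i,j) * class_rep c' (inv g) $$ (p,q)) =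
    (if c = c' \<and> i = q \<and> j = p then of_nat (card (carrier G)) / of_nat (class_dim G c) else 0)"
proof (cases "c = c'")
  case True
  then show ?thesis using orthogonality_same[OF class_rep_irreducible[OF c(1)]] b by simp
next
  case False
  then have "\<not> equivalent_reps G (class_rep c') (class_rep c)" using class_rep_equivalent c by metis
  then show ?thesis
    using orthogonality_distinct[OF class_rep_irreducible[OF c(1)] class_rep_irreducible[OF c(2)] _ b] False by simp
qed

lemma sum_dims_le:
  assumes K: "finite K" "K \<subseteq> irrep_classes G"
  shows "(\<Sum>c\<in>K. class_dim G c ^ 2) \<le> card (carrier G)"
proof -
  let ?I = "Sigma K (\<lambda>c. {..<class_dim G c} \<times> {..<class_dim G c})"
  let ?X = "\<lambda>g (c,i,j). class_rep c g $$ (i,j)"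
  let ?Y = "\<lambda>(c,i,j) g. of_nat (class_dim G c) / of_nat (card (carrier G)) * class_rep c (inv g) $$ (j,i)"
  have "card ?I \<le> card (carrier G)"
  proof (rule card_le_of_biorthogonal[of _ _ ?Y ?X])
    show "finite ?I" using K by auto
    show "finite (carrier G)" by (rule fin_carrier)
    fix x y assume "x \<in> ?I" "y \<in> ?I"
    then obtain c i j c' i' j' where x: "x = (c,i,j)" "c \<in> K" "i < class_dim G c" "j < class_dim G c"
      and y: "y = (c',i',j')" "c' \<in> K" "i' < class_dim G c'" "j' < class_dim G c'" by auto
    have cK: "c \<in> irrep_classes G" "c' \<in> irrep_classes G" using x y K by auto
    have "(\<Sum>g\<in>carrier G. ?Y x g * ?X g y) = of_nat (class_dim G c) / of_nat (card (carrier G)) *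
        (\<Sum>g\<in>carrier G. class_rep c' g $$ (i',j') * class_rep c (inv g) $$ (j,i))"
      unfolding x y by (simp add: sum_distrib_left mult_ac)
    also have "\<dots> = (if x = y then 1 else 0)"
      unfolding class_orthogonality[OF cK(2,1) y(3,4) x(4,3)] using class_dim_pos[OF cK(1)] order_pos x y by auto
    finally show "(\<Sum>g\<in>carrier G. ?Y x g * ?X g y) = (if x = y then 1 else 0)" .
  qed
  also have "card ?I = (\<Sum>c\<in>K. class_dim G c ^ 2)" using K by (simp add: power2_eq_square)
  finally show ?thesis .
qed

lemma finite_irrep_classes: "finite (irrep_classes G)"
proof (rule ccontr)
  assume "infinite (irrep_classes G)"
  then obtain K where K: "K \<subseteq> irrep_classes G" "finite K" "card K = Suc (card (carrier G))"
    using infinite_arbitrarily_large by blast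
  have "card K \<le> (\<Sum>c\<in>K. class_dim G c ^ 2)"
    using sum_mono[of K "\<lambda>_. 1" "\<lambda>c. class_dim G c ^ 2"] class_dim_pos K by (fastforce simp: Suc_le_eq)
  also have "\<dots> \<le> card (carrier G)" using sum_dims_le K by blast
  finally show False using K by simp
qed

definition class_trace :: "('a \<Rightarrow> complex mat) set \<Rightarrow> 'a \<Rightarrow> complex" where
  "class_trace c g = (\<Sum>i<class_dim G c. class_rep c g $$ (i,i))"

lemma completeness:
  assumes g: "g \<in> carrier G"
  shows "(\<Sum>c\<in>irrep_classes G. of_nat (class_dim G c) * class_trace c g)
    = (if g = \<one> then of_nat (card (carrier G)) else 0)"
proof -
  let ?K = "irrep_classes G"
  define N where "N = (of_nat (card (carrier G)) :: complex)"
  define v where "v h = (if h = \<one> then N else 0) - (\<Sum>c\<in>?K. of_nat (class_dim G c) * class_trace c (inv h))" for h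
  have base: "fourier (class_dim G c) v (class_rep c) = 0\<^sub>m (class_dim G c) (class_dim G c)" if c: "c \<in> ?K" for c
  proof (rule eq_matI)
    let ?n = "class_dim G c"
    have n: "?n > 0" using class_dim_pos[OF c] .
    fix p q assume "p < dim_row (0\<^sub>m ?n ?n)" "q < dim_col (0\<^sub>m ?n ?n)"
    then have pq: "p < ?n" "q < ?n" by auto
    have "fourier ?n v (class_rep c) $$ (p,q) = (\<Sum>h\<in>carrier G. v h * class_rep c h $$ (p,q))"
      unfolding fourier_def using pq carrier_matD[OF class_rep_carrier[OF c]] by (simp add: mat_sum_entry)
    also have "\<dots> = (\<Sum>h\<in>carrier G. (if h = \<one> then N * class_rep c h $$ (p,q) else 0)) -
       (\<Sum>h\<in>carrier G. \<Sum>c'\<in>?K. \<Sum>i<class_dim G c'. of_nat (class_dim G c') *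
          (class_rep c h $$ (p,q) * class_rep c' (inv h) $$ (i,i)))"
      unfolding v_def class_trace_def sum_subtractf[symmetric]
      by (intro sum.cong refl) (simp add: sum_distrib_left sum_distrib_right algebra_simps)
    also have "(\<Sum>h\<in>carrier G. (if h = \<one> then N * class_rep c h $$ (p,q) else 0)) = (if p = q then N else 0)"
      using fin_carrier pq class_rep_irreducible[OF c] mat_repD(2)[of G ?n "class_rep c"]
      unfolding irreducible_mat_rep_def by simp
    also have "(\<Sum>h\<in>carrier G. \<Sum>c'\<in>?K. \<Sum>i<class_dim G c'. of_nat (class_dim G c') *
          (class_rep c h $$ (p,q) * class_rep c' (inv h) $$ (i,i)))
        = (\<Sum>c'\<in>?K. \<Sum>i<class_dim G c'. of_nat (class_dim G c') *
          (\<Sum>h\<in>carrier G. class_rep c h $$ (p,q) * class_rep c' (inv h) $$ (i,i)))"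
      by (subst sum.swap, rule sum.cong[OF refl], subst sum.swap) (simp add: sum_distrib_left)
    also have "\<dots> = (\<Sum>c'\<in>?K. \<Sum>i<class_dim G c'. if c' = c then (if i = p then (if p = q then N else 0) else 0) else 0)"
      using c pq n by (intro sum.cong refl) (auto simp: class_orthogonality N_def)
    also have "\<dots> = (\<Sum>c'\<in>?K. if c' = c then (if p = q then N else 0) else 0)"
      using pq by (intro sum.cong refl) auto
    also have "\<dots> = (if p = q then N else 0)" using finite_irrep_classes c by simp
    finally show "fourier ?n v (class_rep c) $$ (p,q) = 0\<^sub>m ?n ?n $$ (p,q)" using pq by simp
  qed (simp_all add: fourier_def mat_sum_def)
  have "v (inv g) = 0"
  proof (rule fourier_injective)
    show "\<forall>m S. irreducible_mat_rep G m S \<longrightarrow> fourier m v S = 0\<^sub>m m m"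
    proof (intro allI impI)
      fix m S assume S: "irreducible_mat_rep G m S"
      then have Sr: "mat_rep G m S" unfolding irreducible_mat_rep_def by simp
      have d: "rep_dim G S = m" by (rule mat_rep_dim[OF Sr])
      obtain c where c: "c \<in> ?K" and e: "equivalent_reps G (class_rep c) S"
        using ex_class_rep[of S] S d unfolding irreducible_rep_iff by auto
      have dc: "class_dim G c = m" using e d unfolding equivalent_reps_def class_dim_class_rep by simp
      obtain P where PU: "P \<in> Units (mat_ring m)" and int: "\<And>h. h \<in> carrier G \<Longrightarrow> S h * P = P * class_rep c h"
        using e dc unfolding equivalent_reps_def class_dim_class_rep by auto
      from PU obtain P' where P: "P \<in> carrier_mat m m" "P' \<in> carrier_mat m m" "P * P' = 1\<^sub>m m"
        by (rule Units_mat_ringE)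
      have Rr: "mat_rep G m (class_rep c)" using class_rep_irreducible[OF c] dc unfolding irreducible_mat_rep_def by simp
      have "fourier m v S * P = 0\<^sub>m m m"
        using fourier_mult[OF Sr Rr P(1) int] base[OF c] P(1) dc by simp
      then have "fourier m v S * P * P' = 0\<^sub>m m m" using P(2) by simp
      then show "fourier m v S = 0\<^sub>m m m" using assoc_mult_mat[OF fourier_carrier P(1,2)] P(3)
        by (simp add: right_mult_one_mat[OF fourier_carrier])
    qed
  qed (use g in simp)
  then show ?thesis using g unfolding v_def N_def by auto
qed

end

section \<open>Dual representations and the Frobenius-Schur indicator\<close>

context finite_group
begin

definition dual_rep :: "('a \<Rightarrow> complex mat) \<Rightarrow> 'a \<Rightarrow> complex mat" where
  "dual_rep R g = transpose_mat (R (inv g))"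

lemma dual_mat_rep:
  assumes R: "mat_rep G n R"
  shows "mat_rep G n (dual_rep R)"
  unfolding mat_rep_def
proof (intro conjI ballI)
  note Rc = mat_repD(1)[OF R]
  show "dual_rep R g \<in> carrier_mat n n" if "g \<in> carrier G" for g
    using Rc[of "inv g"] that unfolding dual_rep_def by simp
  show "dual_rep R \<one> = 1\<^sub>m n" unfolding dual_rep_def by (simp add: mat_repD(2)[OF R])
  fix g h assume g: "g \<in> carrier G" and h: "h \<in> carrier G"
  have "dual_rep R (g \<otimes> h) = transpose_mat (R (inv h) * R (inv g))"
    unfolding dual_rep_def using g h by (simp add: inv_mult_group mat_repD(3)[OF R])
  also have "\<dots> = dual_rep R g * dual_rep R h"
    unfolding dual_rep_def using g h by (intro transpose_mult[of _ n n _ n] Rc) auto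
  finally show "dual_rep R (g \<otimes> h) = dual_rep R g * dual_rep R h" .
qed

lemma dual_irreducible:
  assumes irr: "irreducible_mat_rep G n R"
  shows "irreducible_mat_rep G n (dual_rep R)"
  unfolding irreducible_mat_rep_def
proof (intro conjI allI impI)
  have R: "mat_rep G n R" and n: "n > 0"
    and triv: "\<And>W. lin_subspace n W \<Longrightarrow> \<forall>g\<in>carrier G. \<forall>w\<in>W. R g *\<^sub>v w \<in> W \<Longrightarrow> W = {0\<^sub>v n} \<or> W = carrier_vec n"
    using irr unfolding irreducible_mat_rep_def by auto
  note Rc = mat_repD(1)[OF R]
  note D = dual_mat_rep[OF R]
  note Dc = mat_repD(1)[OF D]
  show "mat_rep G n (dual_rep R)" "n > 0" by fact+
  fix W assume W: "lin_subspace n W" and inv: "\<forall>g\<in>carrier G. \<forall>w\<in>W. dual_rep R g *\<^sub>v w \<in> W"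
  obtain m P Q where P: "P \<in> carrier_mat n m" and Q: "Q \<in> carrier_mat m n" and QP: "Q * P = 1\<^sub>m m"
    and WP: "W = {P *\<^sub>v x | x. x \<in> carrier_vec m}" by (rule lin_subspace_basis[OF W])
  note S = invariant_subspace_rep[OF D WP inv P Q QP]
  let ?S = "\<lambda>g. Q * dual_rep R g * P"
  have PT: "transpose_mat P \<in> carrier_mat m n" and QT: "transpose_mat Q \<in> carrier_mat n m" using P Q by auto
  let ?V = "{x \<in> carrier_vec n. transpose_mat P *\<^sub>v x = 0\<^sub>v m}"
  have invV: "R g *\<^sub>v x \<in> ?V" if g: "g \<in> carrier G" and x: "x \<in> ?V" for g x
  proof -
    have ig: "inv g \<in> carrier G" using g by simp
    have xc: "x \<in> carrier_vec n" using x by simp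
    have Sc: "transpose_mat (?S (inv g)) \<in> carrier_mat m m" using mat_repD(1)[OF S(1) ig] by simp
    have "transpose_mat P * R g = transpose_mat (transpose_mat (R g) * P)"
      using transpose_mult[of "transpose_mat (R g)" n n P m] Rc[OF g] P by simp
    also have "transpose_mat (R g) = dual_rep R (inv g)" unfolding dual_rep_def using g by simp
    also have "dual_rep R (inv g) * P = P * ?S (inv g)" by (rule S(2)[OF ig])
    also have "transpose_mat (P * ?S (inv g)) = transpose_mat (?S (inv g)) * transpose_mat P"
      by (rule transpose_mult[OF P mat_repD(1)[OF S(1) ig]])
    finally have e: "transpose_mat P * R g = transpose_mat (?S (inv g)) * transpose_mat P" .
    have "transpose_mat P *\<^sub>v (R g *\<^sub>v x) = (transpose_mat P * R g) *\<^sub>v x"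
      by (rule assoc_mult_mat_vec[OF PT Rc[OF g] xc, symmetric])
    also have "\<dots> = transpose_mat (?S (inv g)) *\<^sub>v (transpose_mat P *\<^sub>v x)"
      unfolding e by (rule assoc_mult_mat_vec[OF Sc PT xc])
    also have "\<dots> = transpose_mat (?S (inv g)) *\<^sub>v 0\<^sub>v m" using x by simp
    also have "\<dots> = 0\<^sub>v m" by (rule mult_mat_zero_vec[OF Sc])
    finally show ?thesis using Rc[OF g] xc by auto
  qed
  have "?V = {0\<^sub>v n} \<or> ?V = carrier_vec n"
    using triv[OF lin_subspace_kernel[OF PT]] invV by blast
  then show "W = {0\<^sub>v n} \<or> W = carrier_vec n"
  proof
    assume V: "?V = carrier_vec n"
    have "transpose_mat P = 0\<^sub>m m n"
    proof (rule mat_eq_by_vec[OF PT])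
      fix x :: "complex vec" assume "x \<in> carrier_vec n"
      then show "transpose_mat P *\<^sub>v x = 0\<^sub>m m n *\<^sub>v x" using V by (subst mult_zero_mat_vec) auto
    qed simp
    then have "transpose_mat (transpose_mat P) = transpose_mat (0\<^sub>m m n)" by (rule arg_cong)
    then have "P = 0\<^sub>m n m" unfolding transpose_transpose zero_transpose_mat .
    then have "W \<subseteq> {0\<^sub>v n}" unfolding WP using mult_zero_mat_vec by auto
    then show ?thesis using W unfolding lin_subspace_def by blast
  next
    assume V: "?V = {0\<^sub>v n}"
    have QPT: "transpose_mat P * transpose_mat Q = 1\<^sub>m m"
      unfolding transpose_mult[OF Q P, symmetric] QP by simp
    have one: "transpose_mat Q * transpose_mat P = 1\<^sub>m n"
    proof (rule mat_eq_by_vec[of _ n n])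
      show "transpose_mat Q * transpose_mat P \<in> carrier_mat n n" using PT QT by auto
      fix x :: "complex vec" assume x: "x \<in> carrier_vec n"
      let ?y = "transpose_mat P *\<^sub>v x"
      have y: "?y \<in> carrier_vec m" using PT x by auto
      have z: "transpose_mat Q *\<^sub>v ?y \<in> carrier_vec n" using QT y by auto
      have "transpose_mat P *\<^sub>v (transpose_mat Q *\<^sub>v ?y - x)
        = transpose_mat P *\<^sub>v (transpose_mat Q *\<^sub>v ?y) - ?y" by (rule mult_minus_distrib_mat_vec[OF PT z x])
      also have "transpose_mat P *\<^sub>v (transpose_mat Q *\<^sub>v ?y) = ?y"
        using assoc_mult_mat_vec[OF PT QT y] QPT y by simp
      also have "?y - ?y = 0\<^sub>v m" using y by simp
      finally have "transpose_mat Q *\<^sub>v ?y - x \<in> ?V" using x z by simp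
      then have z0: "transpose_mat Q *\<^sub>v ?y - x = 0\<^sub>v n" using V by blast
      have "transpose_mat Q *\<^sub>v ?y = x"
      proof (rule eq_vecI)
        fix i assume i: "i < dim_vec x"
        have "(transpose_mat Q *\<^sub>v ?y - x) $ i = 0" using z0 i x by simp
        then show "(transpose_mat Q *\<^sub>v ?y) $ i = x $ i" using i by (simp del: index_mult_mat_vec)
      qed (use QT x in simp)
      then show "(transpose_mat Q * transpose_mat P) *\<^sub>v x = 1\<^sub>m n *\<^sub>v x"
        using assoc_mult_mat_vec[OF QT PT x] x by simp
    qed simp
    have "transpose_mat (transpose_mat (P * Q)) = transpose_mat (1\<^sub>m n)"
      unfolding transpose_mult[OF P Q] one ..
    then have "P * Q = 1\<^sub>m n" unfolding transpose_transpose transpose_one .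
    then have "x \<in> W" if x: "x \<in> carrier_vec n" for x
    proof -
      have "x = P *\<^sub>v (Q *\<^sub>v x)" using assoc_mult_mat_vec[OF P Q x] \<open>P * Q = 1\<^sub>m n\<close> x by simp
      moreover have "Q *\<^sub>v x \<in> carrier_vec m" using Q x by auto
      ultimately show ?thesis unfolding WP by blast
    qed
    then show ?thesis using W unfolding lin_subspace_def by blast
  qed
qed

lemma dual_irreducible_rep: "irreducible_rep G R \<Longrightarrow> irreducible_rep G (dual_rep R)"
proof -
  assume "irreducible_rep G R"
  then have i: "irreducible_mat_rep G (rep_dim G R) (dual_rep R)"
    unfolding irreducible_rep_iff by (rule dual_irreducible)
  then have "rep_dim G (dual_rep R) = rep_dim G R"
    unfolding irreducible_mat_rep_def using mat_rep_dim by blast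
  then show ?thesis using i unfolding irreducible_rep_iff by simp
qed

lemma rep_dim_dual: "irreducible_rep G R \<Longrightarrow> rep_dim G (dual_rep R) = rep_dim G R"
  by (rule mat_rep_dim[OF dual_mat_rep]) (simp add: irreducible_rep_iff irreducible_mat_rep_def)

lemma equivalent_reps_sym:
  assumes "irreducible_rep G R" "irreducible_rep G S" "equivalent_reps G R S"
  shows "equivalent_reps G S R"
  using equiv_irreducible assms unfolding equiv_def sym_def by blast

lemma equivalent_reps_trans:
  assumes "irreducible_rep G R" "irreducible_rep G S" "irreducible_rep G U"
    "equivalent_reps G R S" "equivalent_reps G S U"
  shows "equivalent_reps G R U"
  using equiv_irreducible assms unfolding equiv_def trans_def by blast

lemma equivalent_reps_dual:
  assumes R: "irreducible_rep G R" and S: "irreducible_rep G S" and e: "equivalent_reps G R S"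
  shows "equivalent_reps G (dual_rep R) (dual_rep S)"
proof -
  define n where "n = rep_dim G R"
  have d: "rep_dim G S = n" using e unfolding equivalent_reps_def n_def by simp
  have Rr: "mat_rep G n R" and Sr: "mat_rep G n S"
    using R S d unfolding irreducible_rep_iff irreducible_mat_rep_def n_def by auto
  obtain P where PU: "P \<in> Units (mat_ring n)" and int: "\<forall>g\<in>carrier G. P * R g = S g * P"
    using e unfolding equivalent_reps_def n_def by blast
  from PU obtain P' where P: "P \<in> carrier_mat n n" "P' \<in> carrier_mat n n" "P * P' = 1\<^sub>m n" "P' * P = 1\<^sub>m n"
    by (rule Units_mat_ringE)
  have RP: "P' * S g = R g * P'" if g: "g \<in> carrier G" for g
  proof -
    have rc: "R g \<in> carrier_mat n n" and sc: "S g \<in> carrier_mat n n"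
      using mat_repD(1)[OF Rr g] mat_repD(1)[OF Sr g] by auto
    have "P' * S g = P' * (S g * (P * P'))" using P sc by simp
    also have "\<dots> = P' * ((S g * P) * P')" using assoc_mult_mat[OF sc P(1,2)] by simp
    also have "\<dots> = P' * (P * R g * P')" using int g by simp
    also have "\<dots> = P' * (P * R g) * P'" using assoc_mult_mat[OF P(2) mult_carrier_mat[OF P(1) rc] P(2)] by simp
    also have "\<dots> = P' * P * R g * P'" using assoc_mult_mat[OF P(2,1) rc] by simp
    also have "\<dots> = R g * P'" using P rc by simp
    finally show ?thesis .
  qed
  let ?T = "transpose_mat P'"
  have "?T * transpose_mat P = 1\<^sub>m n" "transpose_mat P * ?T = 1\<^sub>m n"
    unfolding transpose_mult[OF P(1,2), symmetric] transpose_mult[OF P(2,1), symmetric] P(3,4) by simp_all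
  then have "?T \<in> Units (mat_ring n)"
    using Units_mat_ringI[of ?T n "transpose_mat P"] P(1,2) by simp
  moreover have "?T * dual_rep R g = dual_rep S g * ?T" if g: "g \<in> carrier G" for g
  proof -
    have ig: "inv g \<in> carrier G" using g by simp
    show ?thesis unfolding dual_rep_def
      using transpose_mult[OF mat_repD(1)[OF Rr ig] P(2)] transpose_mult[OF P(2) mat_repD(1)[OF Sr ig]] RP[OF ig] by simp
  qed
  ultimately show ?thesis unfolding equivalent_reps_def rep_dim_dual[OF R] rep_dim_dual[OF S] n_def[symmetric] d by blast
qed

lemma equivalent_reps_dual_dual:
  assumes R: "irreducible_rep G R"
  shows "equivalent_reps G (dual_rep (dual_rep R)) R"
proof -
  have Rr: "mat_rep G (rep_dim G R) R" using R unfolding irreducible_rep_iff irreducible_mat_rep_def by simp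
  have "equivalent_reps G R R" using equiv_irreducible R unfolding equiv_def refl_on_def by blast
  moreover have "dual_rep (dual_rep R) g = R g" if "g \<in> carrier G" for g
    unfolding dual_rep_def using that by simp
  ultimately show ?thesis unfolding equivalent_reps_def
    rep_dim_dual[OF dual_irreducible_rep[OF R]] rep_dim_dual[OF R] by simp
qed

definition dual_pair :: "('a \<Rightarrow> complex mat) set \<Rightarrow> ('a \<Rightarrow> complex mat) set \<Rightarrow> bool" where
  "dual_pair c c' \<longleftrightarrow> equivalent_reps G (class_rep c) (dual_rep (class_rep c'))"

lemma dual_pair_sym:
  assumes c: "c \<in> irrep_classes G" "c' \<in> irrep_classes G" and "dual_pair c c'"
  shows "dual_pair c' c"
proof -
  note i = class_rep_in(2)[OF c(1)] and i' = class_rep_in(2)[OF c(2)]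
  note d = dual_irreducible_rep[OF i] and d' = dual_irreducible_rep[OF i']
  have "equivalent_reps G (dual_rep (class_rep c)) (dual_rep (dual_rep (class_rep c')))"
    using equivalent_reps_dual[OF i d'] assms(3) unfolding dual_pair_def .
  then have "equivalent_reps G (dual_rep (class_rep c)) (class_rep c')"
    using equivalent_reps_trans[OF d dual_irreducible_rep[OF d'] i'] equivalent_reps_dual_dual[OF i'] by blast
  then show ?thesis unfolding dual_pair_def by (rule equivalent_reps_sym[OF d i'])
qed

lemma dual_pair_unique:
  assumes c: "c \<in> irrep_classes G" "c' \<in> irrep_classes G" "c'' \<in> irrep_classes G"
    and "dual_pair c c'" "dual_pair c c''"
  shows "c' = c''"
proof (rule class_rep_equivalent[OF c(2,3)])
  note i = class_rep_in(2)[OF c(1)] and i' = class_rep_in(2)[OF c(2)] and i'' = class_rep_in(2)[OF c(3)]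
  have a: "equivalent_reps G (class_rep c') (dual_rep (class_rep c))"
    using dual_pair_sym[OF c(1,2) assms(4)] unfolding dual_pair_def .
  have b: "equivalent_reps G (class_rep c'') (dual_rep (class_rep c))"
    using dual_pair_sym[OF c(1,3) assms(5)] unfolding dual_pair_def .
  show "equivalent_reps G (class_rep c') (class_rep c'')"
    using equivalent_reps_trans[OF i' dual_irreducible_rep[OF i] i'' a]
      equivalent_reps_sym[OF i'' dual_irreducible_rep[OF i] b] by blast
qed

lemma not_dual_pair_orthogonal:
  assumes c: "c \<in> irrep_classes G" "c' \<in> irrep_classes G" and nd: "\<not> dual_pair c c'"
    and b: "i < class_dim G c" "j < class_dim G c" "p < class_dim G c'" "q < class_dim G c'"
  shows "(\<Sum>g\<in>carrier G. class_rep c g $$ (i,j) * class_rep c' g $$ (p,q)) = 0"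
proof -
  note i' = class_rep_in(2)[OF c(2)]
  have "\<not> equivalent_reps G (dual_rep (class_rep c')) (class_rep c)"
    using nd equivalent_reps_sym[OF dual_irreducible_rep[OF i'] class_rep_in(2)[OF c(1)]]
    unfolding dual_pair_def by blast
  from orthogonality_distinct[OF class_rep_irreducible[OF c(1)] dual_irreducible[OF class_rep_irreducible[OF c(2)]] this b(1,2,4,3)]
  have "(\<Sum>g\<in>carrier G. class_rep c g $$ (i,j) * dual_rep (class_rep c') (inv g) $$ (q,p)) = 0" .
  moreover have "dual_rep (class_rep c') (inv g) $$ (q,p) = class_rep c' g $$ (p,q)" if g: "g \<in> carrier G" for g
    unfolding dual_rep_def using g b class_rep_carrier[OF c(2) g] by simp
  ultimately show ?thesis by simp
qed

definition invariant_form :: "('a \<Rightarrow> complex mat) set \<Rightarrow> complex \<Rightarrow> complex mat \<Rightarrow> complex mat \<Rightarrow> bool" where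
  "invariant_form c \<epsilon> B B' \<longleftrightarrow> B \<in> carrier_mat (class_dim G c) (class_dim G c) \<and>
     B' \<in> carrier_mat (class_dim G c) (class_dim G c) \<and> B * B' = 1\<^sub>m (class_dim G c) \<and>
     transpose_mat B = \<epsilon> \<cdot>\<^sub>m B \<and> transpose_mat B' = \<epsilon> \<cdot>\<^sub>m B' \<and> (\<epsilon> = 1 \<or> \<epsilon> = -1) \<and>
     (\<forall>i<class_dim G c. \<forall>j<class_dim G c. \<forall>p<class_dim G c. \<forall>q<class_dim G c.
       (\<Sum>g\<in>carrier G. class_rep c g $$ (i,j) * class_rep c g $$ (p,q)) =
         of_nat (card (carrier G)) / of_nat (class_dim G c) * (B $$ (i,p) * B' $$ (q,j)))"

lemma ex_invariant_form:
  assumes c: "c \<in> irrep_classes G" and sd: "dual_pair c c"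
  shows "\<exists>\<epsilon> B B'. invariant_form c \<epsilon> B B'"
proof -
  define n where "n = class_dim G c"
  define R where "R = class_rep c"
  have irr: "irreducible_mat_rep G n R" using class_rep_irreducible[OF c] unfolding n_def R_def .
  then have Rr: "mat_rep G n R" and n: "n > 0" unfolding irreducible_mat_rep_def by auto
  note Rc = mat_repD(1)[OF Rr]
  note Dc = mat_repD(1)[OF dual_mat_rep[OF Rr]]
  obtain P where PU: "P \<in> Units (mat_ring n)" and int: "\<And>g. g \<in> carrier G \<Longrightarrow> P * R g = dual_rep R g * P"
    using sd mat_rep_dim[OF Rr] unfolding dual_pair_def equivalent_reps_def R_def by auto
  from PU obtain P' where P: "P \<in> carrier_mat n n" and P': "P' \<in> carrier_mat n n"
    and PP': "P * P' = 1\<^sub>m n" and P'P: "P' * P = 1\<^sub>m n" by (rule Units_mat_ringE)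
  let ?PT = "transpose_mat P"
  have PT: "?PT \<in> carrier_mat n n" using P by simp
  have intT: "?PT * R g = dual_rep R g * ?PT" if g: "g \<in> carrier G" for g
  proof -
    have ig: "inv g \<in> carrier G" using g by simp
    have "transpose_mat (P * R (inv g)) = transpose_mat (dual_rep R (inv g) * P)" using int[OF ig] by simp
    then have "transpose_mat (R (inv g)) * ?PT = ?PT * transpose_mat (dual_rep R (inv g))"
      using transpose_mult[OF P Rc[OF ig]] transpose_mult[OF Dc[OF ig] P] by simp
    then show ?thesis unfolding dual_rep_def using g by simp
  qed
  have intP': "P' * dual_rep R g = R g * P'" if g: "g \<in> carrier G" for g
  proof -
    have "P' * dual_rep R g = P' * (dual_rep R g * (P * P'))" using PP' Dc[OF g] by simp
    also have "\<dots> = P' * ((dual_rep R g * P) * P')" using assoc_mult_mat[OF Dc[OF g] P P'] by simp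
    also have "\<dots> = P' * (P * R g * P')" using int[OF g] by simp
    also have "\<dots> = P' * (P * R g) * P'" using assoc_mult_mat[OF P' mult_carrier_mat[OF P Rc[OF g]] P'] by simp
    also have "\<dots> = P' * P * R g * P'" using assoc_mult_mat[OF P' P Rc[OF g]] by simp
    also have "\<dots> = R g * P'" using P'P Rc[OF g] by simp
    finally show ?thesis .
  qed
  have "\<exists>\<epsilon>. P' * ?PT = \<epsilon> \<cdot>\<^sub>m 1\<^sub>m n"
  proof (rule schur_scalar[OF irr])
    show "P' * ?PT \<in> carrier_mat n n" using P' PT by simp
    fix g assume g: "g \<in> carrier G"
    have "P' * ?PT * R g = P' * (dual_rep R g * ?PT)"
      unfolding assoc_mult_mat[OF P' PT Rc[OF g]] intT[OF g] ..
    also have "\<dots> = R g * P' * ?PT" using assoc_mult_mat[OF P' Dc[OF g] PT] intP'[OF g] by simp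
    also have "\<dots> = R g * (P' * ?PT)" by (rule assoc_mult_mat[OF Rc[OF g] P' PT])
    finally show "P' * ?PT * R g = R g * (P' * ?PT)" .
  qed
  then obtain \<epsilon> where \<epsilon>: "P' * ?PT = \<epsilon> \<cdot>\<^sub>m 1\<^sub>m n" by blast
  have T: "?PT = \<epsilon> \<cdot>\<^sub>m P"
  proof -
    have "?PT = P * P' * ?PT" using PP' PT by simp
    also have "\<dots> = P * (P' * ?PT)" by (rule assoc_mult_mat[OF P P' PT])
    also have "\<dots> = \<epsilon> \<cdot>\<^sub>m P" unfolding \<epsilon> by (rule smult_one_mat_commute(2)[OF P])
    finally show ?thesis .
  qed
  have ent: "P $$ (j,i) = \<epsilon> * P $$ (i,j)" if "i < n" "j < n" for i j
    using arg_cong[OF T, of "\<lambda>A. A $$ (i,j)"] that P by simp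
  have "\<exists>i<n. \<exists>j<n. P $$ (i,j) \<noteq> 0"
  proof (rule ccontr)
    assume z: "\<not> ?thesis"
    have "(P * P') $$ (0,0) = 0" unfolding mat_entry_mult[OF P P' n n] using z n by (intro sum.neutral) auto
    then show False using PP' n by simp
  qed
  then obtain i0 j0 where ij0: "i0 < n" "j0 < n" "P $$ (i0,j0) \<noteq> 0" by blast
  have "P $$ (i0,j0) = \<epsilon> * (\<epsilon> * P $$ (i0,j0))" using ent[OF ij0(1,2)] ent[OF ij0(2,1)] by simp
  then have "\<epsilon> * \<epsilon> = 1" using ij0(3) by (simp add: mult.assoc[symmetric])
  then have \<epsilon>1: "\<epsilon> = 1 \<or> \<epsilon> = -1" by (simp add: square_eq_1_iff)
  have T': "transpose_mat P' = \<epsilon> \<cdot>\<^sub>m P'"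
  proof -
    let ?Q = "transpose_mat P'"
    have Qc: "?Q \<in> carrier_mat n n" using P' by simp
    have "?Q * ?PT = 1\<^sub>m n" unfolding transpose_mult[OF P P', symmetric] PP' by simp
    then have "\<epsilon> \<cdot>\<^sub>m (?Q * P) = 1\<^sub>m n" unfolding T using mult_smult_distrib[OF Qc P] by simp
    then have "\<epsilon> \<cdot>\<^sub>m (?Q * P) * P' = P'" using P' by simp
    then have "\<epsilon> \<cdot>\<^sub>m (?Q * P * P') = P'" using mult_smult_assoc_mat[OF mult_carrier_mat[OF Qc P] P'] by simp
    then have "\<epsilon> \<cdot>\<^sub>m ?Q = P'" using assoc_mult_mat[OF Qc P P'] PP' Qc by simp
    then have "\<epsilon> \<cdot>\<^sub>m P' = \<epsilon> \<cdot>\<^sub>m (\<epsilon> \<cdot>\<^sub>m ?Q)" by simp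
    also have "\<dots> = ?Q" using \<open>\<epsilon> * \<epsilon> = 1\<close> by (intro eq_matI) (auto simp: mult.assoc[symmetric])
    finally show ?thesis by simp
  qed
  have sum: "(\<Sum>g\<in>carrier G. R g $$ (i,j) * R g $$ (p,q)) =
      of_nat (card (carrier G)) / of_nat n * (P' $$ (i,p) * P $$ (q,j))"
    if b: "i < n" "j < n" "p < n" "q < n" for i j p q
  proof -
    have Re: "R g $$ (p,q) = (\<Sum>u<n. \<Sum>v<n. P $$ (q,u) * P' $$ (v,p) * R (inv g) $$ (u,v))"
      if g: "g \<in> carrier G" for g
    proof -
      have ig: "inv g \<in> carrier G" using g by simp
      have "dual_rep R (inv g) = dual_rep R (inv g) * (P * P')" using PP' Dc[OF ig] by simp
      also have "\<dots> = P * R (inv g) * P'" using assoc_mult_mat[OF Dc[OF ig] P P'] int[OF ig] by simp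
      finally have e: "dual_rep R (inv g) = P * R (inv g) * P'" .
      have "R g $$ (p,q) = dual_rep R (inv g) $$ (q,p)" unfolding dual_rep_def using g b Rc[OF g] by simp
      also have "\<dots> = (\<Sum>v<n. (\<Sum>u<n. P $$ (q,u) * R (inv g) $$ (u,v)) * P' $$ (v,p))"
        unfolding e mat_entry_mult[OF mult_carrier_mat[OF P Rc[OF ig]] P' b(4,3)]
        by (intro sum.cong refl) (use mat_entry_mult[OF P Rc[OF ig] b(4)] in simp)
      also have "\<dots> = (\<Sum>u<n. \<Sum>v<n. P $$ (q,u) * P' $$ (v,p) * R (inv g) $$ (u,v))"
        unfolding sum_distrib_right by (subst sum.swap) (simp add: mult_ac)
      finally show ?thesis .
    qed
    have "(\<Sum>g\<in>carrier G. R g $$ (i,j) * R g $$ (p,q)) =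
       (\<Sum>g\<in>carrier G. \<Sum>u<n. \<Sum>v<n. P $$ (q,u) * P' $$ (v,p) * (R g $$ (i,j) * R (inv g) $$ (u,v)))"
      by (intro sum.cong refl) (simp add: Re sum_distrib_left mult_ac)
    also have "\<dots> = (\<Sum>u<n. \<Sum>v<n. P $$ (q,u) * P' $$ (v,p) *
        (\<Sum>g\<in>carrier G. R g $$ (i,j) * R (inv g) $$ (u,v)))"
      by (subst sum.swap, rule sum.cong[OF refl], subst sum.swap) (simp add: sum_distrib_left)
    also have "\<dots> = (\<Sum>u<n. \<Sum>v<n. if v = i then (if u = j then
        P $$ (q,u) * P' $$ (v,p) * (of_nat (card (carrier G)) / of_nat n) else 0) else 0)"
      using b by (intro sum.cong refl) (auto simp: orthogonality_same[OF irr])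
    also have "\<dots> = P $$ (q,j) * P' $$ (i,p) * (of_nat (card (carrier G)) / of_nat n)"
      using b by simp
    finally show ?thesis by simp
  qed
  show ?thesis unfolding invariant_form_def n_def[symmetric] R_def[symmetric]
    using P P' P'P T T' \<epsilon>1 sum by blast
qed

lemma frobenius_schur_sum:
  assumes c: "c \<in> irrep_classes G"
  shows "class_frobenius_schur G c = 1 / of_nat (card (carrier G)) *
    (\<Sum>i<class_dim G c. \<Sum>p<class_dim G c. \<Sum>g\<in>carrier G. class_rep c g $$ (i,p) * class_rep c g $$ (p,i))"
proof -
  let ?n = "class_dim G c"
  have Rr: "mat_rep G ?n (class_rep c)" using class_rep_irreducible[OF c] unfolding irreducible_mat_rep_def by simp
  have ch: "rep_character G (class_rep c) (g \<otimes> g) = (\<Sum>i<?n. \<Sum>p<?n. class_rep c g $$ (i,p) * class_rep c g $$ (p,i))"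
    if g: "g \<in> carrier G" for g
    unfolding rep_character_def class_dim_class_rep[symmetric] mat_repD(3)[OF Rr g g]
    by (intro sum.cong refl) (use mat_entry_mult[OF class_rep_carrier[OF c g] class_rep_carrier[OF c g]] in simp)
  have "(\<Sum>g\<in>carrier G. rep_character G (class_rep c) (g \<otimes> g)) =
     (\<Sum>i<?n. \<Sum>p<?n. \<Sum>g\<in>carrier G. class_rep c g $$ (i,p) * class_rep c g $$ (p,i))"
    by (simp add: ch, subst sum.swap, rule sum.cong[OF refl], rule sum.swap)
  then show ?thesis
    unfolding class_frobenius_schur_def class_rep_def[symmetric] frobenius_schur_def by simp
qed

lemma frobenius_schur_form:
  assumes c: "c \<in> irrep_classes G" and f: "invariant_form c \<epsilon> B B'"
  shows "class_frobenius_schur G c = \<epsilon>"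
proof -
  define n where "n = class_dim G c"
  have n: "n > 0" unfolding n_def by (rule class_dim_pos[OF c])
  have B: "B \<in> carrier_mat n n" "B' \<in> carrier_mat n n" "B * B' = 1\<^sub>m n" "transpose_mat B = \<epsilon> \<cdot>\<^sub>m B"
    and s: "\<And>i j p q. i < n \<Longrightarrow> j < n \<Longrightarrow> p < n \<Longrightarrow> q < n \<Longrightarrow>
      (\<Sum>g\<in>carrier G. class_rep c g $$ (i,j) * class_rep c g $$ (p,q)) =
         of_nat (card (carrier G)) / of_nat n * (B $$ (i,p) * B' $$ (q,j))"
    and \<epsilon>: "\<epsilon> = 1 \<or> \<epsilon> = -1" and T': "transpose_mat B' = \<epsilon> \<cdot>\<^sub>m B'"
    using f unfolding invariant_form_def n_def[symmetric] by auto
  have ent: "B' $$ (i,p) = \<epsilon> * B' $$ (p,i)" if "i < n" "p < n" for i p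
    using arg_cong[OF T', of "\<lambda>A. A $$ (p,i)"] that B by simp
  have "class_frobenius_schur G c = 1 / of_nat (card (carrier G)) *
    (\<Sum>i<n. \<Sum>p<n. of_nat (card (carrier G)) / of_nat n * (B $$ (i,p) * B' $$ (i,p)))"
    unfolding frobenius_schur_sum[OF c] n_def[symmetric] by (simp add: s)
  also have "\<dots> = 1 / of_nat n * (\<Sum>i<n. \<Sum>p<n. B $$ (i,p) * B' $$ (i,p))"
    unfolding sum_distrib_left[symmetric] using order_pos by simp
  also have "(\<Sum>i<n. \<Sum>p<n. B $$ (i,p) * B' $$ (i,p)) = (\<Sum>i<n. \<Sum>p<n. \<epsilon> * (B $$ (i,p) * B' $$ (p,i)))"
  proof (intro sum.cong refl)
    fix i p assume "i \<in> {..<n}" "p \<in> {..<n}"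
    then show "B $$ (i,p) * B' $$ (i,p) = \<epsilon> * (B $$ (i,p) * B' $$ (p,i))"
      by (subst ent) (auto simp: mult_ac)
  qed
  also have "\<dots> = (\<Sum>i<n. \<epsilon> * (B * B') $$ (i,i))"
    by (intro sum.cong refl) (use mat_entry_mult[OF B(1,2)] in \<open>simp add: sum_distrib_left\<close>)
  also have "\<dots> = of_nat n * \<epsilon>" unfolding B by simp
  finally show ?thesis using n by simp
qed

lemma frobenius_schur_not_self_dual:
  assumes c: "c \<in> irrep_classes G" and nd: "\<not> dual_pair c c"
  shows "class_frobenius_schur G c = 0"
  unfolding frobenius_schur_sum[OF c] using not_dual_pair_orthogonal[OF c c nd] by simp

end

section \<open>Parity of the Euler characteristic\<close>

lemma permutes_finite_permutation: "finite S \<Longrightarrow> p permutes S \<Longrightarrow> permutation p"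
  using permutation_permutes by blast

lemma sign_cycle_of_list:
  assumes "distinct cs" "cs \<noteq> []"
  shows "sign (cycle_of_list cs) = (-1) ^ (length cs - 1)"
  using assms
proof (induction cs rule: cycle_of_list.induct)
  case (1 i j cs)
  have "sign (cycle_of_list (i # j # cs)) = sign (transpose i j) * sign (cycle_of_list (j # cs))"
    by (simp add: sign_compose permutation_swap_id permutation_of_cycle)
  also have "\<dots> = - sign (cycle_of_list (j # cs))" using 1 by (simp add: sign_swap_id)
  also have "\<dots> = - ((-1) ^ (length (j # cs) - 1))" using 1 by simp
  also have "\<dots> = (-1) ^ (length (i # j # cs) - 1)" by simp
  finally show ?case .
qed (simp_all add: id_def)

lemma orbit_cycle_of_list:
  assumes d: "distinct cs" and x: "x \<in> set cs"
  shows "orbit (cycle_of_list cs) x = set cs"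
proof -
  let ?f = "cycle_of_list cs"
  have f: "permutation ?f" by (rule permutation_of_cycle)
  have ne: "cs \<noteq> []" using x by auto
  have pow: "(?f ^^ n) (hd cs) = cs ! (n mod length cs)" for n
  proof -
    have "(?f ^^ n) (hd cs) = hd (map (?f ^^ n) cs)" using ne by (simp add: hd_map)
    also have "\<dots> = cs ! (n mod length cs)"
      unfolding cyclic_rotation[OF d] using ne by (simp add: hd_rotate_conv_nth)
    finally show ?thesis .
  qed
  have "orbit ?f (hd cs) = set cs"
  proof
    show "orbit ?f (hd cs) \<subseteq> set cs"
      unfolding orbit_altdef_permutation[OF f] pow using ne by auto
    show "set cs \<subseteq> orbit ?f (hd cs)"
    proof
      fix y assume "y \<in> set cs"
      then obtain n where n: "n < length cs" "y = cs ! n" by (auto simp: in_set_conv_nth)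
      then have "y = (?f ^^ n) (hd cs)" unfolding pow by simp
      then show "y \<in> orbit ?f (hd cs)" unfolding orbit_altdef_permutation[OF f] by blast
    qed
  qed
  then show ?thesis using x permutation_self_in_orbit[OF f]
    by (metis orbit_cyclic_eq3 cyclic_on_alldef cyclic_on_def list.set_sel(1) ne)
qed

lemma orbit_restrict_eq:
  assumes "x \<in> S" "\<And>y. y \<in> S \<Longrightarrow> f y = g y" "\<And>y. y \<in> S \<Longrightarrow> g y \<in> S"
  shows "orbit f x = orbit g x"
proof -
  have p: "(f ^^ n) x = (g ^^ n) x \<and> (g ^^ n) x \<in> S" for n
    by (induction n) (use assms in auto)
  then show ?thesis unfolding orbit_altdef by auto
qed

lemma sign_eq_orbits:
  assumes "finite S" "p permutes S"
  shows "sign p = (-1) ^ (card S + card (orbit p ` S))"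
proof -
  have "cycle_decomp S p" using cycle_decomposition[OF assms(2,1)] .
  then have "sign p = (-1) ^ (card S + card (orbit p ` S)) \<and> finite S \<and> p permutes S"
  proof (induction rule: cycle_decomp.induct)
    case empty
    show ?case using sign_id permutes_id by (simp add: id_def)
  next
    case (comp I p cs)
    have fin: "finite I" and p: "p permutes I" and IH: "sign p = (-1) ^ (card I + card (orbit p ` I))"
      using comp by auto
    let ?c = "cycle_of_list cs"
    have cp: "?c permutes set cs" by (rule cycle_permutes)
    have perm: "(?c \<circ> p) permutes (set cs \<union> I)"
      using permutes_compose[OF permutes_subset[OF p] permutes_subset[OF cp]] by blast
    show ?case
    proof (cases "cs = []")
      case True
      then show ?thesis using comp by simp
    next
      case False
      have a: "(?c \<circ> p) x = p x" if "x \<in> I" for x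
      proof -
        have "p x \<notin> set cs" using permutes_in_image[OF p, of x] that comp(3) by auto
        then show ?thesis by (simp add: id_outside_supp)
      qed
      have b: "(?c \<circ> p) x = ?c x" if "x \<in> set cs" for x
      proof -
        have "p x = x" using permutes_not_in[OF p, of x] that comp(3) by blast
        then show ?thesis by simp
      qed
      have oI: "orbit (?c \<circ> p) x = orbit p x" if "x \<in> I" for x
        by (rule orbit_restrict_eq[OF that a]) (use permutes_in_image[OF p] in auto)
      have oc: "orbit (?c \<circ> p) x = set cs" if "x \<in> set cs" for x
      proof -
        have "orbit (?c \<circ> p) x = orbit ?c x"
          by (rule orbit_restrict_eq[OF that b]) (use permutes_in_image[OF cp] in auto)
        then show ?thesis using orbit_cycle_of_list[OF comp(2) that] by simp
      qed
      have "orbit (?c \<circ> p) ` (set cs \<union> I) = insert (set cs) (orbit p ` I)"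
        using oI oc False by (auto simp: image_Un image_iff intro: hd_in_set)
      moreover have "set cs \<notin> orbit p ` I"
      proof
        assume "set cs \<in> orbit p ` I"
        then have "set cs \<subseteq> I" using permutes_orbit_subset[OF p] by auto
        then show False using comp(3) False by (cases cs) auto
      qed
      ultimately have co: "card (orbit (?c \<circ> p) ` (set cs \<union> I)) = Suc (card (orbit p ` I))"
        using fin by simp
      have cS: "card (set cs \<union> I) = length cs + card I"
        using fin comp(2,3) by (simp add: card_Un_disjoint distinct_card)
      have "sign (?c \<circ> p) = sign ?c * sign p"
        by (rule sign_compose[OF permutation_of_cycle permutes_finite_permutation[OF fin p]])
      also have "\<dots> = (-1) ^ (length cs - 1 + (card I + card (orbit p ` I)))"
        unfolding sign_cycle_of_list[OF comp(2) False] IH by (simp add: power_add)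
      also have "\<dots> = (-1) ^ (length cs - 1 + (card I + card (orbit p ` I)) + 2)" by simp
      also have "length cs - 1 + (card I + card (orbit p ` I)) + 2 =
          card (set cs \<union> I) + card (orbit (?c \<circ> p) ` (set cs \<union> I))"
        using False cS co by (cases cs) auto
      finally show ?thesis using perm fin by (metis finite_Un List.finite_set)
    qed
  qed
  then show ?thesis by blast
qed

lemma sign_involution:
  assumes "finite Y" "\<And>y. u (u y) = y" "Y \<inter> u ` Y = {}"
  shows "restrict_id u (Y \<union> u ` Y) permutes (Y \<union> u ` Y) \<and> sign (restrict_id u (Y \<union> u ` Y)) = (-1) ^ card Y"
  using assms(1,3)
proof (induction Y)
  case empty
  have "restrict_id u ({} \<union> u ` {}) = id" by (auto simp: restrict_id_def id_def)
  then show ?case using permutes_id sign_id by auto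
next
  case (insert y Y)
  let ?X = "Y \<union> u ` Y"
  have IH: "restrict_id u ?X permutes ?X" "sign (restrict_id u ?X) = (-1) ^ card Y"
    using insert by auto
  have y: "y \<notin> ?X" "u y \<notin> ?X" "u y \<noteq> y"
    using insert(2,4) assms(2) by (auto, metis assms(2) imageI)
  have e: "restrict_id u (insert y Y \<union> u ` insert y Y) = transpose y (u y) \<circ> restrict_id u ?X"
  proof
    fix x show "restrict_id u (insert y Y \<union> u ` insert y Y) x = (transpose y (u y) \<circ> restrict_id u ?X) x"
    proof (cases "x \<in> ?X")
      case True
      then have "u x \<in> ?X" using assms(2) by auto
      then show ?thesis using True y by (auto simp: restrict_id_def transpose_def)
    next
      case False
      then show ?thesis using y assms(2) by (auto simp: restrict_id_def transpose_def)
    qed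
  qed
  have finX: "finite ?X" using insert by simp
  have p: "permutation (restrict_id u ?X)" by (rule permutes_finite_permutation[OF finX IH(1)])
  have "sign (transpose y (u y) \<circ> restrict_id u ?X) = - ((-1) ^ card Y)"
    unfolding sign_compose[OF permutation_swap_id p] IH using y by (simp add: sign_swap_id)
  moreover have "transpose y (u y) \<circ> restrict_id u ?X permutes (insert y Y \<union> u ` insert y Y)"
    by (rule permutes_compose[OF permutes_subset[OF IH(1)] permutes_swap_id]) auto
  moreover have "- ((-1) ^ card Y) = ((-1) ^ card (insert y Y) :: int)" using insert by simp
  ultimately show ?case unfolding e by metis
qed

definition flips :: "'c set \<Rightarrow> ('c \<Rightarrow> 'c) \<Rightarrow> 'c set \<Rightarrow> bool" where
  "flips C u S \<longleftrightarrow> S \<subseteq> C \<and> (\<forall>x\<in>C. u x \<in> S \<longleftrightarrow> x \<notin> S)"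

definition carries :: "'c set \<Rightarrow> ('c \<Rightarrow> 'c) \<Rightarrow> 'c set \<Rightarrow> ('c \<Rightarrow> 'c) \<Rightarrow> 'c set \<Rightarrow> ('c \<Rightarrow> 'c) \<Rightarrow> bool" where
  "carries C u S w S' g \<longleftrightarrow> g permutes C \<and> (\<forall>x\<in>C. g (u x) = w (g x)) \<and> g ` S = S'"

lemma carries_comp:
  assumes "carries C u S w S' g" "carries C w S' z S'' h" "u permutes C"
  shows "carries C u S z S'' (h \<circ> g)"
  using assms unfolding carries_def
  by (auto simp: permutes_compose permutes_in_image image_comp[symmetric])

lemma carries_permutation: "finite C \<Longrightarrow> carries C u S w S' g \<Longrightarrow> permutation g"
  unfolding carries_def by (blast intro: permutes_finite_permutation)

locale involution_on =
  fixes C :: "'c set" and u :: "'c \<Rightarrow> 'c"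
  assumes fin: "finite C" and perm: "u permutes C" and inv: "\<And>x. u (u x) = x"
begin

lemma closed: "x \<in> C \<Longrightarrow> u x \<in> C"
  using perm by (simp add: permutes_in_image)

end

lemma (in involution_on) carries_flip:
  assumes S: "flips C u S" and S': "flips C u S'"
  shows "\<exists>g. carries C u S u S' g \<and> sign g = (-1) ^ card (S - S')"
proof -
  let ?Y = "S - S'"
  have im: "u ` ?Y = S' - S"
  proof
    show "u ` ?Y \<subseteq> S' - S" using S S' closed unfolding flips_def by blast
    show "S' - S \<subseteq> u ` ?Y"
    proof
      fix x assume x: "x \<in> S' - S"
      then have "u x \<in> ?Y" using S S' closed unfolding flips_def by blast
      then show "x \<in> u ` ?Y" using inv by (metis imageI)
    qed
  qed
  have fY: "finite ?Y" using S fin unfolding flips_def by (meson finite_Diff finite_subset)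
  let ?g = "restrict_id u (?Y \<union> u ` ?Y)"
  have dis: "?Y \<inter> u ` ?Y = {}" using im by auto
  note si = sign_involution[OF fY inv dis]
  have YC: "?Y \<union> u ` ?Y \<subseteq> C" using im S S' unfolding flips_def by auto
  have "?g permutes C" using si permutes_subset YC by blast
  moreover have "?g (u x) = u (?g x)" for x
  proof -
    have "u x \<in> ?Y \<union> u ` ?Y \<longleftrightarrow> x \<in> ?Y \<union> u ` ?Y" using inv by (metis Un_iff imageE imageI)
    then show ?thesis by (auto simp: restrict_id_def)
  qed
  moreover have "?g ` S = S'"
  proof -
    have "?g ` S = ?g ` (?Y \<union> (S \<inter> S'))" by (rule arg_cong[where f = "\<lambda>A. ?g ` A"]) auto
    also have "\<dots> = u ` ?Y \<union> (S \<inter> S')"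
      unfolding image_Un by (rule arg_cong2[where f = "(\<union>)"]) (auto simp: restrict_id_def im image_iff)
    also have "\<dots> = S'" using im by auto
    finally show ?thesis .
  qed
  ultimately show ?thesis using si unfolding carries_def by blast
qed

lemma carries_shift:
  assumes "involution_on C u" "involution_on C w" and S: "flips C u S" "flips C w S"
  shows "\<exists>g. carries C u S w S g \<and> sign g = (-1) ^ (card S + card (orbit (w \<circ> u) ` S))"
proof -
  interpret u: involution_on C u by fact
  interpret w: involution_on C w by fact
  have SC: "S \<subseteq> C" using S unfolding flips_def by simp
  have fS: "finite S" using SC u.fin finite_subset by blast
  let ?g = "restrict_id (w \<circ> u) S"
  have wu: "w (u x) \<in> S" if "x \<in> S" for x
    using that S u.closed w.closed SC unfolding flips_def by (metis subsetD)
  have uw: "u (w x) \<in> S" if "x \<in> S" for x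
    using that S u.closed w.closed SC unfolding flips_def by (metis subsetD)
  have "bij_betw (w \<circ> u) S S"
    by (rule bij_betw_byWitness[where f' = "u \<circ> w"]) (use u.inv w.inv wu uw in auto)
  then have g: "?g permutes S" by (rule permutes_restrict_id)
  have "?g permutes C" using permutes_subset[OF g SC] .
  moreover have "?g (u x) = w (?g x)" if "x \<in> C" for x
    using that S u.inv w.inv unfolding flips_def restrict_id_def by auto
  moreover have "?g ` S = S" by (rule permutes_image[OF g])
  moreover have "orbit ?g x = orbit (w \<circ> u) x" if "x \<in> S" for x
    by (rule orbit_restrict_eq[OF that]) (use wu in \<open>auto simp: restrict_id_def\<close>)
  then have "sign ?g = (-1) ^ (card S + card (orbit (w \<circ> u) ` S))"
    unfolding sign_eq_orbits[OF fS g] by (metis (no_types, lifting) image_cong)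
  ultimately show ?thesis unfolding carries_def by blast
qed

lemma (in involution_on) carries_self_even:
  assumes S: "flips C u S" and g: "carries C u S u S g"
  shows "sign g = 1"
proof -
  have gC: "g permutes C" and comm: "\<And>x. x \<in> C \<Longrightarrow> g (u x) = u (g x)" and gS: "g ` S = S"
    using g unfolding carries_def by auto
  have SC: "S \<subseteq> C" using S unfolding flips_def by simp
  have fS: "finite S" using SC fin finite_subset by blast
  let ?h = "restrict_id g S"
  have "bij_betw g S S" using gS permutes_inj_on[OF gC] unfolding bij_betw_def by blast
  then have h: "?h permutes S" by (rule permutes_restrict_id)
  have e: "g = ?h \<circ> (u \<circ> ?h \<circ> u)"
  proof
    fix x show "g x = (?h \<circ> (u \<circ> ?h \<circ> u)) x"
    proof (cases "x \<in> C")
      case False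
      then have "g x = x" "u x = x" "x \<notin> S"
        using permutes_not_in[OF gC] permutes_not_in[OF perm] SC by auto
      then show ?thesis by (simp add: restrict_id_def)
    next
      case x: True
      show ?thesis
      proof (cases "x \<in> S")
        case True
        then have "u x \<notin> S" using S x unfolding flips_def by blast
        then show ?thesis using True inv by (simp add: restrict_id_def)
      next
        case False
        then have ux: "u x \<in> S" using S x unfolding flips_def by blast
        have "u (g (u x)) = g x" using comm[OF x] inv by simp
        moreover have "g x \<notin> S"
          using False gS permutes_inj[OF gC] by (metis imageE injD)
        ultimately show ?thesis using ux by (simp add: restrict_id_def)
      qed
    qed
  qed
  have ph: "permutation ?h" by (rule permutes_finite_permutation[OF fS h])
  have pu: "permutation u" by (rule permutes_finite_permutation[OF fin perm])
  have "sign g = sign ?h * ((sign u * sign ?h) * sign u)"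
    by (subst e) (simp only: sign_compose ph pu permutation_compose)
  also have "\<dots> = (sign ?h * sign ?h) * (sign u * sign u)" by (simp only: mult_ac)
  also have "\<dots> = 1" by (simp only: sign_idempotent mult_1)
  finally show ?thesis .
qed

lemma carries_sign_unique:
  assumes "involution_on C u" and S: "flips C u S" and g: "carries C u S w S' g" and h: "carries C u S w S' h"
  shows "sign g = sign h"
proof -
  interpret involution_on C u by fact
  have gC: "g permutes C" and hC: "h permutes C" using g h unfolding carries_def by auto
  have "carries C u S u S (inv_into UNIV h \<circ> g)" unfolding carries_def
  proof (intro conjI ballI)
    show "inv_into UNIV h \<circ> g permutes C" by (rule permutes_compose[OF gC permutes_inv[OF hC]])
    fix x assume x: "x \<in> C"
    let ?y = "inv_into UNIV h (g x)"
    have hy: "h ?y = g x" using permutes_inverses(1)[OF hC] by simp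
    have "?y \<in> C" using x gC hC by (simp add: permutes_in_image permutes_inv)
    then have "h (u ?y) = w (g x)" using h hy unfolding carries_def by auto
    also have "\<dots> = g (u x)" using g x unfolding carries_def by auto
    finally have "inv_into UNIV h (g (u x)) = u ?y" using permutes_inverses(2)[OF hC] by metis
    then show "(inv_into UNIV h \<circ> g) (u x) = u ((inv_into UNIV h \<circ> g) x)" by simp
  next
    have "(inv_into UNIV h \<circ> g) ` S = inv_into UNIV h ` (h ` S)"
      using g h unfolding carries_def image_comp[symmetric] by metis
    also have "\<dots> = S" using permutes_inverses(2)[OF hC] by (simp add: image_image)
    finally show "(inv_into UNIV h \<circ> g) ` S = S" .
  qed
  then have "sign (inv_into UNIV h \<circ> g) = 1" by (rule carries_self_even[OF S])
  moreover have "sign (inv_into UNIV h \<circ> g) = sign h * sign g"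
    using permutes_finite_permutation[OF fin gC] permutes_finite_permutation[OF fin hC]
    by (simp add: sign_compose permutation_inverse sign_inverse)
  ultimately show ?thesis by (metis mult.right_neutral sign_left_idempotent)
qed

text \<open>\<open>c\<close> stands for \<open>\<tau>\<sigma>\<close>: the fixed-point-free involution that pairs the two crosses at a corner.\<close>

locale three_involutions =
  th: involution_on C \<theta> + si: involution_on C \<sigma> + co: involution_on C c
  for C :: "'c set" and \<theta> \<sigma> c :: "'c \<Rightarrow> 'c" +
  assumes commute: "\<And>x. \<theta> (\<sigma> x) = \<sigma> (\<theta> x)"
    and free: "\<And>x. x \<in> C \<Longrightarrow> \<theta> x \<noteq> x" "\<And>x. x \<in> C \<Longrightarrow> \<sigma> x \<noteq> x" "\<And>x. x \<in> C \<Longrightarrow> \<theta> (\<sigma> x) \<noteq> x"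
      "\<And>x. x \<in> C \<Longrightarrow> c x \<noteq> x"

locale oriented_involutions = three_involutions +
  fixes P L T :: "'a set"
  assumes P: "flips C \<sigma> P" "flips C c P" and L: "flips C \<theta> L" "flips C c L"
    and T: "T \<subseteq> P" "\<And>x. x \<in> P \<Longrightarrow> (if \<theta> x \<in> P then \<theta> x else \<theta> (\<sigma> x)) \<in> T \<longleftrightarrow> x \<notin> T"
begin

definition partner :: "'a \<Rightarrow> 'a" where "partner x = (if \<theta> x \<in> P then \<theta> x else \<theta> (\<sigma> x))"

definition twisted :: "'a set" where "twisted = {t \<in> T. \<theta> t \<in> P}"

lemma PC: "P \<subseteq> C" and LC: "L \<subseteq> C" using P L unfolding flips_def by auto

lemma TC: "t \<in> T \<Longrightarrow> t \<in> C" using T(1) PC by auto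

lemma finites: "finite P" "finite L" "finite T"
  using finite_subset[OF PC th.fin] finite_subset[OF LC th.fin]
    finite_subset[OF subset_trans[OF T(1) PC] th.fin] by auto

lemma memP: "x \<in> C \<Longrightarrow> \<sigma> x \<in> P \<longleftrightarrow> x \<notin> P" "x \<in> C \<Longrightarrow> c x \<in> P \<longleftrightarrow> x \<notin> P"
  and memL: "x \<in> C \<Longrightarrow> \<theta> x \<in> L \<longleftrightarrow> x \<notin> L" "x \<in> C \<Longrightarrow> c x \<in> L \<longleftrightarrow> x \<notin> L"
  using P L unfolding flips_def by auto

lemma partner_in: "x \<in> P \<Longrightarrow> partner x \<in> P"
  unfolding partner_def using memP(1)[of "\<theta> x"] PC th.closed commute by auto

lemma partner_T: "x \<in> P \<Longrightarrow> partner x \<in> T \<longleftrightarrow> x \<notin> T"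
  unfolding partner_def by (rule T(2))

lemma partner_partner: "x \<in> P \<Longrightarrow> partner (partner x) = x"
  unfolding partner_def using memP(1) PC th.closed si.closed th.inv si.inv commute by (auto split: if_splits)

lemma partner_inj: "inj_on partner P"
  using partner_partner by (metis inj_onI)

lemma P_eq: "P = T \<union> partner ` T"
proof
  show "P \<subseteq> T \<union> partner ` T"
  proof
    fix x assume x: "x \<in> P"
    show "x \<in> T \<union> partner ` T"
    proof (cases "x \<in> T")
      case False
      then have "partner x \<in> T" using partner_T[OF x] by simp
      then show ?thesis using partner_partner[OF x] by (metis UnI2 imageI)
    qed simp
  qed
  show "T \<union> partner ` T \<subseteq> P" using T(1) partner_in by auto
qed

lemma T_disj: "T \<inter> partner ` T = {}"
  using partner_T T(1) by auto

lemma partner_inj_T: "inj_on partner T"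
  by (rule inj_on_subset[OF partner_inj T(1)])

lemma sum_P: "(\<Sum>x\<in>P. f x) = (\<Sum>t\<in>T. f t + f (partner t))" for f :: "'a \<Rightarrow> 'b :: comm_monoid_add"
proof -
  have "(\<Sum>x\<in>P. f x) = (\<Sum>x\<in>T. f x) + (\<Sum>x\<in>partner ` T. f x)"
    by (subst P_eq, rule sum.union_disjoint) (use finites T_disj in auto)
  then show ?thesis by (simp add: sum.reindex[OF partner_inj_T] sum.distrib)
qed

lemma prod_P: "(\<Prod>x\<in>P. f x) = (\<Prod>t\<in>T. f t * f (partner t))" for f :: "'a \<Rightarrow> 'b :: comm_monoid_mult"
proof -
  have "(\<Prod>x\<in>P. f x) = (\<Prod>x\<in>T. f x) * (\<Prod>x\<in>partner ` T. f x)"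
    by (subst P_eq, rule prod.union_disjoint) (use finites T_disj in auto)
  then show ?thesis by (simp add: prod.reindex[OF partner_inj_T] prod.distrib)
qed

lemma card_P: "card P = 2 * card T"
proof -
  have "card P = card T + card (partner ` T)" by (subst P_eq, rule card_Un_disjoint) (use finites T_disj in auto)
  then show ?thesis by (simp add: card_image[OF partner_inj_T])
qed

lemma edge_unique:
  assumes x: "x \<in> C"
  shows "(x \<in> T \<and> \<theta> x \<notin> T \<and> \<sigma> x \<notin> T \<and> \<theta> (\<sigma> x) \<notin> T) \<or> (x \<notin> T \<and> \<theta> x \<in> T \<and> \<sigma> x \<notin> T \<and> \<theta> (\<sigma> x) \<notin> T) \<or>
    (x \<notin> T \<and> \<theta> x \<notin> T \<and> \<sigma> x \<in> T \<and> \<theta> (\<sigma> x) \<notin> T) \<or> (x \<notin> T \<and> \<theta> x \<notin> T \<and> \<sigma> x \<notin> T \<and> \<theta> (\<sigma> x) \<in> T)"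
proof -
  have c: "\<theta> x \<in> C" "\<sigma> x \<in> C" "\<theta> (\<sigma> x) \<in> C" using x th.closed si.closed by auto
  have m: "\<sigma> x \<in> P \<longleftrightarrow> x \<notin> P" "\<theta> (\<sigma> x) \<in> P \<longleftrightarrow> \<theta> x \<notin> P" using memP(1)[OF x] memP(1)[OF c(1)] commute by auto
  have t: "y \<notin> T" if "y \<notin> P" for y using T(1) that by auto
  have a: "\<theta> (\<sigma> x) \<in> T \<longleftrightarrow> x \<notin> T" if "x \<in> P" "\<theta> x \<notin> P" using T(2)[OF that(1)] that by simp
  have b: "\<theta> x \<in> T \<longleftrightarrow> x \<notin> T" if "x \<in> P" "\<theta> x \<in> P" using T(2)[OF that(1)] that by simp
  have d: "\<theta> (\<sigma> x) \<in> T \<longleftrightarrow> \<sigma> x \<notin> T" if "\<sigma> x \<in> P" "\<theta> (\<sigma> x) \<in> P" using T(2)[OF that(1)] that by simp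
  have e: "\<theta> x \<in> T \<longleftrightarrow> \<sigma> x \<notin> T" if "\<sigma> x \<in> P" "\<theta> (\<sigma> x) \<notin> P" using T(2)[OF that(1)] that si.inv by simp
  show ?thesis using m t a b d e by (cases "x \<in> P"; cases "\<theta> x \<in> P") auto
qed

lemma flips_edge:
  "flips C \<sigma> (T \<union> \<theta> ` T)" "flips C \<theta> (T \<union> \<sigma> ` T)"
proof -
  have im: "y \<in> \<theta> ` T \<longleftrightarrow> \<theta> y \<in> T" "y \<in> \<sigma> ` T \<longleftrightarrow> \<sigma> y \<in> T" for y
    using th.inv si.inv by (metis imageE imageI)+
  have sub: "T \<union> \<theta> ` T \<subseteq> C" "T \<union> \<sigma> ` T \<subseteq> C" using TC th.closed si.closed by auto
  show "flips C \<sigma> (T \<union> \<theta> ` T)" unfolding flips_def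
    using sub edge_unique by (auto simp: im)
  show "flips C \<theta> (T \<union> \<sigma> ` T)" unfolding flips_def
    using sub edge_unique by (auto simp: im commute[symmetric])
qed

lemma carries_edge:
  "\<exists>g. carries C \<sigma> (T \<union> \<theta> ` T) \<theta> (T \<union> \<sigma> ` T) g \<and> sign g = (-1) ^ card T"
proof -
  let ?u = "\<lambda>x. \<theta> (\<sigma> x)"
  let ?Y = "\<theta> ` T"
  have inv: "?u (?u y) = y" for y by (simp add: commute th.inv si.inv)
  have uY: "?u ` ?Y = \<sigma> ` T" using commute th.inv by (auto simp: image_image)
  have im: "y \<in> \<theta> ` T \<longleftrightarrow> \<theta> y \<in> T" "y \<in> \<sigma> ` T \<longleftrightarrow> \<sigma> y \<in> T" for y
    using th.inv si.inv by (metis imageE imageI)+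
  have YC: "?Y \<subseteq> C" "\<sigma> ` T \<subseteq> C" using TC th.closed si.closed by auto
  have dis: "?Y \<inter> ?u ` ?Y = {}"
  proof -
    have False if y: "y \<in> ?Y" "y \<in> \<sigma> ` T" for y
    proof -
      have yC: "y \<in> C" using y(1) YC(1) by (rule rev_subsetD)
      have "\<theta> y \<in> T" "\<sigma> y \<in> T" using y by (simp_all only: im)
      then show False using edge_unique[OF yC] by simp
    qed
    then show ?thesis unfolding uY by blast
  qed
  have fY: "finite ?Y" using finites by simp
  let ?g = "restrict_id ?u (?Y \<union> ?u ` ?Y)"
  have si: "?g permutes (?Y \<union> ?u ` ?Y)" "sign ?g = (-1) ^ card ?Y"
    using sign_involution[OF fY inv dis] by auto
  have g: "?g x = (if \<theta> x \<in> T \<or> \<sigma> x \<in> T then \<theta> (\<sigma> x) else x)" for x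
    unfolding restrict_id_def uY Un_iff im ..
  have "?g permutes C" by (rule permutes_subset[OF si(1)]) (use YC uY in auto)
  moreover have "?g (\<sigma> x) = \<theta> (?g x)" if x: "x \<in> C" for x
    unfolding g th.inv si.inv using edge_unique[OF x] by (auto simp: th.inv)
  moreover have "?g ` (T \<union> \<theta> ` T) = T \<union> \<sigma> ` T"
  proof -
    have "?g t = t" if "t \<in> T" for t
      unfolding g using edge_unique[OF TC[OF that]] that by auto
    then have "?g ` T = (\<lambda>t. t) ` T" by (rule image_cong[OF refl])
    then have "?g ` T = T" by simp
    moreover have "?g (\<theta> t) = \<sigma> t" if "t \<in> T" for t
      unfolding g th.inv using that by (simp add: commute[symmetric] th.inv)
    then have "?g ` \<theta> ` T = \<sigma> ` T" unfolding image_image by (rule image_cong[OF refl])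
    ultimately show ?thesis unfolding image_Un by simp
  qed
  moreover have "card ?Y = card T" by (rule card_image) (metis inj_onI th.inv)
  ultimately show ?thesis unfolding carries_def
    by (intro exI[of _ ?g]) (simp only: si(2), blast)
qed

lemma card_L: "card L = card P"
proof -
  have "card S = card (C - S)" if "flips C c S" for S
  proof -
    have "bij_betw c S (C - S)"
      by (rule bij_betw_byWitness[where f' = c]) (use that co.inv co.closed in \<open>auto simp: flips_def\<close>)
    then show ?thesis by (rule bij_betw_same_card)
  qed
  then have "2 * card S = card C" if "flips C c S" for S
  proof -
    have "S \<subseteq> C" using that unfolding flips_def by simp
    then have "card (C - S) = card C - card S" "card S \<le> card C"
      using th.fin by (simp_all add: card_Diff_subset finite_subset card_mono)
    then show ?thesis using \<open>\<And>S. flips C c S \<Longrightarrow> card S = card (C - S)\<close>[OF that] by simp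
  qed
  from this[OF L(2)] this[OF P(2)] show ?thesis by simp
qed

theorem euler_parity:
  "even (card (orbit (c \<circ> \<sigma>) ` P) + card T + card (orbit (c \<circ> \<theta>) ` L) +
     card {t \<in> twisted. t \<in> L \<longleftrightarrow> \<sigma> t \<in> L})"
proof -
  let ?P2 = "T \<union> \<theta> ` T" and ?L2 = "T \<union> \<sigma> ` T"
  let ?V = "card (orbit (c \<circ> \<sigma>) ` P)" and ?F = "card (orbit (c \<circ> \<theta>) ` L)"
  note s = si.involution_on_axioms and t = th.involution_on_axioms and c = co.involution_on_axioms
  obtain a1 where a1: "carries C \<sigma> P c P a1" "sign a1 = (-1) ^ (card P + ?V)"
    using carries_shift[OF s c P] by blast
  obtain a2 where a2: "carries C c P c L a2" "sign a2 = (-1) ^ card (P - L)"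
    using co.carries_flip[OF P(2) L(2)] by blast
  obtain b1 where b1: "carries C \<sigma> P \<sigma> ?P2 b1" "sign b1 = (-1) ^ card (P - ?P2)"
    using si.carries_flip[OF P(1) flips_edge(1)] by blast
  obtain b2 where b2: "carries C \<sigma> ?P2 \<theta> ?L2 b2" "sign b2 = (-1) ^ card T"
    using carries_edge by blast
  obtain b3 where b3: "carries C \<theta> ?L2 \<theta> L b3" "sign b3 = (-1) ^ card (?L2 - L)"
    using th.carries_flip[OF flips_edge(2) L(1)] by blast
  obtain b4 where b4: "carries C \<theta> L c L b4" "sign b4 = (-1) ^ (card L + ?F)"
    using carries_shift[OF t c L] by blast
  have A: "carries C \<sigma> P c L (a2 \<circ> a1)" using carries_comp[OF a1(1) a2(1) si.perm] .
  have B: "carries C \<sigma> P c L (b4 \<circ> (b3 \<circ> (b2 \<circ> b1)))"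
    using carries_comp[OF carries_comp[OF carries_comp[OF b1(1) b2(1) si.perm] b3(1) si.perm] b4(1) si.perm] .
  have pm: "permutation a1" "permutation a2" "permutation b1" "permutation b2" "permutation b3" "permutation b4"
    by (rule carries_permutation[OF th.fin], rule a1(1) a2(1) b1(1) b2(1) b3(1) b4(1))+
  have "sign (a2 \<circ> a1) = sign (b4 \<circ> (b3 \<circ> (b2 \<circ> b1)))" by (rule carries_sign_unique[OF s P(1) A B])
  then have "(-1::int) ^ (card (P - L) + (card P + ?V)) =
      (-1) ^ ((card L + ?F) + (card (?L2 - L) + (card T + card (P - ?P2))))"
    by (simp only: sign_compose pm permutation_compose a1 a2 b1 b2 b3 b4 power_add)
  then have par: "even (card (P - L) + (card P + ?V)) \<longleftrightarrow>
      even ((card L + ?F) + (card (?L2 - L) + (card T + card (P - ?P2))))"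
    by (metis neg_one_even_power neg_one_odd_power one_neq_neg_one)
  have im: "y \<in> \<theta> ` T \<longleftrightarrow> \<theta> y \<in> T" "y \<in> \<sigma> ` T \<longleftrightarrow> \<sigma> y \<in> T" for y
    using th.inv si.inv by (metis imageE imageI)+
  have cardif: "card {x \<in> A. Q x} = (\<Sum>x\<in>A. if Q x then 1 else 0)" if "finite A" for A :: "'a set" and Q
    using that by (simp add: sum.If_cases Int_def)
  have cardP: "card {x \<in> P. Q x} = (\<Sum>t\<in>T. (if Q t then 1 else 0) + (if Q (partner t) then 1 else 0))" for Q
    by (rule trans[OF cardif[OF finites(1)] sum_P])
  have 1: "card (P - L) = (\<Sum>t\<in>T. (if t \<notin> L then 1 else 0) + (if partner t \<notin> L then 1 else 0))"
  proof -
    have e: "P - L = {x \<in> P. x \<notin> L}" by auto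
    show ?thesis unfolding e by (rule cardP)
  qed
  have 2: "card (P - ?P2) = (\<Sum>t\<in>T. if \<theta> t \<in> P then 0 else 1)"
  proof -
    have e: "P - ?P2 = {x \<in> P. x \<notin> ?P2}" by auto
    have "card (P - ?P2) = (\<Sum>t\<in>T. (if t \<notin> ?P2 then 1 else 0) + (if partner t \<notin> ?P2 then 1 else 0))"
      unfolding e by (rule cardP)
    also have "\<dots> = (\<Sum>t\<in>T. if \<theta> t \<in> P then 0 else 1)"
    proof (rule sum.cong[OF refl])
      fix t assume t: "t \<in> T"
      have "t \<in> P" using t T(1) by auto
      have "partner t \<in> ?P2 \<longleftrightarrow> \<theta> t \<in> P"
        unfolding partner_def using edge_unique[OF TC[OF t]] t T(1) th.inv by (auto simp: im)
      then show "(if t \<notin> ?P2 then 1 else 0) + (if partner t \<notin> ?P2 then 1 else 0) = (if \<theta> t \<in> P then 0 else (1::nat))"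
        using t by simp
    qed
    finally show ?thesis .
  qed
  have 3: "card (?L2 - L) = (\<Sum>t\<in>T. (if t \<notin> L then 1 else 0) + (if \<sigma> t \<notin> L then 1 else 0))"
  proof -
    have e: "?L2 - L = {x \<in> T. x \<notin> L} \<union> {x \<in> \<sigma> ` T. x \<notin> L}" by auto
    have "card (?L2 - L) = card {x \<in> T. x \<notin> L} + card {x \<in> \<sigma> ` T. x \<notin> L}"
      unfolding e
    proof (rule card_Un_disjoint)
      have "x \<notin> \<sigma> ` T" if "x \<in> T" for x
        using edge_unique[OF TC[OF that]] that by (simp add: im)
      then show "{x \<in> T. x \<notin> L} \<inter> {x \<in> \<sigma> ` T. x \<notin> L} = {}" by blast
    qed (use finites in simp_all)
    moreover have "inj_on \<sigma> T" by (metis inj_onI si.inv)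
    ultimately show ?thesis using cardif finites by (simp add: sum.reindex sum.distrib)
  qed
  have 4: "card {t \<in> twisted. t \<in> L \<longleftrightarrow> \<sigma> t \<in> L} = (\<Sum>t\<in>T. if \<theta> t \<in> P \<and> (t \<in> L \<longleftrightarrow> \<sigma> t \<in> L) then 1 else 0)"
  proof -
    have "{t \<in> twisted. t \<in> L \<longleftrightarrow> \<sigma> t \<in> L} = {t \<in> T. \<theta> t \<in> P \<and> (t \<in> L \<longleftrightarrow> \<sigma> t \<in> L)}"
      unfolding twisted_def by auto
    then show ?thesis using cardif[OF finites(3)] by simp
  qed
  have "even (card (P - L) + card (P - ?P2) + card (?L2 - L) + card {t \<in> twisted. t \<in> L \<longleftrightarrow> \<sigma> t \<in> L})"
    unfolding 1 2 3 4 sum.distrib[symmetric]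
  proof (rule dvd_sum)
    fix t assume t: "t \<in> T"
    have tC: "t \<in> C" "\<sigma> t \<in> C" using TC[OF t] si.closed by auto
    have m: "partner t \<in> L \<longleftrightarrow> (if \<theta> t \<in> P then t \<notin> L else \<sigma> t \<notin> L)"
      unfolding partner_def using memL(1)[OF tC(1)] memL(1)[OF tC(2)] by auto
    show "2 dvd (if t \<notin> L then 1 else 0) + (if partner t \<notin> L then 1 else 0) + (if \<theta> t \<in> P then 0 else 1) +
       ((if t \<notin> L then 1 else 0) + (if \<sigma> t \<notin> L then 1 else 0)) +
       (if \<theta> t \<in> P \<and> (t \<in> L \<longleftrightarrow> \<sigma> t \<in> L) then 1 else (0::nat))"
      unfolding m by (cases "t \<in> L"; cases "\<sigma> t \<in> L"; cases "\<theta> t \<in> P") simp_all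
  qed
  then show ?thesis using par card_P card_L by (auto simp: even_add)
qed

end

section \<open>State sums\<close>

lemma card_image_eq_if_kernel_eq:
  assumes "\<And>x y. x \<in> S \<Longrightarrow> y \<in> S \<Longrightarrow> p x = p y \<longleftrightarrow> q x = q y"
  shows "card (p ` S) = card (q ` S)"
proof -
  let ?f = "\<lambda>v. q (inv_into S p v)"
  have "bij_betw ?f (p ` S) (q ` S)"
  proof (rule bij_betw_imageI)
    show "inj_on ?f (p ` S)"
    proof (rule inj_onI)
      fix v w assume vw: "v \<in> p ` S" "w \<in> p ` S" "?f v = ?f w"
      then have "p (inv_into S p v) = p (inv_into S p w)" using assms inv_into_into by metis
      then show "v = w" using vw by (simp add: f_inv_into_f)
    qed
    have "?f (p x) = q x" if "x \<in> S" for x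
      using assms[OF inv_into_into[of "p x" p S] that] that by (simp add: f_inv_into_f)
    then show "?f ` p ` S = q ` S" unfolding image_image by (rule image_cong[OF refl])
  qed
  then show ?thesis by (rule bij_betw_same_card)
qed

locale two_involutions = u: involution_on C u + w: involution_on C w
  for C :: "'c set" and u w :: "'c \<Rightarrow> 'c" +
  assumes free: "\<And>x. x \<in> C \<Longrightarrow> u x \<noteq> x" "\<And>x. x \<in> C \<Longrightarrow> w x \<noteq> x"
begin

definition step :: "'c \<Rightarrow> 'c" where "step x = w (u x)"

lemma step_eq: "w \<circ> u = step" by (auto simp: step_def)

lemma step_permutes: "step permutes C"
  unfolding step_eq[symmetric] by (rule permutes_compose[OF u.perm w.perm])

lemma step_permutation: "permutation step"
  by (rule permutes_finite_permutation[OF u.fin step_permutes])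

lemma step_ne: "x \<in> C \<Longrightarrow> (step ^^ k) x \<noteq> u x"
proof (induction k arbitrary: x rule: less_induct)
  case (less k)
  consider "k = 0" | "k = 1" | m where "k = Suc (Suc m)" by (metis One_nat_def old.nat.exhaust)
  then show ?case
  proof cases
    case 1 then show ?thesis using free(1)[OF less.prems] by auto
  next
    case 2 then show ?thesis using free(2)[OF u.closed[OF less.prems]] by (simp add: step_def)
  next
    case 3
    show ?thesis
    proof
      assume "(step ^^ k) x = u x"
      then have "step ((step ^^ m) (step x)) = u x" using 3 by (simp add: funpow_swap1)
      also have "u x = w (step x)" unfolding step_def by (simp add: w.inv)
      finally have "u ((step ^^ m) (step x)) = step x" unfolding step_def[of "(step ^^ m) (step x)"] by (metis w.inv)
      then have "(step ^^ m) (step x) = u (step x)" by (metis u.inv)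
      moreover have "step x \<in> C" unfolding step_def using less.prems u.closed w.closed by simp
      moreover have "m < k" using 3 by simp
      ultimately show False using less.IH by blast
    qed
  qed
qed

lemma u_notin_orbit: "x \<in> C \<Longrightarrow> u x \<notin> orbit step x"
  unfolding orbit_altdef_permutation[OF step_permutation] using step_ne by fastforce

lemma orbit_u_step: "orbit step (u (step x)) = orbit step (u x)"
proof -
  have "u x = step (u (step x))" unfolding step_def by (simp add: u.inv w.inv)
  then show ?thesis using permutation_orbit_step[OF step_permutation] by metis
qed

definition orbit_pair :: "'c \<Rightarrow> 'c set set" where
  "orbit_pair x = {orbit step x, orbit step (u x)}"

lemma orbit_eq_imp_pair_eq:
  assumes "orbit step x = orbit step y"
  shows "orbit_pair x = orbit_pair y"
proof -
  have "y \<in> orbit step x" using assms permutation_self_in_orbit[OF step_permutation] by simp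
  then have "orbit step (u y) = orbit step (u x)"
    by induction (auto simp: orbit_u_step)
  then show ?thesis unfolding orbit_pair_def using assms by simp
qed

lemma orbit_pair_u: "orbit_pair (u x) = orbit_pair x"
  unfolding orbit_pair_def by (auto simp: u.inv)

lemma orbit_w: "orbit step (w x) = orbit step (u x)"
proof -
  have "w x = step (u x)" by (simp add: step_def u.inv)
  then show ?thesis using permutation_orbit_step[OF step_permutation] by simp
qed

lemma orbit_pair_w: "orbit_pair (w x) = orbit_pair x"
  using orbit_eq_imp_pair_eq[OF orbit_w] orbit_pair_u by simp

lemma ex_flips: "\<exists>S. flips C u S \<and> flips C w S"
proof -
  define ch where "ch v = (SOME Q. Q \<in> v)" for v :: "'c set set"
  have ch: "ch (orbit_pair x) = orbit step x \<or> ch (orbit_pair x) = orbit step (u x)" for x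
  proof -
    have "ch (orbit_pair x) \<in> orbit_pair x" unfolding ch_def by (rule someI[of _ "orbit step x"]) (simp add: orbit_pair_def)
    then show ?thesis unfolding orbit_pair_def by simp
  qed
  have ne: "orbit step x \<noteq> orbit step (u x)" if "x \<in> C" for x
    using u_notin_orbit[OF that] permutation_self_in_orbit[OF step_permutation, of "u x"] by auto
  define S where "S = {x \<in> C. orbit step x = ch (orbit_pair x)}"
  have "u x \<in> S \<longleftrightarrow> x \<notin> S" if "x \<in> C" for x
    unfolding S_def using ch[of x] ne[OF that] u.closed[OF that] that by (auto simp: orbit_pair_u)
  then have "flips C u S" unfolding flips_def S_def by blast
  moreover have "w x \<in> S \<longleftrightarrow> x \<notin> S" if "x \<in> C" for x
    unfolding S_def using ch[of x] ne[OF that] w.closed[OF that] that by (auto simp: orbit_pair_w orbit_w)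
  then have "flips C w S" unfolding flips_def S_def by blast
  ultimately show ?thesis by blast
qed

lemma orbit_subset_flips:
  assumes "flips C u S" "flips C w S" "x \<in> S"
  shows "orbit step x \<subseteq> S"
proof
  fix y assume "y \<in> orbit step x"
  then show "y \<in> S"
    by induction (use assms u.closed w.closed in \<open>auto simp: flips_def step_def\<close>)
qed

lemma card_orbit_pairs:
  assumes S: "flips C u S" "flips C w S"
  shows "card (orbit_pair ` C) = card (orbit step ` S)"
proof -
  have "orbit_pair ` C = orbit_pair ` S"
  proof
    show "orbit_pair ` C \<subseteq> orbit_pair ` S"
    proof
      fix v assume "v \<in> orbit_pair ` C"
      then obtain x where x: "x \<in> C" "v = orbit_pair x" by auto
      show "v \<in> orbit_pair ` S"
      proof (cases "x \<in> S")
        case False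
        then have "u x \<in> S" using S(1) x unfolding flips_def by auto
        then show ?thesis using x orbit_pair_u by (metis imageI)
      qed (use x in auto)
    qed
  qed (use S in \<open>auto simp: flips_def\<close>)
  also have "card (orbit_pair ` S) = card (orbit step ` S)"
  proof (rule card_image_eq_if_kernel_eq)
    fix x y assume x: "x \<in> S" and y: "y \<in> S"
    have "orbit step x \<noteq> orbit step (u y)"
    proof
      assume "orbit step x = orbit step (u y)"
      then have "u y \<in> S" using orbit_subset_flips[OF S x] permutation_self_in_orbit[OF step_permutation, of "u y"] by auto
      then show False using S(1) y unfolding flips_def by auto
    qed
    note ne = this
    show "orbit_pair x = orbit_pair y \<longleftrightarrow> orbit step x = orbit step y"
    proof
      have "orbit step x \<in> orbit_pair x" by (simp add: orbit_pair_def)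
      moreover assume "orbit_pair x = orbit_pair y"
      ultimately have "orbit step x \<in> orbit_pair y" by (simp only:)
      then show "orbit step x = orbit step y" using ne by (simp add: orbit_pair_def)
    qed (rule orbit_eq_imp_pair_eq)
  qed
  finally show ?thesis .
qed

end

lemma (in involution_on) bij_betw_flips:
  assumes S: "flips C u S" and S': "flips C u S'"
  shows "bij_betw (\<lambda>x. if x \<in> S' then x else u x) S S'"
proof (rule bij_betw_byWitness[where f' = "\<lambda>x. if x \<in> S then x else u x"])
  show "\<forall>x\<in>S. (if (if x \<in> S' then x else u x) \<in> S then (if x \<in> S' then x else u x) else u (if x \<in> S' then x else u x)) = x"
    using S inv unfolding flips_def by auto
  show "\<forall>x\<in>S'. (if (if x \<in> S then x else u x) \<in> S' then (if x \<in> S then x else u x) else u (if x \<in> S then x else u x)) = x"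
    using S' inv unfolding flips_def by auto
qed (use S S' in \<open>auto simp: flips_def\<close>)

lemma sum_PiE_insert:
  assumes "x \<notin> S"
  shows "(\<Sum>i\<in>PiE (insert x S) D. F i) = (\<Sum>y\<in>D x. \<Sum>i\<in>PiE S D. F (i(x := y)))"
proof -
  have "(\<Sum>i\<in>PiE (insert x S) D. F i) = (\<Sum>p\<in>D x \<times> PiE S D. F (case p of (y, i) \<Rightarrow> i(x := y)))"
    unfolding PiE_insert_eq by (subst sum.reindex[OF inj_combinator[OF assms]]) (simp only: o_def)
  also have "\<dots> = (\<Sum>(y,i)\<in>D x \<times> PiE S D. F (i(x := y)))"
    by (simp only: case_prod_unfold)
  also have "\<dots> = (\<Sum>y\<in>D x. \<Sum>i\<in>PiE S D. F (i(x := y)))"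
    by (rule sum.cartesian_product[symmetric])
  finally show ?thesis .
qed

lemma restrict_comp_bij:
  assumes f: "bij_betw f A B" and g: "\<And>y. y \<in> B \<Longrightarrow> g y \<in> A" "\<And>y. y \<in> B \<Longrightarrow> f (g y) = y"
    and j: "j \<in> B \<rightarrow>\<^sub>E D"
  shows "(\<lambda>y\<in>B. (\<lambda>x\<in>A. j (f x)) (g y)) = j"
proof
  fix y show "(\<lambda>y\<in>B. (\<lambda>x\<in>A. j (f x)) (g y)) y = j y"
  proof (cases "y \<in> B")
    case True
    then show ?thesis using g by simp
  next
    case False
    then show ?thesis using PiE_arb[OF j False] by simp
  qed
qed

lemma sum_PiE_reindex:
  assumes f: "bij_betw f A B"
  shows "(\<Sum>i\<in>A \<rightarrow>\<^sub>E D. F i) = (\<Sum>j\<in>B \<rightarrow>\<^sub>E D. F (\<lambda>x\<in>A. j (f x)))"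
proof -
  let ?g = "inv_into A f"
  have g: "bij_betw ?g B A" by (rule bij_betw_inv_into[OF f])
  have fB: "f x \<in> B" "?g (f x) = x" if "x \<in> A" for x
    using bij_betw_apply[OF f that] bij_betw_inv_into_left[OF f that] by simp_all
  have gA: "?g y \<in> A" "f (?g y) = y" if "y \<in> B" for y
    using bij_betw_apply[OF g that] bij_betw_inv_into_right[OF f that] by simp_all
  have "bij_betw (\<lambda>j. \<lambda>x\<in>A. j (f x)) (B \<rightarrow>\<^sub>E D) (A \<rightarrow>\<^sub>E D)"
  proof (rule bij_betw_byWitness[where f' = "\<lambda>i. \<lambda>y\<in>B. i (?g y)"])
    show "\<forall>j\<in>B \<rightarrow>\<^sub>E D. (\<lambda>y\<in>B. (\<lambda>x\<in>A. j (f x)) (?g y)) = j"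
      by (intro ballI restrict_comp_bij[OF f gA])
    show "\<forall>i\<in>A \<rightarrow>\<^sub>E D. (\<lambda>x\<in>A. (\<lambda>y\<in>B. i (?g y)) (f x)) = i"
      by (intro ballI restrict_comp_bij[OF g fB])
    show "(\<lambda>j. \<lambda>x\<in>A. j (f x)) ` (B \<rightarrow>\<^sub>E D) \<subseteq> A \<rightarrow>\<^sub>E D"
    proof (rule image_subsetI)
      fix j assume j: "j \<in> B \<rightarrow>\<^sub>E D"
      show "(\<lambda>x\<in>A. j (f x)) \<in> A \<rightarrow>\<^sub>E D"
        by (rule restrict_PiE_iff[THEN iffD2]) (use PiE_mem[OF j fB(1)] in blast)
    qed
    show "(\<lambda>i. \<lambda>y\<in>B. i (?g y)) ` (A \<rightarrow>\<^sub>E D) \<subseteq> B \<rightarrow>\<^sub>E D"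
    proof (rule image_subsetI)
      fix i assume i: "i \<in> A \<rightarrow>\<^sub>E D"
      show "(\<lambda>y\<in>B. i (?g y)) \<in> B \<rightarrow>\<^sub>E D"
        by (rule restrict_PiE_iff[THEN iffD2]) (use PiE_mem[OF i gA(1)] in blast)
    qed
  qed
  then show ?thesis by (rule sum.reindex_bij_betw[symmetric])
qed

lemma bij_betw_PiE_Un:
  assumes AB: "A \<inter> B = {}"
  shows "bij_betw (\<lambda>i. (restrict i A, restrict i B)) (PiE (A \<union> B) D) (PiE A D \<times> PiE B D)"
proof (rule bij_betw_byWitness[where f' = "\<lambda>p x. if x \<in> A then fst p x else snd p x"])
  show "\<forall>i\<in>PiE (A \<union> B) D. (\<lambda>x. if x \<in> A then fst (restrict i A, restrict i B) x else snd (restrict i A, restrict i B) x) = i"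
  proof (intro ballI ext)
    fix i x assume i: "i \<in> PiE (A \<union> B) D"
    show "(if x \<in> A then fst (restrict i A, restrict i B) x else snd (restrict i A, restrict i B) x) = i x"
    proof (cases "x \<in> A \<union> B")
      case False
      then show ?thesis using PiE_arb[OF i False] by simp
    qed auto
  qed
  show "\<forall>p\<in>PiE A D \<times> PiE B D. (restrict (\<lambda>x. if x \<in> A then fst p x else snd p x) A,
      restrict (\<lambda>x. if x \<in> A then fst p x else snd p x) B) = p"
  proof
    fix p assume "p \<in> PiE A D \<times> PiE B D"
    then obtain i j where p: "p = (i,j)" and i: "i \<in> PiE A D" and j: "j \<in> PiE B D" by blast
    have "restrict (\<lambda>x. if x \<in> A then i x else j x) A = i"
    proof
      fix x show "restrict (\<lambda>x. if x \<in> A then i x else j x) A x = i x"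
        using PiE_arb[OF i, of x] by (cases "x \<in> A") simp_all
    qed
    moreover have "restrict (\<lambda>x. if x \<in> A then i x else j x) B = j"
    proof
      fix x show "restrict (\<lambda>x. if x \<in> A then i x else j x) B x = j x"
      proof (cases "x \<in> B")
        case True
        then have "x \<notin> A" using AB by blast
        then show ?thesis using True by simp
      next
        case False
        then show ?thesis using PiE_arb[OF j False] by simp
      qed
    qed
    ultimately show "(restrict (\<lambda>x. if x \<in> A then fst p x else snd p x) A,
      restrict (\<lambda>x. if x \<in> A then fst p x else snd p x) B) = p" by (simp only: p fst_conv snd_conv)
  qed
  show "(\<lambda>i. (restrict i A, restrict i B)) ` PiE (A \<union> B) D \<subseteq> PiE A D \<times> PiE B D"
    by (auto simp: restrict_PiE_iff)
  show "(\<lambda>p x. if x \<in> A then fst p x else snd p x) ` (PiE A D \<times> PiE B D) \<subseteq> PiE (A \<union> B) D"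
  proof (rule image_subsetI)
    fix p assume p: "p \<in> PiE A D \<times> PiE B D"
    show "(\<lambda>x. if x \<in> A then fst p x else snd p x) \<in> PiE (A \<union> B) D"
    proof (rule PiE_I)
      fix x assume "x \<in> A \<union> B"
      then show "(if x \<in> A then fst p x else snd p x) \<in> D x"
        using p by (cases "x \<in> A") (auto dest: PiE_mem)
    next
      fix x assume "x \<notin> A \<union> B"
      then show "(if x \<in> A then fst p x else snd p x) = undefined"
        using p PiE_arb[of "snd p" B D x] by auto
    qed
  qed
qed

lemma prod_sum_PiE_Union:
  fixes f :: "'c set \<Rightarrow> ('c \<Rightarrow> 'd) \<Rightarrow> 'b :: comm_semiring_1"
  assumes "finite \<D>" "disjoint \<D>"
  shows "(\<Prod>Q\<in>\<D>. \<Sum>i\<in>PiE Q D. f Q i) = (\<Sum>i\<in>PiE (\<Union>\<D>) D. \<Prod>Q\<in>\<D>. f Q (restrict i Q))"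
  using assms
proof (induction \<D>)
  case empty
  then show ?case by simp
next
  case (insert A \<D>)
  have dA: "A \<inter> \<Union>\<D> = {}"
  proof -
    have "A \<inter> Q = {}" if "Q \<in> \<D>" for Q
      by (rule disjointD[OF insert(4)]) (use that insert(2) in auto)
    then show ?thesis by blast
  qed
  have dD: "disjoint \<D>" using insert(4) by (rule pairwise_subset) auto
  have "(\<Prod>Q\<in>insert A \<D>. \<Sum>i\<in>PiE Q D. f Q i) =
      (\<Sum>i\<in>PiE A D. f A i) * (\<Sum>j\<in>PiE (\<Union>\<D>) D. \<Prod>Q\<in>\<D>. f Q (restrict j Q))"
    unfolding prod.insert[OF insert(1,2)] insert.IH[OF dD] ..
  also have "\<dots> = (\<Sum>p\<in>PiE A D \<times> PiE (\<Union>\<D>) D. f A (fst p) * (\<Prod>Q\<in>\<D>. f Q (restrict (snd p) Q)))"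
    unfolding sum_product sum.cartesian_product by (simp only: case_prod_unfold)
  also have "\<dots> = (\<Sum>i\<in>PiE (A \<union> \<Union>\<D>) D. f A (restrict i A) * (\<Prod>Q\<in>\<D>. f Q (restrict (restrict i (\<Union>\<D>)) Q)))"
    by (subst sum.reindex_bij_betw[OF bij_betw_PiE_Un[OF dA], symmetric]) (simp only: fst_conv snd_conv)
  also have "\<dots> = (\<Sum>i\<in>PiE (A \<union> \<Union>\<D>) D. \<Prod>Q\<in>insert A \<D>. f Q (restrict i Q))"
  proof (rule sum.cong[OF refl])
    fix i :: "'c \<Rightarrow> 'd"
    have "restrict (restrict i (\<Union>\<D>)) Q = restrict i Q" if "Q \<in> \<D>" for Q
      unfolding restrict_restrict using that by (intro arg_cong[where f = "restrict i"]) blast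
    then show "f A (restrict i A) * (\<Prod>Q\<in>\<D>. f Q (restrict (restrict i (\<Union>\<D>)) Q)) = (\<Prod>Q\<in>insert A \<D>. f Q (restrict i Q))"
      unfolding prod.insert[OF insert(1,2)] by (simp only: cong: prod.cong)
  qed
  finally show ?case unfolding Union_insert .
qed

fun path_weight :: "('c \<Rightarrow> 'b :: comm_ring_1 mat) \<Rightarrow> ('c \<Rightarrow> nat) \<Rightarrow> 'c list \<Rightarrow> nat \<Rightarrow> 'b" where
  "path_weight X i [] s = 1"
| "path_weight X i [x] s = X x $$ (i x, s)"
| "path_weight X i (x # y # ys) s = X x $$ (i x, i y) * path_weight X i (y # ys) s"

definition mat_list_prod :: "nat \<Rightarrow> ('c \<Rightarrow> 'b :: comm_ring_1 mat) \<Rightarrow> 'c list \<Rightarrow> 'b mat" where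
  "mat_list_prod d X xs = foldr (\<lambda>x A. X x * A) xs (1\<^sub>m d)"

lemma mat_list_prod_simps [simp]:
  "mat_list_prod d X [] = 1\<^sub>m d"
  "mat_list_prod d X (x # xs) = X x * mat_list_prod d X xs"
  unfolding mat_list_prod_def by simp_all

lemma mat_list_prod_carrier:
  assumes "\<And>x. x \<in> set xs \<Longrightarrow> X x \<in> carrier_mat d d"
  shows "mat_list_prod d X xs \<in> carrier_mat d d"
  using assms
proof (induction xs)
  case (Cons x xs)
  have "X x \<in> carrier_mat d d" "mat_list_prod d X xs \<in> carrier_mat d d"
    using Cons by (simp_all only: list.set_intros)
  then show ?case by (simp only: mat_list_prod_simps mult_carrier_mat)
qed simp

lemma path_weight_cong:
  assumes "\<And>x. x \<in> set xs \<Longrightarrow> i x = j x"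
  shows "path_weight X i xs s = path_weight X j xs s"
  using assms by (induction X i xs s rule: path_weight.induct) auto

lemma sum_path_weight_from:
  assumes "distinct (x # xs)" "\<And>y. y \<in> set (x # xs) \<Longrightarrow> X y \<in> carrier_mat d d" "r < d" "s < d"
  shows "(\<Sum>i\<in>set (x # xs) \<rightarrow>\<^sub>E {..<d}. if i x = r then path_weight X i (x # xs) s else 0)
    = mat_list_prod d X (x # xs) $$ (r, s)"
  using assms
proof (induction xs arbitrary: x r)
  case Nil
  have Xx: "X x \<in> carrier_mat d d" using Nil.prems by simp
  have "(\<Sum>i\<in>set [x] \<rightarrow>\<^sub>E {..<d}. if i x = r then path_weight X i [x] s else 0)
      = (\<Sum>y<d. \<Sum>i\<in>{} \<rightarrow>\<^sub>E {..<d}. if (i(x := y)) x = r then X x $$ ((i(x := y)) x, s) else 0)"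
    unfolding list.set path_weight.simps by (rule sum_PiE_insert) simp
  also have "\<dots> = (\<Sum>y<d. if y = r then X x $$ (r, s) else 0)" by (intro sum.cong refl) simp
  also have "\<dots> = X x $$ (r, s)" using Nil.prems by simp
  finally show ?case using right_mult_one_mat[OF Xx] by simp
next
  case (Cons y ys)
  have Xx: "X x \<in> carrier_mat d d" using Cons.prems by simp
  have Xs: "\<And>z. z \<in> set (y # ys) \<Longrightarrow> X z \<in> carrier_mat d d" using Cons.prems(2) by simp
  have dis: "distinct (y # ys)" and xn: "x \<notin> set (y # ys)" using Cons.prems(1) by auto
  have set_eq: "set (x # y # ys) = insert x (set (y # ys))" by simp
  let ?E = "set (y # ys) \<rightarrow>\<^sub>E {..<d}"
  have "(\<Sum>i\<in>set (x # y # ys) \<rightarrow>\<^sub>E {..<d}. if i x = r then path_weight X i (x # y # ys) s else 0)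
      = (\<Sum>v<d. \<Sum>i\<in>?E. if (i(x := v)) x = r then path_weight X (i(x := v)) (x # y # ys) s else 0)"
    unfolding set_eq by (rule sum_PiE_insert[OF xn])
  also have "\<dots> = (\<Sum>v<d. if v = r then (\<Sum>i\<in>?E. X x $$ (r, i y) * path_weight X i (y # ys) s) else 0)"
  proof (intro sum.cong refl)
    fix v
    have "path_weight X (i(x := w)) (y # ys) s = path_weight X i (y # ys) s" for i w
      by (rule path_weight_cong) (use xn in auto)
    moreover have "y \<noteq> x" using xn by auto
    ultimately show "(\<Sum>i\<in>?E. if (i(x := v)) x = r then path_weight X (i(x := v)) (x # y # ys) s else 0) =
      (if v = r then (\<Sum>i\<in>?E. X x $$ (r, i y) * path_weight X i (y # ys) s) else 0)"
      by simp
  qed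
  also have "\<dots> = (\<Sum>i\<in>?E. X x $$ (r, i y) * path_weight X i (y # ys) s)" using Cons.prems(3) by simp
  also have "\<dots> = (\<Sum>i\<in>?E. \<Sum>q<d. if i y = q then X x $$ (r, q) * path_weight X i (y # ys) s else 0)"
  proof (rule sum.cong[OF refl])
    fix i assume "i \<in> ?E"
    then have "i y < d" using PiE_mem[of i "set (y # ys)" "\<lambda>_. {..<d}" y] by simp
    then show "X x $$ (r, i y) * path_weight X i (y # ys) s =
        (\<Sum>q<d. if i y = q then X x $$ (r, q) * path_weight X i (y # ys) s else 0)" by simp
  qed
  also have "\<dots> = (\<Sum>q<d. X x $$ (r, q) * (\<Sum>i\<in>?E. if i y = q then path_weight X i (y # ys) s else 0))"
    by (subst sum.swap) (simp only: sum_distrib_left if_distrib mult_zero_right)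
  also have "\<dots> = (\<Sum>q<d. X x $$ (r, q) * mat_list_prod d X (y # ys) $$ (q, s))"
    by (intro sum.cong refl arg_cong2[where f = "(*)"] Cons.IH[OF dis Xs _ Cons.prems(4)]) simp_all
  also have "\<dots> = (X x * mat_list_prod d X (y # ys)) $$ (r, s)"
    by (rule mat_entry_mult[OF Xx mat_list_prod_carrier[OF Xs] Cons.prems(3,4), symmetric]) simp
  finally show ?case by (simp only: mat_list_prod_simps)
qed

lemma sum_closed_path_weight:
  assumes "distinct (x # xs)" "\<And>y. y \<in> set (x # xs) \<Longrightarrow> X y \<in> carrier_mat d d"
  shows "(\<Sum>i\<in>set (x # xs) \<rightarrow>\<^sub>E {..<d}. path_weight X i (x # xs) (i x))
    = (\<Sum>r<d. mat_list_prod d X (x # xs) $$ (r, r))"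
proof -
  let ?E = "set (x # xs) \<rightarrow>\<^sub>E {..<d}"
  have "(\<Sum>r<d. mat_list_prod d X (x # xs) $$ (r, r)) =
     (\<Sum>r<d. \<Sum>i\<in>?E. if i x = r then path_weight X i (x # xs) r else 0)"
    by (intro sum.cong refl sum_path_weight_from[OF assms, symmetric]) simp_all
  also have "\<dots> = (\<Sum>i\<in>?E. \<Sum>r<d. if i x = r then path_weight X i (x # xs) r else 0)" by (rule sum.swap)
  also have "\<dots> = (\<Sum>i\<in>?E. path_weight X i (x # xs) (i x))"
  proof (rule sum.cong[OF refl])
    fix i assume "i \<in> ?E"
    then have "i x < d" using PiE_mem[of i "set (x # xs)" "\<lambda>_. {..<d}" x] by simp
    then show "(\<Sum>r<d. if i x = r then path_weight X i (x # xs) r else 0) = path_weight X i (x # xs) (i x)" by simp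
  qed
  finally show ?thesis by simp
qed

lemma path_weight_iterates:
  "path_weight X i (map (\<lambda>k. (f ^^ k) a) [m..<m + Suc n]) s =
    (\<Prod>k\<in>{m..<m + n}. X ((f ^^ k) a) $$ (i ((f ^^ k) a), i ((f ^^ Suc k) a))) *
      X ((f ^^ (m + n)) a) $$ (i ((f ^^ (m + n)) a), s)"
proof (induction n arbitrary: m)
  case 0
  then show ?case by simp
next
  case (Suc n)
  have u: "[m..<m + Suc (Suc n)] = m # [Suc m..<Suc m + Suc n]" by (simp add: upt_conv_Cons)
  have u2: "[Suc m..<Suc m + Suc n] = Suc m # [Suc (Suc m)..<Suc m + Suc n]" by (simp add: upt_conv_Cons)
  have "path_weight X i (map (\<lambda>k. (f ^^ k) a) [m..<m + Suc (Suc n)]) s =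
     X ((f ^^ m) a) $$ (i ((f ^^ m) a), i ((f ^^ Suc m) a)) *
       path_weight X i (map (\<lambda>k. (f ^^ k) a) [Suc m..<Suc m + Suc n]) s"
    unfolding u u2 list.map path_weight.simps ..
  also have "\<dots> = X ((f ^^ m) a) $$ (i ((f ^^ m) a), i ((f ^^ Suc m) a)) *
      ((\<Prod>k\<in>{Suc m..<Suc m + n}. X ((f ^^ k) a) $$ (i ((f ^^ k) a), i ((f ^^ Suc k) a))) *
      X ((f ^^ (Suc m + n)) a) $$ (i ((f ^^ (Suc m + n)) a), s))"
    unfolding Suc.IH ..
  also have "\<dots> = (\<Prod>k\<in>{m..<m + Suc n}. X ((f ^^ k) a) $$ (i ((f ^^ k) a), i ((f ^^ Suc k) a))) *
      X ((f ^^ (Suc m + n)) a) $$ (i ((f ^^ (Suc m + n)) a), s)"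
    by (subst (2) prod.atLeast_Suc_lessThan) (simp_all only: mult.assoc, auto)
  finally show ?case by simp
qed

lemma orbit_eq_support:
  assumes "permutation f"
  shows "orbit f a = set (support f a)"
  unfolding support_set[OF assms] orbit_altdef_permutation[OF assms] by auto

lemma sum_orbit_trace:
  assumes f: "permutation f" and X: "\<And>x. x \<in> orbit f a \<Longrightarrow> X x \<in> carrier_mat d d"
  shows "(\<Sum>i\<in>orbit f a \<rightarrow>\<^sub>E {..<d}. \<Prod>x\<in>orbit f a. X x $$ (i x, i (f x)))
    = (\<Sum>r<d. mat_list_prod d X (support f a) $$ (r, r))"
proof -
  let ?N = "least_power f a"
  obtain n where N: "?N = Suc n" using least_power_of_permutation(2)[OF f, of a] by (metis gr0_implies_Suc)
  have per: "(f ^^ Suc n) a = a" using least_power_of_permutation(1)[OF f, of a] unfolding N .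
  have dis: "distinct (support f a)" by (rule cycle_of_permutation[OF f])
  define xs where "xs = map (\<lambda>k. (f ^^ k) a) [Suc 0..<Suc n]"
  have sup: "support f a = a # xs" unfolding N xs_def by (simp add: upt_conv_Cons del: upt_Suc)
  have orb: "orbit f a = set (a # xs)" unfolding orbit_eq_support[OF f] sup ..
  have w: "(\<Prod>x\<in>orbit f a. X x $$ (i x, i (f x))) = path_weight X i (a # xs) (i a)" for i
  proof -
    have "(\<Prod>x\<in>orbit f a. X x $$ (i x, i (f x))) = (\<Prod>k\<in>{0..<Suc n}. X ((f ^^ k) a) $$ (i ((f ^^ k) a), i ((f ^^ Suc k) a)))"
    proof -
      have inj: "inj_on (\<lambda>k. (f ^^ k) a) {0..<Suc n}" using dis unfolding N by (simp add: distinct_map del: upt_Suc)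
      have "orbit f a = (\<lambda>k. (f ^^ k) a) ` {0..<Suc n}" unfolding orbit_eq_support[OF f] N by (simp del: upt_Suc)
      then show ?thesis by (simp add: prod.reindex[OF inj] del: prod.op_ivl_Suc)
    qed
    also have "\<dots> = (\<Prod>k\<in>{0..<n}. X ((f ^^ k) a) $$ (i ((f ^^ k) a), i ((f ^^ Suc k) a))) *
       X ((f ^^ n) a) $$ (i ((f ^^ n) a), i a)"
      unfolding prod.op_ivl_Suc using per by simp
    also have "\<dots> = path_weight X i (map (\<lambda>k. (f ^^ k) a) [0..<0 + Suc n]) (i a)"
      unfolding path_weight_iterates by simp
    also have "map (\<lambda>k. (f ^^ k) a) [0..<0 + Suc n] = a # xs" using sup unfolding N by simp
    finally show ?thesis .
  qed
  show ?thesis unfolding w sup unfolding orb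
    by (rule sum_closed_path_weight) (use dis sup X orb in auto)
qed

lemma mat_list_prod_telescope:
  assumes UV: "\<And>x. x \<in> S \<Longrightarrow> U x \<in> carrier_mat d d" "\<And>x. x \<in> S \<Longrightarrow> V x \<in> carrier_mat d d"
      "\<And>x. x \<in> S \<Longrightarrow> U x * V x = 1\<^sub>m d" "\<And>x. x \<in> S \<Longrightarrow> V x * U x = 1\<^sub>m d"
    and f: "\<And>x. x \<in> S \<Longrightarrow> f x \<in> S" and a: "a \<in> S"
  shows "mat_list_prod d (\<lambda>x. V x * U (f x)) (map (\<lambda>k. (f ^^ k) a) [m..<m + n]) =
    V ((f ^^ m) a) * U ((f ^^ (m + n)) a)"
proof (induction n arbitrary: m)
  case 0
  have "(f ^^ m) a \<in> S" by (induction m) (use a f in auto)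
  then show ?case using UV by simp
next
  case (Suc n)
  have S: "(f ^^ k) a \<in> S" for k by (induction k) (use a f in auto)
  let ?x = "(f ^^ m) a" and ?y = "(f ^^ Suc m) a" and ?z = "(f ^^ (Suc m + n)) a"
  have u: "[m..<m + Suc n] = m # [Suc m..<Suc m + n]" by (simp add: upt_conv_Cons)
  have fx: "f ?x = ?y" by simp
  have "mat_list_prod d (\<lambda>x. V x * U (f x)) (map (\<lambda>k. (f ^^ k) a) [m..<m + Suc n])
      = V ?x * U ?y * (V ?y * U ?z)"
    unfolding u list.map mat_list_prod_simps Suc.IH fx ..
  also have "\<dots> = V ?x * (U ?y * (V ?y * U ?z))"
    by (rule assoc_mult_mat[OF UV(2)[OF S] UV(1)[OF S] mult_carrier_mat[OF UV(2)[OF S] UV(1)[OF S]]])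
  also have "U ?y * (V ?y * U ?z) = U ?y * V ?y * U ?z"
    by (rule assoc_mult_mat[OF UV(1)[OF S] UV(2)[OF S] UV(1)[OF S], symmetric])
  also have "\<dots> = U ?z" unfolding UV(3)[OF S] by (rule left_mult_one_mat[OF UV(1)[OF S]])
  finally show ?case by simp
qed

lemma disjoint_orbits:
  assumes "permutation f"
  shows "disjoint (orbit f ` S)"
proof (rule disjointI)
  fix A B assume "A \<in> orbit f ` S" "B \<in> orbit f ` S" "A \<noteq> B"
  then show "A \<inter> B = {}" using disjoint_support[OF assms] orbit_eq_support[OF assms] by (auto simp: disjoint_def)
qed

lemma Union_orbits:
  assumes f: "permutation f" and S: "\<And>x. x \<in> S \<Longrightarrow> f x \<in> S"
  shows "\<Union>(orbit f ` S) = S"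
proof
  show "S \<subseteq> \<Union>(orbit f ` S)" using permutation_self_in_orbit[OF f] by blast
  have "y \<in> S" if "y \<in> orbit f x" "x \<in> S" for x y
    using that by induction (use S in auto)
  then show "\<Union>(orbit f ` S) \<subseteq> S" by blast
qed

lemma sum_telescoping_cycles:
  fixes U V :: "'c \<Rightarrow> 'b :: comm_ring_1 mat"
  assumes f: "permutation f" and fin: "finite S" and S: "\<And>x. x \<in> S \<Longrightarrow> f x \<in> S"
    and UV: "\<And>x. x \<in> S \<Longrightarrow> U x \<in> carrier_mat d d" "\<And>x. x \<in> S \<Longrightarrow> V x \<in> carrier_mat d d"
      "\<And>x. x \<in> S \<Longrightarrow> U x * V x = 1\<^sub>m d" "\<And>x. x \<in> S \<Longrightarrow> V x * U x = 1\<^sub>m d"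
  shows "(\<Sum>i\<in>S \<rightarrow>\<^sub>E {..<d}. \<Prod>x\<in>S. (V x * U (f x)) $$ (i x, i (f x))) = of_nat d ^ card (orbit f ` S)"
proof -
  let ?X = "\<lambda>x. V x * U (f x)" and ?D = "orbit f ` S"
  have Un: "\<Union>?D = S" by (rule Union_orbits[OF f S])
  have finD: "finite ?D" using fin by simp
  have finQ: "\<forall>Q\<in>?D. finite Q" using fin Un by (metis Union_upper finite_subset)
  have dis: "disjoint ?D" by (rule disjoint_orbits[OF f])
  have dis2: "\<forall>A\<in>?D. \<forall>B\<in>?D. A \<noteq> B \<longrightarrow> A \<inter> B = {}" using dis by (simp add: disjoint_def)
  have closed: "f x \<in> Q" if "Q \<in> ?D" "x \<in> Q" for Q x using that by (auto intro: orbit.intros)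
  have one: "(\<Sum>i\<in>Q \<rightarrow>\<^sub>E {..<d}. \<Prod>x\<in>Q. ?X x $$ (i x, i (f x))) = of_nat d" if Q: "Q \<in> ?D" for Q
  proof -
    obtain a where a: "a \<in> S" "Q = orbit f a" using Q by auto
    have QS: "x \<in> S" if "x \<in> Q" for x using that Q Un by blast
    have X: "?X x \<in> carrier_mat d d" if "x \<in> orbit f a" for x
      by (rule mult_carrier_mat[OF UV(2) UV(1)[OF S]]) (use QS a that in auto)
    have "mat_list_prod d ?X (support f a) = mat_list_prod d ?X (map (\<lambda>k. (f ^^ k) a) [0..<0 + least_power f a])" by simp
    also have "\<dots> = V ((f ^^ 0) a) * U ((f ^^ (0 + least_power f a)) a)"
      by (rule mat_list_prod_telescope[where S = S]) (use UV S a in auto)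
    also have "\<dots> = 1\<^sub>m d" using least_power_of_permutation(1)[OF f, of a] UV(4)[OF a(1)] by simp
    finally have "mat_list_prod d ?X (support f a) = 1\<^sub>m d" .
    then have tr: "(\<Sum>r<d. mat_list_prod d ?X (support f a) $$ (r, r)) = of_nat d" by simp
    have "(\<Sum>i\<in>orbit f a \<rightarrow>\<^sub>E {..<d}. \<Prod>x\<in>orbit f a. ?X x $$ (i x, i (f x)))
        = (\<Sum>r<d. mat_list_prod d ?X (support f a) $$ (r, r))"
      by (rule sum_orbit_trace[OF f]) (rule X)
    then show ?thesis unfolding a(2) tr .
  qed
  have "(\<Sum>i\<in>S \<rightarrow>\<^sub>E {..<d}. \<Prod>x\<in>S. ?X x $$ (i x, i (f x)))
      = (\<Sum>i\<in>\<Union>?D \<rightarrow>\<^sub>E {..<d}. \<Prod>Q\<in>?D. \<Prod>x\<in>Q. ?X x $$ (restrict i Q x, restrict i Q (f x)))"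
    unfolding Un
  proof (rule sum.cong[OF refl])
    fix i
    have "(\<Prod>x\<in>S. ?X x $$ (i x, i (f x))) = (\<Prod>x\<in>\<Union>?D. ?X x $$ (i x, i (f x)))" unfolding Un ..
    also have "\<dots> = (\<Prod>Q\<in>?D. \<Prod>x\<in>Q. ?X x $$ (i x, i (f x)))"
      using prod.Union_disjoint[OF finQ dis2] by (simp only: o_def)
    also have "\<dots> = (\<Prod>Q\<in>?D. \<Prod>x\<in>Q. ?X x $$ (restrict i Q x, restrict i Q (f x)))"
      by (intro prod.cong refl) (simp add: closed)
    finally show "(\<Prod>x\<in>S. ?X x $$ (i x, i (f x))) = (\<Prod>Q\<in>?D. \<Prod>x\<in>Q. ?X x $$ (restrict i Q x, restrict i Q (f x)))" .
  qed
  also have "\<dots> = (\<Prod>Q\<in>?D. \<Sum>i\<in>Q \<rightarrow>\<^sub>E {..<d}. \<Prod>x\<in>Q. ?X x $$ (i x, i (f x)))"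
    by (rule prod_sum_PiE_Union[OF finD dis, symmetric])
  also have "\<dots> = (\<Prod>Q\<in>?D. of_nat d)" by (intro prod.cong refl one)
  finally show ?thesis by simp
qed

context oriented_involutions
begin

lemma prod_L: "(\<Prod>x\<in>L. f x) = (\<Prod>t\<in>T. f (if t \<in> L then t else \<theta> t) * f (if \<sigma> t \<in> L then \<sigma> t else \<theta> (\<sigma> t)))"
  for f :: "'a \<Rightarrow> 'b :: comm_monoid_mult"
proof -
  let ?g = "\<lambda>y. f (if y \<in> L then y else \<theta> y)"
  have "(\<Prod>x\<in>L. f x) = (\<Prod>y\<in>T \<union> \<sigma> ` T. ?g y)"
    by (rule prod.reindex_bij_betw[OF th.bij_betw_flips[OF flips_edge(2) L(1)], symmetric])
  also have "\<dots> = (\<Prod>y\<in>T. ?g y) * (\<Prod>y\<in>\<sigma> ` T. ?g y)"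
  proof (rule prod.union_disjoint)
    have False if "x \<in> T" "x \<in> \<sigma> ` T" for x
    proof -
      have "\<sigma> x \<in> T" using that(2) si.inv by auto
      then show False using edge_unique[OF TC[OF that(1)]] that(1) by simp
    qed
    then show "T \<inter> \<sigma> ` T = {}" by blast
  qed (use finites in simp_all)
  also have "(\<Prod>y\<in>\<sigma> ` T. ?g y) = (\<Prod>t\<in>T. ?g (\<sigma> t))"
  proof (rule prod.reindex_cong)
    show "inj_on \<sigma> T" by (metis inj_onI si.inv)
  qed simp_all
  finally show ?thesis by (simp only: prod.distrib)
qed

text \<open>The matrices \<open>B\<close> that a twisted edge contributes cancel along every face: with \<open>U x = 1\<close> for
  \<open>x \<in> P\<close> and \<open>U x = B\<close> otherwise, the matrix attached to \<open>x \<in> L\<close> is \<open>U x\<^sup>-\<^sup>1 U (\<tau>\<sigma>\<theta> x)\<close>.\<close>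

lemma index_sum:
  fixes \<epsilon> :: "'b :: comm_ring_1"
  assumes B: "B \<in> carrier_mat d d" "B' \<in> carrier_mat d d" "B * B' = 1\<^sub>m d" "B' * B = 1\<^sub>m d"
    and sym: "\<And>i j. i < d \<Longrightarrow> j < d \<Longrightarrow> B $$ (i,j) = \<epsilon> * B $$ (j,i)"
      "\<And>i j. i < d \<Longrightarrow> j < d \<Longrightarrow> B' $$ (i,j) = \<epsilon> * B' $$ (j,i)"
    and \<epsilon>: "\<epsilon> * \<epsilon> = 1"
  shows "(\<Sum>i\<in>P \<rightarrow>\<^sub>E {..<d}. \<Prod>t\<in>T.
      if \<theta> t \<in> P then B $$ (i t, i (partner t)) * B' $$ (i (c (\<sigma> (partner t))), i (c (\<sigma> t)))
      else if i t = i (c (\<sigma> (partner t))) \<and> i (c (\<sigma> t)) = i (partner t) then 1 else 0)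
    = \<epsilon> ^ card {t \<in> twisted. t \<in> L \<longleftrightarrow> \<sigma> t \<in> L} * of_nat d ^ card (orbit (c \<circ> \<theta>) ` L)"
    (is "(\<Sum>i\<in>_. \<Prod>t\<in>T. ?W i t) = _")
proof -
  define f where "f x = c (\<theta> x)" for x
  define U where "U x = (if x \<in> P then 1\<^sub>m d else B)" for x
  define V where "V x = (if x \<in> P then 1\<^sub>m d else B')" for x
  define M where "M x = V x * U (f x)" for x
  define lf where "lf y = (if y \<in> L then y else c y)" for y
  have f_perm: "permutation f"
  proof -
    have "c \<circ> \<theta> permutes C" by (rule permutes_compose[OF th.perm co.perm])
    then have "permutation (c \<circ> \<theta>)" by (rule permutes_finite_permutation[OF th.fin])
    moreover have "c \<circ> \<theta> = f" by (auto simp: f_def)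
    ultimately show ?thesis by simp
  qed
  have f_L: "f x \<in> L" if "x \<in> L" for x
    unfolding f_def using that memL(1)[of x] memL(2)[OF th.closed, of x] LC by auto
  have f_P: "f x \<in> P \<longleftrightarrow> \<theta> x \<notin> P" if "x \<in> L" for x
    unfolding f_def using memP(2)[OF th.closed, of x] that LC by auto
  have M: "M x = (if x \<in> P then if \<theta> x \<in> P then B else 1\<^sub>m d else if \<theta> x \<in> P then 1\<^sub>m d else B')" if "x \<in> L" for x
    unfolding M_def U_def V_def using f_P[OF that] B by auto
  have lf_L: "lf y \<in> L" if "y \<in> C" for y unfolding lf_def using memL(2)[OF that] by simp
  have lf_c: "lf (c y) = lf y" if "y \<in> C" for y
    unfolding lf_def using memL(2)[OF that] by (auto simp: co.inv)
  have lf_id: "lf y = y" if "y \<in> L" for y using that unfolding lf_def by simp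
  have lf_bij: "bij_betw lf P L" unfolding lf_def by (rule co.bij_betw_flips[OF P(2) L(2)])
  define s where "s t = (if \<theta> t \<in> P \<and> (t \<in> L \<longleftrightarrow> \<sigma> t \<in> L) then \<epsilon> else 1)" for t
  have edge: "?W (\<lambda>x\<in>P. j (lf x)) t = s t * (let y = (if t \<in> L then t else \<theta> t) in M y $$ (j y, j (f y))) *
       (let y = (if \<sigma> t \<in> L then \<sigma> t else \<theta> (\<sigma> t)) in M y $$ (j y, j (f y)))"
    if j: "j \<in> L \<rightarrow>\<^sub>E {..<d}" and t: "t \<in> T" for j t
  proof -
    define J where "J y = j (lf y)" for y
    have Jd: "J y < d" if "y \<in> C" for y
      unfolding J_def using PiE_mem[OF j lf_L[OF that]] by simp
    have tP: "t \<in> P" using t T(1) by auto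
    have tC: "t \<in> C" "\<theta> t \<in> C" "\<sigma> t \<in> C" "\<theta> (\<sigma> t) \<in> C" "\<sigma> (\<theta> t) \<in> C"
      using TC[OF t] th.closed si.closed by auto
    have tau_P: "c (\<sigma> y) \<in> P" if "y \<in> P" for y
      using memP(2)[OF si.closed, of y] memP(1)[of y] that PC by auto
    have Jtau: "J (c (\<sigma> y)) = J (\<sigma> y)" if "y \<in> C" for y
      unfolding J_def using lf_c[OF si.closed[OF that]] by simp
    have jf: "j (f y) = J (\<theta> y)" if "y \<in> L" for y
    proof -
      have "J (\<theta> y) = J (c (\<theta> y))" unfolding J_def using lf_c[OF th.closed, of y] that LC by auto
      also have "\<dots> = j (f y)" unfolding J_def f_def[symmetric] using lf_id[OF f_L[OF that]] by simp
      finally show ?thesis by simp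
    qed
    have jj: "j y = J y" if "y \<in> L" for y unfolding J_def lf_id[OF that] ..
    have i: "(\<lambda>x\<in>P. j (lf x)) y = J y" if "y \<in> P" for y using that unfolding J_def by simp
    have pP: "partner t \<in> P" and pC: "partner t \<in> C" using partner_in[OF tP] PC by auto
    have W: "?W (\<lambda>x\<in>P. j (lf x)) t =
       (if \<theta> t \<in> P then B $$ (J t, J (partner t)) * B' $$ (J (\<sigma> (partner t)), J (\<sigma> t))
        else if J t = J (\<sigma> (partner t)) \<and> J (\<sigma> t) = J (partner t) then 1 else 0)"
      unfolding i[OF tP] i[OF pP] i[OF tau_P[OF tP]] i[OF tau_P[OF pP]] Jtau[OF tC(1)] Jtau[OF pC] ..
    have sP: "\<sigma> t \<notin> P" using memP(1)[OF tC(1)] tP by simp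
    have tsP: "\<theta> (\<sigma> t) \<in> P \<longleftrightarrow> \<theta> t \<notin> P" using memP(1)[OF tC(2)] commute by simp
    have m: "\<theta> t \<in> L \<longleftrightarrow> t \<notin> L" "\<theta> (\<sigma> t) \<in> L \<longleftrightarrow> \<sigma> t \<notin> L" using memL(1)[OF tC(1)] memL(1)[OF tC(3)] by auto
    define y where "y = (if t \<in> L then t else \<theta> t)"
    define z where "z = (if \<sigma> t \<in> L then \<sigma> t else \<theta> (\<sigma> t))"
    have yL: "y \<in> L" and zL: "z \<in> L" unfolding y_def z_def using m by auto
    have yC: "y \<in> C" "\<theta> y \<in> C" and zC: "z \<in> C" "\<theta> z \<in> C" using yL zL LC th.closed by auto
    have e: "M y $$ (j y, j (f y)) = M y $$ (J y, J (\<theta> y))" "M z $$ (j z, j (f z)) = M z $$ (J z, J (\<theta> z))"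
      unfolding jf[OF yL] jf[OF zL] jj[OF yL] jj[OF zL] by simp_all
    show ?thesis
    proof (cases "\<theta> t \<in> P")
      case True
      have p: "partner t = \<theta> t" using True unfolding partner_def by simp
      have "y \<in> P \<and> \<theta> y \<in> P" unfolding y_def using True tP by (simp add: th.inv)
      then have My: "M y = B" using M[OF yL] by simp
      have "z \<notin> P \<and> \<theta> z \<notin> P" unfolding z_def using True sP tsP by (simp add: th.inv)
      then have Mz: "M z = B'" using M[OF zL] by simp
      have b: "B $$ (J t, J (\<theta> t)) = (if t \<in> L then 1 else \<epsilon>) * B $$ (J y, J (\<theta> y))"
        unfolding y_def using sym(1)[OF Jd[OF tC(1)] Jd[OF tC(2)]] by (simp add: th.inv)
      have b': "B' $$ (J (\<theta> (\<sigma> t)), J (\<sigma> t)) = (if \<sigma> t \<in> L then \<epsilon> else 1) * B' $$ (J z, J (\<theta> z))"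
        unfolding z_def using sym(2)[OF Jd[OF tC(4)] Jd[OF tC(3)]] by (simp add: th.inv)
      have "?W (\<lambda>x\<in>P. j (lf x)) t = B $$ (J t, J (\<theta> t)) * B' $$ (J (\<theta> (\<sigma> t)), J (\<sigma> t))"
        by (rule trans[OF W]) (simp add: True p commute)
      also have "\<dots> = s t * B $$ (J y, J (\<theta> y)) * B' $$ (J z, J (\<theta> z))"
        unfolding b b' s_def using True \<epsilon> by (auto simp: mult_ac) (simp add: mult.assoc[symmetric])
      finally show ?thesis unfolding y_def[symmetric] z_def[symmetric] Let_def e unfolding My Mz .
    next
      case ut: False
      have p: "partner t = \<theta> (\<sigma> t)" using ut unfolding partner_def by simp
      have "y \<in> P \<longleftrightarrow> \<theta> y \<notin> P" unfolding y_def using ut tP by (simp add: th.inv)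
      then have My: "M y = 1\<^sub>m d" using M[OF yL] by simp
      have "z \<in> P \<longleftrightarrow> \<theta> z \<notin> P" unfolding z_def using ut sP tsP by (simp add: th.inv)
      then have Mz: "M z = 1\<^sub>m d" using M[OF zL] by simp
      have b: "(1\<^sub>m d :: 'b mat) $$ (J y, J (\<theta> y)) = (if J t = J (\<theta> t) then 1 else 0)"
        using Jd[OF yC(1)] Jd[OF yC(2)] unfolding y_def by (auto simp: th.inv)
      have b': "(1\<^sub>m d :: 'b mat) $$ (J z, J (\<theta> z)) = (if J (\<sigma> t) = J (\<theta> (\<sigma> t)) then 1 else 0)"
        using Jd[OF zC(1)] Jd[OF zC(2)] unfolding z_def by (auto simp: th.inv)
      have sp: "\<sigma> (\<theta> (\<sigma> t)) = \<theta> t" using commute[of "\<sigma> t"] si.inv by simp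
      have st: "s t = 1" unfolding s_def using ut by simp
      have "?W (\<lambda>x\<in>P. j (lf x)) t = (if J t = J (\<theta> t) then 1 else 0) * (if J (\<sigma> t) = J (\<theta> (\<sigma> t)) then 1 else 0)"
        by (rule trans[OF W]) (simp add: ut p sp)
      then show ?thesis unfolding y_def[symmetric] z_def[symmetric] Let_def e unfolding My Mz b b' st by (simp only: mult_1)
    qed
  qed
  have "(\<Sum>i\<in>P \<rightarrow>\<^sub>E {..<d}. \<Prod>t\<in>T. ?W i t) = (\<Sum>j\<in>L \<rightarrow>\<^sub>E {..<d}. \<Prod>t\<in>T. ?W (\<lambda>x\<in>P. j (lf x)) t)"
    by (rule sum_PiE_reindex[OF lf_bij])
  also have "\<dots> = (\<Sum>j\<in>L \<rightarrow>\<^sub>E {..<d}. (\<Prod>t\<in>T. s t) * (\<Prod>x\<in>L. M x $$ (j x, j (f x))))"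
  proof (rule sum.cong[OF refl])
    fix j assume j: "j \<in> L \<rightarrow>\<^sub>E {..<d}"
    have "(\<Prod>t\<in>T. ?W (\<lambda>x\<in>P. j (lf x)) t) = (\<Prod>t\<in>T. s t * ((let y = (if t \<in> L then t else \<theta> t) in M y $$ (j y, j (f y))) *
       (let y = (if \<sigma> t \<in> L then \<sigma> t else \<theta> (\<sigma> t)) in M y $$ (j y, j (f y)))))"
      by (rule prod.cong[OF refl], subst edge[OF j]) (simp_all only: mult.assoc)
    also have "\<dots> = (\<Prod>t\<in>T. s t) * (\<Prod>x\<in>L. M x $$ (j x, j (f x)))"
      unfolding prod_L[of "\<lambda>y. M y $$ (j y, j (f y))"] prod.distrib Let_def ..
    finally show "(\<Prod>t\<in>T. ?W (\<lambda>x\<in>P. j (lf x)) t) = (\<Prod>t\<in>T. s t) * (\<Prod>x\<in>L. M x $$ (j x, j (f x)))" .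
  qed
  also have "\<dots> = (\<Prod>t\<in>T. s t) * (\<Sum>j\<in>L \<rightarrow>\<^sub>E {..<d}. \<Prod>x\<in>L. (V x * U (f x)) $$ (j x, j (f x)))"
    unfolding M_def by (rule sum_distrib_left[symmetric])
  also have "(\<Sum>j\<in>L \<rightarrow>\<^sub>E {..<d}. \<Prod>x\<in>L. (V x * U (f x)) $$ (j x, j (f x))) = of_nat d ^ card (orbit f ` L)"
    by (rule sum_telescoping_cycles[OF f_perm finites(2) f_L]) (use B in \<open>auto simp: U_def V_def\<close>)
  also have "f = c \<circ> \<theta>" by (auto simp: f_def)
  also have "(\<Prod>t\<in>T. s t) = \<epsilon> ^ card {t \<in> twisted. t \<in> L \<longleftrightarrow> \<sigma> t \<in> L}"
  proof -
    have e: "{t \<in> twisted. t \<in> L \<longleftrightarrow> \<sigma> t \<in> L} = {t \<in> T. \<theta> t \<in> P \<and> (t \<in> L \<longleftrightarrow> \<sigma> t \<in> L)}"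
      unfolding twisted_def by auto
    have "(\<Prod>t\<in>T. s t) = (\<Prod>t\<in>{t \<in> T. \<theta> t \<in> P \<and> (t \<in> L \<longleftrightarrow> \<sigma> t \<in> L)}. \<epsilon>)"
      unfolding s_def by (rule prod.inter_filter[OF finites(3), symmetric])
    then show ?thesis unfolding e by simp
  qed
  finally show ?thesis .
qed

end

lemma prod_indicator:
  fixes N :: "'b :: comm_semiring_1"
  shows "finite A \<Longrightarrow> (\<Prod>Q\<in>A. if p Q then N else 0) = (if \<forall>Q\<in>A. p Q then 1 else 0) * N ^ card A"
  by (induction A rule: finite_induct) auto

context group
begin

definition cycle_prod :: "('c \<Rightarrow> 'c) \<Rightarrow> ('c \<Rightarrow> 'a) \<Rightarrow> 'c \<Rightarrow> 'a" where
  "cycle_prod f \<psi> a = foldr (\<lambda>x y. x \<otimes> y) (map \<psi> (support f a)) \<one>"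

definition iterate_prod :: "('c \<Rightarrow> 'c) \<Rightarrow> ('c \<Rightarrow> 'a) \<Rightarrow> 'c \<Rightarrow> nat \<Rightarrow> 'a" where
  "iterate_prod f \<psi> a n = foldr (\<lambda>x y. x \<otimes> y) (map (\<lambda>k. \<psi> ((f ^^ k) a)) [0..<n]) \<one>"

lemma foldr_mult_closed:
  "set xs \<subseteq> carrier G \<Longrightarrow> z \<in> carrier G \<Longrightarrow> foldr (\<lambda>x y. x \<otimes> y) xs z \<in> carrier G"
  by (induction xs) auto

lemma foldr_mult_init:
  "set xs \<subseteq> carrier G \<Longrightarrow> z \<in> carrier G \<Longrightarrow> foldr (\<lambda>x y. x \<otimes> y) xs z = foldr (\<lambda>x y. x \<otimes> y) xs \<one> \<otimes> z"
  by (induction xs) (auto simp: m_assoc foldr_mult_closed)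

lemma cycle_prod_iterate: "cycle_prod f \<psi> a = iterate_prod f \<psi> a (least_power f a)"
  unfolding cycle_prod_def iterate_prod_def by (simp add: comp_def)

lemma iterate_prod_0: "iterate_prod f \<psi> a 0 = \<one>"
  unfolding iterate_prod_def by simp

lemma iterate_prod_Suc:
  assumes "\<And>k. \<psi> ((f ^^ k) a) \<in> carrier G"
  shows "iterate_prod f \<psi> a (Suc n) = iterate_prod f \<psi> a n \<otimes> \<psi> ((f ^^ n) a)"
proof -
  have "iterate_prod f \<psi> a (Suc n) = foldr (\<lambda>x y. x \<otimes> y) (map (\<lambda>k. \<psi> ((f ^^ k) a)) [0..<n]) (\<psi> ((f ^^ n) a) \<otimes> \<one>)"
    unfolding iterate_prod_def by simp
  also have "\<psi> ((f ^^ n) a) \<otimes> \<one> = \<psi> ((f ^^ n) a)" using assms by simp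
  also have "foldr (\<lambda>x y. x \<otimes> y) (map (\<lambda>k. \<psi> ((f ^^ k) a)) [0..<n]) (\<psi> ((f ^^ n) a)) =
      iterate_prod f \<psi> a n \<otimes> \<psi> ((f ^^ n) a)"
    unfolding iterate_prod_def by (rule foldr_mult_init) (use assms in auto)
  finally show ?thesis .
qed

lemma iterate_prod_closed:
  assumes "\<And>k. \<psi> ((f ^^ k) a) \<in> carrier G"
  shows "iterate_prod f \<psi> a n \<in> carrier G"
  unfolding iterate_prod_def by (rule foldr_mult_closed) (use assms in auto)

text \<open>A product around a cycle is trivial iff its factors are the increments of a potential \<open>h\<close>.\<close>

definition potential :: "('c \<Rightarrow> 'c) \<Rightarrow> 'c set \<Rightarrow> ('c \<Rightarrow> 'a) \<Rightarrow> ('c \<Rightarrow> 'a) \<Rightarrow> bool" where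
  "potential f S \<psi> h \<longleftrightarrow> (\<forall>x\<in>S. h x \<in> carrier G \<and> \<psi> x = inv (h x) \<otimes> h (f x))"

lemma cycle_prod_potential:
  assumes f: "permutation f" and h: "potential f S \<psi> h" and S: "\<And>x. x \<in> S \<Longrightarrow> f x \<in> S" and a: "a \<in> S"
  shows "cycle_prod f \<psi> a = \<one>"
proof -
  have fS: "(f ^^ k) a \<in> S" for k by (induction k) (use a S in auto)
  have hc: "h x \<in> carrier G" if "x \<in> S" for x using h that unfolding potential_def by blast
  have \<psi>: "\<psi> x = inv (h x) \<otimes> h (f x)" if "x \<in> S" for x using h that unfolding potential_def by blast
  have c: "\<psi> ((f ^^ k) a) \<in> carrier G" for k
    unfolding \<psi>[OF fS] using hc[OF fS] hc[OF S[OF fS]] by simp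
  have "iterate_prod f \<psi> a n = inv (h a) \<otimes> h ((f ^^ n) a)" for n
  proof (induction n)
    case 0
    show ?case using hc[OF a] by (simp add: iterate_prod_0)
  next
    case (Suc n)
    let ?x = "(f ^^ n) a"
    have "iterate_prod f \<psi> a (Suc n) = inv (h a) \<otimes> h ?x \<otimes> (inv (h ?x) \<otimes> h (f ?x))"
      unfolding iterate_prod_Suc[of \<psi> f a, OF c] Suc \<psi>[OF fS] ..
    also have "\<dots> = inv (h a) \<otimes> h (f ?x)"
      using hc[OF a] hc[OF fS, of n] hc[OF S[OF fS], of n] by (simp add: m_assoc[symmetric]) (simp add: m_assoc)
    finally show ?case by simp
  qed
  then show ?thesis unfolding cycle_prod_iterate
    using least_power_of_permutation(1)[OF f, of a] hc[OF a] by simp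
qed

lemma ex_potential_orbit:
  assumes f: "permutation f" and \<psi>: "\<And>x. x \<in> orbit f a \<Longrightarrow> \<psi> x \<in> carrier G" and one: "cycle_prod f \<psi> a = \<one>"
  shows "\<exists>h. potential f (orbit f a) \<psi> h"
proof -
  let ?N = "least_power f a"
  have N: "?N > 0" "(f ^^ ?N) a = a" using least_power_of_permutation[OF f] by auto
  have dis: "distinct (support f a)" by (rule cycle_of_permutation[OF f])
  then have inj: "(f ^^ k) a = (f ^^ l) a \<Longrightarrow> k < ?N \<Longrightarrow> l < ?N \<Longrightarrow> k = l" for k l
    by (auto simp: distinct_map inj_on_def)
  have orb: "(f ^^ k) a \<in> orbit f a" for k unfolding orbit_altdef_permutation[OF f] by auto
  have c: "\<psi> ((f ^^ k) a) \<in> carrier G" for k by (rule \<psi>[OF orb])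
  define h where "h x = iterate_prod f \<psi> a (SOME k. k < ?N \<and> (f ^^ k) a = x)" for x
  have h: "h ((f ^^ k) a) = iterate_prod f \<psi> a k" if "k < ?N" for k
  proof -
    have "(SOME l. l < ?N \<and> (f ^^ l) a = (f ^^ k) a) = k"
      by (rule some_equality) (use that inj in auto)
    then show ?thesis unfolding h_def by simp
  qed
  have "h x \<in> carrier G \<and> \<psi> x = inv (h x) \<otimes> h (f x)" if x: "x \<in> orbit f a" for x
  proof -
    obtain k where k: "k < ?N" "x = (f ^^ k) a" using x unfolding orbit_altdef_bounded[OF N(2,1)] by blast
    have g: "iterate_prod f \<psi> a n \<in> carrier G" for n by (rule iterate_prod_closed[of \<psi> f a, OF c])
    have "h (f x) = iterate_prod f \<psi> a (Suc k)"
    proof (cases "Suc k < ?N")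
      case True
      then show ?thesis using h[OF True] k by simp
    next
      case False
      then have Sk: "Suc k = ?N" using k by simp
      have "f x = (f ^^ Suc k) a" using k by simp
      then have "f x = (f ^^ 0) a" unfolding Sk using N by simp
      then have "h (f x) = iterate_prod f \<psi> a 0" using h[OF N(1)] by simp
      then show ?thesis unfolding Sk using one by (simp add: iterate_prod_0 cycle_prod_iterate)
    qed
    also have "\<dots> = h x \<otimes> \<psi> x" unfolding iterate_prod_Suc[of \<psi> f a, OF c] k(2) h[OF k(1)] ..
    finally have "h (f x) = h x \<otimes> \<psi> x" .
    moreover have "h x \<in> carrier G" unfolding k(2) h[OF k(1)] by (rule g)
    ultimately show ?thesis using \<psi>[OF x] by (simp add: m_assoc[symmetric])
  qed
  then show ?thesis unfolding potential_def by blast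
qed

lemma orbit_eq_of_mem: "permutation f \<Longrightarrow> x \<in> orbit f a \<Longrightarrow> orbit f x = orbit f a"
  by (metis orbit_cyclic_eq3 cyclic_on_def permutation_self_in_orbit)

lemma ex_potential:
  assumes f: "permutation f" and S: "\<And>x. x \<in> S \<Longrightarrow> f x \<in> S"
    and \<psi>: "\<And>x. x \<in> S \<Longrightarrow> \<psi> x \<in> carrier G" and one: "\<And>a. a \<in> S \<Longrightarrow> cycle_prod f \<psi> a = \<one>"
  shows "\<exists>h. potential f S \<psi> h"
proof -
  have sub: "x \<in> S" if "x \<in> orbit f a" "a \<in> S" for x a
    using that by induction (use S in auto)
  define H where "H Q = (SOME h. potential f Q \<psi> h)" for Q
  have H: "potential f (orbit f a) \<psi> (H (orbit f a))" if "a \<in> S" for a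
    unfolding H_def using ex_potential_orbit[OF f \<psi>[OF sub[OF _ that]] one[OF that]] by (rule someI_ex)
  have "potential f S \<psi> (\<lambda>x. H (orbit f x) x)" unfolding potential_def
  proof
    fix x assume x: "x \<in> S"
    have "x \<in> orbit f x" by (rule permutation_self_in_orbit[OF f])
    then show "H (orbit f x) x \<in> carrier G \<and> \<psi> x = inv (H (orbit f x) x) \<otimes> H (orbit f (f x)) (f x)"
      using H[OF x] permutation_orbit_step[OF f] unfolding potential_def by simp
  qed
  then show ?thesis by blast
qed

end

context finite_group
begin

lemma rep_foldr:
  assumes R: "mat_rep G d R" and xs: "\<And>x. x \<in> set xs \<Longrightarrow> \<psi> x \<in> carrier G"
  shows "mat_list_prod d (\<lambda>x. R (\<psi> x)) xs = R (foldr (\<lambda>x y. x \<otimes> y) (map \<psi> xs) \<one>)"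
  using xs
proof (induction xs)
  case Nil
  then show ?case using mat_repD(2)[OF R] by simp
next
  case (Cons x xs)
  have "foldr (\<lambda>x y. x \<otimes> y) (map \<psi> xs) \<one> \<in> carrier G"
    by (rule foldr_mult_closed) (use Cons in auto)
  then show ?case using Cons mat_repD(3)[OF R, of "\<psi> x"] by simp
qed

lemma vertex_delta:
  assumes f: "permutation f" and \<psi>: "\<And>x. x \<in> orbit f a \<Longrightarrow> \<psi> x \<in> carrier G"
  shows "(\<Sum>k\<in>irrep_classes G. of_nat (class_dim G k) *
      (\<Sum>i\<in>orbit f a \<rightarrow>\<^sub>E {..<class_dim G k}. \<Prod>x\<in>orbit f a. class_rep k (\<psi> x) $$ (i x, i (f x))))
    = (if \<forall>b\<in>orbit f a. cycle_prod f \<psi> b = \<one> then of_nat (card (carrier G)) else 0)"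
proof -
  have cp: "cycle_prod f \<psi> a \<in> carrier G"
    unfolding cycle_prod_def by (rule foldr_mult_closed) (use \<psi> orbit_eq_support[OF f] in auto)
  have "(\<Sum>i\<in>orbit f a \<rightarrow>\<^sub>E {..<class_dim G k}. \<Prod>x\<in>orbit f a. class_rep k (\<psi> x) $$ (i x, i (f x)))
      = class_trace k (cycle_prod f \<psi> a)" if k: "k \<in> irrep_classes G" for k
  proof -
    have R: "mat_rep G (class_dim G k) (class_rep k)"
      using class_rep_irreducible[OF k] unfolding irreducible_mat_rep_def by simp
    have "(\<Sum>i\<in>orbit f a \<rightarrow>\<^sub>E {..<class_dim G k}. \<Prod>x\<in>orbit f a. class_rep k (\<psi> x) $$ (i x, i (f x)))
      = (\<Sum>r<class_dim G k. mat_list_prod (class_dim G k) (\<lambda>x. class_rep k (\<psi> x)) (support f a) $$ (r, r))"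
      by (rule sum_orbit_trace[OF f]) (rule class_rep_carrier[OF k \<psi>])
    also have "mat_list_prod (class_dim G k) (\<lambda>x. class_rep k (\<psi> x)) (support f a) = class_rep k (cycle_prod f \<psi> a)"
      unfolding cycle_prod_def by (rule rep_foldr[OF R]) (use \<psi> orbit_eq_support[OF f] in auto)
    finally show ?thesis unfolding class_trace_def .
  qed
  then have "(\<Sum>k\<in>irrep_classes G. of_nat (class_dim G k) *
      (\<Sum>i\<in>orbit f a \<rightarrow>\<^sub>E {..<class_dim G k}. \<Prod>x\<in>orbit f a. class_rep k (\<psi> x) $$ (i x, i (f x))))
      = (\<Sum>k\<in>irrep_classes G. of_nat (class_dim G k) * class_trace k (cycle_prod f \<psi> a))"
    by (intro sum.cong refl) simp
  also have "\<dots> = (if cycle_prod f \<psi> a = \<one> then of_nat (card (carrier G)) else 0)"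
    by (rule completeness[OF cp])
  also have "cycle_prod f \<psi> a = \<one> \<longleftrightarrow> (\<forall>b\<in>orbit f a. cycle_prod f \<psi> b = \<one>)"
  proof
    assume one: "cycle_prod f \<psi> a = \<one>"
    have "\<exists>h. potential f (orbit f a) \<psi> h" by (rule ex_potential_orbit[OF f _ one]) (rule \<psi>)
    then obtain h where h: "potential f (orbit f a) \<psi> h" by blast
    show "\<forall>b\<in>orbit f a. cycle_prod f \<psi> b = \<one>"
      by (intro ballI cycle_prod_potential[OF f h]) (rule orbit.step)
  next
    assume "\<forall>b\<in>orbit f a. cycle_prod f \<psi> b = \<one>"
    then show "cycle_prod f \<psi> a = \<one>" using permutation_self_in_orbit[OF f] by blast
  qed
  finally show ?thesis .
qed

end

locale map_state_sum = finite_group G + oriented_involutions C \<theta> \<sigma> c P L T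
  for G :: "('g, 'x) monoid_scheme" (structure) and C :: "'c set" and \<theta> \<sigma> c P L T
begin

definition vstep :: "'c \<Rightarrow> 'c" where "vstep x = c (\<sigma> x)"

lemma vstep_eq: "c \<circ> \<sigma> = vstep" by (auto simp: vstep_def)

lemma vstep_permutes: "vstep permutes C"
  unfolding vstep_eq[symmetric] by (rule permutes_compose[OF si.perm co.perm])

lemma vstep_permutation: "permutation vstep"
  by (rule permutes_finite_permutation[OF th.fin vstep_permutes])

lemma vstep_P: "x \<in> P \<Longrightarrow> vstep x \<in> P"
  unfolding vstep_def using memP(2)[OF si.closed, of x] memP(1)[of x] PC by auto

lemma vstep_sigma: "vstep (\<sigma> (vstep x)) = \<sigma> x"
  unfolding vstep_def by (simp add: si.inv co.inv)

definition edge_funs :: "('c \<Rightarrow> 'g) set" where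
  "edge_funs = {\<psi> \<in> C \<rightarrow>\<^sub>E carrier G. \<forall>a\<in>C. \<psi> (\<sigma> a) = inv (\<psi> a) \<and> \<psi> (\<theta> a) = \<psi> a}"

definition flows :: "('c \<Rightarrow> 'g) set" where
  "flows = {\<psi> \<in> edge_funs. \<forall>a\<in>C. cycle_prod vstep \<psi> a = \<one>}"

definition extend :: "('c \<Rightarrow> 'g) \<Rightarrow> 'c \<Rightarrow> 'g" where
  "extend \<xi> x = (if x \<in> C then if x \<in> T then \<xi> x else if \<theta> x \<in> T then \<xi> (\<theta> x)
     else if \<sigma> x \<in> T then inv (\<xi> (\<sigma> x)) else inv (\<xi> (\<theta> (\<sigma> x))) else undefined)"

lemma extend_edge_fun:
  assumes \<xi>: "\<xi> \<in> T \<rightarrow>\<^sub>E carrier G"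
  shows "extend \<xi> \<in> edge_funs"
proof -
  have c: "\<xi> t \<in> carrier G" if "t \<in> T" for t by (rule PiE_mem[OF \<xi> that])
  have "extend \<xi> x \<in> carrier G" if "x \<in> C" for x
    unfolding extend_def using edge_unique[OF that] c that by auto
  moreover have "extend \<xi> (\<sigma> x) = inv (extend \<xi> x) \<and> extend \<xi> (\<theta> x) = extend \<xi> x" if "x \<in> C" for x
  proof -
    have C: "\<sigma> x \<in> C" "\<theta> x \<in> C" using si.closed th.closed that by auto
    have e: "\<sigma> (\<theta> x) = \<theta> (\<sigma> x)" "\<theta> (\<theta> (\<sigma> x)) = \<sigma> x" using commute th.inv by auto
    show ?thesis unfolding extend_def using edge_unique[OF that] that C c
      by (elim disjE) (auto simp: th.inv si.inv e)
  qed
  ultimately show ?thesis unfolding edge_funs_def extend_def by (auto intro!: PiE_I)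
qed

lemma bij_extend: "bij_betw extend (T \<rightarrow>\<^sub>E carrier G) edge_funs"
proof (rule bij_betw_byWitness[where f' = "\<lambda>\<psi>. restrict \<psi> T"])
  show "\<forall>\<xi>\<in>T \<rightarrow>\<^sub>E carrier G. restrict (extend \<xi>) T = \<xi>"
  proof (intro ballI ext)
    fix \<xi> x assume \<xi>: "\<xi> \<in> T \<rightarrow>\<^sub>E carrier G"
    show "restrict (extend \<xi>) T x = \<xi> x"
      using PiE_arb[OF \<xi>, of x] TC[of x] by (cases "x \<in> T") (simp_all add: extend_def)
  qed
  show "\<forall>\<psi>\<in>edge_funs. extend (restrict \<psi> T) = \<psi>"
  proof (intro ballI ext)
    fix \<psi> x assume \<psi>: "\<psi> \<in> edge_funs"
    show "extend (restrict \<psi> T) x = \<psi> x"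
    proof (cases "x \<in> C")
      case True
      have C: "\<sigma> x \<in> C" using si.closed True by auto
      have p: "\<psi> (\<theta> x) = \<psi> x" "\<psi> (\<sigma> x) = inv (\<psi> x)" "\<psi> (\<theta> (\<sigma> x)) = inv (\<psi> x)" "\<psi> x \<in> carrier G"
      proof -
        have e: "\<psi> (\<sigma> y) = inv (\<psi> y) \<and> \<psi> (\<theta> y) = \<psi> y" if "y \<in> C" for y
          using \<psi> that unfolding edge_funs_def by blast
        show "\<psi> (\<theta> x) = \<psi> x" "\<psi> (\<sigma> x) = inv (\<psi> x)" using e[OF True] by simp_all
        then show "\<psi> (\<theta> (\<sigma> x)) = inv (\<psi> x)" using e[OF C] by simp
        show "\<psi> x \<in> carrier G" using \<psi> True unfolding edge_funs_def by blast
      qed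
      from edge_unique[OF True] show ?thesis
        unfolding extend_def restrict_apply by (elim disjE) (simp_all add: True p)
    next
      case False
      have "\<psi> \<in> C \<rightarrow>\<^sub>E carrier G" using \<psi> unfolding edge_funs_def by blast
      from PiE_arb[OF this False] show ?thesis using False unfolding extend_def by simp
    qed
  qed
  show "extend ` (T \<rightarrow>\<^sub>E carrier G) \<subseteq> edge_funs" using extend_edge_fun by blast
  show "(\<lambda>\<psi>. restrict \<psi> T) ` edge_funs \<subseteq> T \<rightarrow>\<^sub>E carrier G"
  proof (rule image_subsetI)
    fix \<psi> assume "\<psi> \<in> edge_funs"
    then have "\<psi> x \<in> carrier G" if "x \<in> T" for x using TC[OF that] unfolding edge_funs_def by auto
    then show "restrict \<psi> T \<in> T \<rightarrow>\<^sub>E carrier G" by (simp only: restrict_PiE_iff) blast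
  qed
qed

lemma extend_T: "t \<in> T \<Longrightarrow> extend \<xi> t = \<xi> t"
  unfolding extend_def using TC by simp

lemma extend_partner:
  assumes t: "t \<in> T"
  shows "extend \<xi> (partner t) = (if \<theta> t \<in> P then \<xi> t else inv (\<xi> t))"
proof -
  have C: "t \<in> C" "\<theta> t \<in> C" "\<theta> (\<sigma> t) \<in> C" using TC[OF t] th.closed si.closed by auto
  have e: "\<sigma> (\<theta> (\<sigma> t)) = \<theta> t" "\<theta> (\<theta> x) = x" for x using commute si.inv th.inv by metis+
  show ?thesis unfolding extend_def partner_def using edge_unique[OF C(1)] t C by (auto simp: e)
qed

lemma sum_edge_funs:
  fixes F :: "'c \<Rightarrow> 'g \<Rightarrow> complex"
  shows "(\<Sum>\<psi>\<in>edge_funs. \<Prod>x\<in>P. F x (\<psi> x)) =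
    (\<Prod>t\<in>T. \<Sum>g\<in>carrier G. F t g * F (partner t) (if \<theta> t \<in> P then g else inv g))"
proof -
  have "(\<Sum>\<psi>\<in>edge_funs. \<Prod>x\<in>P. F x (\<psi> x)) = (\<Sum>\<xi>\<in>T \<rightarrow>\<^sub>E carrier G. \<Prod>x\<in>P. F x (extend \<xi> x))"
    by (rule sum.reindex_bij_betw[OF bij_extend, symmetric])
  also have "\<dots> = (\<Sum>\<xi>\<in>T \<rightarrow>\<^sub>E carrier G. \<Prod>t\<in>T. F t (\<xi> t) * F (partner t) (if \<theta> t \<in> P then \<xi> t else inv (\<xi> t)))"
    unfolding prod_P by (intro sum.cong prod.cong refl) (simp only: extend_T extend_partner)
  also have "\<dots> = (\<Prod>t\<in>T. \<Sum>g\<in>carrier G. F t g * F (partner t) (if \<theta> t \<in> P then g else inv g))"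
    by (rule prod_sum_PiE[symmetric]) (use finites fin_carrier in auto)
  finally show ?thesis .
qed

abbreviation Orb :: "'c set set" where "Orb \<equiv> orbit vstep ` P"

lemma Orb_facts: "finite Orb" "disjoint Orb" "\<Union>Orb = P"
  using finites disjoint_orbits[OF vstep_permutation] Union_orbits[OF vstep_permutation vstep_P] by auto

lemma orbit_mem_Orb: "Q \<in> Orb \<Longrightarrow> x \<in> Q \<Longrightarrow> orbit vstep x = Q"
  using orbit_eq_of_mem[OF vstep_permutation] by auto

lemma edge_fun_carrier: "\<psi> \<in> edge_funs \<Longrightarrow> x \<in> C \<Longrightarrow> \<psi> x \<in> carrier G"
  unfolding edge_funs_def by auto

lemma flow_iff:
  assumes \<psi>: "\<psi> \<in> edge_funs"
  shows "(\<forall>a\<in>C. cycle_prod vstep \<psi> a = \<one>) \<longleftrightarrow> (\<forall>Q\<in>Orb. \<forall>a\<in>Q. cycle_prod vstep \<psi> a = \<one>)"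
proof
  assume "\<forall>a\<in>C. cycle_prod vstep \<psi> a = \<one>"
  then show "\<forall>Q\<in>Orb. \<forall>a\<in>Q. cycle_prod vstep \<psi> a = \<one>" using Orb_facts(3) PC by blast
next
  assume "\<forall>Q\<in>Orb. \<forall>a\<in>Q. cycle_prod vstep \<psi> a = \<one>"
  then have one: "cycle_prod vstep \<psi> a = \<one>" if "a \<in> P" for a using Orb_facts(3) that by blast
  have "\<exists>h. potential vstep P \<psi> h"
    by (rule ex_potential[OF vstep_permutation vstep_P _ one]) (use edge_fun_carrier[OF \<psi>] PC in auto)
  then obtain h where h: "potential vstep P \<psi> h" by blast
  let ?h = "\<lambda>x. h (vstep (\<sigma> x))"
  have h': "potential vstep (C - P) \<psi> ?h" unfolding potential_def
  proof
    fix x assume x: "x \<in> C - P"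
    have xC: "x \<in> C" and sx: "\<sigma> x \<in> P" using x memP(1) by auto
    have hc: "h (\<sigma> x) \<in> carrier G" "h (vstep (\<sigma> x)) \<in> carrier G" and e: "\<psi> (\<sigma> x) = inv (h (\<sigma> x)) \<otimes> h (vstep (\<sigma> x))"
      using h sx vstep_P[OF sx] unfolding potential_def by blast+
    have "\<psi> x = \<psi> (\<sigma> (\<sigma> x))" by (simp add: si.inv)
    also have "\<dots> = inv (\<psi> (\<sigma> x))" using \<psi> si.closed[OF xC] unfolding edge_funs_def by blast
    also have "\<dots> = inv (h (vstep (\<sigma> x))) \<otimes> h (\<sigma> x)" unfolding e using hc by (simp add: inv_mult_group)
    finally show "?h x \<in> carrier G \<and> \<psi> x = inv (?h x) \<otimes> ?h (vstep x)" using hc by (simp add: vstep_sigma)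
  qed
  have cl: "vstep x \<in> C - P" if "x \<in> C - P" for x
    unfolding vstep_def using that memP(2)[OF si.closed, of x] memP(1)[of x] co.closed si.closed by auto
  show "\<forall>a\<in>C. cycle_prod vstep \<psi> a = \<one>"
  proof
    fix a assume "a \<in> C"
    then show "cycle_prod vstep \<psi> a = \<one>"
      using one cycle_prod_potential[OF vstep_permutation h' cl, of a] by (cases "a \<in> P") auto
  qed
qed

definition edge_sum :: "('c \<Rightarrow> ('g \<Rightarrow> complex mat) set) \<Rightarrow> ('c \<Rightarrow> nat) \<Rightarrow> 'c \<Rightarrow> complex" where
  "edge_sum \<kappa> i t = (\<Sum>g\<in>carrier G. class_rep (\<kappa> t) g $$ (i t, i (vstep t)) *
     class_rep (\<kappa> (partner t)) (if \<theta> t \<in> P then g else inv g) $$ (i (partner t), i (vstep (partner t))))"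

lemma finite_edge_funs: "finite edge_funs"
  using bij_betw_finite[OF bij_extend] finite_PiE[of T "\<lambda>_. carrier G"] finites fin_carrier by simp

lemma state_sum:
  "of_nat (card flows) * of_nat (card (carrier G)) ^ card Orb =
    (\<Sum>\<kappa>\<in>Orb \<rightarrow>\<^sub>E irrep_classes G. (\<Prod>Q\<in>Orb. of_nat (class_dim G (\<kappa> Q))) *
      (\<Sum>i\<in>PiE P (\<lambda>x. {..<class_dim G (\<kappa> (orbit vstep x))}). \<Prod>t\<in>T. edge_sum (\<lambda>x. \<kappa> (orbit vstep x)) i t))"
proof -
  let ?K = "irrep_classes G" and ?N = "of_nat (card (carrier G)) :: complex"
  let ?W = "\<lambda>k \<psi> i x. class_rep k (\<psi> x) $$ (i x, i (vstep x))"
  let ?D = "\<lambda>\<kappa> x. {..<class_dim G (\<kappa> (orbit vstep x))}"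
  have ind: "(if \<forall>a\<in>C. cycle_prod vstep \<psi> a = \<one> then 1 else 0) * ?N ^ card Orb =
      (\<Sum>\<kappa>\<in>Orb \<rightarrow>\<^sub>E ?K. (\<Prod>Q\<in>Orb. of_nat (class_dim G (\<kappa> Q))) *
        (\<Sum>i\<in>PiE P (?D \<kappa>). \<Prod>x\<in>P. ?W (\<kappa> (orbit vstep x)) \<psi> i x))"
    if \<psi>: "\<psi> \<in> edge_funs" for \<psi>
  proof -
    have "(if \<forall>a\<in>C. cycle_prod vstep \<psi> a = \<one> then 1 else 0) * ?N ^ card Orb =
       (\<Prod>Q\<in>Orb. if \<forall>b\<in>Q. cycle_prod vstep \<psi> b = \<one> then ?N else 0)"
      unfolding flow_iff[OF \<psi>] by (rule prod_indicator[OF Orb_facts(1), symmetric])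
    also have "\<dots> = (\<Prod>Q\<in>Orb. \<Sum>k\<in>?K. of_nat (class_dim G k) *
        (\<Sum>i\<in>Q \<rightarrow>\<^sub>E {..<class_dim G k}. \<Prod>x\<in>Q. ?W k \<psi> i x))"
    proof (rule prod.cong[OF refl])
      fix Q assume "Q \<in> Orb"
      then obtain a where a: "a \<in> P" "Q = orbit vstep a" by auto
      have "\<psi> x \<in> carrier G" if "x \<in> orbit vstep a" for x
      proof -
        have "x \<in> P" using that a Orb_facts(3) by blast
        then show ?thesis using edge_fun_carrier[OF \<psi>] PC by blast
      qed
      then show "(if \<forall>b\<in>Q. cycle_prod vstep \<psi> b = \<one> then ?N else 0) = (\<Sum>k\<in>?K. of_nat (class_dim G k) *
        (\<Sum>i\<in>Q \<rightarrow>\<^sub>E {..<class_dim G k}. \<Prod>x\<in>Q. ?W k \<psi> i x))"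
        unfolding a(2) by (rule vertex_delta[OF vstep_permutation, symmetric])
    qed
    also have "\<dots> = (\<Sum>\<kappa>\<in>Orb \<rightarrow>\<^sub>E ?K. \<Prod>Q\<in>Orb. of_nat (class_dim G (\<kappa> Q)) *
        (\<Sum>i\<in>Q \<rightarrow>\<^sub>E {..<class_dim G (\<kappa> Q)}. \<Prod>x\<in>Q. ?W (\<kappa> Q) \<psi> i x))"
      by (rule prod_sum_PiE[OF Orb_facts(1)]) (rule finite_irrep_classes)
    also have "\<dots> = (\<Sum>\<kappa>\<in>Orb \<rightarrow>\<^sub>E ?K. (\<Prod>Q\<in>Orb. of_nat (class_dim G (\<kappa> Q))) *
        (\<Sum>i\<in>PiE P (?D \<kappa>). \<Prod>x\<in>P. ?W (\<kappa> (orbit vstep x)) \<psi> i x))"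
    proof (rule sum.cong[OF refl])
      fix \<kappa> assume "\<kappa> \<in> Orb \<rightarrow>\<^sub>E ?K"
      have finQ: "\<forall>Q\<in>Orb. finite Q" using finites(1) Orb_facts(3) by (metis Union_upper finite_subset)
      have dis: "\<forall>A\<in>Orb. \<forall>B\<in>Orb. A \<noteq> B \<longrightarrow> A \<inter> B = {}" using Orb_facts(2) by (simp add: disjoint_def)
      have "(\<Prod>Q\<in>Orb. \<Sum>i\<in>Q \<rightarrow>\<^sub>E {..<class_dim G (\<kappa> Q)}. \<Prod>x\<in>Q. ?W (\<kappa> Q) \<psi> i x) =
         (\<Prod>Q\<in>Orb. \<Sum>i\<in>PiE Q (?D \<kappa>). \<Prod>x\<in>Q. ?W (\<kappa> Q) \<psi> i x)"
      proof (rule prod.cong[OF refl], rule sum.cong)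
        fix Q assume Q: "Q \<in> Orb"
        show "Q \<rightarrow>\<^sub>E {..<class_dim G (\<kappa> Q)} = PiE Q (?D \<kappa>)"
        proof (rule PiE_cong)
          fix x assume "x \<in> Q"
          show "{..<class_dim G (\<kappa> Q)} = ?D \<kappa> x" unfolding orbit_mem_Orb[OF Q \<open>x \<in> Q\<close>] ..
        qed
      qed (rule refl)
      also have "\<dots> = (\<Sum>i\<in>PiE (\<Union>Orb) (?D \<kappa>). \<Prod>Q\<in>Orb. \<Prod>x\<in>Q. ?W (\<kappa> Q) \<psi> (restrict i Q) x)"
        by (rule prod_sum_PiE_Union[OF Orb_facts(1,2)])
      also have "\<dots> = (\<Sum>i\<in>PiE P (?D \<kappa>). \<Prod>x\<in>P. ?W (\<kappa> (orbit vstep x)) \<psi> i x)"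
        unfolding Orb_facts(3)
      proof (rule sum.cong[OF refl])
        fix i
        have "(\<Prod>Q\<in>Orb. \<Prod>x\<in>Q. ?W (\<kappa> Q) \<psi> (restrict i Q) x) = (\<Prod>Q\<in>Orb. \<Prod>x\<in>Q. ?W (\<kappa> (orbit vstep x)) \<psi> i x)"
        proof (intro prod.cong refl)
          fix Q x assume Q: "Q \<in> Orb" "x \<in> Q"
          have "vstep x \<in> Q" using Q orbit.step by auto
          then show "?W (\<kappa> Q) \<psi> (restrict i Q) x = ?W (\<kappa> (orbit vstep x)) \<psi> i x"
            using Q orbit_mem_Orb[OF Q] by simp
        qed
        also have "\<dots> = (\<Prod>x\<in>\<Union>Orb. ?W (\<kappa> (orbit vstep x)) \<psi> i x)"
          by (rule prod.Union_disjoint[OF finQ dis, unfolded o_def, symmetric])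
        finally show "(\<Prod>Q\<in>Orb. \<Prod>x\<in>Q. ?W (\<kappa> Q) \<psi> (restrict i Q) x) = (\<Prod>x\<in>P. ?W (\<kappa> (orbit vstep x)) \<psi> i x)"
          unfolding Orb_facts(3) .
      qed
      finally show "(\<Prod>Q\<in>Orb. of_nat (class_dim G (\<kappa> Q)) *
        (\<Sum>i\<in>Q \<rightarrow>\<^sub>E {..<class_dim G (\<kappa> Q)}. \<Prod>x\<in>Q. ?W (\<kappa> Q) \<psi> i x)) =
        (\<Prod>Q\<in>Orb. of_nat (class_dim G (\<kappa> Q))) * (\<Sum>i\<in>PiE P (?D \<kappa>). \<Prod>x\<in>P. ?W (\<kappa> (orbit vstep x)) \<psi> i x)"
        unfolding prod.distrib by (rule arg_cong)
    qed
    finally show ?thesis .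
  qed
  have "of_nat (card flows) * ?N ^ card Orb =
     (\<Sum>\<psi>\<in>edge_funs. (if \<forall>a\<in>C. cycle_prod vstep \<psi> a = \<one> then 1 else 0) * ?N ^ card Orb)"
    unfolding flows_def sum_distrib_right[symmetric] using finite_edge_funs by (simp add: sum.If_cases Int_def)
  also have "\<dots> = (\<Sum>\<psi>\<in>edge_funs. \<Sum>\<kappa>\<in>Orb \<rightarrow>\<^sub>E ?K. (\<Prod>Q\<in>Orb. of_nat (class_dim G (\<kappa> Q))) *
        (\<Sum>i\<in>PiE P (?D \<kappa>). \<Prod>x\<in>P. ?W (\<kappa> (orbit vstep x)) \<psi> i x))"
    by (intro sum.cong refl ind)
  also have "\<dots> = (\<Sum>\<kappa>\<in>Orb \<rightarrow>\<^sub>E ?K. (\<Prod>Q\<in>Orb. of_nat (class_dim G (\<kappa> Q))) *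
        (\<Sum>i\<in>PiE P (?D \<kappa>). \<Sum>\<psi>\<in>edge_funs. \<Prod>x\<in>P. ?W (\<kappa> (orbit vstep x)) \<psi> i x))"
    by (subst sum.swap, rule sum.cong[OF refl], subst sum_distrib_left[symmetric], subst sum.swap) (rule refl)
  also have "\<dots> = (\<Sum>\<kappa>\<in>Orb \<rightarrow>\<^sub>E ?K. (\<Prod>Q\<in>Orb. of_nat (class_dim G (\<kappa> Q))) *
      (\<Sum>i\<in>PiE P (?D \<kappa>). \<Prod>t\<in>T. edge_sum (\<lambda>x. \<kappa> (orbit vstep x)) i t))"
    unfolding edge_sum_def
    by (intro sum.cong refl arg_cong2[where f = "(*)"] sum_edge_funs)
  finally show ?thesis .
qed

end

context map_state_sum
begin

lemma edge_sum_eq_0: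
  assumes \<kappa>: "\<kappa> t \<in> irrep_classes G" "\<kappa> (partner t) \<in> irrep_classes G"
    and bad: "\<not> (if \<theta> t \<in> P then dual_pair (\<kappa> t) (\<kappa> (partner t)) else \<kappa> t = \<kappa> (partner t))"
    and i: "i t < class_dim G (\<kappa> t)" "i (vstep t) < class_dim G (\<kappa> t)"
      "i (partner t) < class_dim G (\<kappa> (partner t))" "i (vstep (partner t)) < class_dim G (\<kappa> (partner t))"
  shows "edge_sum \<kappa> i t = 0"
proof (cases "\<theta> t \<in> P")
  case True
  then have "\<not> dual_pair (\<kappa> t) (\<kappa> (partner t))" using bad by simp
  from not_dual_pair_orthogonal[OF \<kappa> this i] show ?thesis
    unfolding edge_sum_def if_P[OF True] .
next
  case False
  then have "\<kappa> t \<noteq> \<kappa> (partner t)" using bad by simp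
  then show ?thesis
    unfolding edge_sum_def if_not_P[OF False] class_orthogonality[OF \<kappa> i] by simp
qed

lemma edge_sum_const:
  assumes k: "k \<in> irrep_classes G" and sd: "\<theta> t \<in> P \<Longrightarrow> invariant_form k \<epsilon> B B'"
    and i: "i t < class_dim G k" "i (vstep t) < class_dim G k"
      "i (partner t) < class_dim G k" "i (vstep (partner t)) < class_dim G k"
  shows "edge_sum (\<lambda>x. k) i t = of_nat (card (carrier G)) / of_nat (class_dim G k) *
    (if \<theta> t \<in> P then B $$ (i t, i (partner t)) * B' $$ (i (c (\<sigma> (partner t))), i (c (\<sigma> t)))
     else if i t = i (c (\<sigma> (partner t))) \<and> i (c (\<sigma> t)) = i (partner t) then 1 else 0)"
proof (cases "\<theta> t \<in> P")
  case True
  have "(\<Sum>g\<in>carrier G. class_rep k g $$ (i t, i (vstep t)) * class_rep k g $$ (i (partner t), i (vstep (partner t)))) =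
    of_nat (card (carrier G)) / of_nat (class_dim G k) *
      (B $$ (i t, i (partner t)) * B' $$ (i (vstep (partner t)), i (vstep t)))"
    using sd[OF True] i unfolding invariant_form_def by blast
  then show ?thesis unfolding edge_sum_def if_P[OF True] vstep_def .
next
  case False
  show ?thesis
    unfolding edge_sum_def if_not_P[OF False] class_orthogonality[OF k k i] unfolding vstep_def by auto
qed

text \<open>If the only assignments of representations to the vertices that survive the edge sums are
  the constant ones with values in \<open>K\<close>, each of them contributes one closed index sum.\<close>

lemma flow_count:
  assumes ne: "P \<noteq> {}" and K: "K \<subseteq> irrep_classes G"
    and surv: "\<And>\<kappa>. \<kappa> \<in> Orb \<rightarrow>\<^sub>E irrep_classes G \<Longrightarrow>
      (\<And>t. t \<in> T \<Longrightarrow> if \<theta> t \<in> P then dual_pair (\<kappa> (orbit vstep t)) (\<kappa> (orbit vstep (partner t)))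
         else \<kappa> (orbit vstep t) = \<kappa> (orbit vstep (partner t))) \<Longrightarrow>
      \<exists>k\<in>K. \<kappa> = (\<lambda>Q\<in>Orb. k)"
    and form: "\<And>k. k \<in> K \<Longrightarrow> \<epsilon> k * \<epsilon> k = 1 \<and> (twisted \<noteq> {} \<longrightarrow> (\<exists>B B'. invariant_form k (\<epsilon> k) B B'))"
    and form1: "\<And>k. twisted = {} \<Longrightarrow> k \<in> K \<Longrightarrow> \<epsilon> k = 1"
  shows "of_nat (card flows) * of_nat (card (carrier G)) ^ card Orb =
    (\<Sum>k\<in>K. of_nat (class_dim G k) ^ card Orb * (of_nat (card (carrier G)) / of_nat (class_dim G k)) ^ card T *
       (\<epsilon> k ^ card {t \<in> twisted. t \<in> L \<longleftrightarrow> \<sigma> t \<in> L} * of_nat (class_dim G k) ^ card (orbit (c \<circ> \<theta>) ` L)))"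
proof -
  let ?KK = "irrep_classes G" and ?N = "of_nat (card (carrier G)) :: complex"
  let ?F = "\<lambda>\<kappa>. (\<Prod>Q\<in>Orb. of_nat (class_dim G (\<kappa> Q))) *
      (\<Sum>i\<in>PiE P (\<lambda>x. {..<class_dim G (\<kappa> (orbit vstep x))}). \<Prod>t\<in>T. edge_sum (\<lambda>x. \<kappa> (orbit vstep x)) i t)"
  let ?cst = "\<lambda>k. \<lambda>Q\<in>Orb. k"
  have OrbP: "orbit vstep x \<in> Orb" if "x \<in> P" for x using that by simp
  have TP: "t \<in> P" "partner t \<in> P" "vstep t \<in> P" "vstep (partner t) \<in> P" if "t \<in> T" for t
  proof -
    show 1: "t \<in> P" using that T(1) by blast
    show 2: "partner t \<in> P" by (rule partner_in[OF 1])
    show "vstep t \<in> P" "vstep (partner t) \<in> P" using vstep_P[OF 1] vstep_P[OF 2] .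
  qed
  have orb_step: "orbit vstep (vstep x) = orbit vstep x" for x by (rule permutation_orbit_step[OF vstep_permutation])
  have fin: "finite (Orb \<rightarrow>\<^sub>E ?KK)" by (rule finite_PiE[OF Orb_facts(1)]) (rule finite_irrep_classes)
  have sub: "?cst ` K \<subseteq> Orb \<rightarrow>\<^sub>E ?KK" using K by (auto simp: restrict_PiE_iff)
  have zero: "?F \<kappa> = 0" if \<kappa>: "\<kappa> \<in> (Orb \<rightarrow>\<^sub>E ?KK) - ?cst ` K" for \<kappa>
  proof -
    have \<kappa>P: "\<kappa> \<in> Orb \<rightarrow>\<^sub>E ?KK" using \<kappa> by blast
    have "\<not> (\<exists>k\<in>K. \<kappa> = ?cst k)" using \<kappa> by blast
    then have "\<not> (\<forall>t\<in>T. if \<theta> t \<in> P then dual_pair (\<kappa> (orbit vstep t)) (\<kappa> (orbit vstep (partner t)))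
         else \<kappa> (orbit vstep t) = \<kappa> (orbit vstep (partner t)))"
      using surv[OF \<kappa>P] by blast
    then obtain t where t: "t \<in> T" and bad: "\<not> (if \<theta> t \<in> P then dual_pair (\<kappa> (orbit vstep t)) (\<kappa> (orbit vstep (partner t)))
         else \<kappa> (orbit vstep t) = \<kappa> (orbit vstep (partner t)))" by blast
    have "(\<Prod>t\<in>T. edge_sum (\<lambda>x. \<kappa> (orbit vstep x)) i t) = 0"
      if i: "i \<in> PiE P (\<lambda>x. {..<class_dim G (\<kappa> (orbit vstep x))})" for i
    proof (rule prod_zero[OF finites(3)], rule bexI[OF _ t], rule edge_sum_eq_0[OF _ _ bad])
      have ii: "i x < class_dim G (\<kappa> (orbit vstep x))" if "x \<in> P" for x
        using PiE_mem[OF i that] by simp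
      show "\<kappa> (orbit vstep t) \<in> ?KK" "\<kappa> (orbit vstep (partner t)) \<in> ?KK"
        using PiE_mem[OF \<kappa>P OrbP[OF TP(1)[OF t]]] PiE_mem[OF \<kappa>P OrbP[OF TP(2)[OF t]]] .
      show "i t < class_dim G (\<kappa> (orbit vstep t))" "i (partner t) < class_dim G (\<kappa> (orbit vstep (partner t)))"
        using ii[OF TP(1)[OF t]] ii[OF TP(2)[OF t]] .
      show "i (vstep t) < class_dim G (\<kappa> (orbit vstep t))"
        using ii[OF TP(3)[OF t]] unfolding orb_step .
      show "i (vstep (partner t)) < class_dim G (\<kappa> (orbit vstep (partner t)))"
        using ii[OF TP(4)[OF t]] unfolding orb_step .
    qed
    then show ?thesis by (simp add: sum.neutral)
  qed
  have Orb0: "Orb \<noteq> {}" using ne by simp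
  have inj: "inj_on ?cst K"
  proof (rule inj_onI)
    fix k l assume "?cst k = ?cst l"
    moreover obtain Q where "Q \<in> Orb" using Orb0 by blast
    ultimately show "k = l" by (metis restrict_apply')
  qed
  have val: "?F (?cst k) = of_nat (class_dim G k) ^ card Orb * (?N / of_nat (class_dim G k)) ^ card T *
       (\<epsilon> k ^ card {t \<in> twisted. t \<in> L \<longleftrightarrow> \<sigma> t \<in> L} * of_nat (class_dim G k) ^ card (orbit (c \<circ> \<theta>) ` L))"
    if k: "k \<in> K" for k
  proof -
    let ?d = "class_dim G k"
    have kK: "k \<in> ?KK" using k K by blast
    obtain B B' where B: "B \<in> carrier_mat ?d ?d" "B' \<in> carrier_mat ?d ?d" "B * B' = 1\<^sub>m ?d"
      and tr: "transpose_mat B = \<epsilon> k \<cdot>\<^sub>m B" "transpose_mat B' = \<epsilon> k \<cdot>\<^sub>m B'"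
      and fm: "twisted \<noteq> {} \<Longrightarrow> invariant_form k (\<epsilon> k) B B'"
    proof (cases "twisted = {}")
      case True
      have "\<epsilon> k = 1" by (rule form1[OF True k])
      then have one: "transpose_mat (1\<^sub>m ?d) = \<epsilon> k \<cdot>\<^sub>m 1\<^sub>m ?d" by (intro eq_matI) auto
      show ?thesis by (rule that[OF _ _ _ one one]) (use True in simp_all)
    next
      case False
      then obtain B B' where "invariant_form k (\<epsilon> k) B B'" using form[OF k] by blast
      then show ?thesis using that[of B B'] unfolding invariant_form_def by blast
    qed
    have B4: "B' * B = 1\<^sub>m ?d" by (rule mat_mult_left_right_inverse[OF B])
    have sym: "A $$ (i,j) = \<epsilon> k * A $$ (j,i)" if A: "A \<in> carrier_mat ?d ?d" "transpose_mat A = \<epsilon> k \<cdot>\<^sub>m A"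
      and ij: "i < ?d" "j < ?d" for A i j
      using arg_cong[OF A(2), of "\<lambda>A. A $$ (j,i)"] A(1) ij by simp
    have tw: "t \<in> T \<Longrightarrow> \<theta> t \<in> P \<Longrightarrow> twisted \<noteq> {}" for t unfolding twisted_def by blast
    have dims: "PiE P (\<lambda>x. {..<class_dim G (?cst k (orbit vstep x))}) = P \<rightarrow>\<^sub>E {..<?d}"
      by (rule PiE_cong) (simp add: OrbP)
    let ?W = "\<lambda>i t. if \<theta> t \<in> P then B $$ (i t, i (partner t)) * B' $$ (i (c (\<sigma> (partner t))), i (c (\<sigma> t)))
     else if i t = i (c (\<sigma> (partner t))) \<and> i (c (\<sigma> t)) = i (partner t) then 1 else 0"
    have es: "edge_sum (\<lambda>x. ?cst k (orbit vstep x)) i t = ?N / of_nat ?d * ?W i t"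
      if i: "i \<in> P \<rightarrow>\<^sub>E {..<?d}" and t: "t \<in> T" for i t
    proof -
      have ii: "i x < ?d" if "x \<in> P" for x using PiE_mem[OF i that] by simp
      have "edge_sum (\<lambda>x. ?cst k (orbit vstep x)) i t = edge_sum (\<lambda>x. k) i t"
        unfolding edge_sum_def using OrbP[OF TP(1)[OF t]] OrbP[OF TP(2)[OF t]] by (simp only: restrict_apply')
      also have "\<dots> = ?N / of_nat ?d * ?W i t"
        by (rule edge_sum_const[OF kK]) (use fm tw[OF t] ii TP[OF t] in blast)+
      finally show ?thesis .
    qed
    have "(\<Sum>i\<in>P \<rightarrow>\<^sub>E {..<?d}. \<Prod>t\<in>T. edge_sum (\<lambda>x. ?cst k (orbit vstep x)) i t) =
        (\<Sum>i\<in>P \<rightarrow>\<^sub>E {..<?d}. (?N / of_nat ?d) ^ card T * (\<Prod>t\<in>T. ?W i t))"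
    proof (rule sum.cong[OF refl])
      fix i assume i: "i \<in> P \<rightarrow>\<^sub>E {..<?d}"
      have "(\<Prod>t\<in>T. edge_sum (\<lambda>x. ?cst k (orbit vstep x)) i t) = (\<Prod>t\<in>T. ?N / of_nat ?d * ?W i t)"
        by (rule prod.cong[OF refl es[OF i]])
      also have "\<dots> = (?N / of_nat ?d) ^ card T * (\<Prod>t\<in>T. ?W i t)"
        unfolding prod.distrib prod_constant ..
      finally show "(\<Prod>t\<in>T. edge_sum (\<lambda>x. ?cst k (orbit vstep x)) i t) = (?N / of_nat ?d) ^ card T * (\<Prod>t\<in>T. ?W i t)" .
    qed
    also have "\<dots> = (?N / of_nat ?d) ^ card T * (\<Sum>i\<in>P \<rightarrow>\<^sub>E {..<?d}. \<Prod>t\<in>T. ?W i t)"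
      by (rule sum_distrib_left[symmetric])
    also have "(\<Sum>i\<in>P \<rightarrow>\<^sub>E {..<?d}. \<Prod>t\<in>T. ?W i t) =
      \<epsilon> k ^ card {t \<in> twisted. t \<in> L \<longleftrightarrow> \<sigma> t \<in> L} * of_nat ?d ^ card (orbit (c \<circ> \<theta>) ` L)"
      by (rule index_sum[OF B B4 sym[OF B(1) tr(1)] sym[OF B(2) tr(2)]]) (assumption | rule conjunct1[OF form[OF k]])+
    finally have "(\<Sum>i\<in>P \<rightarrow>\<^sub>E {..<?d}. \<Prod>t\<in>T. edge_sum (\<lambda>x. ?cst k (orbit vstep x)) i t) = (?N / of_nat ?d) ^ card T *
      (\<epsilon> k ^ card {t \<in> twisted. t \<in> L \<longleftrightarrow> \<sigma> t \<in> L} * of_nat ?d ^ card (orbit (c \<circ> \<theta>) ` L))" .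
    moreover have "(\<Prod>Q\<in>Orb. of_nat (class_dim G (?cst k Q))) = (of_nat ?d :: complex) ^ card Orb"
      by (simp cong: prod.cong)
    ultimately show ?thesis unfolding dims by (simp only: mult.assoc)
  qed
  have "of_nat (card flows) * ?N ^ card Orb = (\<Sum>\<kappa>\<in>Orb \<rightarrow>\<^sub>E ?KK. ?F \<kappa>)" by (rule state_sum)
  also have "\<dots> = (\<Sum>\<kappa>\<in>?cst ` K. ?F \<kappa>)"
    by (rule sum.mono_neutral_right[OF fin sub]) (use zero in blast)
  also have "\<dots> = (\<Sum>k\<in>K. ?F (?cst k))" unfolding sum.reindex[OF inj] o_def ..
  also have "\<dots> = (\<Sum>k\<in>K. of_nat (class_dim G k) ^ card Orb * (?N / of_nat (class_dim G k)) ^ card T *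
       (\<epsilon> k ^ card {t \<in> twisted. t \<in> L \<longleftrightarrow> \<sigma> t \<in> L} * of_nat (class_dim G k) ^ card (orbit (c \<circ> \<theta>) ` L)))"
    by (intro sum.cong refl val)
  finally show ?thesis .
qed

end

context finite_group
begin

lemma sum_class_dim_sq: "(\<Sum>k\<in>irrep_classes G. class_dim G k ^ 2) = card (carrier G)"
proof -
  have "(\<Sum>k\<in>irrep_classes G. of_nat (class_dim G k) * class_trace k \<one>) = (of_nat (card (carrier G)) :: complex)"
    using completeness[OF one_closed] by simp
  moreover have "class_trace k \<one> = of_nat (class_dim G k)" if "k \<in> irrep_classes G" for k
    using class_rep_irreducible[OF that] mat_repD(2)[of G "class_dim G k" "class_rep k"]
    unfolding irreducible_mat_rep_def class_trace_def by simp
  ultimately have "(\<Sum>k\<in>irrep_classes G. of_nat (class_dim G k ^ 2)) = (of_nat (card (carrier G)) :: complex)"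
    by (simp add: power2_eq_square)
  then show ?thesis by (metis of_nat_eq_iff of_nat_sum)
qed

end

lemma power_int_of_two_powers:
  fixes x :: complex
  assumes "x \<noteq> 0"
  shows "x ^ a / x ^ b = x powi (int a - int b)"
  using assms by (simp add: power_int_diff)

context map_state_sum
begin

abbreviation faces :: "'c set set" where "faces \<equiv> orbit (c \<circ> \<theta>) ` L"

abbreviation euler_char :: int where "euler_char \<equiv> int (card Orb) - int (card T) + int (card faces)"

lemma compatible_P:
  assumes compat: "\<And>t. t \<in> T \<Longrightarrow> if \<theta> t \<in> P then dual_pair (\<kappa> t) (\<kappa> (partner t)) else \<kappa> t = \<kappa> (partner t)"
    and irr: "\<And>x. x \<in> P \<Longrightarrow> \<kappa> x \<in> irrep_classes G" and x: "x \<in> P"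
  shows "if \<theta> x \<in> P then dual_pair (\<kappa> x) (\<kappa> (partner x)) else \<kappa> x = \<kappa> (partner x)"
proof (cases "x \<in> T")
  case True
  then show ?thesis by (rule compat)
next
  case False
  have xC: "x \<in> C" using x PC by blast
  have pT: "partner x \<in> T" using partner_T[OF x] False by simp
  have pp: "partner (partner x) = x" by (rule partner_partner[OF x])
  have tw: "\<theta> (partner x) \<in> P \<longleftrightarrow> \<theta> x \<in> P"
    unfolding partner_def using x memP(1)[OF xC] by (simp add: th.inv)
  show ?thesis
  proof (cases "\<theta> x \<in> P")
    case True
    have "dual_pair (\<kappa> (partner x)) (\<kappa> x)" using compat[OF pT] True unfolding tw pp by simp
    then show ?thesis using True dual_pair_sym[OF irr[OF partner_in[OF x]] irr[OF x]] by simp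
  next
    case ut: False
    then show ?thesis using compat[OF pT] unfolding tw pp by simp
  qed
qed

lemma const_assignment:
  assumes \<kappa>: "\<kappa> \<in> Orb \<rightarrow>\<^sub>E K" and k: "\<And>x. x \<in> P \<Longrightarrow> \<kappa> (orbit vstep x) = k"
  shows "\<kappa> = (\<lambda>Q\<in>Orb. k)"
proof
  fix Q show "\<kappa> Q = (\<lambda>Q\<in>Orb. k) Q"
  proof (cases "Q \<in> Orb")
    case True
    then show ?thesis using k by auto
  next
    case False
    then show ?thesis using PiE_arb[OF \<kappa> False] by (simp only: restrict_apply if_False)
  qed
qed

lemma group_order_nz: "(of_nat (card (carrier G)) :: complex) \<noteq> 0"
  using order_pos by simp

lemma combine_powers:
  fixes d N :: complex
  assumes "d \<noteq> 0"
  shows "d ^ card Orb * (N / d) ^ card T * (e * d ^ card faces) = N ^ card T * (e * d powi euler_char)"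
proof -
  have "d powi euler_char = d ^ (card Orb + card faces) / d ^ card T"
    using power_int_of_two_powers[OF assms, of "card Orb + card faces" "card T"] by (simp add: algebra_simps)
  then show ?thesis by (simp add: power_add power_divide)
qed

lemma divide_vertex_power:
  assumes "of_nat (card flows) * (of_nat (card (carrier G)) :: complex) ^ card Orb =
     of_nat (card (carrier G)) ^ card T * S"
  shows "(of_nat (card flows) :: complex) = of_nat (card (carrier G)) powi (int (card T) - int (card Orb)) * S"
proof -
  have "of_nat (card flows) = of_nat (card (carrier G)) ^ card T * S / (of_nat (card (carrier G)) :: complex) ^ card Orb"
    using assms group_order_nz by (simp add: field_simps)
  also have "\<dots> = of_nat (card (carrier G)) ^ card T / of_nat (card (carrier G)) ^ card Orb * S" by simp
  finally show ?thesis unfolding power_int_of_two_powers[OF group_order_nz] .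
qed

theorem flows_orientable:
  assumes ne: "P \<noteq> {}" and ut: "twisted = {}"
    and conn: "\<And>X. X \<subseteq> P \<Longrightarrow> X \<noteq> {} \<Longrightarrow> (\<forall>x\<in>X. vstep x \<in> X \<and> \<theta> (\<sigma> x) \<in> X) \<Longrightarrow> X = P"
  shows "(of_nat (card flows) :: complex) = of_nat (card (carrier G)) powi (int (card T) - int (card Orb)) *
    (\<Sum>k\<in>irrep_classes G. of_nat (class_dim G k) powi euler_char)"
    and "even euler_char"
proof -
  have untw: "\<theta> x \<notin> P" if x: "x \<in> P" for x
  proof (cases "x \<in> T")
    case True
    then show ?thesis using ut unfolding twisted_def by blast
  next
    case False
    then have "partner x \<in> T" using partner_T[OF x] by simp
    then have "\<theta> (partner x) \<notin> P" using ut unfolding twisted_def by blast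
    then show ?thesis using x unfolding partner_def by (auto simp: th.inv)
  qed
  have "of_nat (card flows) * of_nat (card (carrier G)) ^ card Orb =
    (\<Sum>k\<in>irrep_classes G. of_nat (class_dim G k) ^ card Orb * (of_nat (card (carrier G)) / of_nat (class_dim G k)) ^ card T *
       ((1::complex) ^ card {t \<in> twisted. t \<in> L \<longleftrightarrow> \<sigma> t \<in> L} * of_nat (class_dim G k) ^ card (orbit (c \<circ> \<theta>) ` L)))"
  proof (rule flow_count[OF ne subset_refl])
    fix \<kappa> assume \<kappa>: "\<kappa> \<in> Orb \<rightarrow>\<^sub>E irrep_classes G"
      and compat: "\<And>t. t \<in> T \<Longrightarrow> if \<theta> t \<in> P then dual_pair (\<kappa> (orbit vstep t)) (\<kappa> (orbit vstep (partner t)))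
         else \<kappa> (orbit vstep t) = \<kappa> (orbit vstep (partner t))"
    obtain x0 where x0: "x0 \<in> P" using ne by blast
    define X where "X = {x \<in> P. \<kappa> (orbit vstep x) = \<kappa> (orbit vstep x0)}"
    have irr: "\<kappa> (orbit vstep x) \<in> irrep_classes G" if "x \<in> P" for x
      by (rule PiE_mem[OF \<kappa>]) (use that in simp)
    have nb: "\<kappa> (orbit vstep (\<theta> (\<sigma> x))) = \<kappa> (orbit vstep x) \<and> \<theta> (\<sigma> x) \<in> P" if x: "x \<in> P" for x
    proof -
      have p: "partner x = \<theta> (\<sigma> x)" unfolding partner_def using untw[OF x] by simp
      have "if \<theta> x \<in> P then dual_pair (\<kappa> (orbit vstep x)) (\<kappa> (orbit vstep (partner x)))
         else \<kappa> (orbit vstep x) = \<kappa> (orbit vstep (partner x))"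
        by (rule compatible_P[of "\<lambda>x. \<kappa> (orbit vstep x)"]) (use compat irr x in blast)+
      then show ?thesis using partner_in[OF x] untw[OF x] unfolding p by simp
    qed
    have "\<forall>x\<in>X. vstep x \<in> X \<and> \<theta> (\<sigma> x) \<in> X"
    proof
      fix x assume "x \<in> X"
      then have x: "x \<in> P" "\<kappa> (orbit vstep x) = \<kappa> (orbit vstep x0)" unfolding X_def by auto
      show "vstep x \<in> X \<and> \<theta> (\<sigma> x) \<in> X"
        using nb[OF x(1)] vstep_P[OF x(1)] x(2) permutation_orbit_step[OF vstep_permutation, of x] unfolding X_def by simp
    qed
    moreover have "x0 \<in> X" unfolding X_def using x0 by simp
    ultimately have "X = P" by (intro conn) (auto simp: X_def)
    then have "\<kappa> (orbit vstep x) = \<kappa> (orbit vstep x0)" if "x \<in> P" for x using that unfolding X_def by blast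
    from const_assignment[OF \<kappa> this] show "\<exists>k\<in>irrep_classes G. \<kappa> = (\<lambda>Q\<in>Orb. k)" using irr[OF x0] by blast
  qed (use ut in simp_all)
  also have "\<dots> = (\<Sum>k\<in>irrep_classes G. of_nat (card (carrier G)) ^ card T * of_nat (class_dim G k) powi euler_char)"
  proof (rule sum.cong[OF refl])
    fix k assume "k \<in> irrep_classes G"
    then have "(of_nat (class_dim G k) :: complex) \<noteq> 0" using class_dim_pos by simp
    from combine_powers[OF this, of "of_nat (card (carrier G))" "1 ^ card {t \<in> twisted. t \<in> L \<longleftrightarrow> \<sigma> t \<in> L}"]
    show "of_nat (class_dim G k) ^ card Orb * (of_nat (card (carrier G)) / of_nat (class_dim G k)) ^ card T *
       ((1::complex) ^ card {t \<in> twisted. t \<in> L \<longleftrightarrow> \<sigma> t \<in> L} * of_nat (class_dim G k) ^ card (orbit (c \<circ> \<theta>) ` L)) =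
       of_nat (card (carrier G)) ^ card T * of_nat (class_dim G k) powi euler_char" by simp
  qed
  also have "\<dots> = of_nat (card (carrier G)) ^ card T * (\<Sum>k\<in>irrep_classes G. of_nat (class_dim G k) powi euler_char)"
    by (rule sum_distrib_left[symmetric])
  finally show "(of_nat (card flows) :: complex) = of_nat (card (carrier G)) powi (int (card T) - int (card Orb)) *
    (\<Sum>k\<in>irrep_classes G. of_nat (class_dim G k) powi euler_char)"
    by (rule divide_vertex_power)
  have "even (card Orb + card T + card faces)" using euler_parity ut unfolding vstep_eq by simp
  then show "even euler_char" by presburger
qed

text \<open>Functions on the faces act on the trivial flow by gauge transformations, and only the constants
  act trivially.  Compared with the state sum, this bound excludes \<open>\<chi> = 2\<close> for a non-orientable
  component when some representation is not self-dual; for such a representation \<open>F(\<rho>)\<close> to the power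
  \<open>2 - \<chi>\<close> would otherwise be \<open>0\<^sup>0 = 1\<close> instead of \<open>0\<close>.\<close>

lemma gauge_bound:
  assumes ne: "P \<noteq> {}"
    and conn: "\<And>X. X \<subseteq> C \<Longrightarrow> X \<noteq> {} \<Longrightarrow> (\<forall>x\<in>X. vstep x \<in> X \<and> \<theta> (\<sigma> x) \<in> X) \<Longrightarrow> X = C"
  shows "card (carrier G) ^ card faces \<le> card flows * card (carrier G)"
proof -
  define f where "f x = c (\<theta> x)" for x
  have feq: "c \<circ> \<theta> = f" by (auto simp: f_def)
  have f_perm: "permutation f"
    unfolding feq[symmetric]
    by (rule permutes_finite_permutation[OF th.fin permutes_compose[OF th.perm co.perm]])
  have fstep: "orbit f (f x) = orbit f x" for x by (rule permutation_orbit_step[OF f_perm])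
  define face where "face x = orbit f (if x \<in> L then x else c x)" for x
  have faceF: "face x \<in> faces" if "x \<in> C" for x
    unfolding face_def feq using memL(2)[OF that] by auto
  have face_c: "face (c x) = face x" if "x \<in> C" for x
    unfolding face_def using memL(2)[OF that] by (auto simp: co.inv)
  have face_th: "face (\<theta> x) = face x" if "x \<in> C" for x
  proof (cases "x \<in> L")
    case True
    then show ?thesis unfolding face_def using memL(1)[OF that] fstep[of x] by (simp add: f_def)
  next
    case False
    then show ?thesis unfolding face_def using memL(1)[OF that] fstep[of "\<theta> x"] by (simp add: f_def th.inv)
  qed
  obtain x0 where "x0 \<in> P" using ne by blast
  then have x0: "x0 \<in> C" using PC by blast
  define h where "h H x = H (face x)" for H :: "'c set \<Rightarrow> 'g" and x
  define flow where "flow H = (\<lambda>x\<in>C. inv (h H x) \<otimes> h H (vstep x))" for H :: "'c set \<Rightarrow> 'g"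
  have vC: "vstep x \<in> C" "\<sigma> x \<in> C" "\<theta> x \<in> C" "\<theta> (\<sigma> x) \<in> C" if "x \<in> C" for x
    using that permutes_in_image[OF vstep_permutes] si.closed th.closed by auto
  have face_v: "face (vstep x) = face (\<sigma> x)" if "x \<in> C" for x
    unfolding vstep_def by (rule face_c[OF vC(2)[OF that]])
  have hc: "h H x \<in> carrier G" if "H \<in> faces \<rightarrow>\<^sub>E carrier G" "x \<in> C" for H x
    unfolding h_def by (rule PiE_mem[OF that(1) faceF[OF that(2)]])
  have flow: "flow H \<in> flows" if H: "H \<in> faces \<rightarrow>\<^sub>E carrier G" for H
  proof -
    have fl: "flow H x = inv (h H x) \<otimes> h H (vstep x)" if "x \<in> C" for x unfolding flow_def using that by simp
    have c1: "flow H x \<in> carrier G" if "x \<in> C" for x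
      unfolding fl[OF that] using hc[OF H that] hc[OF H vC(1)[OF that]] by simp
    have c2: "flow H (\<sigma> x) = inv (flow H x) \<and> flow H (\<theta> x) = flow H x" if x: "x \<in> C" for x
    proof
      have "h H (vstep (\<sigma> x)) = h H x" unfolding h_def face_v[OF vC(2)[OF x]] by (simp add: si.inv)
      moreover have "h H (\<sigma> x) = h H (vstep x)" unfolding h_def face_v[OF x] ..
      ultimately have "flow H (\<sigma> x) = inv (h H (vstep x)) \<otimes> h H x" unfolding fl[OF vC(2)[OF x]] by simp
      then show "flow H (\<sigma> x) = inv (flow H x)"
        unfolding fl[OF x] using hc[OF H x] hc[OF H vC(1)[OF x]] by (simp add: inv_mult_group)
      have "h H (vstep (\<theta> x)) = h H (vstep x)"
        unfolding h_def face_v[OF x] face_v[OF vC(3)[OF x]] commute[symmetric] by (simp only: face_th[OF vC(2)[OF x]])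
      moreover have "h H (\<theta> x) = h H x" unfolding h_def face_th[OF x] ..
      ultimately show "flow H (\<theta> x) = flow H x" unfolding fl[OF x] fl[OF vC(3)[OF x]] by simp
    qed
    have "flow H \<in> C \<rightarrow>\<^sub>E carrier G"
      by (rule PiE_I) (use c1 in \<open>auto simp: flow_def\<close>)
    then have ef: "flow H \<in> edge_funs" unfolding edge_funs_def using c2 by blast
    have pot: "potential vstep C (flow H) (h H)" unfolding potential_def using fl hc[OF H] by blast
    have "cycle_prod vstep (flow H) a = \<one>" if "a \<in> C" for a
      by (rule cycle_prod_potential[OF vstep_permutation pot vC(1) that])
    then show ?thesis unfolding flows_def using ef by blast
  qed
  have inj: "inj_on (\<lambda>H. (flow H, h H x0)) (faces \<rightarrow>\<^sub>E carrier G)"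
  proof (rule inj_onI)
    fix H H' assume H: "H \<in> faces \<rightarrow>\<^sub>E carrier G" and H': "H' \<in> faces \<rightarrow>\<^sub>E carrier G"
      and eq: "(flow H, h H x0) = (flow H', h H' x0)"
    define X where "X = {x \<in> C. h H x = h H' x}"
    have v: "vstep x \<in> X" if x: "x \<in> X" for x
    proof -
      have xC: "x \<in> C" and e: "h H x = h H' x" using x unfolding X_def by auto
      have "flow H x = flow H' x" using eq by simp
      then have "inv (h H x) \<otimes> h H (vstep x) = inv (h H x) \<otimes> h H' (vstep x)"
        unfolding flow_def using xC e by simp
      then have "h H (vstep x) = h H' (vstep x)"
        using hc[OF H xC] hc[OF H vC(1)[OF xC]] hc[OF H' vC(1)[OF xC]] by simp
      then show ?thesis unfolding X_def using vC(1)[OF xC] by simp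
    qed
    have s: "\<theta> (\<sigma> x) \<in> X" if x: "x \<in> X" for x
    proof -
      have xC: "x \<in> C" using x unfolding X_def by auto
      have "face (\<theta> (\<sigma> x)) = face (vstep x)" unfolding face_v[OF xC] by (rule face_th[OF vC(2)[OF xC]])
      then have "h H (\<theta> (\<sigma> x)) = h H (vstep x)" "h H' (\<theta> (\<sigma> x)) = h H' (vstep x)" unfolding h_def by simp_all
      then show ?thesis using v[OF x] vC(4)[OF xC] unfolding X_def by simp
    qed
    have "X = C"
    proof (rule conn)
      show "X \<noteq> {}" using eq x0 unfolding X_def by auto
    qed (use v s in \<open>auto simp: X_def\<close>)
    show "H = H'"
    proof (rule PiE_ext[OF H H'])
      fix Q assume "Q \<in> faces"
      then obtain x where x: "x \<in> L" "Q = face x" unfolding feq face_def by auto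
      then have "x \<in> X" using \<open>X = C\<close> LC by blast
      then show "H Q = H' Q" unfolding X_def h_def x(2) by blast
    qed
  qed
  have "finite flows" unfolding flows_def using finite_edge_funs by simp
  then have fin: "finite (flows \<times> carrier G)" using fin_carrier by simp
  have "card (faces \<rightarrow>\<^sub>E carrier G) \<le> card (flows \<times> carrier G)"
  proof (rule card_inj_on_le[OF inj _ fin])
    show "(\<lambda>H. (flow H, h H x0)) ` (faces \<rightarrow>\<^sub>E carrier G) \<subseteq> flows \<times> carrier G"
      using flow hc[OF _ x0] by blast
  qed
  then show ?thesis using finites(2) by (simp add: card_PiE card_cartesian_product)
qed

theorem flows_nonorientable:
  assumes ne: "P \<noteq> {}"
    and conn: "\<And>X. X \<subseteq> C \<Longrightarrow> X \<noteq> {} \<Longrightarrow> (\<forall>x\<in>X. vstep x \<in> X \<and> \<theta> (\<sigma> x) \<in> X) \<Longrightarrow> X = C"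
  shows "(of_nat (card flows) :: complex) = of_nat (card (carrier G)) powi (int (card T) - int (card Orb)) *
    (\<Sum>k\<in>irrep_classes G. class_frobenius_schur G k powi (2 - euler_char) * of_nat (class_dim G k) powi euler_char)"
proof -
  let ?SD = "{k \<in> irrep_classes G. dual_pair k k}"
  let ?n = "card {t \<in> twisted. t \<in> L \<longleftrightarrow> \<sigma> t \<in> L}"
  let ?N = "of_nat (card (carrier G)) :: complex"
  obtain x0 where x0: "x0 \<in> P" using ne by blast
  have tw: "twisted \<noteq> {}"
  proof
    assume ut: "twisted = {}"
    have "\<theta> (\<sigma> x) \<in> P" if x: "x \<in> P" for x
    proof -
      have "\<theta> x \<notin> P"
      proof (cases "x \<in> T")
        case True
        then show ?thesis using ut unfolding twisted_def by blast
      next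
        case False
        then have "partner x \<in> T" using partner_T[OF x] by simp
        then have "\<theta> (partner x) \<notin> P" using ut unfolding twisted_def by blast
        then show ?thesis using x unfolding partner_def by (auto simp: th.inv)
      qed
      then show ?thesis using partner_in[OF x] unfolding partner_def by simp
    qed
    then have "P = C" by (intro conn[OF PC ne]) (use vstep_P in blast)
    then show False using memP(1)[of x0] x0 si.closed by blast
  qed
  have form: "(\<exists>B B'. invariant_form k (class_frobenius_schur G k) B B') \<and>
      (class_frobenius_schur G k = 1 \<or> class_frobenius_schur G k = -1)" if k: "k \<in> ?SD" for k
  proof -
    have kK: "k \<in> irrep_classes G" "dual_pair k k" using k by auto
    obtain \<epsilon> B B' where f: "invariant_form k \<epsilon> B B'" using ex_invariant_form[OF kK] by blast
    have "class_frobenius_schur G k = \<epsilon>" by (rule frobenius_schur_form[OF kK(1) f])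
    moreover have "\<epsilon> = 1 \<or> \<epsilon> = -1" using f unfolding invariant_form_def by blast
    ultimately show ?thesis using f by auto
  qed
  have "of_nat (card flows) * ?N ^ card Orb =
    (\<Sum>k\<in>?SD. of_nat (class_dim G k) ^ card Orb * (?N / of_nat (class_dim G k)) ^ card T *
       (class_frobenius_schur G k ^ ?n * of_nat (class_dim G k) ^ card (orbit (c \<circ> \<theta>) ` L)))"
  proof (rule flow_count[OF ne])
    show "?SD \<subseteq> irrep_classes G" by blast
    show "class_frobenius_schur G k * class_frobenius_schur G k = 1 \<and>
        (twisted \<noteq> {} \<longrightarrow> (\<exists>B B'. invariant_form k (class_frobenius_schur G k) B B'))" if "k \<in> ?SD" for k
      using form[OF that] by auto
    show "class_frobenius_schur G k = 1" if "twisted = {}" for k using that tw by blast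
    fix \<kappa> assume \<kappa>: "\<kappa> \<in> Orb \<rightarrow>\<^sub>E irrep_classes G"
      and compat: "\<And>t. t \<in> T \<Longrightarrow> if \<theta> t \<in> P then dual_pair (\<kappa> (orbit vstep t)) (\<kappa> (orbit vstep (partner t)))
         else \<kappa> (orbit vstep t) = \<kappa> (orbit vstep (partner t))"
    define q where "q x = \<kappa> (orbit vstep x)" for x
    have qv: "q (vstep x) = q x" for x unfolding q_def permutation_orbit_step[OF vstep_permutation] ..
    have irr: "q x \<in> irrep_classes G" if "x \<in> P" for x
      unfolding q_def by (rule PiE_mem[OF \<kappa>]) (use that in simp)
    have comp: "if \<theta> x \<in> P then dual_pair (q x) (q (partner x)) else q x = q (partner x)" if x: "x \<in> P" for x
      by (rule compatible_P) (use compat irr x in \<open>unfold q_def, blast\<close>)+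
    define k0 where "k0 = q x0"
    have k0: "k0 \<in> irrep_classes G" unfolding k0_def by (rule irr[OF x0])
    define X where "X = {x \<in> C. if x \<in> P then q x = k0 else dual_pair k0 (q (\<sigma> x))}"
    have XP: "x \<in> X \<longleftrightarrow> q x = k0" if "x \<in> P" for x using that PC unfolding X_def by auto
    have XP': "x \<in> X \<longleftrightarrow> dual_pair k0 (q (\<sigma> x))" if "x \<in> C" "x \<notin> P" for x using that unfolding X_def by auto
    have v: "vstep x \<in> X" if x: "x \<in> X" for x
    proof (cases "x \<in> P")
      case True
      then show ?thesis using x XP[OF True] XP[OF vstep_P[OF True]] qv by simp
    next
      case False
      have xC: "x \<in> C" using x unfolding X_def by simp
      have vn: "vstep x \<notin> P" "vstep x \<in> C"
        unfolding vstep_def using memP(2)[OF si.closed[OF xC]] memP(1)[OF xC] False co.closed si.closed xC by auto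
      have "q (\<sigma> (vstep x)) = q (\<sigma> x)" using qv[of "\<sigma> (vstep x)"] unfolding vstep_sigma by simp
      then show ?thesis using XP'[OF xC False] XP'[OF vn(2,1)] x by simp
    qed
    have s: "\<theta> (\<sigma> x) \<in> X" if x: "x \<in> X" for x
    proof -
      have xC: "x \<in> C" using x unfolding X_def by simp
      have C: "\<sigma> x \<in> C" "\<theta> x \<in> C" "\<theta> (\<sigma> x) \<in> C" using si.closed th.closed xC by auto
      have m: "\<sigma> x \<in> P \<longleftrightarrow> x \<notin> P" "\<theta> (\<sigma> x) \<in> P \<longleftrightarrow> \<theta> x \<notin> P"
        using memP(1)[OF xC] memP(1)[OF C(2)] commute by auto
      have e: "\<sigma> (\<theta> (\<sigma> x)) = \<theta> x" using commute[of "\<sigma> x"] si.inv by simp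
      show ?thesis
      proof (cases "x \<in> P")
        case True
        have qx: "q x = k0" using XP[OF True] x by simp
        show ?thesis
        proof (cases "\<theta> x \<in> P")
          case t: True
          then have "dual_pair k0 (q (\<theta> x))" using comp[OF True] qx unfolding partner_def by simp
          then show ?thesis using XP'[OF C(3)] m t e by simp
        next
          case f: False
          then have "q (\<theta> (\<sigma> x)) = k0" using comp[OF True] qx unfolding partner_def by simp
          then show ?thesis using XP[of "\<theta> (\<sigma> x)"] m f by simp
        qed
      next
        case False
        have sP: "\<sigma> x \<in> P" using m False by simp
        have dq: "dual_pair k0 (q (\<sigma> x))" using XP'[OF xC False] x by simp
        show ?thesis
        proof (cases "\<theta> (\<sigma> x) \<in> P")
          case t: True
          then have "dual_pair (q (\<sigma> x)) (q (\<theta> (\<sigma> x)))" using comp[OF sP] unfolding partner_def by simp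
          moreover have "dual_pair (q (\<sigma> x)) k0" by (rule dual_pair_sym[OF k0 irr[OF sP] dq])
          ultimately have "q (\<theta> (\<sigma> x)) = k0" by (rule dual_pair_unique[OF irr[OF sP] irr[OF t] k0])
          then show ?thesis using XP[OF t] by simp
        next
          case f: False
          have "\<theta> (\<sigma> (\<sigma> x)) = \<theta> x" using si.inv by simp
          then have "q (\<sigma> x) = q (\<theta> x)" using comp[OF sP] f unfolding partner_def by simp
          then show ?thesis using XP'[OF C(3) f] e dq by simp
        qed
      qed
    qed
    have "x0 \<in> X" using XP[OF x0] unfolding k0_def by simp
    have XC: "X = C"
    proof (rule conn)
      show "X \<subseteq> C" unfolding X_def by blast
      show "X \<noteq> {}" using \<open>x0 \<in> X\<close> by blast
      show "\<forall>x\<in>X. vstep x \<in> X \<and> \<theta> (\<sigma> x) \<in> X" using v s by blast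
    qed
    have qk: "q x = k0" if "x \<in> P" for x using XP[OF that] XC PC that by blast
    have x0C: "x0 \<in> C" using x0 PC by blast
    have "\<sigma> x0 \<in> X" "\<sigma> x0 \<notin> P" using XC si.closed[OF x0C] memP(1)[OF x0C] x0 by auto
    then have "dual_pair k0 (q x0)" using XP'[OF si.closed[OF x0C]] si.inv by simp
    then have "k0 \<in> ?SD" using k0 unfolding k0_def by simp
    moreover have "\<kappa> = (\<lambda>Q\<in>Orb. k0)" by (rule const_assignment[OF \<kappa>]) (use qk in \<open>simp add: q_def\<close>)
    ultimately show "\<exists>k\<in>?SD. \<kappa> = (\<lambda>Q\<in>Orb. k)" by blast
  qed
  also have "\<dots> = (\<Sum>k\<in>?SD. ?N ^ card T * (class_frobenius_schur G k ^ ?n * of_nat (class_dim G k) powi euler_char))"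
    by (intro sum.cong refl combine_powers) (use class_dim_pos in auto)
  also have "\<dots> = ?N ^ card T * (\<Sum>k\<in>?SD. class_frobenius_schur G k ^ ?n * of_nat (class_dim G k) powi euler_char)"
    by (rule sum_distrib_left[symmetric])
  finally have count: "of_nat (card flows) * ?N ^ card Orb =
    ?N ^ card T * (\<Sum>k\<in>?SD. class_frobenius_schur G k ^ ?n * of_nat (class_dim G k) powi euler_char)" .
  have par: "even (int ?n) \<longleftrightarrow> even (2 - euler_char)"
  proof -
    have "even (int m) \<longleftrightarrow> even (2 - (int v - int t + int f))" if "even (v + t + f + m)" for v t f m :: nat
      using that by presburger
    from this[OF euler_parity[unfolded vstep_eq]] show ?thesis .
  qed
  have sgn: "class_frobenius_schur G k ^ ?n = class_frobenius_schur G k powi (2 - euler_char)" if "k \<in> ?SD" for k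
  proof -
    have "class_frobenius_schur G k = 1 \<or> class_frobenius_schur G k = -1" using form[OF that] by blast
    then show ?thesis
    proof
      assume e: "class_frobenius_schur G k = -1"
      show ?thesis unfolding e
        using par by (cases "even ?n") (simp_all add: power_int_minus_left)
    qed simp
  qed
  have zero: "class_frobenius_schur G k powi (2 - euler_char) = 0" if k: "k \<in> irrep_classes G - ?SD" for k
  proof -
    have kK: "k \<in> irrep_classes G" "\<not> dual_pair k k" using k by auto
    have "class_frobenius_schur G k = 0" by (rule frobenius_schur_not_self_dual[OF kK])
    moreover have "euler_char \<noteq> 2"
    proof
      assume chi: "euler_char = 2"
      have "norm (of_nat (card flows) * ?N ^ card Orb) \<le>
         real (card (carrier G)) ^ card T * (\<Sum>k\<in>?SD. real (class_dim G k) ^ 2)"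
      proof -
        have "norm (\<Sum>k\<in>?SD. class_frobenius_schur G k ^ ?n * of_nat (class_dim G k) powi euler_char) \<le>
          (\<Sum>k\<in>?SD. norm (class_frobenius_schur G k ^ ?n * of_nat (class_dim G k) powi euler_char))" by (rule norm_sum)
        also have "\<dots> = (\<Sum>k\<in>?SD. real (class_dim G k) ^ 2)"
        proof (rule sum.cong[OF refl])
          fix k assume "k \<in> ?SD"
          then have "norm (class_frobenius_schur G k) = 1" using form by fastforce
          then show "norm (class_frobenius_schur G k ^ ?n * of_nat (class_dim G k) powi euler_char) = real (class_dim G k) ^ 2"
            unfolding chi by (simp add: norm_mult norm_power)
        qed
        finally show ?thesis unfolding count norm_mult norm_power by (simp add: mult_left_mono)
      qed
      then have "real (card flows * card (carrier G) ^ card Orb) \<le> real (card (carrier G) ^ card T * (\<Sum>k\<in>?SD. class_dim G k ^ 2))"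
        by (simp add: norm_mult norm_power)
      then have le: "card flows * card (carrier G) ^ card Orb \<le> card (carrier G) ^ card T * (\<Sum>k\<in>?SD. class_dim G k ^ 2)"
        by (simp only: of_nat_le_iff)
      have "(\<Sum>k\<in>?SD. class_dim G k ^ 2) < (\<Sum>k\<in>irrep_classes G. class_dim G k ^ 2)"
        by (rule sum_strict_mono2[OF finite_irrep_classes _ k]) (use class_dim_pos[OF kK(1)] in auto)
      then have lt: "(\<Sum>k\<in>?SD. class_dim G k ^ 2) < card (carrier G)" unfolding sum_class_dim_sq .
      have VF: "card Orb + card faces = card T + 2" using chi by linarith
      have "card (carrier G) ^ (card Orb + card faces) = card (carrier G) ^ card faces * card (carrier G) ^ card Orb"
        by (simp add: power_add)
      also have "\<dots> \<le> card flows * card (carrier G) * card (carrier G) ^ card Orb"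
        by (rule mult_right_mono[OF gauge_bound[OF ne conn]]) simp_all
      also have "\<dots> = card (carrier G) * (card flows * card (carrier G) ^ card Orb)" by simp
      also have "\<dots> \<le> card (carrier G) * (card (carrier G) ^ card T * (\<Sum>k\<in>?SD. class_dim G k ^ 2))"
        using le by simp
      also have "\<dots> < card (carrier G) * (card (carrier G) ^ card T * card (carrier G))"
        using lt order_pos by simp
      also have "\<dots> = card (carrier G) ^ (card T + 2)" by (simp add: power_add power2_eq_square)
      finally show False unfolding VF by simp
    qed
    ultimately show ?thesis by simp
  qed
  have "(\<Sum>k\<in>?SD. class_frobenius_schur G k ^ ?n * of_nat (class_dim G k) powi euler_char) =
     (\<Sum>k\<in>?SD. class_frobenius_schur G k powi (2 - euler_char) * of_nat (class_dim G k) powi euler_char)"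
    by (intro sum.cong refl arg_cong2[where f = "(*)"] sgn)
  also have "\<dots> = (\<Sum>k\<in>irrep_classes G. class_frobenius_schur G k powi (2 - euler_char) * of_nat (class_dim G k) powi euler_char)"
    by (rule sum.mono_neutral_left[OF finite_irrep_classes]) (use zero in auto)
  finally have s: "(\<Sum>k\<in>?SD. class_frobenius_schur G k ^ ?n * of_nat (class_dim G k) powi euler_char) =
    (\<Sum>k\<in>irrep_classes G. class_frobenius_schur G k powi (2 - euler_char) * of_nat (class_dim G k) powi euler_char)" .
  show ?thesis by (rule divide_vertex_power[OF count[unfolded s]])
qed

end

section \<open>Maps as triples of involutions\<close>

lemma sym_grp_simps:
  "carrier (sym_grp C) = {p. p permutes C}" "p \<otimes>\<^bsub>sym_grp C\<^esub> q = p \<circ> q" "\<one>\<^bsub>sym_grp C\<^esub> = id"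
  unfolding sym_grp_def by simp_all

lemma sym_grp_inv:
  assumes "p permutes C"
  shows "inv\<^bsub>sym_grp C\<^esub> p = inv_into UNIV p"
  unfolding m_inv_def sym_grp_simps
proof (rule the_equality)
  show "inv_into UNIV p \<in> {p. p permutes C} \<and> p \<circ> inv_into UNIV p = id \<and> inv_into UNIV p \<circ> p = id"
    using permutes_inv[OF assms] permutes_inv_o[OF assms] by blast
  fix y assume "y \<in> {p. p permutes C} \<and> p \<circ> y = id \<and> y \<circ> p = id"
  then have "p \<circ> y = id" by blast
  then have "inv_into UNIV p \<circ> (p \<circ> y) = inv_into UNIV p \<circ> id" by (rule arg_cong)
  then show "y = inv_into UNIV p"
    unfolding o_assoc permutes_inv_o(2)[OF assms] id_o o_id .
qed

lemma permutes_closed_inv: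
  assumes "p permutes C" "X \<subseteq> C" "finite C" "\<And>x. x \<in> X \<Longrightarrow> p x \<in> X" "p x \<in> X"
  shows "x \<in> X"
proof -
  have "finite X" by (rule finite_subset[OF assms(2,3)])
  moreover have "p ` X \<subseteq> X" by (rule image_subsetI[OF assms(4)])
  moreover have "card (p ` X) = card X" by (rule card_image[OF permutes_inj_on[OF assms(1)]])
  ultimately have "p ` X = X" by (rule card_subset_eq)
  then obtain y where y: "y \<in> X" "p x = p y" using assms(5) by (metis imageE)
  then have "x = y" using permutes_inj[OF assms(1)] by (meson injD)
  then show ?thesis using y by simp
qed

context
  fixes C :: "'c set" and S :: "('c \<Rightarrow> 'c) set"
  assumes fin: "finite C" and perm: "\<And>s. s \<in> S \<Longrightarrow> s permutes C"
begin

lemma generate_closed: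
  assumes p: "p \<in> generate (sym_grp C) S" and X: "X \<subseteq> C" "\<forall>x\<in>X. \<forall>s\<in>S. s x \<in> X"
  shows "p permutes C \<and> (\<forall>x\<in>X. p x \<in> X)"
  using p
proof (induction rule: generate.induct)
  case one
  show ?case unfolding sym_grp_simps by (intro conjI permutes_id ballI) simp
next
  case (incl h)
  then show ?case using perm X(2) by blast
next
  case (inv h)
  have h: "h permutes C" by (rule perm[OF inv])
  have "inv_into UNIV h x \<in> X" if "x \<in> X" for x
  proof (rule permutes_closed_inv[OF h X(1) fin])
    show "h y \<in> X" if "y \<in> X" for y using X(2) inv that by blast
    show "h (inv_into UNIV h x) \<in> X" unfolding permutes_inverses(1)[OF h] by (rule that)
  qed
  then show ?case unfolding sym_grp_inv[OF h] using permutes_inv[OF h] by blast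
next
  case (eng h1 h2)
  then have h: "h2 permutes C" "h1 permutes C" "\<forall>x\<in>X. h1 (h2 x) \<in> X" by simp_all
  show ?case unfolding sym_grp_simps
  proof (intro conjI ballI)
    show "h1 \<circ> h2 permutes C" by (rule permutes_compose[OF h(1,2)])
    show "(h1 \<circ> h2) x \<in> X" if "x \<in> X" for x using h(3) that by simp
  qed
qed

lemma gen_orbit_subset:
  assumes "X \<subseteq> C" "\<forall>x\<in>X. \<forall>s\<in>S. s x \<in> X" "a \<in> X"
  shows "gen_orbit C S a \<subseteq> X"
proof
  fix y assume "y \<in> gen_orbit C S a"
  then obtain p where "p \<in> generate (sym_grp C) S" "y = p a" unfolding gen_orbit_def by blast
  then show "y \<in> X" using generate_closed[OF _ assms(1,2)] assms(3) by blast
qed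

lemma gen_orbit_self: "a \<in> gen_orbit C S a"
proof -
  have "id \<in> generate (sym_grp C) S" using generate.one[of "sym_grp C" S] unfolding sym_grp_simps .
  then show ?thesis unfolding gen_orbit_def by (intro CollectI exI[of _ id]) simp
qed

lemma gen_orbit_step:
  assumes "x \<in> gen_orbit C S a" "s \<in> S"
  shows "s x \<in> gen_orbit C S a"
proof -
  obtain p where p: "p \<in> generate (sym_grp C) S" "x = p a" using assms(1) unfolding gen_orbit_def by blast
  have "s \<circ> p \<in> generate (sym_grp C) S"
    using generate.eng[OF generate.incl[OF assms(2)] p(1)] unfolding sym_grp_simps .
  moreover have "s x = (s \<circ> p) a" using p by simp
  ultimately show ?thesis unfolding gen_orbit_def by blast
qed

lemma gen_orbit_in: "a \<in> C \<Longrightarrow> gen_orbit C S a \<subseteq> C"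
  by (rule gen_orbit_subset) (use permutes_in_image[OF perm] in auto)

lemma gen_orbit_eq:
  assumes a: "a \<in> C" and b: "b \<in> gen_orbit C S a"
  shows "gen_orbit C S b = gen_orbit C S a"
proof
  show sub: "gen_orbit C S b \<subseteq> gen_orbit C S a"
    by (rule gen_orbit_subset[OF gen_orbit_in[OF a] _ b]) (rule ballI, rule ballI, rule gen_orbit_step)
  have bC: "b \<in> C" using gen_orbit_in[OF a] b by blast
  have "a \<in> gen_orbit C S b"
  proof (rule ccontr)
    assume na: "a \<notin> gen_orbit C S b"
    have "gen_orbit C S a \<subseteq> C - gen_orbit C S b"
    proof (rule gen_orbit_subset, goal_cases)
      case 2
      show ?case
      proof (intro ballI)
      fix x s assume x: "x \<in> C - gen_orbit C S b" and s: "s \<in> S"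
      have "s x \<notin> gen_orbit C S b"
        using permutes_closed_inv[OF perm[OF s] gen_orbit_in[OF bC] fin gen_orbit_step[OF _ s], of x] x by blast
      then show "s x \<in> C - gen_orbit C S b" using x permutes_in_image[OF perm[OF s]] by blast
      qed
    qed (use a na in auto)
    then show False using b gen_orbit_self[of b] by blast
  qed
  note ain = this
  show "gen_orbit C S a \<subseteq> gen_orbit C S b"
    by (rule gen_orbit_subset[OF gen_orbit_in[OF bC] _ ain]) (rule ballI, rule ballI, rule gen_orbit_step)
qed

lemma gen_orbits_disjoint: "disjoint (gen_orbits C S)"
  unfolding gen_orbits_def
proof (rule disjointI)
  fix A B assume "A \<in> gen_orbit C S ` C" "B \<in> gen_orbit C S ` C" "A \<noteq> B"
  then obtain a b where ab: "a \<in> C" "b \<in> C" "A = gen_orbit C S a" "B = gen_orbit C S b" "A \<noteq> B" by blast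
  show "A \<inter> B = {}"
  proof (rule ccontr)
    assume "A \<inter> B \<noteq> {}"
    then obtain x where x: "x \<in> A" "x \<in> B" by blast
    show False using gen_orbit_eq[OF ab(1) x(1)[unfolded ab(3)]] gen_orbit_eq[OF ab(2) x(2)[unfolded ab(4)]] ab by simp
  qed
qed

lemma gen_orbits_Union: "\<Union>(gen_orbits C S) = C"
  unfolding gen_orbits_def
proof
  show "\<Union>(gen_orbit C S ` C) \<subseteq> C" by (rule Union_least) (use gen_orbit_in in blast)
  show "C \<subseteq> \<Union>(gen_orbit C S ` C)"
  proof
    fix x assume "x \<in> C"
    then show "x \<in> \<Union>(gen_orbit C S ` C)" using gen_orbit_self[of x] by (rule_tac UN_I)
  qed
qed

lemma gen_orbits_finite: "finite (gen_orbits C S)"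
  unfolding gen_orbits_def using fin by simp

lemma gen_orbits_mem:
  assumes "D \<in> gen_orbits C S" "x \<in> D"
  shows "x \<in> C" "gen_orbit C S x = D"
proof -
  obtain a where a: "a \<in> C" "D = gen_orbit C S a" using assms(1) unfolding gen_orbits_def by blast
  show "x \<in> C" using gen_orbit_in[OF a(1)] assms(2) a(2) by blast
  show "gen_orbit C S x = D" using gen_orbit_eq[OF a(1)] assms(2) a(2) by blast
qed

lemma card_image_gen_orbits:
  assumes "\<And>x y. x \<in> C \<Longrightarrow> y \<in> C \<Longrightarrow> g x = g y \<Longrightarrow> y \<in> gen_orbit C S x"
  shows "card (g ` C) = (\<Sum>D\<in>gen_orbits C S. card (g ` D))"
proof -
  have "g ` C = (\<Union>D\<in>gen_orbits C S. g ` D)"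
    by (subst gen_orbits_Union[symmetric]) (rule image_Union)
  also have "card \<dots> = (\<Sum>D\<in>gen_orbits C S. card (g ` D))"
  proof (rule card_UN_disjoint[OF gen_orbits_finite])
    show "\<forall>D\<in>gen_orbits C S. finite (g ` D)"
    proof
      fix D assume "D \<in> gen_orbits C S"
      then have "D \<subseteq> C" using gen_orbits_Union by blast
      then show "finite (g ` D)" using finite_subset[OF _ fin] by blast
    qed
    show "\<forall>D\<in>gen_orbits C S. \<forall>E\<in>gen_orbits C S. D \<noteq> E \<longrightarrow> g ` D \<inter> g ` E = {}"
    proof (intro ballI impI)
      fix D E assume D: "D \<in> gen_orbits C S" and E: "E \<in> gen_orbits C S" and "D \<noteq> E"
      show "g ` D \<inter> g ` E = {}"
      proof (rule ccontr)
        assume "g ` D \<inter> g ` E \<noteq> {}"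
        then obtain x y where xy: "x \<in> D" "y \<in> E" "g x = g y" by blast
        have "y \<in> gen_orbit C S x" by (rule assms[OF gen_orbits_mem(1)[OF D xy(1)] gen_orbits_mem(1)[OF E xy(2)] xy(3)])
        then have "gen_orbit C S y = gen_orbit C S x" by (rule gen_orbit_eq[OF gen_orbits_mem(1)[OF D xy(1)]])
        then show False using gen_orbits_mem(2)[OF D xy(1)] gen_orbits_mem(2)[OF E xy(2)] \<open>D \<noteq> E\<close> by simp
      qed
    qed
  qed
  finally show ?thesis .
qed

end

locale cross_map =
  fixes M :: "'c gmap"
  assumes fin: "finite (crosses M)"
    and theta_perm: "theta M permutes crosses M" and sigma_perm: "sigma M permutes crosses M"
    and tau_perm: "tau M permutes crosses M"
    and theta_inv: "theta M (theta M x) = x" and sigma_inv: "sigma M (sigma M x) = x"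
    and theta_sigma: "theta M (sigma M x) = sigma M (theta M x)"
    and theta_free: "x \<in> crosses M \<Longrightarrow> theta M x \<noteq> x" and sigma_free: "x \<in> crosses M \<Longrightarrow> sigma M x \<noteq> x"
    and theta_sigma_free: "x \<in> crosses M \<Longrightarrow> theta M (sigma M x) \<noteq> x"
    and tau_sigma_tau: "tau M (sigma M (tau M x)) = sigma M x"
    and tau_sigma_free: "x \<in> crosses M \<Longrightarrow> tau M (sigma M x) \<noteq> x"
begin

abbreviation "C \<equiv> crosses M"
abbreviation "\<theta> \<equiv> theta M"
abbreviation "\<sigma> \<equiv> sigma M"
abbreviation "\<tau> \<equiv> tau M"

definition corner :: "'c \<Rightarrow> 'c" where "corner x = \<tau> (\<sigma> x)"

lemma corner_inv: "corner (corner x) = x"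
  unfolding corner_def tau_sigma_tau sigma_inv ..

lemma corner_perm: "corner permutes C"
proof -
  have "corner = \<tau> \<circ> \<sigma>" by (auto simp: corner_def)
  then show ?thesis using permutes_compose[OF sigma_perm tau_perm] by simp
qed

lemma corner_free: "x \<in> C \<Longrightarrow> corner x \<noteq> x"
  unfolding corner_def by (rule tau_sigma_free)

lemma perm_in: "x \<in> C \<Longrightarrow> \<theta> x \<in> C" "x \<in> C \<Longrightarrow> \<sigma> x \<in> C" "x \<in> C \<Longrightarrow> \<tau> x \<in> C"
  using permutes_in_image[OF theta_perm] permutes_in_image[OF sigma_perm] permutes_in_image[OF tau_perm] by auto

sublocale inv: three_involutions C \<theta> \<sigma> corner
  by unfold_locales
    (rule fin theta_perm sigma_perm corner_perm theta_inv sigma_inv corner_inv theta_sigma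
      theta_free sigma_free theta_sigma_free corner_free, assumption?)+

sublocale vert: two_involutions C \<sigma> corner
  by unfold_locales (rule sigma_free corner_free, assumption)+

sublocale face: two_involutions C \<theta> corner
  by unfold_locales (rule theta_free corner_free, assumption)+

lemma vert_step: "vert.step = \<tau>"
  by (rule ext) (simp add: vert.step_def corner_def sigma_inv)

lemma face_step: "face.step = phi M"
  by (rule ext) (simp add: face.step_def corner_def phi_def theta_sigma)

lemma tau_permutation: "permutation \<tau>"
  by (rule permutes_finite_permutation[OF fin tau_perm])

lemma cycle_vertices_eq: "cycle_vertices M = vert.orbit_pair ` C"
  unfolding cycle_vertices_def vert.orbit_pair_def vert_step ..

lemma cycle_faces_eq: "cycle_faces M = face.orbit_pair ` C"
  unfolding cycle_faces_def face.orbit_pair_def face_step ..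

definition edge :: "'c \<Rightarrow> 'c set" where "edge x = {x, \<theta> x, \<sigma> x, \<theta> (\<sigma> x)}"

lemma edge_closed: "y \<in> edge x \<Longrightarrow> \<theta> y \<in> edge x \<and> \<sigma> y \<in> edge x"
  unfolding edge_def by (auto simp: theta_inv sigma_inv theta_sigma[symmetric])

lemma edge_eq: "y \<in> edge x \<Longrightarrow> edge y = edge x"
  unfolding edge_def by (auto simp: theta_inv sigma_inv theta_sigma[symmetric])

lemma gen_orbit_edge:
  assumes x: "x \<in> C"
  shows "gen_orbit C {\<theta>, \<sigma>} x = edge x"
proof
  have perm: "\<And>s. s \<in> {\<theta>, \<sigma>} \<Longrightarrow> s permutes C" using theta_perm sigma_perm by auto
  note step = gen_orbit_step[OF fin perm] and self = gen_orbit_self[OF fin perm]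
  show "gen_orbit C {\<theta>, \<sigma>} x \<subseteq> edge x"
  proof (rule gen_orbit_subset[OF fin perm])
    show "edge x \<subseteq> C" unfolding edge_def using x perm_in by simp
    show "\<forall>y\<in>edge x. \<forall>s\<in>{\<theta>, \<sigma>}. s y \<in> edge x" using edge_closed by blast
    show "x \<in> edge x" unfolding edge_def by blast
  qed
  have "x \<in> gen_orbit C {\<theta>, \<sigma>} x" by (rule self)
  moreover from this have "\<theta> x \<in> gen_orbit C {\<theta>, \<sigma>} x" "\<sigma> x \<in> gen_orbit C {\<theta>, \<sigma>} x" by (auto intro: step)
  moreover from this(2) have "\<theta> (\<sigma> x) \<in> gen_orbit C {\<theta>, \<sigma>} x" by (auto intro: step)
  ultimately show "edge x \<subseteq> gen_orbit C {\<theta>, \<sigma>} x" unfolding edge_def by blast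
qed

lemma edges_eq: "edges M = edge ` C"
  unfolding edges_def gen_orbits_def using gen_orbit_edge by simp

end

section \<open>Deletion of edges\<close>

inductive first_return :: "('c \<Rightarrow> 'c) \<Rightarrow> 'c set \<Rightarrow> 'c \<Rightarrow> 'c \<Rightarrow> bool" for f X where
  stop: "f b \<notin> X \<Longrightarrow> first_return f X b (f b)"
| skip: "f b \<in> X \<Longrightarrow> first_return f X (f b) y \<Longrightarrow> first_return f X b y"

lemma first_return_det:
  assumes "first_return f X b y" "first_return f X b z"
  shows "y = z"
  using assms
proof (induction arbitrary: z rule: first_return.induct)
  case (stop b)
  from stop(2) show ?case by cases (use stop(1) in blast)+
next
  case (skip b y)
  from skip(4) show ?case by cases (use skip in blast)+
qed

lemma first_return_notin: "first_return f X b y \<Longrightarrow> y \<notin> X"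
  by (induction rule: first_return.induct)

lemma first_return_orbit: "first_return f X b y \<Longrightarrow> y \<in> orbit f b"
proof (induction rule: first_return.induct)
  case (stop b)
  show ?case by (rule orbit.base)
next
  case (skip b y)
  then show ?case by (metis orbit.base orbit_trans)
qed

lemma first_return_closed:
  assumes "first_return f X b y" "b \<in> S" "\<And>x. x \<in> S \<Longrightarrow> f x \<in> S"
  shows "y \<in> S"
  using assms(1,2) by (induction rule: first_return.induct) (rule assms(3), assumption, use assms(3) in blast)

lemma first_return_funpow:
  assumes "1 \<le> n" "(f ^^ n) b \<notin> X" "\<And>i. 1 \<le> i \<Longrightarrow> i < n \<Longrightarrow> (f ^^ i) b \<in> X"
  shows "first_return f X b ((f ^^ n) b)"
  using assms
proof (induction n arbitrary: b)
  case 0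
  then show ?case by simp
next
  case (Suc n)
  show ?case
  proof (cases "n = 0")
    case True
    then show ?thesis using first_return.stop[of f b X] Suc.prems by simp
  next
    case False
    have "f b \<in> X" using Suc.prems(3)[of 1] False by simp
    moreover have "first_return f X (f b) ((f ^^ n) (f b))"
    proof (rule Suc.IH)
      show "1 \<le> n" using False by simp
      show "(f ^^ n) (f b) \<notin> X" using Suc.prems(2) by (simp add: funpow_swap1)
      show "(f ^^ i) (f b) \<in> X" if "1 \<le> i" "i < n" for i
        using Suc.prems(3)[of "Suc i"] that by (simp add: funpow_swap1)
    qed
    ultimately show ?thesis by (simp add: funpow_swap1 first_return.skip)
  qed
qed

lemma first_return_Least:
  assumes "permutation f" "b \<notin> X"
  shows "first_return f X b ((f ^^ (LEAST j. 1 \<le> j \<and> (f ^^ j) b \<notin> X)) b)"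
proof -
  obtain n where "n > 0" "(f ^^ n) b = b" using least_power_of_permutation[OF assms(1)] by blast
  then have ex: "1 \<le> n \<and> (f ^^ n) b \<notin> X" using assms(2) by simp
  let ?j = "LEAST j. 1 \<le> j \<and> (f ^^ j) b \<notin> X"
  have j: "1 \<le> ?j \<and> (f ^^ ?j) b \<notin> X" by (rule LeastI[of "\<lambda>j. 1 \<le> j \<and> (f ^^ j) b \<notin> X", OF ex])
  have "(f ^^ i) b \<in> X" if "1 \<le> i" "i < ?j" for i
    using not_less_Least[OF that(2)] that(1) by blast
  then show ?thesis using first_return_funpow[of ?j f b X] j by blast
qed

lemma perm_restrict_permutes:
  assumes "finite D" "inj f" "\<And>x. x \<in> D \<Longrightarrow> f x \<in> D"
  shows "perm_restrict f D permutes D"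
proof (rule bij_imp_permutes)
  have inj: "inj_on f D" by (rule inj_on_subset[OF assms(2) subset_UNIV])
  have "bij_betw f D D"
  proof (rule bij_betw_imageI[OF inj])
    show "f ` D = D" by (rule card_subset_eq[OF assms(1) image_subsetI card_image[OF inj]]) (rule assms(3))
  qed
  then show "bij_betw (perm_restrict f D) D D"
    by (subst bij_betw_cong[of _ _ f]) (simp_all add: perm_restrict_def)
qed (simp add: perm_restrict_def)

lemma first_return_comp:
  assumes r: "first_return f X b z" and XY: "z \<in> Y \<longrightarrow> first_return f (X \<union> Y) z y"
    "z \<notin> Y \<longrightarrow> y = z"
  shows "first_return f (X \<union> Y) b y"
  using r XY
proof (induction rule: first_return.induct)
  case (stop b)
  show ?case
  proof (cases "f b \<in> Y")
    case True
    show ?thesis by (rule first_return.skip) (use True stop in auto)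
  next
    case False
    then have "y = f b" using stop by simp
    then show ?thesis using first_return.stop[of f b "X \<union> Y"] False stop by simp
  qed
next
  case (skip b z)
  show ?case by (rule first_return.skip) (use skip in auto)
qed

lemma first_return_reverse:
  assumes rev: "\<And>x. f (s (f x)) = s x" and X: "\<And>x. s x \<in> X \<longleftrightarrow> x \<in> X"
    and r: "first_return f X b y"
  shows "(b \<notin> X \<longrightarrow> first_return f X (s y) (s b)) \<and> (b \<in> X \<longrightarrow> (\<forall>z. first_return f X (s b) z \<longrightarrow> first_return f X (s y) z))"
  using r
proof (induction rule: first_return.induct)
  case (stop b)
  show ?case
    using first_return.stop[of f "s (f b)" X] first_return.skip[of f "s (f b)" X] unfolding rev X by blast
next
  case (skip b y)
  then show ?case
    using first_return.stop[of f "s (f b)" X] first_return.skip[of f "s (f b)" X] unfolding rev X by blast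
qed

context cross_map
begin

definition vertex :: "'c \<Rightarrow> 'c set" where "vertex x = orbit \<tau> x \<union> orbit \<tau> (\<sigma> x)"

lemma Union_orbit_pair: "\<Union>(vert.orbit_pair x) = vertex x"
  unfolding vert.orbit_pair_def vertex_def vert_step by simp

lemma vertex_self: "x \<in> vertex x"
  unfolding vertex_def using permutation_self_in_orbit[OF tau_permutation] by blast

lemma vertex_subset: "x \<in> C \<Longrightarrow> vertex x \<subseteq> C"
  unfolding vertex_def using permutes_orbit_subset[OF tau_perm] perm_in(2) by blast

lemma orbit_pair_eq_iff: "vert.orbit_pair x = vert.orbit_pair y \<longleftrightarrow> y \<in> vertex x"
proof
  assume "vert.orbit_pair x = vert.orbit_pair y"
  then have "vertex x = vertex y" unfolding Union_orbit_pair[symmetric] by (rule arg_cong)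
  then show "y \<in> vertex x" using vertex_self[of y] by (rule ssubst)
next
  have eq: "vert.orbit_pair z = vert.orbit_pair y" if "y \<in> orbit \<tau> z" for z
  proof -
    have "orbit \<tau> y = orbit \<tau> z" by (rule orbit_cyclic_eq3[OF cyclic_on_orbit'[OF tau_permutation] that])
    then show ?thesis by (intro vert.orbit_eq_imp_pair_eq) (simp only: vert_step)
  qed
  assume "y \<in> vertex x"
  then consider "y \<in> orbit \<tau> x" | "y \<in> orbit \<tau> (\<sigma> x)" unfolding vertex_def by blast
  then show "vert.orbit_pair x = vert.orbit_pair y"
    by cases (use eq vert.orbit_pair_u in metis)+
qed

abbreviation "first_ret X \<equiv> first_return \<tau> X"

context
  fixes X :: "'c set"
  assumes XC: "X \<subseteq> C" and X: "\<And>x. x \<in> X \<Longrightarrow> \<theta> x \<in> X" "\<And>x. x \<in> X \<Longrightarrow> \<sigma> x \<in> X"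
begin

lemma X_iff: "\<theta> x \<in> X \<longleftrightarrow> x \<in> X" "\<sigma> x \<in> X \<longleftrightarrow> x \<in> X"
  using X theta_inv sigma_inv by metis+

lemma delete_sel:
  "crosses (delete_edge M X) = C - X" "theta (delete_edge M X) = perm_restrict \<theta> (C - X)"
  "sigma (delete_edge M X) = perm_restrict \<sigma> (C - X)"
  "empty_pairs (delete_edge M X) = empty_pairs M + card {v \<in> cycle_vertices M. \<Union>v \<subseteq> X}"
  unfolding delete_edge_def by simp_all

abbreviation "\<tau>' \<equiv> tau (delete_edge M X)"

lemma tau'_ret:
  assumes "b \<in> C" "b \<notin> X"
  shows "first_ret X b (\<tau>' b)"
  using first_return_Least[OF tau_permutation assms(2)] assms
  unfolding delete_edge_def perm_restrict_def by simp

lemma tau'_out: "b \<notin> C - X \<Longrightarrow> \<tau>' b = b"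
  unfolding delete_edge_def perm_restrict_def gmap.simps by (rule if_not_P)

lemma tau'_in: "b \<in> C - X \<Longrightarrow> \<tau>' b \<in> C - X"
proof -
  assume b: "b \<in> C - X"
  then have r: "first_ret X b (\<tau>' b)" by (intro tau'_ret) simp_all
  have "\<tau>' b \<in> C" by (rule first_return_closed[OF r]) (use b perm_in in auto)
  then show ?thesis using first_return_notin[OF r] by simp
qed

lemma tau'_eq: "b \<in> C - X \<Longrightarrow> first_ret X b y \<Longrightarrow> \<tau>' b = y"
  using first_return_det[OF tau'_ret] by blast

lemma tau'_reverse:
  assumes b: "b \<in> C - X"
  shows "\<tau>' (\<sigma> (\<tau>' b)) = \<sigma> b"
proof (rule tau'_eq)
  show "\<sigma> (\<tau>' b) \<in> C - X" using tau'_in[OF b] X_iff perm_in by simp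
  show "first_ret X (\<sigma> (\<tau>' b)) (\<sigma> b)"
    using first_return_reverse[OF tau_sigma_tau X_iff(2) tau'_ret] b by blast
qed

lemma tau'_permutes: "\<tau>' permutes (C - X)"
proof (rule bij_imp_permutes)
  have inj: "inj_on \<tau>' (C - X)"
  proof (rule inj_onI)
    fix x y assume "x \<in> C - X" "y \<in> C - X" "\<tau>' x = \<tau>' y"
    then have "\<sigma> x = \<sigma> y" using tau'_reverse[of x] tau'_reverse[of y] by simp
    then show "x = y" using sigma_inv by metis
  qed
  show "bij_betw \<tau>' (C - X) (C - X)"
  proof (rule bij_betw_imageI[OF inj])
    show "\<tau>' ` (C - X) = C - X"
      by (rule card_subset_eq) (use fin tau'_in card_image[OF inj] in auto)
  qed
qed (rule tau'_out)

lemma orbit_tau':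
  assumes a: "a \<in> C - X"
  shows "orbit \<tau>' a = orbit \<tau> a \<inter> (C - X)"
proof
  show "orbit \<tau>' a \<subseteq> orbit \<tau> a \<inter> (C - X)"
  proof
    fix y assume "y \<in> orbit \<tau>' a"
    then show "y \<in> orbit \<tau> a \<inter> (C - X)"
    proof induction
      case base
      show ?case using first_return_orbit[OF tau'_ret] tau'_in[OF a] a by simp
    next
      case (step y)
      then have y: "y \<in> orbit \<tau> a" "y \<in> C - X" by auto
      have "\<tau>' y \<in> orbit \<tau> y" using first_return_orbit[OF tau'_ret] y(2) by simp
      then show ?case using orbit_trans[OF _ y(1)] tau'_in[OF y(2)] by simp
    qed
  qed
  have walk: "(\<tau> z \<notin> X \<longrightarrow> \<tau> z \<in> orbit \<tau>' a) \<and> (\<tau> z \<in> X \<longrightarrow> (\<exists>w\<in>orbit \<tau>' a. first_ret X (\<tau> z) w))"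
    if r: "first_ret X z w" and w: "w \<in> orbit \<tau>' a" for z w
    using r by cases (use w in auto)
  have "(z \<notin> X \<longrightarrow> z \<in> orbit \<tau>' a) \<and> (z \<in> X \<longrightarrow> (\<exists>w\<in>orbit \<tau>' a. first_ret X z w))" if "z \<in> orbit \<tau> a" for z
    using that
  proof induction
    case base
    show ?case by (rule walk[OF tau'_ret orbit.base]) (use a in simp_all)
  next
    case (step z)
    show ?case
    proof (cases "z \<in> X")
      case True
      then obtain w where "w \<in> orbit \<tau>' a" "first_ret X z w" using step by blast
      then show ?thesis by (intro walk)
    next
      case False
      have "orbit \<tau> a \<subseteq> C" by (rule permutes_orbit_subset[OF tau_perm]) (use a in simp)
      then have "z \<in> C" using step.hyps by blast
      moreover have "\<tau>' z \<in> orbit \<tau>' a" by (rule orbit.step) (use step.IH False in blast)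
      ultimately show ?thesis using walk[OF tau'_ret[OF _ False]] by blast
    qed
  qed
  then show "orbit \<tau> a \<inter> (C - X) \<subseteq> orbit \<tau>' a" by blast
qed

lemma cross_map_delete: "cross_map (delete_edge M X)"
proof (unfold_locales, unfold delete_sel)
  let ?D = "C - X"
  have r: "perm_restrict \<theta> ?D x = (if x \<in> ?D then \<theta> x else x)" "perm_restrict \<sigma> ?D x = (if x \<in> ?D then \<sigma> x else x)" for x
    unfolding perm_restrict_def by simp_all
  have cl: "\<theta> x \<in> ?D \<longleftrightarrow> x \<in> ?D" "\<sigma> x \<in> ?D \<longleftrightarrow> x \<in> ?D" for x
    using X_iff permutes_in_image[OF theta_perm] permutes_in_image[OF sigma_perm] by auto
  show "finite ?D" using fin by simp
  show "perm_restrict \<theta> ?D permutes ?D" using cl(1) by (intro perm_restrict_permutes permutes_inj[OF theta_perm]) (use fin in simp_all)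
  show "perm_restrict \<sigma> ?D permutes ?D" using cl(2) by (intro perm_restrict_permutes permutes_inj[OF sigma_perm]) (use fin in simp_all)
  show "\<tau>' permutes ?D" by (rule tau'_permutes)
  fix x
  show "perm_restrict \<theta> ?D (perm_restrict \<theta> ?D x) = x" using cl[of x] theta_inv[of x] unfolding r by presburger
  show "perm_restrict \<sigma> ?D (perm_restrict \<sigma> ?D x) = x" using cl[of x] sigma_inv[of x] unfolding r by presburger
  show "perm_restrict \<theta> ?D (perm_restrict \<sigma> ?D x) = perm_restrict \<sigma> ?D (perm_restrict \<theta> ?D x)"
    using cl[of x] theta_sigma[of x] unfolding r by presburger
  show "\<tau>' (perm_restrict \<sigma> ?D (\<tau>' x)) = perm_restrict \<sigma> ?D x"
  proof (cases "x \<in> ?D")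
    case True
    show ?thesis using tau'_reverse[OF True] tau'_in[OF True] True unfolding r by presburger
  next
    case False
    show ?thesis using tau'_out[OF False] False unfolding r by presburger
  qed
  assume x: "x \<in> ?D"
  then have xC: "x \<in> C" by simp
  show "perm_restrict \<theta> ?D x \<noteq> x" "perm_restrict \<sigma> ?D x \<noteq> x" "perm_restrict \<theta> ?D (perm_restrict \<sigma> ?D x) \<noteq> x"
    using theta_free[OF xC] sigma_free[OF xC] theta_sigma_free[OF xC] x cl unfolding r by presburger+
  have s: "\<sigma> x \<in> C - X" using x cl by blast
  have "\<tau>' (\<sigma> x) \<in> orbit \<tau> (\<sigma> x)" using first_return_orbit[OF tau'_ret] s by blast
  moreover have "x \<notin> orbit \<tau> (\<sigma> x)" using vert.u_notin_orbit[of "\<sigma> x"] s unfolding vert_step sigma_inv by blast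
  ultimately show "\<tau>' (perm_restrict \<sigma> ?D x) \<noteq> x" using x unfolding r by auto
qed

lemma delete_restrict:
  assumes "x \<in> C - X"
  shows "theta (delete_edge M X) x = \<theta> x" "sigma (delete_edge M X) x = \<sigma> x"
  unfolding delete_sel perm_restrict_def using assms by simp_all

lemma delete_vertex:
  assumes a: "a \<in> C - X"
  shows "cross_map.vertex (delete_edge M X) a = vertex a \<inter> (C - X)"
proof -
  interpret N: cross_map "delete_edge M X" by (rule cross_map_delete)
  have "\<sigma> a \<in> C - X" using a X_iff perm_in by simp
  then show ?thesis unfolding N.vertex_def vertex_def delete_restrict[OF a] using orbit_tau'[OF a] orbit_tau' by blast
qed

lemma card_vertices_delete:
  "card {v \<in> cycle_vertices (delete_edge M X). \<Union>v \<subseteq> Y} + card {v \<in> cycle_vertices M. \<Union>v \<subseteq> X}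
    = card {v \<in> cycle_vertices M. \<Union>v \<subseteq> X \<union> Y}"
proof -
  interpret N: cross_map "delete_edge M X" by (rule cross_map_delete)
  define S where "S = {a \<in> C - X. vertex a \<subseteq> X \<union> Y}"
  have Nsub: "N.vertex a \<subseteq> Y \<longleftrightarrow> vertex a \<subseteq> X \<union> Y" if "a \<in> C - X" for a
    unfolding delete_vertex[OF that] using vertex_subset[of a] that by blast
  have 1: "{v \<in> cycle_vertices (delete_edge M X). \<Union>v \<subseteq> Y} = N.vert.orbit_pair ` S"
  proof -
    have "{v \<in> cycle_vertices (delete_edge M X). \<Union>v \<subseteq> Y} = N.vert.orbit_pair ` {a \<in> C - X. N.vertex a \<subseteq> Y}"
      unfolding N.cycle_vertices_eq delete_sel N.Union_orbit_pair[symmetric] by blast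
    also have "{a \<in> C - X. N.vertex a \<subseteq> Y} = S" unfolding S_def using Nsub by blast
    finally show ?thesis .
  qed
  have 2: "{v \<in> cycle_vertices M. \<Union>v \<subseteq> X \<union> Y} = vert.orbit_pair ` S \<union> {v \<in> cycle_vertices M. \<Union>v \<subseteq> X}"
  proof
    show "{v \<in> cycle_vertices M. \<Union>v \<subseteq> X \<union> Y} \<subseteq> vert.orbit_pair ` S \<union> {v \<in> cycle_vertices M. \<Union>v \<subseteq> X}"
    proof
      fix v assume v: "v \<in> {v \<in> cycle_vertices M. \<Union>v \<subseteq> X \<union> Y}"
      then obtain a where a: "a \<in> C" "v = vert.orbit_pair a" unfolding cycle_vertices_eq by blast
      show "v \<in> vert.orbit_pair ` S \<union> {v \<in> cycle_vertices M. \<Union>v \<subseteq> X}"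
      proof (cases "\<Union>v \<subseteq> X")
        case True
        then show ?thesis using v by blast
      next
        case False
        then obtain b where b: "b \<in> vertex a" "b \<notin> X" unfolding a(2) Union_orbit_pair by blast
        then have "v = vert.orbit_pair b" using orbit_pair_eq_iff a(2) by metis
        moreover have "vertex b \<subseteq> X \<union> Y" using v calculation Union_orbit_pair by blast
        then have "b \<in> S" unfolding S_def using b vertex_subset[OF a(1)] by blast
        ultimately show ?thesis by blast
      qed
    qed
    show "vert.orbit_pair ` S \<union> {v \<in> cycle_vertices M. \<Union>v \<subseteq> X} \<subseteq> {v \<in> cycle_vertices M. \<Union>v \<subseteq> X \<union> Y}"
      unfolding cycle_vertices_eq S_def using Union_orbit_pair by blast
  qed
  have "\<not> \<Union>v \<subseteq> X" if "v \<in> vert.orbit_pair ` S" for v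
  proof -
    obtain a where "a \<in> S" "v = vert.orbit_pair a" using \<open>v \<in> _\<close> by blast
    then have "a \<in> \<Union>v" "a \<notin> X" unfolding S_def using Union_orbit_pair vertex_self by blast+
    then show ?thesis by blast
  qed
  then have dis: "vert.orbit_pair ` S \<inter> {v \<in> cycle_vertices M. \<Union>v \<subseteq> X} = {}" by blast
  have finS: "finite S" unfolding S_def using fin by simp
  have finV: "finite (cycle_vertices M)" unfolding cycle_vertices_eq using fin by simp
  have "card (N.vert.orbit_pair ` S) = card (vert.orbit_pair ` S)"
  proof (rule card_image_eq_if_kernel_eq)
    fix x y assume "x \<in> S" "y \<in> S"
    then have xy: "x \<in> C - X" "y \<in> C - X" unfolding S_def by blast+
    show "N.vert.orbit_pair x = N.vert.orbit_pair y \<longleftrightarrow> vert.orbit_pair x = vert.orbit_pair y"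
      unfolding orbit_pair_eq_iff N.orbit_pair_eq_iff delete_vertex[OF xy(1)] using xy by blast
  qed
  then show ?thesis unfolding 1 2 using card_Un_disjoint[OF _ _ dis] finS finV by simp
qed

lemma num_vertices_delete: "num_vertices (delete_edge M X) = num_vertices M"
proof -
  interpret N: cross_map "delete_edge M X" by (rule cross_map_delete)
  have 1: "{v \<in> cycle_vertices (delete_edge M X). \<Union>v \<subseteq> C} = cycle_vertices (delete_edge M X)"
    unfolding N.cycle_vertices_eq using N.vertex_subset N.Union_orbit_pair delete_sel(1) by blast
  have 2: "{v \<in> cycle_vertices M. \<Union>v \<subseteq> X \<union> C} = cycle_vertices M"
    unfolding cycle_vertices_eq using vertex_subset Union_orbit_pair by blast
  show ?thesis using card_vertices_delete[of C] unfolding 1 2 num_vertices_def delete_sel by simp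
qed

lemma delete_delete: "delete_edge (delete_edge M X) Y = delete_edge M (X \<union> Y)"
proof -
  interpret N: cross_map "delete_edge M X" by (rule cross_map_delete)
  have ret: "first_ret (X \<union> Y) b y" if "first_return \<tau>' Y b y" "b \<in> C - X" for b y
    using that
  proof (induction rule: first_return.induct)
    case (stop b)
    show ?case by (rule first_return_comp[OF tau'_ret]) (use stop in blast)+
  next
    case (skip b y)
    have "first_ret (X \<union> Y) (\<tau>' b) y" by (rule skip.IH[OF tau'_in[OF skip.prems]])
    then show ?case by (intro first_return_comp[OF tau'_ret]) (use skip in blast)+
  qed
  have D: "C - X - Y = C - (X \<union> Y)" by blast
  have th: "theta (delete_edge (delete_edge M X) Y) = theta (delete_edge M (X \<union> Y))"
    "sigma (delete_edge (delete_edge M X) Y) = sigma (delete_edge M (X \<union> Y))"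
    unfolding delete_edge_def by (rule ext, simp add: perm_restrict_def)+
  have ta: "tau (delete_edge (delete_edge M X) Y) = tau (delete_edge M (X \<union> Y))"
  proof
    fix b
    show "tau (delete_edge (delete_edge M X) Y) b = tau (delete_edge M (X \<union> Y)) b"
    proof (cases "b \<in> C - (X \<union> Y)")
      case True
      have "first_ret (X \<union> Y) b ((\<tau>' ^^ (LEAST j. 1 \<le> j \<and> (\<tau>' ^^ j) b \<notin> Y)) b)"
        by (rule ret[OF first_return_Least[OF N.tau_permutation]]) (use True in blast)+
      moreover have "first_ret (X \<union> Y) b ((\<tau> ^^ (LEAST j. 1 \<le> j \<and> (\<tau> ^^ j) b \<notin> X \<union> Y)) b)"
        by (rule first_return_Least[OF tau_permutation]) (use True in blast)
      ultimately have "(\<tau>' ^^ (LEAST j. 1 \<le> j \<and> (\<tau>' ^^ j) b \<notin> Y)) b = (\<tau> ^^ (LEAST j. 1 \<le> j \<and> (\<tau> ^^ j) b \<notin> X \<union> Y)) b"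
        by (rule first_return_det)
      then show ?thesis
        unfolding delete_edge_def[of _ Y] delete_edge_def[of _ "X \<union> Y"] delete_sel D perm_restrict_def gmap.simps
        using True by argo
    next
      case False
      then show ?thesis
        unfolding delete_edge_def[of _ Y] delete_edge_def[of _ "X \<union> Y"] delete_sel D perm_restrict_def gmap.simps by argo
    qed
  qed
  have cr: "crosses (delete_edge (delete_edge M X) Y) = crosses (delete_edge M (X \<union> Y))"
    unfolding delete_edge_def gmap.simps by (rule D)
  have em: "empty_pairs (delete_edge (delete_edge M X) Y) = empty_pairs (delete_edge M (X \<union> Y))"
    using card_vertices_delete[of Y] unfolding delete_edge_def[of _ Y] delete_edge_def[of _ "X \<union> Y"] delete_sel gmap.simps by simp
  show ?thesis by (rule gmap.equality) (use cr th ta em in simp_all)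
qed

lemma delete_edge_edges: "edges (delete_edge M X) = edge ` (C - X)"
proof -
  interpret N: cross_map "delete_edge M X" by (rule cross_map_delete)
  have "N.edge x = edge x" if "x \<in> C - X" for x
  proof -
    have s: "\<sigma> x \<in> C - X" using that X_iff perm_in by simp
    show ?thesis unfolding N.edge_def edge_def delete_restrict[OF that] delete_restrict[OF s] ..
  qed
  then show ?thesis unfolding N.edges_eq delete_sel by (rule image_cong[OF refl])
qed

end

lemma Union_edges_closed:
  assumes "B \<subseteq> edges M"
  shows "\<Union>B \<subseteq> C" "x \<in> \<Union>B \<Longrightarrow> \<theta> x \<in> \<Union>B" "x \<in> \<Union>B \<Longrightarrow> \<sigma> x \<in> \<Union>B"
proof -
  have e: "\<exists>y\<in>C. e = edge y" if "e \<in> B" for e using assms that unfolding edges_eq by blast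
  have "edge y \<subseteq> C" if "y \<in> C" for y unfolding edge_def using that perm_in by simp
  then show "\<Union>B \<subseteq> C" using e by blast
  assume "x \<in> \<Union>B"
  then obtain e where "e \<in> B" "x \<in> e" by blast
  then show "\<theta> x \<in> \<Union>B" "\<sigma> x \<in> \<Union>B" using e edge_closed by blast+
qed

lemma delete_empty: "delete_edge M {} = M"
proof -
  have "(LEAST j. 1 \<le> j \<and> (\<tau> ^^ j) b \<notin> {}) = 1" for b
    by (rule Least_equality) simp_all
  then have 1: "(\<tau> ^^ (LEAST j. 1 \<le> j \<and> (\<tau> ^^ j) b \<notin> {})) b = \<tau> b" for b
    by (simp only: funpow.simps One_nat_def o_id)
  have r: "perm_restrict f C = f" if "f permutes C" for f
    unfolding perm_restrict_def using permutes_not_in[OF that] by auto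
  have v: "\<not> \<Union>v \<subseteq> {}" if "v \<in> cycle_vertices M" for v
    using that unfolding cycle_vertices_eq using Union_orbit_pair vertex_self by blast
  have "card {v \<in> cycle_vertices M. \<Union>v \<subseteq> {}} = 0" using v by (metis (mono_tags, lifting) Collect_empty_eq card.empty)
  then have 2: "empty_pairs M + card {v \<in> cycle_vertices M. \<Union>v \<subseteq> {}} = empty_pairs M" by linarith
  show ?thesis unfolding 2 delete_edge_def Diff_empty 1 r[OF theta_perm] r[OF sigma_perm] r[OF tau_perm] by simp
qed

lemma delete_edges_eq:
  assumes B: "B \<subseteq> edges M"
  shows "delete_edges M B = delete_edge M (\<Union>B)"
proof -
  let ?f = "\<lambda>e N. delete_edge N e"
  have "finite (edges M)" unfolding edges_eq using fin by simp
  then have finB: "finite B" using finite_subset[OF B] by blast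
  have N: "N = delete_edge M (\<Union>B)" if "fold_graph ?f M B N" for N
    using that B
  proof (induction rule: fold_graph.induct)
    case emptyI
    show ?case unfolding Union_empty delete_empty ..
  next
    case (insertI x A y)
    then have A: "A \<subseteq> edges M" and y: "y = delete_edge M (\<Union>A)" by simp_all
    have "\<Union>(insert x A) = \<Union>A \<union> x" unfolding Union_insert by (rule Un_commute)
    then show ?case unfolding y by (simp only: delete_delete[OF Union_edges_closed[OF A]])
  qed
  from finite_imp_fold_graph[OF finB, of ?f M] obtain N' where N': "fold_graph ?f M B N'" ..
  have "(THE N. fold_graph ?f M B N) = delete_edge M (\<Union>B)"
    by (rule the_equality, rule N'[unfolded N[OF N']], rule N)
  then show ?thesis unfolding delete_edges_def Finite_Set.fold_def using finB by simp
qed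

lemma edges_delete_edges:
  assumes B: "B \<subseteq> edges M"
  shows "edges (delete_edges M B) = edges M - B"
proof -
  have "edges (delete_edges M B) = edge ` (C - \<Union>B)"
    unfolding delete_edges_eq[OF B] by (rule delete_edge_edges[OF Union_edges_closed[OF B]])
  also have "\<dots> = edges M - B"
  proof -
    have "edge x \<in> B \<longleftrightarrow> x \<in> \<Union>B" if "x \<in> C" for x
    proof
      assume "edge x \<in> B"
      then show "x \<in> \<Union>B" unfolding edge_def by blast
    next
      assume "x \<in> \<Union>B"
      then obtain e where e: "e \<in> B" "x \<in> e" by blast
      then obtain y where "e = edge y" using B unfolding edges_eq by blast
      then show "edge x \<in> B" using e edge_eq by metis
    qed
    then show ?thesis unfolding edges_eq by blast
  qed
  finally show ?thesis .
qed

lemma cross_map_delete_edges: "B \<subseteq> edges M \<Longrightarrow> cross_map (delete_edges M B)"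
  unfolding delete_edges_eq by (rule cross_map_delete[OF Union_edges_closed])

lemma num_vertices_delete_edges: "B \<subseteq> edges M \<Longrightarrow> num_vertices (delete_edges M B) = num_vertices M"
  unfolding delete_edges_eq by (rule num_vertices_delete[OF Union_edges_closed])

end

context group
begin

lemma local_flows_cycle_prod:
  "local_flows G M = {\<psi> \<in> crosses M \<rightarrow>\<^sub>E carrier G.
     (\<forall>a\<in>crosses M. \<psi> (sigma M a) = inv (\<psi> a) \<and> \<psi> (theta M a) = \<psi> a) \<and>
     (\<forall>a\<in>crosses M. cycle_prod (tau M) \<psi> a = \<one>)}"
  unfolding local_flows_def cycle_prod_def ..

lemma cycle_prod_iff_potential:
  assumes f: "permutation f" and S: "\<And>x. x \<in> S \<Longrightarrow> f x \<in> S" and \<psi>: "\<And>x. x \<in> S \<Longrightarrow> \<psi> x \<in> carrier G"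
  shows "(\<forall>a\<in>S. cycle_prod f \<psi> a = \<one>) \<longleftrightarrow> (\<exists>h. potential f S \<psi> h)"
proof
  assume one: "\<forall>a\<in>S. cycle_prod f \<psi> a = \<one>"
  show "\<exists>h. potential f S \<psi> h" by (rule ex_potential[OF f S \<psi>]) (use one in blast)+
next
  assume "\<exists>h. potential f S \<psi> h"
  then obtain h where h: "potential f S \<psi> h" by blast
  show "\<forall>a\<in>S. cycle_prod f \<psi> a = \<one>"
  proof
    fix a assume a: "a \<in> S"
    show "cycle_prod f \<psi> a = \<one>" by (rule cycle_prod_potential[OF f h _ a]) (rule S)
  qed
qed

lemma potential_first_return:
  assumes h: "potential f S \<psi> h" and S: "\<And>x. x \<in> S \<Longrightarrow> f x \<in> S" and one: "\<And>x. x \<in> S \<Longrightarrow> x \<in> X \<Longrightarrow> \<psi> x = \<one>"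
    and r: "first_return f X b y" "b \<in> S"
  shows "h y = h (f b)"
  using r
proof (induction rule: first_return.induct)
  case (stop b)
  show ?case ..
next
  case (skip b y)
  have fb: "f b \<in> S" by (rule S[OF skip.prems])
  have hc: "h (f b) \<in> carrier G" "h (f (f b)) \<in> carrier G" using h fb S[OF fb] unfolding potential_def by simp_all
  have "\<one> = inv (h (f b)) \<otimes> h (f (f b))" using h fb one[OF fb skip.hyps(1)] unfolding potential_def by metis
  then have "h (f b) = h (f (f b))" using hc by (metis inv_solve_left' one_closed r_one)
  then show ?case using skip.IH[OF fb] by simp
qed

end

context cross_map
begin

context
  fixes X :: "'c set" and G :: "('g, 'x) monoid_scheme" (structure)
  assumes XC: "X \<subseteq> C" and X: "\<And>x. x \<in> X \<Longrightarrow> \<theta> x \<in> X" "\<And>x. x \<in> X \<Longrightarrow> \<sigma> x \<in> X"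
    and group: "group G"
begin

interpretation group G by (rule group)
interpretation N: cross_map "delete_edge M X" by (rule cross_map_delete[OF XC X])

lemma ret: "b \<in> C \<Longrightarrow> b \<notin> X \<Longrightarrow> first_ret X b (tau (delete_edge M X) b)"
  by (rule tau'_ret[OF XC X])

lemma ret_in: "b \<in> C - X \<Longrightarrow> tau (delete_edge M X) b \<in> C - X"
  by (rule tau'_in[OF XC X])

lemma del_crosses: "crosses (delete_edge M X) = C - X"
  by (rule delete_sel(1)[OF XC X])

lemma del_restrict: "a \<in> C - X \<Longrightarrow> theta (delete_edge M X) a = \<theta> a" "a \<in> C - X \<Longrightarrow> sigma (delete_edge M X) a = \<sigma> a"
  by (rule delete_restrict(1)[OF XC X], assumption+) (rule delete_restrict(2)[OF XC X], assumption+)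

lemma del_in: "a \<in> C - X \<Longrightarrow> \<theta> a \<in> C - X" "a \<in> C - X \<Longrightarrow> \<sigma> a \<in> C - X"
  using X_iff(1)[OF XC X, of a] X_iff(2)[OF XC X, of a] perm_in by simp_all

lemma cycle_prod_delete:
  assumes \<psi>: "\<And>x. x \<in> C \<Longrightarrow> \<psi> x \<in> carrier G" and one: "\<And>x. x \<in> X \<Longrightarrow> \<psi> x = \<one>"
    and \<xi>: "\<And>x. x \<in> C - X \<Longrightarrow> \<xi> x = \<psi> x"
  shows "(\<forall>a\<in>C. cycle_prod \<tau> \<psi> a = \<one>) \<longleftrightarrow> (\<forall>a\<in>C - X. cycle_prod (tau (delete_edge M X)) \<xi> a = \<one>)"
proof -
  let ?t = "tau (delete_edge M X)" and ?D = "C - X"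
  have 1: "(\<forall>a\<in>C. cycle_prod \<tau> \<psi> a = \<one>) \<longleftrightarrow> (\<exists>h. potential \<tau> C \<psi> h)"
    by (rule cycle_prod_iff_potential[OF tau_permutation perm_in(3) \<psi>])
  have 2: "(\<forall>a\<in>?D. cycle_prod ?t \<xi> a = \<one>) \<longleftrightarrow> (\<exists>h. potential ?t ?D \<xi> h)"
    by (rule cycle_prod_iff_potential[OF N.tau_permutation ret_in]) (use \<psi> \<xi> in simp_all)
  have 3: "potential ?t ?D \<xi> h" if h: "potential \<tau> C \<psi> h" for h
    unfolding potential_def
  proof
    fix x assume x: "x \<in> ?D"
    have "h (?t x) = h (\<tau> x)" by (rule potential_first_return[OF h perm_in(3) one ret]) (use x in simp_all)
    then show "h x \<in> carrier G \<and> \<xi> x = inv (h x) \<otimes> h (?t x)" using h x \<xi>[OF x] unfolding potential_def by simp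
  qed
  have 4: "\<exists>h. potential \<tau> C \<psi> h" if h: "potential ?t ?D \<xi> h" for h
  proof -
    have hc: "h z \<in> carrier G" and hx: "\<xi> z = inv (h z) \<otimes> h (?t z)" if "z \<in> ?D" for z
      using h that unfolding potential_def by blast+
    define k where "k z = (if z \<in> ?D then h z else if \<exists>y. first_ret X z y then h (THE y. first_ret X z y) else \<one>)" for z
    have kD: "k z = h z" if "z \<in> ?D" for z unfolding k_def using that by (rule if_P)
    have kX: "k z = h y" if "z \<in> X" "first_ret X z y" for z y
    proof -
      have "(THE y. first_ret X z y) = y" by (rule the_equality, rule that(2), rule first_return_det[OF _ that(2)])
      then show ?thesis unfolding k_def using that by (metis DiffD2)
    qed
    have kO: "k z = \<one>" if "z \<in> X" "\<nexists>y. first_ret X z y" for z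
    proof -
      have "z \<notin> ?D" using that(1) by simp
      then show ?thesis unfolding k_def if_not_P[OF that(2)] by (rule if_not_P)
    qed
    have kret: "k (\<tau> z) = h y" if "z \<in> C" "first_ret X z y" for z y
      using that(2)
    proof cases
      case stop
      then show ?thesis using kD perm_in(3)[OF that(1)] by simp
    next
      case skip
      then show ?thesis using kX by simp
    qed
    have "potential \<tau> C \<psi> k"
      unfolding potential_def
    proof
      fix x assume x: "x \<in> C"
      show "k x \<in> carrier G \<and> \<psi> x = inv (k x) \<otimes> k (\<tau> x)"
      proof (cases "x \<in> X")
        case False
        then have xD: "x \<in> ?D" using x by blast
        have "k (\<tau> x) = h (?t x)" by (rule kret[OF x ret[OF x False]])
        then show ?thesis using hc[OF xD] hx[OF xD] \<xi>[OF xD] kD[OF xD] by simp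
      next
        case True
        have "k x \<in> carrier G \<and> k (\<tau> x) = k x"
        proof (cases "\<exists>y. first_ret X x y")
          case ex: True
          then obtain y where y: "first_ret X x y" by blast
          have "y \<in> C" by (rule first_return_closed[OF y x perm_in(3)])
          then have "h y \<in> carrier G" using hc first_return_notin[OF y] by simp
          then show ?thesis using kret[OF x y] kX[OF True y] by simp
        next
          case no: False
          have tX: "\<tau> x \<in> X" using no first_return.stop[of \<tau> x X] by blast
          then have "\<nexists>y. first_ret X (\<tau> x) y" using no first_return.skip[of \<tau> x X] by blast
          then show ?thesis using kO[OF tX] kO[OF True no] by simp
        qed
        then show ?thesis using one[OF True] by simp
      qed
    qed
    then show ?thesis by blast
  qed
  show ?thesis unfolding 1 2 using 3 4 by blast
qed

lemma card_flows_delete: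
  "card {\<psi> \<in> local_flows G M. \<forall>a\<in>X. \<psi> a = \<one>} = card (local_flows G (delete_edge M X))"
proof -
  let ?D = "C - X" and ?N = "delete_edge M X"
  have bij: "bij_betw (\<lambda>\<psi>. restrict \<psi> ?D) {\<psi> \<in> local_flows G M. \<forall>a\<in>X. \<psi> a = \<one>} (local_flows G ?N)"
  proof (rule bij_betw_imageI)
    show "inj_on (\<lambda>\<psi>. restrict \<psi> ?D) {\<psi> \<in> local_flows G M. \<forall>a\<in>X. \<psi> a = \<one>}"
    proof (rule inj_onI)
      fix \<psi> \<chi> assume p: "\<psi> \<in> {\<psi> \<in> local_flows G M. \<forall>a\<in>X. \<psi> a = \<one>}" and c: "\<chi> \<in> {\<psi> \<in> local_flows G M. \<forall>a\<in>X. \<psi> a = \<one>}"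
        and eq: "restrict \<psi> ?D = restrict \<chi> ?D"
      have "\<psi> \<in> C \<rightarrow>\<^sub>E carrier G" "\<chi> \<in> C \<rightarrow>\<^sub>E carrier G" using p c unfolding local_flows_def by blast+
      then show "\<psi> = \<chi>"
      proof (rule PiE_ext)
        fix x assume "x \<in> C"
        show "\<psi> x = \<chi> x"
        proof (cases "x \<in> X")
          case True
          then show ?thesis using p c by simp
        next
          case False
          then show ?thesis using fun_cong[OF eq, of x] \<open>x \<in> C\<close> by simp
        qed
      qed
    qed
    show "(\<lambda>\<psi>. restrict \<psi> ?D) ` {\<psi> \<in> local_flows G M. \<forall>a\<in>X. \<psi> a = \<one>} = local_flows G ?N"
    proof
      show "(\<lambda>\<psi>. restrict \<psi> ?D) ` {\<psi> \<in> local_flows G M. \<forall>a\<in>X. \<psi> a = \<one>} \<subseteq> local_flows G ?N"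
      proof (rule image_subsetI)
        fix \<psi> assume p: "\<psi> \<in> {\<psi> \<in> local_flows G M. \<forall>a\<in>X. \<psi> a = \<one>}"
        then have "\<psi> \<in> local_flows G M" by blast
        note p' = CollectD[OF this[unfolded local_flows_cycle_prod]]
        have pc: "\<psi> x \<in> carrier G" if "x \<in> C" for x by (rule PiE_mem[OF conjunct1[OF p'] that])
        have cyc: "\<forall>a\<in>C. cycle_prod \<tau> \<psi> a = \<one>" by (rule conjunct2[OF conjunct2[OF p']])
        have 1: "restrict \<psi> ?D \<in> ?D \<rightarrow>\<^sub>E carrier G" using pc by simp
        have 2: "\<forall>a\<in>?D. cycle_prod (tau ?N) (restrict \<psi> ?D) a = \<one>"
          using cyc cycle_prod_delete[of \<psi> "restrict \<psi> ?D", OF pc] p by simp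
        have 3: "restrict \<psi> ?D (sigma ?N a) = inv (restrict \<psi> ?D a) \<and> restrict \<psi> ?D (theta ?N a) = restrict \<psi> ?D a"
          if a: "a \<in> ?D" for a
        proof -
          have aC: "a \<in> C" using a by blast
          have "\<psi> (\<sigma> a) = inv (\<psi> a) \<and> \<psi> (\<theta> a) = \<psi> a" by (rule bspec[OF conjunct1[OF conjunct2[OF p']] aC])
          then show ?thesis unfolding del_restrict[OF a] restrict_apply'[OF a] restrict_apply'[OF del_in(1)[OF a]] restrict_apply'[OF del_in(2)[OF a]] .
        qed
        show "restrict \<psi> ?D \<in> local_flows G ?N" unfolding local_flows_cycle_prod del_crosses using 1 2 3 by blast
      qed
      show "local_flows G ?N \<subseteq> (\<lambda>\<psi>. restrict \<psi> ?D) ` {\<psi> \<in> local_flows G M. \<forall>a\<in>X. \<psi> a = \<one>}"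
      proof
        fix \<xi> assume \<xi>: "\<xi> \<in> local_flows G ?N"
        note \<xi>' = CollectD[OF \<xi>[unfolded local_flows_cycle_prod del_crosses]]
        define \<psi> where "\<psi> = (\<lambda>a\<in>C. if a \<in> X then \<one> else \<xi> a)"
        have pX: "\<psi> a = \<one>" if "a \<in> X" for a unfolding \<psi>_def using that XC by auto
        have pD: "\<psi> a = \<xi> a" if "a \<in> ?D" for a unfolding \<psi>_def using that by simp
        have \<xi>c: "\<xi> a \<in> carrier G" if "a \<in> ?D" for a by (rule PiE_mem[OF conjunct1[OF \<xi>'] that])
        have pc: "\<psi> x \<in> carrier G" if "x \<in> C" for x unfolding \<psi>_def using that \<xi>c by simp
        have \<xi>cyc: "\<forall>a\<in>?D. cycle_prod (tau ?N) \<xi> a = \<one>" by (rule conjunct2[OF conjunct2[OF \<xi>']])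
        have cyc: "\<forall>a\<in>C. cycle_prod \<tau> \<psi> a = \<one>"
          using \<xi>cyc cycle_prod_delete[of \<psi> \<xi>, OF pc pX pD[symmetric]] by blast
        have ed: "\<psi> (\<sigma> a) = inv (\<psi> a) \<and> \<psi> (\<theta> a) = \<psi> a" if a: "a \<in> C" for a
        proof (cases "a \<in> X")
          case True
          then show ?thesis using pX[OF True] pX[OF X(1)[OF True]] pX[OF X(2)[OF True]] by simp
        next
          case False
          then have aD: "a \<in> ?D" using a by blast
          have "\<xi> (sigma ?N a) = inv (\<xi> a) \<and> \<xi> (theta ?N a) = \<xi> a" by (rule bspec[OF conjunct1[OF conjunct2[OF \<xi>']] aD])
          then show ?thesis unfolding del_restrict[OF aD] pD[OF aD] pD[OF del_in(1)[OF aD]] pD[OF del_in(2)[OF aD]] .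
        qed
        have "\<psi> \<in> C \<rightarrow>\<^sub>E carrier G" using pc unfolding \<psi>_def by (intro PiE_I) simp_all
        then have "\<psi> \<in> {\<psi> \<in> local_flows G M. \<forall>a\<in>X. \<psi> a = \<one>}"
          unfolding local_flows_cycle_prod using cyc ed pX by blast
        moreover have "restrict \<psi> ?D = \<xi>"
        proof
          fix x
          have "\<xi> x = undefined" if "x \<notin> ?D" by (rule PiE_arb[OF conjunct1[OF \<xi>'] that])
          then show "restrict \<psi> ?D x = \<xi> x" using pD[of x] unfolding restrict_def by presburger
        qed
        ultimately show "\<xi> \<in> (\<lambda>\<psi>. restrict \<psi> ?D) ` {\<psi> \<in> local_flows G M. \<forall>a\<in>X. \<psi> a = \<one>}" by blast
      qed
    qed
  qed
  show ?thesis by (rule bij_betw_same_card[OF bij])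
qed

end

lemma finite_local_flows:
  assumes "finite (carrier G)"
  shows "finite (local_flows G M)"
  by (rule finite_subset[of _ "C \<rightarrow>\<^sub>E carrier G"]) (use finite_PiE[of C "\<lambda>_. carrier G"] assms fin in \<open>auto simp: local_flows_def\<close>)

lemma nowhere_identity_inclusion_exclusion:
  fixes G :: "('g, 'x) monoid_scheme" (structure)
  assumes grp: "group G" and finG: "finite (carrier G)"
  shows "(of_nat (num_nowhere_identity_flows G M) :: 'b :: comm_ring_1) =
    (\<Sum>B\<in>Pow (edges M). (- 1) ^ card B * of_nat (card (local_flows G (delete_edges M B))))"
proof -
  interpret group G by (rule grp)
  define bad where "bad \<psi> = {e \<in> edges M. \<forall>a\<in>e. \<psi> a = \<one>}" for \<psi> :: "'c \<Rightarrow> 'g"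
  have finE: "finite (edges M)" unfolding edges_eq using fin by simp
  have finF: "finite (local_flows G M)" by (rule finite_local_flows[OF finG])
  have bad: "bad \<psi> = {} \<longleftrightarrow> (\<forall>a\<in>C. \<psi> a \<noteq> \<one>)" if \<psi>: "\<psi> \<in> local_flows G M" for \<psi>
  proof -
    have "(\<forall>a\<in>edge x. \<psi> a = \<one>) \<longleftrightarrow> \<psi> x = \<one>" if x: "x \<in> C" for x
    proof
      assume "\<forall>a\<in>edge x. \<psi> a = \<one>"
      then show "\<psi> x = \<one>" unfolding edge_def by blast
    next
      assume 1: "\<psi> x = \<one>"
      have f: "\<psi> (\<sigma> a) = inv (\<psi> a)" "\<psi> (\<theta> a) = \<psi> a" if "a \<in> C" for a using \<psi> that unfolding local_flows_def by blast+
      show "\<forall>a\<in>edge x. \<psi> a = \<one>" unfolding edge_def using f[OF x] f(2)[OF perm_in(2)[OF x]] 1 by simp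
    qed
    then show ?thesis unfolding bad_def edges_eq by blast
  qed
  have alt: "(\<Sum>B\<in>Pow E. (- 1) ^ card B) = (if E = {} then 1 else 0 :: 'b)" if "finite E" for E :: "'c set set"
  proof (cases "E = {}")
    case True
    then show ?thesis by simp
  next
    case False
    then obtain e where e: "e \<in> E" by blast
    have "(\<Sum>B\<in>Pow E. (- 1) ^ card B) = (\<Sum>B\<in>Pow (insert e (E - {e})). (- 1 :: 'b) ^ card B)" using e by (simp add: insert_absorb)
    also have "\<dots> = (\<Sum>B\<in>Pow (E - {e}). (- 1) ^ card B) + (\<Sum>B\<in>insert e ` Pow (E - {e}). (- 1) ^ card B)"
      unfolding Pow_insert by (rule sum.union_disjoint) (use that in auto)
    also have "(\<Sum>B\<in>insert e ` Pow (E - {e}). (- 1 :: 'b) ^ card B) = (\<Sum>B\<in>Pow (E - {e}). (- 1) ^ card (insert e B))"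
      by (subst sum.reindex) (auto simp: inj_on_def)
    also have "\<dots> = (\<Sum>B\<in>Pow (E - {e}). - ((- 1) ^ card B))"
    proof (rule sum.cong[OF refl])
      fix B assume "B \<in> Pow (E - {e})"
      then have "finite B" "e \<notin> B" using finite_subset[OF _ that] by blast+
      then show "(- 1 :: 'b) ^ card (insert e B) = - ((- 1) ^ card B)" by simp
    qed
    finally show ?thesis using False by (simp add: sum_negf)
  qed
  have "of_nat (num_nowhere_identity_flows G M) = (of_nat (card {\<psi> \<in> local_flows G M. bad \<psi> = {}}) :: 'b)"
  proof -
    have "{\<psi> \<in> local_flows G M. \<forall>a\<in>C. \<psi> a \<noteq> \<one>} = {\<psi> \<in> local_flows G M. bad \<psi> = {}}" using bad by blast
    then show ?thesis unfolding num_nowhere_identity_flows_def by (simp only:)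
  qed
  also have "\<dots> = (\<Sum>\<psi>\<in>local_flows G M. if bad \<psi> = {} then 1 else 0)"
    unfolding sum.inter_filter[OF finF, symmetric] by (simp only: sum_constant mult_1_right)
  also have "\<dots> = (\<Sum>\<psi>\<in>local_flows G M. \<Sum>B\<in>Pow (edges M). if B \<subseteq> bad \<psi> then (- 1) ^ card B else 0)"
  proof (rule sum.cong[OF refl])
    fix \<psi>
    have sub: "bad \<psi> \<subseteq> edges M" unfolding bad_def by blast
    have "(if bad \<psi> = {} then 1 else 0 :: 'b) = (\<Sum>B\<in>Pow (bad \<psi>). (- 1) ^ card B)"
      by (rule alt[OF finite_subset[OF sub finE], symmetric])
    also have "Pow (bad \<psi>) = {B \<in> Pow (edges M). B \<subseteq> bad \<psi>}" using sub by blast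
    also have "(\<Sum>B\<in>{B \<in> Pow (edges M). B \<subseteq> bad \<psi>}. (- 1 :: 'b) ^ card B) = (\<Sum>B\<in>Pow (edges M). if B \<subseteq> bad \<psi> then (- 1) ^ card B else 0)"
      by (rule sum.inter_filter) (use finE in simp)
    finally show "(if bad \<psi> = {} then 1 else 0 :: 'b) = (\<Sum>B\<in>Pow (edges M). if B \<subseteq> bad \<psi> then (- 1) ^ card B else 0)" .
  qed
  also have "\<dots> = (\<Sum>B\<in>Pow (edges M). \<Sum>\<psi>\<in>local_flows G M. if B \<subseteq> bad \<psi> then (- 1) ^ card B else 0)"
    by (rule sum.swap)
  also have "\<dots> = (\<Sum>B\<in>Pow (edges M). (- 1) ^ card B * of_nat (card (local_flows G (delete_edges M B))))"
  proof (rule sum.cong[OF refl])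
    fix B assume "B \<in> Pow (edges M)"
    then have B: "B \<subseteq> edges M" by blast
    have cf: "card {\<psi> \<in> local_flows G M. \<forall>a\<in>\<Union>B. \<psi> a = \<one>} = card (local_flows G (delete_edge M (\<Union>B)))"
      by (rule card_flows_delete[OF Union_edges_closed(1)[OF B] _ _ grp]) (rule Union_edges_closed(2,3)[OF B], assumption)+
    have "(\<Sum>\<psi>\<in>local_flows G M. if B \<subseteq> bad \<psi> then (- 1 :: 'b) ^ card B else 0) = (\<Sum>\<psi>\<in>{\<psi> \<in> local_flows G M. B \<subseteq> bad \<psi>}. (- 1) ^ card B)"
      by (rule sum.inter_filter[OF finF, symmetric])
    also have "{\<psi> \<in> local_flows G M. B \<subseteq> bad \<psi>} = {\<psi> \<in> local_flows G M. \<forall>a\<in>\<Union>B. \<psi> a = \<one>}"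
      unfolding bad_def using B by blast
    also have "(\<Sum>\<psi>\<in>{\<psi> \<in> local_flows G M. \<forall>a\<in>\<Union>B. \<psi> a = \<one>}. (- 1 :: 'b) ^ card B)
      = (- 1) ^ card B * of_nat (card {\<psi> \<in> local_flows G M. \<forall>a\<in>\<Union>B. \<psi> a = \<one>})"
      unfolding sum_constant by (rule mult.commute)
    finally show "(\<Sum>\<psi>\<in>local_flows G M. if B \<subseteq> bad \<psi> then (- 1 :: 'b) ^ card B else 0)
        = (- 1) ^ card B * of_nat (card (local_flows G (delete_edges M B)))"
      by (simp only: cf delete_edges_eq[OF B])
  qed
  finally show ?thesis .
qed

end

section \<open>Connected components\<close>

lemma support_restrict:
  assumes "\<And>x. x \<in> D \<Longrightarrow> g x = f x" "\<And>x. x \<in> D \<Longrightarrow> f x \<in> D" "a \<in> D"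
  shows "support g a = support f a"
proof -
  have p: "(g ^^ n) a = (f ^^ n) a \<and> (f ^^ n) a \<in> D" for n
    by (induction n) (use assms in auto)
  then have e: "(g ^^ n) a = (f ^^ n) a" for n by blast
  show ?thesis unfolding least_power_def e ..
qed

locale transitive_map = cross_map +
  assumes nonempty: "crosses M \<noteq> {}" and no_empty_pairs: "empty_pairs M = 0"
    and transitive: "\<And>X. X \<subseteq> crosses M \<Longrightarrow> X \<noteq> {} \<Longrightarrow> (\<forall>x\<in>X. theta M x \<in> X \<and> sigma M x \<in> X \<and> tau M x \<in> X) \<Longrightarrow> X = crosses M"

context cross_map
begin

abbreviation "pieces \<equiv> gen_orbits C {\<theta>, \<sigma>, \<tau>}"

lemma perms: "s \<in> {\<theta>, \<sigma>, \<tau>} \<Longrightarrow> s permutes C"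
  using theta_perm sigma_perm tau_perm by blast

lemma finite_pieces: "finite pieces" and disjoint_pieces: "disjoint pieces" and Union_pieces: "\<Union>pieces = C"
  by (rule gen_orbits_finite[OF fin perms] gen_orbits_disjoint[OF fin perms] gen_orbits_Union[OF fin perms], assumption)+

context
  fixes D assumes D: "D \<in> pieces"
begin

lemma piece_subset: "D \<subseteq> C" using D Union_pieces by blast

lemma finite_piece: "finite D" by (rule finite_subset[OF piece_subset fin])

lemma piece_orbit:
  assumes "x \<in> D" shows "gen_orbit C {\<theta>, \<sigma>, \<tau>} x = D"
  by (rule gen_orbits_mem(2)[OF fin perms D assms])

lemma piece_closed: "x \<in> D \<Longrightarrow> \<theta> x \<in> D" "x \<in> D \<Longrightarrow> \<sigma> x \<in> D" "x \<in> D \<Longrightarrow> \<tau> x \<in> D"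
proof -
  assume x: "x \<in> D"
  have "s y \<in> D" if "y \<in> D" "s \<in> {\<theta>, \<sigma>, \<tau>}" for s y
  proof -
    have "y \<in> gen_orbit C {\<theta>, \<sigma>, \<tau>} y" by (rule gen_orbit_self[OF fin perms])
    then have "s y \<in> gen_orbit C {\<theta>, \<sigma>, \<tau>} y" by (rule gen_orbit_step[OF fin perms _ that(2), rotated])
    then show ?thesis unfolding piece_orbit[OF that(1)] .
  qed
  then show "\<theta> x \<in> D" "\<sigma> x \<in> D" "\<tau> x \<in> D" using x by blast+
qed

lemma piece_nonempty: "D \<noteq> {}"
proof -
  obtain a where "a \<in> C" "D = gen_orbit C {\<theta>, \<sigma>, \<tau>} a" using D unfolding gen_orbits_def by blast
  moreover have "a \<in> gen_orbit C {\<theta>, \<sigma>, \<tau>} a" by (rule gen_orbit_self[OF fin perms])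
  ultimately show ?thesis by blast
qed

lemma submap_sel:
  "crosses (submap M D) = D" "theta (submap M D) = perm_restrict \<theta> D" "sigma (submap M D) = perm_restrict \<sigma> D"
  "tau (submap M D) = perm_restrict \<tau> D" "empty_pairs (submap M D) = 0"
  unfolding submap_def by simp_all

lemma submap_apply:
  assumes "x \<in> D"
  shows "theta (submap M D) x = \<theta> x" "sigma (submap M D) x = \<sigma> x" "tau (submap M D) x = \<tau> x"
  unfolding submap_sel perm_restrict_def using assms by simp_all

lemma transitive_map_submap: "transitive_map (submap M D)"
proof (unfold_locales, unfold submap_sel)
  have r: "perm_restrict f D x = (if x \<in> D then f x else x)" for f x unfolding perm_restrict_def by simp
  show "finite D" by (rule finite_piece)
  show "perm_restrict \<theta> D permutes D" "perm_restrict \<sigma> D permutes D" "perm_restrict \<tau> D permutes D"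
    by (rule perm_restrict_permutes[OF finite_piece], rule permutes_inj, rule theta_perm sigma_perm tau_perm, rule piece_closed, assumption)+
  fix x
  show "perm_restrict \<theta> D (perm_restrict \<theta> D x) = x" using piece_closed(1)[of x] theta_inv[of x] unfolding r by presburger
  show "perm_restrict \<sigma> D (perm_restrict \<sigma> D x) = x" using piece_closed(2)[of x] sigma_inv[of x] unfolding r by presburger
  show "perm_restrict \<theta> D (perm_restrict \<sigma> D x) = perm_restrict \<sigma> D (perm_restrict \<theta> D x)"
    using piece_closed(1,2)[of x] theta_sigma[of x] unfolding r by presburger
  show "perm_restrict \<tau> D (perm_restrict \<sigma> D (perm_restrict \<tau> D x)) = perm_restrict \<sigma> D x"
    using piece_closed(3)[of x] piece_closed(2)[of "\<tau> x"] tau_sigma_tau[of x] unfolding r by presburger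
  show "D \<noteq> {}" by (rule piece_nonempty)
  show "0 = (0 :: nat)" ..
  assume x: "x \<in> D"
  then have xC: "x \<in> C" using piece_subset by blast
  show "perm_restrict \<theta> D x \<noteq> x" "perm_restrict \<sigma> D x \<noteq> x" "perm_restrict \<theta> D (perm_restrict \<sigma> D x) \<noteq> x"
    "perm_restrict \<tau> D (perm_restrict \<sigma> D x) \<noteq> x"
    using theta_free[OF xC] sigma_free[OF xC] theta_sigma_free[OF xC] tau_sigma_free[OF xC] x piece_closed(2)[OF x] unfolding r by presburger+
next
  fix X assume X: "X \<subseteq> D" "X \<noteq> {}"
    and cl: "\<forall>x\<in>X. perm_restrict \<theta> D x \<in> X \<and> perm_restrict \<sigma> D x \<in> X \<and> perm_restrict \<tau> D x \<in> X"
  obtain a where a: "a \<in> X" using X(2) by blast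
  have cl': "\<forall>x\<in>X. \<forall>s\<in>{\<theta>, \<sigma>, \<tau>}. s x \<in> X"
  proof
    fix x assume x: "x \<in> X"
    then have "x \<in> D" using X(1) by blast
    then show "\<forall>s\<in>{\<theta>, \<sigma>, \<tau>}. s x \<in> X" using bspec[OF cl x] unfolding perm_restrict_def by simp
  qed
  have "gen_orbit C {\<theta>, \<sigma>, \<tau>} a \<subseteq> X" by (rule gen_orbit_subset[OF fin perms subset_trans[OF X(1) piece_subset] cl' a])
  moreover have "a \<in> D" using a X(1) by blast
  ultimately show "X = D" using piece_orbit X(1) by blast
qed

lemma orbit_submap: "a \<in> D \<Longrightarrow> orbit (tau (submap M D)) a = orbit \<tau> a"
  by (rule orbit_restrict_eq[of _ D], assumption, rule submap_apply, assumption, rule piece_closed, assumption)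

lemma cycle_vertices_submap: "cycle_vertices (submap M D) = vert.orbit_pair ` D"
  unfolding cycle_vertices_def submap_sel(1) vert.orbit_pair_def vert_step
  by (rule image_cong[OF refl]) (simp only: submap_apply orbit_submap piece_closed)

lemma edges_submap: "edges (submap M D) = edge ` D"
proof -
  interpret N: transitive_map "submap M D" by (rule transitive_map_submap)
  have "N.edge x = edge x" if "x \<in> D" for x
    unfolding N.edge_def edge_def submap_apply[OF that] submap_apply[OF piece_closed(2)[OF that]] ..
  then show ?thesis unfolding N.edges_eq submap_sel(1) by (rule image_cong[OF refl])
qed

end

lemma vertex_subset_piece: "x \<in> C \<Longrightarrow> vertex x \<subseteq> gen_orbit C {\<theta>, \<sigma>, \<tau>} x"
  and edge_subset_piece: "x \<in> C \<Longrightarrow> edge x \<subseteq> gen_orbit C {\<theta>, \<sigma>, \<tau>} x"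
proof -
  assume x: "x \<in> C"
  let ?D = "gen_orbit C {\<theta>, \<sigma>, \<tau>} x"
  have D: "?D \<in> pieces" using x unfolding gen_orbits_def by blast
  have xD: "x \<in> ?D" by (rule gen_orbit_self[OF fin perms])
  have "orbit \<tau> y \<subseteq> ?D" if "y \<in> ?D" for y
  proof
    fix z assume "z \<in> orbit \<tau> y"
    then show "z \<in> ?D"
    proof induction
      case base
      show ?case by (rule piece_closed(3)[OF D that])
    next
      case (step z)
      show ?case by (rule piece_closed(3)[OF D step.IH])
    qed
  qed
  then show "vertex x \<subseteq> ?D" unfolding vertex_def using xD piece_closed(2)[OF D xD] by blast
  show "edge x \<subseteq> ?D" unfolding edge_def using xD piece_closed(1)[OF D xD] piece_closed(2)[OF D xD] piece_closed(1)[OF D piece_closed(2)[OF D xD]] by blast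
qed

lemma card_vertices_pieces: "card (cycle_vertices M) = (\<Sum>D\<in>pieces. card (cycle_vertices (submap M D)))"
proof -
  have "card (cycle_vertices M) = (\<Sum>D\<in>pieces. card (vert.orbit_pair ` D))"
    unfolding cycle_vertices_eq
  proof (rule card_image_gen_orbits[OF fin perms])
    fix x y assume "x \<in> C" "y \<in> C" "vert.orbit_pair x = vert.orbit_pair y"
    then show "y \<in> gen_orbit C {\<theta>, \<sigma>, \<tau>} x" unfolding orbit_pair_eq_iff using vertex_subset_piece by blast
  qed
  also have "\<dots> = (\<Sum>D\<in>pieces. card (cycle_vertices (submap M D)))"
    by (rule sum.cong[OF refl]) (simp only: cycle_vertices_submap)
  finally show ?thesis .
qed

lemma card_edges_pieces: "card (edges M) = (\<Sum>D\<in>pieces. card (edges (submap M D)))"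
proof -
  have "card (edges M) = (\<Sum>D\<in>pieces. card (edge ` D))"
    unfolding edges_eq
  proof (rule card_image_gen_orbits[OF fin perms])
    fix x y assume x: "x \<in> C" and "edge x = edge y"
    then have "y \<in> edge x" unfolding edge_def by blast
    then show "y \<in> gen_orbit C {\<theta>, \<sigma>, \<tau>} x" using edge_subset_piece[OF x] by blast
  qed
  also have "\<dots> = (\<Sum>D\<in>pieces. card (edges (submap M D)))"
    by (rule sum.cong[OF refl]) (simp only: edges_submap)
  finally show ?thesis .
qed

lemma restrict_local_flow_iff:
  fixes G :: "('g, 'x) monoid_scheme" (structure)
  assumes D: "D \<in> pieces" and \<psi>: "\<psi> \<in> C \<rightarrow>\<^sub>E carrier G"
  shows "restrict \<psi> D \<in> local_flows G (submap M D) \<longleftrightarrow>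
    (\<forall>a\<in>D. (\<psi> (\<sigma> a) = inv (\<psi> a) \<and> \<psi> (\<theta> a) = \<psi> a) \<and> foldr (\<lambda>x y. x \<otimes> y) (map \<psi> (support \<tau> a)) \<one> = \<one>)"
proof -
  have 1: "restrict \<psi> D \<in> D \<rightarrow>\<^sub>E carrier G" using PiE_mem[OF \<psi>] piece_subset[OF D] by (simp add: subset_iff)
  have 2: "restrict \<psi> D (sigma (submap M D) a) = \<psi> (\<sigma> a)" "restrict \<psi> D (theta (submap M D) a) = \<psi> (\<theta> a)"
    "restrict \<psi> D a = \<psi> a" if "a \<in> D" for a
    unfolding submap_apply[OF D that] using piece_closed[OF D that] that by simp_all
  have 3: "map (restrict \<psi> D) (support (tau (submap M D)) a) = map \<psi> (support \<tau> a)" if a: "a \<in> D" for a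
  proof -
    have s: "support (tau (submap M D)) a = support \<tau> a"
      by (rule support_restrict[of D]) (rule submap_apply[OF D] piece_closed[OF D] a, assumption?)+
    have "(\<tau> ^^ n) a \<in> D" for n by (induction n) (use a piece_closed(3)[OF D] in simp_all)
    then have "set (support \<tau> a) \<subseteq> D" by auto
    then show ?thesis unfolding s by (intro map_cong refl) auto
  qed
  show ?thesis unfolding local_flows_def submap_sel(1)[OF D] mem_Collect_eq ball_conj_distrib
    using 1 by (simp only: 2 3 simp_thms cong: ball_cong)
qed

lemma card_local_flows_pieces:
  assumes "finite (carrier G)"
  shows "card (local_flows G M) = (\<Prod>D\<in>pieces. card (local_flows G (submap M D)))"
proof -
  let ?ind = "\<lambda>D \<psi>. if \<psi> \<in> local_flows G (submap M D) then 1 else 0 :: nat"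
  have fin_pi: "finite (E \<rightarrow>\<^sub>E carrier G)" if "finite E" for E :: "'c set" by (rule finite_PiE[OF that assms])
  have "(\<Prod>D\<in>pieces. card (local_flows G (submap M D))) = (\<Prod>D\<in>pieces. \<Sum>\<psi>\<in>D \<rightarrow>\<^sub>E carrier G. ?ind D \<psi>)"
  proof (rule prod.cong[OF refl])
    fix D assume D: "D \<in> pieces"
    have "{\<psi> \<in> D \<rightarrow>\<^sub>E carrier G. \<psi> \<in> local_flows G (submap M D)} = local_flows G (submap M D)"
      unfolding local_flows_def submap_sel(1)[OF D] by blast
    then show "card (local_flows G (submap M D)) = (\<Sum>\<psi>\<in>D \<rightarrow>\<^sub>E carrier G. ?ind D \<psi>)"
      unfolding sum.inter_filter[OF fin_pi[OF finite_piece[OF D]], symmetric] by (simp only: card_eq_sum)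
  qed
  also have "\<dots> = (\<Sum>\<psi>\<in>C \<rightarrow>\<^sub>E carrier G. \<Prod>D\<in>pieces. ?ind D (restrict \<psi> D))"
    by (subst prod_sum_PiE_Union[OF finite_pieces disjoint_pieces]) (simp only: Union_pieces)
  also have "\<dots> = (\<Sum>\<psi>\<in>C \<rightarrow>\<^sub>E carrier G. if \<psi> \<in> local_flows G M then 1 else 0)"
  proof (rule sum.cong[OF refl])
    fix \<psi> assume \<psi>: "\<psi> \<in> C \<rightarrow>\<^sub>E carrier G"
    have "(\<Prod>D\<in>pieces. ?ind D (restrict \<psi> D)) = (if \<forall>D\<in>pieces. restrict \<psi> D \<in> local_flows G (submap M D) then 1 else 0)"
      using prod_indicator[OF finite_pieces, of "\<lambda>D. restrict \<psi> D \<in> local_flows G (submap M D)" "1 :: nat"] by simp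
    moreover have "(\<forall>D\<in>pieces. restrict \<psi> D \<in> local_flows G (submap M D)) \<longleftrightarrow> \<psi> \<in> local_flows G M"
    proof -
      have ball_Union: "(\<forall>D\<in>pieces. \<forall>a\<in>D. P a) \<longleftrightarrow> (\<forall>a\<in>\<Union>pieces. P a)" for P by blast
      have "(\<forall>D\<in>pieces. restrict \<psi> D \<in> local_flows G (submap M D)) \<longleftrightarrow>
        (\<forall>D\<in>pieces. \<forall>a\<in>D. (\<psi> (\<sigma> a) = inv\<^bsub>G\<^esub> (\<psi> a) \<and> \<psi> (\<theta> a) = \<psi> a) \<and> foldr (\<lambda>x y. x \<otimes>\<^bsub>G\<^esub> y) (map \<psi> (support \<tau> a)) \<one>\<^bsub>G\<^esub> = \<one>\<^bsub>G\<^esub>)"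
        using restrict_local_flow_iff[OF _ \<psi>] by (simp only: cong: ball_cong)
      also have "\<dots> \<longleftrightarrow> (\<forall>a\<in>\<Union>pieces. (\<psi> (\<sigma> a) = inv\<^bsub>G\<^esub> (\<psi> a) \<and> \<psi> (\<theta> a) = \<psi> a) \<and> foldr (\<lambda>x y. x \<otimes>\<^bsub>G\<^esub> y) (map \<psi> (support \<tau> a)) \<one>\<^bsub>G\<^esub> = \<one>\<^bsub>G\<^esub>)"
        by (rule ball_Union)
      also have "\<dots> \<longleftrightarrow> \<psi> \<in> local_flows G M"
        unfolding Union_pieces local_flows_def mem_Collect_eq ball_conj_distrib using \<psi> by (simp only: simp_thms)
      finally show ?thesis .
    qed
    ultimately show "(\<Prod>D\<in>pieces. ?ind D (restrict \<psi> D)) = (if \<psi> \<in> local_flows G M then 1 else 0)" by presburger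
  qed
  also have "\<dots> = card {\<psi> \<in> C \<rightarrow>\<^sub>E carrier G. \<psi> \<in> local_flows G M}"
    unfolding sum.inter_filter[OF fin_pi[OF fin], symmetric] by (simp only: card_eq_sum)
  also have "{\<psi> \<in> C \<rightarrow>\<^sub>E carrier G. \<psi> \<in> local_flows G M} = local_flows G M"
    unfolding local_flows_def by blast
  finally show ?thesis ..
qed

end

lemma is_map_cross_map:
  assumes M: "is_map M"
  shows "cross_map M"
proof -
  let ?C = "crosses M" and ?t = "theta M" and ?s = "sigma M" and ?u = "tau M"
  have fin: "finite ?C" and p: "?t permutes ?C" "?s permutes ?C" "?u permutes ?C" using M unfolding is_map_def by blast+
  have perms: "f \<in> {?t, ?s, ?u} \<Longrightarrow> f permutes ?C" for f using p by blast
  let ?O = "gen_orbits ?C {?t, ?s, ?u}"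
  have finO: "finite ?O" by (rule gen_orbits_finite[OF fin perms])
  have main: "?t (?t x) = x \<and> ?s (?s x) = x \<and> ?t (?s x) = ?s (?t x) \<and> ?u (?s (?u x)) = ?s x \<and>
    ?t x \<noteq> x \<and> ?s x \<noteq> x \<and> ?t (?s x) \<noteq> x \<and> ?u (?s x) \<noteq> x" if x: "x \<in> ?C" for x
  proof -
    let ?D = "gen_orbit ?C {?t, ?s, ?u} x"
    have D: "?D \<in> ?O" using x unfolding gen_orbits_def by blast
    have xD: "x \<in> ?D" by (rule gen_orbit_self[OF fin perms])
    have step: "f y \<in> ?D" if "y \<in> ?D" "f \<in> {?t, ?s, ?u}" for f y
      by (rule gen_orbit_step[OF fin perms that])
    have r: "perm_restrict f ?D y = f y" if "y \<in> ?D" for f y using that unfolding perm_restrict_def by simp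
    have "submap M ?D \<in># components M" unfolding components_def using D finO by simp
    then have con: "connected_map (submap M ?D)" using M unfolding is_map_def by blast
    have "crosses (submap M ?D) = ?D" unfolding submap_def by simp
    then have "submap M ?D \<noteq> isolated_vertex" using xD unfolding isolated_vertex_def by force
    with con have ax: "perm_restrict ?u ?D permutes ?D" "perm_restrict ?t ?D \<circ> perm_restrict ?t ?D = id"
      "perm_restrict ?s ?D \<circ> perm_restrict ?s ?D = id" "perm_restrict ?t ?D \<circ> perm_restrict ?s ?D = perm_restrict ?s ?D \<circ> perm_restrict ?t ?D"
      "\<forall>a\<in>?D. distinct [a, perm_restrict ?t ?D a, perm_restrict ?s ?D a, perm_restrict ?t ?D (perm_restrict ?s ?D a)]"
      "perm_restrict ?u ?D \<circ> perm_restrict ?s ?D = perm_restrict ?s ?D \<circ> inv_into UNIV (perm_restrict ?u ?D)"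
      "\<forall>a\<in>?D. orbit (perm_restrict ?u ?D) a \<noteq> orbit (perm_restrict ?u ?D) (perm_restrict ?s ?D a)"
      "finite ?D"
      unfolding connected_map_def submap_def Let_def gmap.simps by blast+
    have tx: "?t x \<in> ?D" "?s x \<in> ?D" "?u x \<in> ?D" using step[OF xD] by blast+
    have sux: "?s (?u x) \<in> ?D" using step[OF tx(3)] by blast
    have 1: "?t (?t x) = x" using fun_cong[OF ax(2), of x] unfolding o_apply id_apply r[OF xD] r[OF tx(1)] .
    have 2: "?s (?s x) = x" using fun_cong[OF ax(3), of x] unfolding o_apply id_apply r[OF xD] r[OF tx(2)] .
    have 3: "?t (?s x) = ?s (?t x)" using fun_cong[OF ax(4), of x] unfolding o_apply r[OF xD] r[OF tx(1)] r[OF tx(2)] .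
    have "inv_into UNIV (perm_restrict ?u ?D) (?u x) = x"
      using permutes_inverses(2)[OF ax(1), of x] unfolding r[OF xD] .
    then have 4: "?u (?s (?u x)) = ?s x"
      using fun_cong[OF ax(6), of "?u x"] unfolding o_apply r[OF tx(3)] r[OF sux] by (simp only: r[OF xD])
    have 5: "?t x \<noteq> x \<and> ?s x \<noteq> x \<and> ?t (?s x) \<noteq> x" using bspec[OF ax(5) xD] unfolding r[OF xD] r[OF tx(2)] by (simp, metis)
    have 6: "?u (?s x) \<noteq> x"
    proof
      assume e: "?u (?s x) = x"
      have "perm_restrict ?u ?D (?s x) = x" unfolding r[OF tx(2)] by (rule e)
      then have "orbit (perm_restrict ?u ?D) x = orbit (perm_restrict ?u ?D) (?s x)"
        using permutation_orbit_step[OF permutes_finite_permutation[OF ax(8,1)], of "?s x"] by simp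
      then show False using bspec[OF ax(7) xD] unfolding r[OF xD] by blast
    qed
    show ?thesis using 1 2 3 4 5 6 by blast
  qed
  have out: "?t x = x" "?s x = x" "?u x = x" if "x \<notin> ?C" for x
    using permutes_not_in[OF p(1) that] permutes_not_in[OF p(2) that] permutes_not_in[OF p(3) that] by blast+
  show ?thesis
  proof
    fix x
    show "?t (?t x) = x" "?s (?s x) = x" "?t (?s x) = ?s (?t x)" "?u (?s (?u x)) = ?s x"
      using main[of x] out[of x] by metis+
  qed (use fin p main in blast)+
qed

context three_involutions
begin

lemma ex_transversal:
  assumes P: "flips C \<sigma> P"
  shows "\<exists>T\<subseteq>P. \<forall>x\<in>P. (if \<theta> x \<in> P then \<theta> x else \<theta> (\<sigma> x)) \<in> T \<longleftrightarrow> x \<notin> T"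
proof -
  define u where "u x = (if x \<in> P then if \<theta> x \<in> P then \<theta> x else \<theta> (\<sigma> x) else x)" for x
  have PC: "x \<in> C" if "x \<in> P" for x using P that unfolding flips_def by blast
  have fl: "\<sigma> x \<in> P \<longleftrightarrow> x \<notin> P" if "x \<in> C" for x using P that unfolding flips_def by blast
  have uP: "u x \<in> P" and uu: "u (u x) = x" and ux: "u x \<noteq> x" if x: "x \<in> P" for x
  proof -
    note xC = PC[OF x]
    have m: "\<theta> (\<sigma> x) \<in> P \<longleftrightarrow> \<theta> x \<notin> P" using fl[OF th.closed[OF xC]] unfolding commute .
    have i: "\<theta> (\<theta> x) = x" "\<theta> (\<theta> (\<sigma> x)) = \<sigma> x" "\<theta> (\<sigma> (\<theta> (\<sigma> x))) = x"
      by (simp_all only: th.inv si.inv commute[symmetric])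
    show "u x \<in> P" unfolding u_def using x m by presburger
    show "u (u x) = x" unfolding u_def using x m i fl[OF xC] by presburger
    show "u x \<noteq> x" unfolding u_def using x free[OF xC] by presburger
  qed
  have out: "u x = x" if "x \<notin> P" for x unfolding u_def using that by (rule if_not_P)
  have inv: "u (u x) = x" for x using uu[of x] out[of x] by metis
  have "u permutes P"
  proof (rule bij_imp_permutes)
    show "bij_betw u P P" by (rule bij_betw_byWitness[of _ u]) (use inv uP in blast)+
  qed (rule out)
  moreover have "finite P" by (rule finite_subset[OF _ th.fin]) (use PC in blast)
  ultimately interpret two_involutions P u u
    by unfold_locales (rule inv ux | assumption)+
  obtain T where "flips P u T" using ex_flips by blast
  then show ?thesis unfolding flips_def u_def by (metis (no_types, lifting))
qed

end

context oriented_involutions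
begin

lemma card_edges_transversal: "card ((\<lambda>x. {x, \<theta> x, \<sigma> x, \<theta> (\<sigma> x)}) ` C) = card T"
proof -
  let ?e = "\<lambda>x. {x, \<theta> x, \<sigma> x, \<theta> (\<sigma> x)}"
  have eq: "?e y = ?e x" if "y \<in> ?e x" for x y
    using that by (auto simp: th.inv si.inv commute[symmetric])
  have "?e ` C = ?e ` T"
  proof
    show "?e ` C \<subseteq> ?e ` T"
    proof (rule image_subsetI)
      fix x assume "x \<in> C"
      from edge_unique[OF this] have "\<exists>t\<in>T. t \<in> ?e x" by blast
      then obtain t where "t \<in> T" "t \<in> ?e x" by blast
      then show "?e x \<in> ?e ` T" using eq[of t x] by (intro image_eqI[of _ _ t]) (rule sym)
    qed
    show "?e ` T \<subseteq> ?e ` C" using TC by blast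
  qed
  also have "card (?e ` T) = card T"
  proof (rule card_image, rule inj_onI)
    fix x y assume x: "x \<in> T" and y: "y \<in> T" and e: "?e x = ?e y"
    have "y \<in> ?e x" unfolding e by blast
    then consider "y = x" | "y = \<theta> x" | "y = \<sigma> x" | "y = \<theta> (\<sigma> x)" by blast
    then show "x = y" using edge_unique[OF TC[OF x]] x y by cases blast+
  qed
  finally show ?thesis .
qed

end

context transitive_map
begin

abbreviation "rot_orbit \<equiv> gen_orbit C {\<theta> \<circ> \<sigma>, \<tau>}"

lemma rot_perms: "s \<in> {\<theta> \<circ> \<sigma>, \<tau>} \<Longrightarrow> s permutes C"
  using permutes_compose[OF sigma_perm theta_perm] tau_perm by blast

lemma rot_orbit_subset:
  assumes "X \<subseteq> C" "\<forall>x\<in>X. \<theta> (\<sigma> x) \<in> X \<and> \<tau> x \<in> X" "a \<in> X"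
  shows "rot_orbit a \<subseteq> X"
  by (rule gen_orbit_subset[OF fin rot_perms assms(1) _ assms(3)]) (use assms(2) in simp_all)

lemma rot_orbit_self: "a \<in> rot_orbit a"
  by (rule gen_orbit_self[OF fin rot_perms])

lemma rot_orbit_in: "a \<in> C \<Longrightarrow> rot_orbit a \<subseteq> C"
  by (rule gen_orbit_in[OF fin rot_perms])

lemma rot_orbit_eq: "a \<in> C \<Longrightarrow> b \<in> rot_orbit a \<Longrightarrow> rot_orbit b = rot_orbit a"
  by (rule gen_orbit_eq[OF fin rot_perms])

lemma rot_orbit_closed:
  assumes "x \<in> rot_orbit a" shows "\<theta> (\<sigma> x) \<in> rot_orbit a" "\<tau> x \<in> rot_orbit a"
proof -
  have "(\<theta> \<circ> \<sigma>) x \<in> rot_orbit a" by (rule gen_orbit_step[OF fin rot_perms assms insertI1])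
  then show "\<theta> (\<sigma> x) \<in> rot_orbit a" unfolding o_apply .
  show "\<tau> x \<in> rot_orbit a" by (rule gen_orbit_step[OF fin rot_perms assms insertI2[OF singletonI]])
qed

lemma rot_orbit_flips:
  assumes a: "a \<in> C" and ne: "rot_orbit a \<noteq> C"
  shows "x \<in> C \<Longrightarrow> \<sigma> x \<in> rot_orbit a \<longleftrightarrow> x \<notin> rot_orbit a"
    and "x \<in> rot_orbit a \<Longrightarrow> \<sigma> (\<tau> (\<sigma> x)) \<in> rot_orbit a"
proof -
  let ?P = "rot_orbit a" and ?Q = "\<sigma> ` rot_orbit a"
  have PC: "?P \<subseteq> C" by (rule rot_orbit_in[OF a])
  have rev: "\<sigma> (\<tau> (\<sigma> y)) \<in> ?P" if y: "y \<in> ?P" for y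
  proof (rule permutes_closed_inv[OF tau_perm PC fin rot_orbit_closed(2)])
    show "\<tau> (\<sigma> (\<tau> (\<sigma> y))) \<in> ?P" unfolding tau_sigma_tau sigma_inv by (rule y)
  qed
  have QC: "?Q \<subseteq> C" using PC perm_in(2) by blast
  have Qcl: "\<theta> (\<sigma> z) \<in> ?Q \<and> \<tau> z \<in> ?Q" if zQ: "z \<in> ?Q" for z
  proof -
    obtain y where y: "y \<in> ?P" "z = \<sigma> y" using zQ by blast
    have 1: "\<theta> (\<sigma> z) = \<sigma> (\<theta> (\<sigma> y))" unfolding y(2) by (rule theta_sigma)
    have 2: "\<tau> z = \<sigma> (\<sigma> (\<tau> (\<sigma> y)))" unfolding y(2) sigma_inv ..
    show ?thesis unfolding 1 2 using rot_orbit_closed(1)[OF y(1)] rev[OF y(1)] by blast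
  qed
  have "?P \<union> ?Q = C"
  proof (rule transitive)
    show "?P \<union> ?Q \<subseteq> C" using PC QC by blast
    show "?P \<union> ?Q \<noteq> {}" using rot_orbit_self[of a] by blast
    show "\<forall>x\<in>?P \<union> ?Q. \<theta> x \<in> ?P \<union> ?Q \<and> \<sigma> x \<in> ?P \<union> ?Q \<and> \<tau> x \<in> ?P \<union> ?Q"
    proof
      fix x assume "x \<in> ?P \<union> ?Q"
      then show "\<theta> x \<in> ?P \<union> ?Q \<and> \<sigma> x \<in> ?P \<union> ?Q \<and> \<tau> x \<in> ?P \<union> ?Q"
      proof
        assume x: "x \<in> ?P"
        have "\<theta> x = \<sigma> (\<theta> (\<sigma> x))" unfolding theta_sigma sigma_inv ..
        then show ?thesis using x rot_orbit_closed[OF x] by blast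
      next
        assume x: "x \<in> ?Q"
        then obtain y where y: "y \<in> ?P" "x = \<sigma> y" by blast
        have "\<theta> x \<in> ?P" unfolding y(2) by (rule rot_orbit_closed(1)[OF y(1)])
        moreover have "\<sigma> x \<in> ?P" unfolding y(2) sigma_inv by (rule y(1))
        ultimately show ?thesis using Qcl[OF x] by blast
      qed
    qed
  qed
  moreover have "?P \<inter> ?Q = {}"
  proof (rule ccontr)
    assume "?P \<inter> ?Q \<noteq> {}"
    then obtain z where z: "z \<in> ?P" "z \<in> ?Q" by blast
    have "?P \<subseteq> ?Q" using rot_orbit_subset[OF QC _ z(2)] Qcl rot_orbit_eq[OF a z(1)] by blast
    then have "?Q = C" using \<open>?P \<union> ?Q = C\<close> by blast
    have "C \<subseteq> ?P"
    proof
      fix x assume "x \<in> C"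
      then have "\<sigma> x \<in> ?Q" unfolding \<open>?Q = C\<close> by (rule perm_in(2))
      then obtain y where "y \<in> ?P" "\<sigma> x = \<sigma> y" by blast
      then show "x \<in> ?P" using sigma_inv by metis
    qed
    then show False using ne PC by blast
  qed
  moreover have "\<sigma> x \<in> ?P \<longleftrightarrow> x \<in> ?Q" for x
  proof
    assume "\<sigma> x \<in> ?P"
    then have "\<sigma> (\<sigma> x) \<in> ?Q" by blast
    then show "x \<in> ?Q" unfolding sigma_inv .
  next
    assume "x \<in> ?Q"
    then obtain y where "y \<in> ?P" "x = \<sigma> y" by blast
    then show "\<sigma> x \<in> ?P" by (simp only: sigma_inv)
  qed
  ultimately show "x \<in> C \<Longrightarrow> \<sigma> x \<in> ?P \<longleftrightarrow> x \<notin> ?P" by blast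
  show "x \<in> ?P \<Longrightarrow> \<sigma> (\<tau> (\<sigma> x)) \<in> ?P" by (rule rev)
qed

lemma rot_orbits_two:
  assumes a: "a \<in> C" and ne: "rot_orbit a \<noteq> C"
  shows "card (gen_orbits C {\<theta> \<circ> \<sigma>, \<tau>}) = 2"
proof -
  let ?P = "rot_orbit a"
  have sa: "\<sigma> a \<in> C" by (rule perm_in(2)[OF a])
  have na: "\<sigma> a \<notin> ?P" using rot_orbit_flips(1)[OF a ne a] rot_orbit_self[of a] by blast
  have dis: "?P \<inter> rot_orbit (\<sigma> a) = {}"
  proof (rule ccontr)
    assume "?P \<inter> rot_orbit (\<sigma> a) \<noteq> {}"
    then obtain z where z: "z \<in> ?P" "z \<in> rot_orbit (\<sigma> a)" by blast
    have "rot_orbit (\<sigma> a) = ?P" by (rule trans[OF rot_orbit_eq[OF sa z(2), symmetric] rot_orbit_eq[OF a z(1)]])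
    then show False using na rot_orbit_self[of "\<sigma> a"] by blast
  qed
  then have ne': "rot_orbit (\<sigma> a) \<noteq> C" using rot_orbit_self[of a] a by blast
  have cover: "x \<in> rot_orbit (\<sigma> a)" if x: "x \<in> C" "x \<notin> ?P" for x
  proof (rule ccontr)
    assume nx: "x \<notin> rot_orbit (\<sigma> a)"
    have "\<sigma> x \<in> ?P" using rot_orbit_flips(1)[OF a ne x(1)] x(2) by blast
    moreover have "\<sigma> x \<in> rot_orbit (\<sigma> a)" using rot_orbit_flips(1)[OF sa ne' x(1)] nx by blast
    ultimately show False using dis by blast
  qed
  have "gen_orbits C {\<theta> \<circ> \<sigma>, \<tau>} = {?P, rot_orbit (\<sigma> a)}"
    unfolding gen_orbits_def
  proof
    show "rot_orbit ` C \<subseteq> {?P, rot_orbit (\<sigma> a)}"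
    proof (rule image_subsetI)
      fix x assume "x \<in> C"
      then show "rot_orbit x \<in> {?P, rot_orbit (\<sigma> a)}"
        using rot_orbit_eq[OF a, of x] rot_orbit_eq[OF sa, of x] cover[of x] by blast
    qed
    show "{?P, rot_orbit (\<sigma> a)} \<subseteq> rot_orbit ` C" using a sa by blast
  qed
  moreover have "?P \<noteq> rot_orbit (\<sigma> a)" using dis rot_orbit_self[of a] by blast
  ultimately show ?thesis by simp
qed

lemma not_isolated: "M \<noteq> isolated_vertex"
  using nonempty unfolding isolated_vertex_def by force

lemma orientation_cases:
  obtains a where "a \<in> C" "rot_orbit a \<noteq> C" "orientable M" "\<not> nonorientable M"
    | "\<And>a. a \<in> C \<Longrightarrow> rot_orbit a = C" "\<not> orientable M" "nonorientable M"
proof (cases "\<exists>a\<in>C. rot_orbit a \<noteq> C")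
  case True
  then obtain a where a: "a \<in> C" "rot_orbit a \<noteq> C" by blast
  show ?thesis by (rule that(1)[OF a]) (use rot_orbits_two[OF a] a in \<open>unfold orientable_def nonorientable_def, blast+\<close>)
next
  case False
  then have "gen_orbits C {\<theta> \<circ> \<sigma>, \<tau>} = {C}" unfolding gen_orbits_def using nonempty by blast
  then have "card (gen_orbits C {\<theta> \<circ> \<sigma>, \<tau>}) \<noteq> 2" by simp
  then show ?thesis
    by (intro that(2)) (use False nonempty not_isolated in \<open>unfold orientable_def nonorientable_def, blast+\<close>)
qed

lemma num_components_eq: "num_components M = 1"
proof -
  have "gen_orbit C {\<theta>, \<sigma>, \<tau>} a = C" if a: "a \<in> C" for a
  proof -
    have D: "gen_orbit C {\<theta>, \<sigma>, \<tau>} a \<in> pieces" using a unfolding gen_orbits_def by blast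
    show ?thesis by (rule transitive[OF piece_subset[OF D] piece_nonempty[OF D]]) (use piece_closed[OF D] in blast)
  qed
  then have "pieces = {C}" unfolding gen_orbits_def using nonempty by blast
  then show ?thesis unfolding num_components_def components_def no_empty_pairs by simp
qed

end

definition component_weight :: "('g, 'x) monoid_scheme \<Rightarrow> 'c gmap \<Rightarrow> complex" where
  "component_weight G N =
    (if orientable N then \<Sum>\<rho>\<in>irrep_classes G. of_nat (class_dim G \<rho>) powi (2 - 2 * genus N) else 1) *
    (if nonorientable N then \<Sum>\<rho>\<in>irrep_classes G. class_frobenius_schur G \<rho> powi genus N *
            of_nat (class_dim G \<rho>) powi (2 - genus N) else 1)"

context transitive_map
begin

context
  fixes G :: "('g, 'x) monoid_scheme" (structure) and P
  assumes G: "finite_group G" and P: "flips C \<sigma> P" "flips C corner P"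
begin

lemma ex_state_sum:
  obtains L T where "map_state_sum G C \<theta> \<sigma> corner P L T"
    "map_state_sum.flows G C \<theta> \<sigma> corner = local_flows G M"
    "card (orbit (map_state_sum.vstep \<sigma> corner) ` P) = card (cycle_vertices M)" "card T = card (edges M)"
    "int (card (orbit (map_state_sum.vstep \<sigma> corner) ` P)) - int (card T) + int (card (orbit (corner \<circ> \<theta>) ` L)) = 2 - euler_genus M"
proof -
  interpret G: finite_group G by (rule G)
  obtain L where L: "flips C \<theta> L" "flips C corner L" using face.ex_flips by blast
  obtain T where T: "T \<subseteq> P" "\<forall>x\<in>P. (if \<theta> x \<in> P then \<theta> x else \<theta> (\<sigma> x)) \<in> T \<longleftrightarrow> x \<notin> T"
    using inv.ex_transversal[OF P(1)] by blast
  interpret S: map_state_sum G C \<theta> \<sigma> corner P L T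
    by unfold_locales (rule P L T(1) bspec[OF T(2)] | assumption)+
  have v: "S.vstep = \<tau>" by (rule ext) (simp only: S.vstep_def corner_def sigma_inv)
  have fl: "S.flows = local_flows G M"
    unfolding S.flows_def S.edge_funs_def G.local_flows_cycle_prod v by blast
  have cv: "card (cycle_vertices M) = card (orbit S.vstep ` P)"
    unfolding cycle_vertices_eq vert.card_orbit_pairs[OF P] vert_step v ..
  have ce: "card (edges M) = card T"
    unfolding edges_eq edge_def[abs_def] by (rule S.card_edges_transversal)
  have cf: "card (cycle_faces M) = card (orbit (corner \<circ> \<theta>) ` L)"
    unfolding cycle_faces_eq face.card_orbit_pairs[OF L] face.step_eq ..
  show ?thesis
    by (rule that[of L T, OF S.map_state_sum_axioms fl])
      (simp_all only: v cv ce cf euler_genus_def num_components_eq num_vertices_def num_edges_def num_faces_def no_empty_pairs)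
qed

end

lemma card_local_flows:
  assumes G: "finite_group G"
  shows "of_nat (card (local_flows G M)) =
    of_nat (card (carrier G)) powi (int (card (edges M)) - int (card (cycle_vertices M))) * component_weight G M"
proof (cases rule: orientation_cases)
  case (1 a)
  let ?P = "rot_orbit a"
  have PC: "?P \<subseteq> C" by (rule rot_orbit_in[OF 1(1)])
  note sig = rot_orbit_flips(1)[OF 1(1,2)]
  have fs: "flips C \<sigma> ?P" unfolding flips_def using PC sig by blast
  have fc: "flips C corner ?P" unfolding flips_def
  proof (intro conjI ballI PC)
    fix x assume x: "x \<in> C"
    have t: "\<tau> (\<sigma> x) \<in> C" using x perm_in by blast
    show "corner x \<in> ?P \<longleftrightarrow> x \<notin> ?P"
    proof (cases "x \<in> ?P")
      case True
      then show ?thesis unfolding corner_def using sig[OF t] rot_orbit_flips(2)[OF 1(1,2) True] by blast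
    next
      case False
      then have "\<sigma> x \<in> ?P" using sig[OF x] by blast
      then show ?thesis unfolding corner_def using rot_orbit_closed(2)[of "\<sigma> x" a] False by blast
    qed
  qed
  obtain L T where S: "map_state_sum G C \<theta> \<sigma> corner ?P L T"
    and fl: "map_state_sum.flows G C \<theta> \<sigma> corner = local_flows G M"
    and cv: "card (orbit (map_state_sum.vstep \<sigma> corner) ` ?P) = card (cycle_vertices M)" and ce: "card T = card (edges M)"
    and ec: "int (card (orbit (map_state_sum.vstep \<sigma> corner) ` ?P)) - int (card T) + int (card (orbit (corner \<circ> \<theta>) ` L)) = 2 - euler_genus M"
    by (rule ex_state_sum[OF G fs fc])
  interpret S: map_state_sum G C \<theta> \<sigma> corner ?P L T by (rule S)
  have v: "S.vstep = \<tau>" by (rule ext) (simp only: S.vstep_def corner_def sigma_inv)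
  have ne: "?P \<noteq> {}" using rot_orbit_self[of a] by blast
  have ut: "S.twisted = {}"
  proof -
    have "\<theta> t \<notin> ?P" if t: "t \<in> ?P" for t
    proof -
      have "\<theta> t \<in> C" using t PC perm_in(1) by blast
      then show ?thesis using sig[of "\<theta> t"] rot_orbit_closed(1)[OF t] unfolding theta_sigma by blast
    qed
    then show ?thesis unfolding S.twisted_def using S.T(1) by blast
  qed
  have conn: "X = ?P" if X: "X \<subseteq> ?P" "X \<noteq> {}" "\<forall>x\<in>X. S.vstep x \<in> X \<and> \<theta> (\<sigma> x) \<in> X" for X
  proof -
    obtain b where b: "b \<in> X" using X(2) by blast
    have "rot_orbit b \<subseteq> X" by (rule rot_orbit_subset[OF subset_trans[OF X(1) PC] _ b]) (use X(3) in \<open>unfold v, blast\<close>)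
    moreover have "rot_orbit b = ?P" using rot_orbit_eq[OF 1(1)] b X(1) by blast
    ultimately show ?thesis using X(1) by blast
  qed
  have "even (2 - euler_genus M)" using S.flows_orientable(2)[OF ne ut conn] unfolding ec .
  then have g: "2 - 2 * genus M = 2 - euler_genus M" unfolding genus_def if_P[OF 1(3)] by simp
  show ?thesis
    using S.flows_orientable(1)[OF ne ut conn] unfolding fl ec unfolding cv ce component_weight_def if_P[OF 1(3)] if_not_P[OF 1(4)] g mult_1_right .
next
  case 2
  obtain P where P: "flips C \<sigma> P" "flips C corner P" using vert.ex_flips by blast
  obtain L T where S: "map_state_sum G C \<theta> \<sigma> corner P L T"
    and fl: "map_state_sum.flows G C \<theta> \<sigma> corner = local_flows G M"
    and cv: "card (orbit (map_state_sum.vstep \<sigma> corner) ` P) = card (cycle_vertices M)" and ce: "card T = card (edges M)"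
    and ec: "int (card (orbit (map_state_sum.vstep \<sigma> corner) ` P)) - int (card T) + int (card (orbit (corner \<circ> \<theta>) ` L)) = 2 - euler_genus M"
    by (rule ex_state_sum[OF G P])
  interpret S: map_state_sum G C \<theta> \<sigma> corner P L T by (rule S)
  have v: "S.vstep = \<tau>" by (rule ext) (simp only: S.vstep_def corner_def sigma_inv)
  have ne: "P \<noteq> {}"
  proof -
    obtain x where "x \<in> C" using nonempty by blast
    then show ?thesis using P(1) unfolding flips_def by blast
  qed
  have conn: "X = C" if X: "X \<subseteq> C" "X \<noteq> {}" "\<forall>x\<in>X. S.vstep x \<in> X \<and> \<theta> (\<sigma> x) \<in> X" for X
  proof -
    obtain b where b: "b \<in> X" using X(2) by blast
    have "rot_orbit b \<subseteq> X" by (rule rot_orbit_subset[OF X(1) _ b]) (use X(3) in \<open>unfold v, blast\<close>)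
    moreover have "rot_orbit b = C" using 2(1) b X(1) by blast
    ultimately show ?thesis using X(1) by blast
  qed
  have g: "genus M = euler_genus M" unfolding genus_def if_not_P[OF 2(2)] ..
  have 22: "2 - (2 - euler_genus M) = euler_genus M" by simp
  show ?thesis
    using S.flows_nonorientable[OF ne conn] unfolding fl ec unfolding cv ce component_weight_def if_P[OF 2(3)] if_not_P[OF 2(2)] g mult_1_left 22 .
qed

end

lemma component_weight_isolated:
  assumes "finite_group G"
  shows "component_weight G (isolated_vertex :: 'c gmap) = of_nat (card (carrier G))"
proof -
  let ?I = "isolated_vertex :: 'c gmap"
  interpret finite_group G by (rule assms)
  have o: "orientable ?I" unfolding orientable_def by blast
  have n: "\<not> nonorientable ?I" unfolding nonorientable_def isolated_vertex_def by simp
  have "euler_genus ?I = 0"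
    unfolding euler_genus_def num_components_def num_vertices_def num_edges_def num_faces_def components_def
      cycle_vertices_def cycle_faces_def edges_def isolated_vertex_def gmap.simps gen_orbits_def image_empty by simp
  then have g: "genus ?I = 0" unfolding genus_def by presburger
  show ?thesis unfolding component_weight_def if_P[OF o] if_not_P[OF n] g using arg_cong[OF sum_class_dim_sq, of "of_nat :: nat \<Rightarrow> complex"]
    by simp
qed

lemma prod_mset_image_filter:
  fixes f :: "'a \<Rightarrow> 'b :: comm_monoid_mult"
  shows "(\<Prod>x\<in>#filter_mset P A. f x) = (\<Prod>x\<in>#A. if P x then f x else 1)"
  by (induction A) auto

context cross_map
begin

lemma card_local_flows_components:
  assumes G: "finite_group G"
  shows "of_nat (card (local_flows G M)) =
    of_nat (card (carrier G)) powi (int (card (edges M)) - int (num_vertices M)) * (\<Prod>N\<in>#components M. component_weight G N)"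
proof -
  interpret finite_group G by (rule G)
  let ?g = "of_nat (card (carrier G)) :: complex"
  have g: "?g \<noteq> 0" using order_pos by simp
  have "of_nat (card (local_flows G M)) = (\<Prod>D\<in>pieces. of_nat (card (local_flows G (submap M D))) :: complex)"
    unfolding card_local_flows_pieces[OF fin_carrier] by (rule of_nat_prod)
  also have "\<dots> = (\<Prod>D\<in>pieces. ?g powi (int (card (edges (submap M D))) - int (card (cycle_vertices (submap M D)))) * component_weight G (submap M D))"
    by (rule prod.cong[OF refl]) (rule transitive_map.card_local_flows[OF transitive_map_submap G])
  also have "\<dots> = ?g powi (\<Sum>D\<in>pieces. int (card (edges (submap M D))) - int (card (cycle_vertices (submap M D)))) * (\<Prod>D\<in>pieces. component_weight G (submap M D))"
  proof -
    have "(\<Prod>D\<in>pieces. ?g powi k D) = ?g powi (\<Sum>D\<in>pieces. k D)" for k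
      using finite_pieces by (induction rule: finite_induct) (use g in \<open>simp_all add: power_int_add\<close>)
    then show ?thesis unfolding prod.distrib by (simp only:)
  qed
  also have "(\<Sum>D\<in>pieces. int (card (edges (submap M D))) - int (card (cycle_vertices (submap M D)))) = int (card (edges M)) - int (card (cycle_vertices M))"
    unfolding card_edges_pieces card_vertices_pieces sum_subtractf by simp
  also have "(\<Prod>D\<in>pieces. component_weight G (submap M D)) = ?g powi (- int (empty_pairs M)) * (\<Prod>N\<in>#components M. component_weight G N)"
    unfolding components_def image_mset_union prod_mset.union multiset.map_comp image_replicate_mset prod_mset_replicate_mset component_weight_isolated[OF G]
    using g by (simp add: prod_unfold_prod_mset comp_def power_int_minus)
  finally show ?thesis unfolding num_vertices_def mult.assoc[symmetric] using g by (simp add: power_int_add[symmetric] algebra_simps flip: power_int_add)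
qed

end

theorem theorem4p6:
  fixes G :: "('g, 'x) monoid_scheme" and M :: "'c gmap"
  assumes "group G" and "finite (carrier G)" and "is_map M"
  shows "(of_nat (num_nowhere_identity_flows G M) :: complex) =
    (\<Sum>A\<in>Pow (edges M).
      (- 1) ^ card (edges M - A) *
      of_nat (card (carrier G)) powi (int (card A) - int (num_vertices M)) *
      (\<Prod>N\<in>#filter_mset orientable (components (delete_edges M (edges M - A))).
         \<Sum>\<rho>\<in>irrep_classes G. of_nat (class_dim G \<rho>) powi (2 - 2 * genus N)) *
      (\<Prod>N\<in>#filter_mset nonorientable (components (delete_edges M (edges M - A))).
         \<Sum>\<rho>\<in>irrep_classes G. class_frobenius_schur G \<rho> powi genus N *
            of_nat (class_dim G \<rho>) powi (2 - genus N)))"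
proof -
  interpret cross_map M by (rule is_map_cross_map[OF assms(3)])
  have G: "finite_group G" by (intro finite_group.intro finite_group_axioms.intro assms)
  let ?E = "edges M"
  have "(of_nat (num_nowhere_identity_flows G M) :: complex) =
    (\<Sum>B\<in>Pow ?E. (- 1) ^ card B * of_nat (card (local_flows G (delete_edges M B))))"
    by (rule nowhere_identity_inclusion_exclusion[OF assms(1,2)])
  also have "\<dots> = (\<Sum>A\<in>Pow ?E. (- 1) ^ card (?E - A) * of_nat (card (local_flows G (delete_edges M (?E - A)))))"
    by (rule sum.reindex_bij_witness[of _ "\<lambda>A. ?E - A" "\<lambda>A. ?E - A"]) (auto simp: double_diff)
  also have "\<dots> = (\<Sum>A\<in>Pow ?E. (- 1) ^ card (?E - A) *
      of_nat (card (carrier G)) powi (int (card A) - int (num_vertices M)) *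
      (\<Prod>N\<in>#filter_mset orientable (components (delete_edges M (?E - A))).
         \<Sum>\<rho>\<in>irrep_classes G. of_nat (class_dim G \<rho>) powi (2 - 2 * genus N)) *
      (\<Prod>N\<in>#filter_mset nonorientable (components (delete_edges M (?E - A))).
         \<Sum>\<rho>\<in>irrep_classes G. class_frobenius_schur G \<rho> powi genus N *
            of_nat (class_dim G \<rho>) powi (2 - genus N)))"
  proof (rule sum.cong[OF refl])
    fix A assume "A \<in> Pow ?E"
    then have A: "?E - (?E - A) = A" and B: "?E - A \<subseteq> ?E" by blast+
    have "of_nat (card (local_flows G (delete_edges M (?E - A)))) =
      of_nat (card (carrier G)) powi (int (card A) - int (num_vertices M)) * (\<Prod>N\<in>#components (delete_edges M (?E - A)). component_weight G N)"
      using cross_map.card_local_flows_components[OF cross_map_delete_edges[OF B] G]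
      unfolding edges_delete_edges[OF B] A num_vertices_delete_edges[OF B] .
    then show "(- 1) ^ card (?E - A) * of_nat (card (local_flows G (delete_edges M (?E - A)))) = (- 1) ^ card (?E - A) *
      of_nat (card (carrier G)) powi (int (card A) - int (num_vertices M)) *
      (\<Prod>N\<in>#filter_mset orientable (components (delete_edges M (?E - A))).
         \<Sum>\<rho>\<in>irrep_classes G. of_nat (class_dim G \<rho>) powi (2 - 2 * genus N)) *
      (\<Prod>N\<in>#filter_mset nonorientable (components (delete_edges M (?E - A))).
         \<Sum>\<rho>\<in>irrep_classes G. class_frobenius_schur G \<rho> powi genus N *
            of_nat (class_dim G \<rho>) powi (2 - genus N))"
      unfolding prod_mset_image_filter component_weight_def prod_mset.distrib by (simp only: mult.assoc)
  qed
  finally show ?thesis .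
qed

end
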